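(* In the setting of the context there exist constants $\kappa>0$ and $C_{dF}>0$, depending only on the initial triangulation $\mathcal T_0$ and $\varrho$, such that for all $\mathcal T\in\mathbb T$ and all $f\in L^2(\Omega)$ the following holds. Let $F(v):=\int_\Omega fv\,dx$ and let $(u,t)\in H^1_0(\Omega)\times H^{-1/2}(\partial\mathcal T)$ be the solution to $b(u,t;v)=F(v)$ for all $v\in H^1(\mathcal T)$. Then any $(v_C,s_0)\in S^1_0(\mathcal T)\times P_0(\mathcal E)$ satisfies $$\gamma_1^2\|\nabla(u-v_C)\|_{L^2(\Omega)}^2\le(1+C_{dF}^2)\,\|F-b(v_C,s_0;\cdot)\|_{CR^1_0(\mathcal T)^*}^2+\kappa^2\|h_{\mathcal T}f\|_{L^2(\Omega)}^2 .$$
   Context: $\Omega\subset\mathbb R^n$ is a bounded Lipschitz domain with polyhedral boundary. $\mathcal T_0$ is a fixed initial regular (conforming) triangulation of $\Omega$ into $n$-simplices and, for a fixed $\varrho>0$, $\mathbb T$ is the set of regular triangulations $\mathcal T$ of $\Omega$ that are refinements of $\mathcal T_0$ with $h_T^n\le\varrho|T|$ for all $T\in\mathcal T$, where $h_T=\operatorname{diam}T$; $h_{\mathcal T}$ is the piecewise constant function with $h_{\mathcal T}|_T=h_T$. $\mathcal E$ is the set of all sides of $\mathcal T$, $\nu_T$ the outer unit normal of $T$; each side $E$ has a globally fixed unit normal $\nu_E$ (equal to $\nu_T|_E$ for one of the simplices $T$ containing $E$), $\mathrm{mid}(E)$ is the barycenter of $E$. Nonlinearity: $\phi:[0,\infty)\to\mathbb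 R$ is continuous, $\phi\in C^2(0,\infty)$, and with constants $0<\gamma_1\le\gamma_2$: $\gamma_1\le\phi(t)\le\gamma_2$ and $\gamma_1\le\phi(t)+t\phi'(t)\le\gamma_2$; $\sigma(A):=\phi(|A|)A$ for $A\in\mathbb R^n$, and $\sigma\in C^1(\mathbb R^n;\mathbb R^n)$. Spaces: $H^{-1/2}(\partial\mathcal T)$ is the set of all $t=(t_T)_{T\in\mathcal T}\in\prod_TH^{-1/2}(\partial T)$ for which there is $q\in H(\operatorname{div},\Omega)$ with $t_T=(q|_T)|_{\partial T}\cdot\nu_T$ for all $T$. $\langle t,v\rangle_{\partial\mathcal T}=\sum_T\langle t_T,v|_T\rangle_{\partial T}$ for $v\in H^1(\mathcal T)$ (duality of $H^{-1/2}(\partial T)$ and $H^{1/2}(\partial T)$ extending the $L^2(\partial T)$ product). $P_0(\mathcal E)$ = functions constant on each side, embedded into $H^{-1/2}(\partial\mathcal T)$ by $t_T|_E=(\nu_T\cdot\nu_E)t_0|_E$. $P_1(\mathcal T)$ = piecewise affine functions, $S^1_0(\mathcal T)=P_1(\mathcal T)\cap H^1_0(\Omega)$; $CR^1_0(\mathcal T)$ = $v\in P_1(\mathcal T)$ continuous at $\mathrm{mid}(E)$ for all interior sides $E$ and zero at $\mathrm{mid}(E)$ for all boundary sides. $H^1(\mathcal T)$ = piecewise $H^1$ functions with piecewise gradient $\nabla_{NC}$ and norm $\|v\|_Y^2=\|v\|_{L^2(\Omega)}^2+\|\nabla_{NC}v\|_{L^2(\Omega)}^2$; $\|G\|_{CR^1_0(\mathcal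 T)^*}=\sup\{G(v):v\in CR^1_0(\mathcal T),\ \|v\|_Y\le1\}$. $b(u,t;v)=\int_\Omega\sigma(\nabla u)\cdot\nabla_{NC}v\,dx-\langle t,v\rangle_{\partial\mathcal T}$. *)

theory Defs
  imports "HOL-Analysis.Analysis"
begin

section \<open>Domains and triangulations\<close>

text \<open>Near each boundary point, and in suitable orthonormal coordinates whose last axis is \<open>e\<close>,
  the domain is the open epigraph of a Lipschitz function on the hyperplane orthogonal to \<open>e\<close>.\<close>

definition lipschitz_domain :: "'a::euclidean_space set \<Rightarrow> bool" where
  "lipschitz_domain \<Omega> \<longleftrightarrow> open \<Omega> \<and> connected \<Omega> \<and> \<Omega> \<noteq> {} \<and>
     (\<forall>x\<in>frontier \<Omega>. \<exists>e g L r. norm e = 1 \<and> r > 0 \<and> L-lipschitz_on {z. z \<bullet> e = 0} g \<and>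
        (\<forall>y\<in>ball x r. y \<in> \<Omega> \<longleftrightarrow> y \<bullet> e > (g (y - (y \<bullet> e) *\<^sub>R e) :: real)))"

definition polyhedral_boundary :: "'a::euclidean_space set \<Rightarrow> bool" where
  "polyhedral_boundary \<Omega> \<longleftrightarrow>
     (\<exists>\<P>. finite \<P> \<and> (\<forall>P\<in>\<P>. polytope P \<and> aff_dim P = int DIM('a) - 1) \<and> frontier \<Omega> = \<Union>\<P>)"

definition regular_triangulation :: "(real^'n) set \<Rightarrow> (real^'n) set set \<Rightarrow> bool" where
  "regular_triangulation \<Omega> \<T> \<longleftrightarrow>
     triangulation \<T> \<and> (\<forall>T\<in>\<T>. int CARD('n) simplex T) \<and> \<Union>\<T> = closure \<Omega>"

definition refinement_of :: "'a set set \<Rightarrow> 'a set set \<Rightarrow> bool" where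
  "refinement_of \<T> \<T>\<^sub>0 \<longleftrightarrow> (\<forall>T\<in>\<T>. \<exists>K\<in>\<T>\<^sub>0. T \<subseteq> K)"

definition admissible_triangulations ::
    "(real^'n) set \<Rightarrow> (real^'n) set set \<Rightarrow> real \<Rightarrow> (real^'n) set set set" where
  "admissible_triangulations \<Omega> \<T>\<^sub>0 \<rho> =
     {\<T>. regular_triangulation \<Omega> \<T> \<and> refinement_of \<T> \<T>\<^sub>0 \<and>
          (\<forall>T\<in>\<T>. diameter T ^ CARD('n) \<le> \<rho> * measure lebesgue T)}"

definition mesh_size :: "(real^'n) set set \<Rightarrow> real^'n \<Rightarrow> real" where
  "mesh_size \<T> x = (\<Sum>T\<in>\<T>. if x \<in> interior T then diameter T else 0)"

definition sides :: "'a::euclidean_space set set \<Rightarrow> 'a set set" where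
  "sides \<T> = {E. \<exists>T\<in>\<T>. E facet_of T}"

definition barycenter :: "'a::euclidean_space set \<Rightarrow> 'a" where
  "barycenter E = (\<Sum>z | z extreme_point_of E. z) /\<^sub>R real (card {z. z extreme_point_of E})"

text \<open>The supporting-hyperplane condition has exactly one unit solution when \<open>E\<close> is a facet of a
  full-dimensional convex \<open>T\<close>: it forces orthogonality to \<open>E\<close> and fixes the sign.\<close>

definition outer_normal :: "'a::euclidean_space set \<Rightarrow> 'a set \<Rightarrow> 'a" where
  "outer_normal T E = (THE \<nu>. norm \<nu> = 1 \<and> (\<forall>x\<in>E. \<forall>y\<in>T. \<nu> \<bullet> y \<le> \<nu> \<bullet> x))"

definition side_normals :: "'a::euclidean_space set set \<Rightarrow> ('a set \<Rightarrow> 'a) \<Rightarrow> bool" where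
  "side_normals \<T> \<nu> \<longleftrightarrow> (\<forall>E\<in>sides \<T>. \<exists>T\<in>\<T>. E facet_of T \<and> \<nu> E = outer_normal T E)"

text \<open>The \<open>(n-1)\<close>-dimensional surface measure on a side \<open>E\<close>: the orthogonal projection onto the
  hyperplane of \<open>E\<close> pushes forward Lebesgue measure on the slab of thickness one around \<open>E\<close>.\<close>

definition slab :: "'a::euclidean_space set \<Rightarrow> 'a set" where
  "slab E = {y. closest_point (affine hull E) y \<in> E \<and>
                dist y (closest_point (affine hull E) y) \<le> 1/2}"

definition side_measure :: "'a::euclidean_space set \<Rightarrow> 'a measure" where
  "side_measure E = distr (lebesgue_on (slab E)) borel (closest_point (affine hull E))"


section \<open>Lebesgue and Sobolev spaces\<close>

text \<open>Elements of all function spaces are represented by functions on the whole space, of which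
  only the equivalence class on the set in question matters.\<close>

definition L2 :: "'a measure \<Rightarrow> ('a \<Rightarrow> 'b::real_normed_vector) set" where
  "L2 M = {f. f \<in> borel_measurable M \<and> integrable M (\<lambda>x. (norm (f x))\<^sup>2)}"

definition L2_norm :: "'a measure \<Rightarrow> ('a \<Rightarrow> 'b::real_normed_vector) \<Rightarrow> real" where
  "L2_norm M f = sqrt (LINT x|M. (norm (f x))\<^sup>2)"

definition partial_deriv :: "'n \<Rightarrow> (real^'n \<Rightarrow> real) \<Rightarrow> real^'n \<Rightarrow> real" where
  "partial_deriv i f x = frechet_derivative f (at x) (axis i 1)"

definition grad :: "(real^'n \<Rightarrow> real) \<Rightarrow> real^'n \<Rightarrow> real^'n" where
  "grad f x = (\<chi> i. partial_deriv i f x)"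

text \<open>\<open>C\<^sup>\<infinity>\<close>: all iterated partial derivatives exist and are (totally) differentiable.\<close>

definition smooth :: "(real^'n \<Rightarrow> real) \<Rightarrow> bool" where
  "smooth f \<longleftrightarrow> (\<forall>js x. foldr partial_deriv js f differentiable (at x))"

definition test_functions :: "(real^'n) set \<Rightarrow> (real^'n \<Rightarrow> real) set" where
  "test_functions U =
     {\<psi>. smooth \<psi> \<and> compact (closure {x. \<psi> x \<noteq> 0}) \<and> closure {x. \<psi> x \<noteq> 0} \<subseteq> U}"

definition has_weak_grad ::
    "(real^'n) set \<Rightarrow> (real^'n \<Rightarrow> real) \<Rightarrow> (real^'n \<Rightarrow> real^'n) \<Rightarrow> bool" where
  "has_weak_grad U v G \<longleftrightarrow> (\<forall>\<psi>\<in>test_functions U.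
     (LINT x|lebesgue_on U. v x *\<^sub>R grad \<psi> x) = - (LINT x|lebesgue_on U. \<psi> x *\<^sub>R G x))"

definition H1 :: "(real^'n) set \<Rightarrow> (real^'n \<Rightarrow> real) set" where
  "H1 U = {v \<in> L2 (lebesgue_on U). \<exists>G \<in> L2 (lebesgue_on U). has_weak_grad U v G}"

definition weak_grad :: "(real^'n) set \<Rightarrow> (real^'n \<Rightarrow> real) \<Rightarrow> real^'n \<Rightarrow> real^'n" where
  "weak_grad U v = (SOME G. G \<in> L2 (lebesgue_on U) \<and> has_weak_grad U v G)"

definition H1_norm :: "(real^'n) set \<Rightarrow> (real^'n \<Rightarrow> real) \<Rightarrow> real" where
  "H1_norm U v =
     sqrt ((L2_norm (lebesgue_on U) v)\<^sup>2 + (L2_norm (lebesgue_on U) (weak_grad U v))\<^sup>2)"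

text \<open>The closure of the test functions in \<open>H1 U\<close>.\<close>

definition H10 :: "(real^'n) set \<Rightarrow> (real^'n \<Rightarrow> real) set" where
  "H10 U = {v \<in> H1 U. \<exists>w. (\<forall>k. w k \<in> test_functions U) \<and>
                          (\<lambda>k. H1_norm U (\<lambda>x. w k x - v x)) \<longlonglongrightarrow> 0}"

definition has_weak_div ::
    "(real^'n) set \<Rightarrow> (real^'n \<Rightarrow> real^'n) \<Rightarrow> (real^'n \<Rightarrow> real) \<Rightarrow> bool" where
  "has_weak_div U q d \<longleftrightarrow> (\<forall>\<psi>\<in>test_functions U.
     (LINT x|lebesgue_on U. q x \<bullet> grad \<psi> x) = - (LINT x|lebesgue_on U. \<psi> x * d x))"

definition Hdiv :: "(real^'n) set \<Rightarrow> (real^'n \<Rightarrow> real^'n) set" where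
  "Hdiv U = {q \<in> L2 (lebesgue_on U). \<exists>d \<in> L2 (lebesgue_on U). has_weak_div U q d}"

definition weak_div :: "(real^'n) set \<Rightarrow> (real^'n \<Rightarrow> real^'n) \<Rightarrow> real^'n \<Rightarrow> real" where
  "weak_div U q = (SOME d. d \<in> L2 (lebesgue_on U) \<and> has_weak_div U q d)"


section \<open>Traces and the space of broken normal traces\<close>

text \<open>The trace on the boundary of a simplex \<open>T\<close> is the continuous extension, from \<open>H1\<close> of the
  interior to \<open>L2\<close> of the boundary, of the restriction of smooth functions.\<close>

definition is_trace :: "(real^'n) set \<Rightarrow> (real^'n \<Rightarrow> real) \<Rightarrow> (real^'n \<Rightarrow> real) \<Rightarrow> bool" where
  "is_trace T v g \<longleftrightarrow> v \<in> H1 (interior T) \<and> (\<forall>E. E facet_of T \<longrightarrow> g \<in> L2 (side_measure E)) \<and>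
     (\<exists>w. (\<forall>k. smooth (w k)) \<and>
          (\<lambda>k. H1_norm (interior T) (\<lambda>x. w k x - v x)) \<longlonglongrightarrow> 0 \<and>
          (\<forall>E. E facet_of T \<longrightarrow> (\<lambda>k. L2_norm (side_measure E) (\<lambda>x. w k x - g x)) \<longlonglongrightarrow> 0))"

definition trace_on :: "(real^'n) set \<Rightarrow> (real^'n \<Rightarrow> real) \<Rightarrow> real^'n \<Rightarrow> real" where
  "trace_on T v = (SOME g. is_trace T v g)"

text \<open>\<open>H\<^sup>1\<^sup>/\<^sup>2(\<partial>T)\<close> is the trace space of \<open>H\<^sup>1(T)\<close> with the quotient norm, so its dual
  \<open>H\<^sup>-\<^sup>1\<^sup>/\<^sup>2(\<partial>T)\<close> consists of the bounded linear functionals on \<open>H\<^sup>1(T)\<close> that vanish on functions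
  with zero trace. Hence \<open>\<tau> v\<close> is the duality pairing of \<open>\<tau>\<close> with the trace of \<open>v\<close>.\<close>

definition H_minus_half :: "(real^'n) set \<Rightarrow> ((real^'n \<Rightarrow> real) \<Rightarrow> real) set" where
  "H_minus_half T = {\<tau>.
     (\<forall>v\<in>H1 (interior T). \<forall>w\<in>H1 (interior T). \<tau> (\<lambda>x. v x + w x) = \<tau> v + \<tau> w) \<and>
     (\<forall>c. \<forall>v\<in>H1 (interior T). \<tau> (\<lambda>x. c * v x) = c * \<tau> v) \<and>
     (\<exists>C. \<forall>v\<in>H1 (interior T). \<bar>\<tau> v\<bar> \<le> C * H1_norm (interior T) v) \<and>
     (\<forall>v. is_trace T v (\<lambda>_. 0) \<longrightarrow> \<tau> v = 0)}"

text \<open>The normal trace of \<open>q|\<^sub>T\<close> is defined by Green's formula.\<close>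

definition normal_trace :: "(real^'n) set \<Rightarrow> (real^'n \<Rightarrow> real^'n) \<Rightarrow> (real^'n \<Rightarrow> real) \<Rightarrow> real" where
  "normal_trace T q v = (LINT x|lebesgue_on (interior T).
     q x \<bullet> weak_grad (interior T) v x + weak_div (interior T) q x * v x)"

definition H_minus_half_skeleton ::
    "(real^'n) set \<Rightarrow> (real^'n) set set \<Rightarrow> ((real^'n) set \<Rightarrow> (real^'n \<Rightarrow> real) \<Rightarrow> real) set" where
  "H_minus_half_skeleton \<Omega> \<T> = {t. (\<forall>T\<in>\<T>. t T \<in> H_minus_half T) \<and>
     (\<exists>q\<in>Hdiv \<Omega>. \<forall>T\<in>\<T>. \<forall>v\<in>H1 (interior T). t T v = normal_trace T q v)}"

definition skeleton_pairing ::
    "(real^'n) set set \<Rightarrow> ((real^'n) set \<Rightarrow> (real^'n \<Rightarrow> real) \<Rightarrow> real) \<Rightarrow> (real^'n \<Rightarrow> real) \<Rightarrow> real" where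
  "skeleton_pairing \<T> t v = (\<Sum>T\<in>\<T>. t T v)"

text \<open>A function that is constant on each side is given by its values \<open>s E\<close> on the sides \<open>E\<close>.
  On \<open>T\<close> it acts through the \<open>L2\<close> product over the boundary, with density
  \<open>(\<nu>\<^sub>T \<bullet> \<nu>\<^sub>E) s E\<close> on \<open>E\<close>.\<close>

definition embed_P0 ::
    "((real^'n) set \<Rightarrow> real^'n) \<Rightarrow> ((real^'n) set \<Rightarrow> real) \<Rightarrow>
     (real^'n) set \<Rightarrow> (real^'n \<Rightarrow> real) \<Rightarrow> real" where
  "embed_P0 \<nu> s T v =
     (\<Sum>E | E facet_of T. LINT x|side_measure E. ((outer_normal T E \<bullet> \<nu> E) * s E) * trace_on T v x)"


section \<open>Piecewise spaces\<close>

definition H1_pw :: "(real^'n) set set \<Rightarrow> (real^'n \<Rightarrow> real) set" where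
  "H1_pw \<T> = {v. \<forall>T\<in>\<T>. v \<in> H1 (interior T)}"

definition pw_grad :: "(real^'n) set set \<Rightarrow> (real^'n \<Rightarrow> real) \<Rightarrow> real^'n \<Rightarrow> real^'n" where
  "pw_grad \<T> v x = (\<Sum>T\<in>\<T>. if x \<in> interior T then weak_grad (interior T) v x else 0)"

definition Y_norm :: "(real^'n) set \<Rightarrow> (real^'n) set set \<Rightarrow> (real^'n \<Rightarrow> real) \<Rightarrow> real" where
  "Y_norm \<Omega> \<T> v =
     sqrt ((L2_norm (lebesgue_on \<Omega>) v)\<^sup>2 + (L2_norm (lebesgue_on \<Omega>) (pw_grad \<T> v))\<^sup>2)"

definition P1 :: "(real^'n) set set \<Rightarrow> (real^'n \<Rightarrow> real) set" where
  "P1 \<T> = {v. \<forall>T\<in>\<T>. \<exists>a c. \<forall>x\<in>interior T. v x = a \<bullet> x + c}"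

definition S10 :: "(real^'n) set \<Rightarrow> (real^'n) set set \<Rightarrow> (real^'n \<Rightarrow> real) set" where
  "S10 \<Omega> \<T> = P1 \<T> \<inter> H10 \<Omega>"

text \<open>The value at a boundary point \<open>x\<close> of \<open>T\<close> of the continuous extension of \<open>v|\<^sub>T\<close>; continuity of
  a piecewise affine function at \<open>x\<close> means that these one-sided values agree.\<close>

definition one_sided_value :: "'a::euclidean_space set \<Rightarrow> ('a \<Rightarrow> real) \<Rightarrow> 'a \<Rightarrow> real" where
  "one_sided_value T v x = Lim (at x within interior T) v"

definition CR10 :: "(real^'n) set \<Rightarrow> (real^'n) set set \<Rightarrow> (real^'n \<Rightarrow> real) set" where
  "CR10 \<Omega> \<T> = {v \<in> P1 \<T>.
     (\<forall>E\<in>sides \<T>. \<not> E \<subseteq> frontier \<Omega> \<longrightarrow>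
        (\<forall>T\<in>\<T>. \<forall>T'\<in>\<T>. E facet_of T \<and> E facet_of T' \<longrightarrow>
           one_sided_value T v (barycenter E) = one_sided_value T' v (barycenter E))) \<and>
     (\<forall>E\<in>sides \<T>. E \<subseteq> frontier \<Omega> \<longrightarrow>
        (\<forall>T\<in>\<T>. E facet_of T \<longrightarrow> one_sided_value T v (barycenter E) = 0))}"

definition CR_dual_norm ::
    "(real^'n) set \<Rightarrow> (real^'n) set set \<Rightarrow> ((real^'n \<Rightarrow> real) \<Rightarrow> real) \<Rightarrow> real" where
  "CR_dual_norm \<Omega> \<T> G = (SUP v\<in>{v \<in> CR10 \<Omega> \<T>. Y_norm \<Omega> \<T> v \<le> 1}. G v)"


section \<open>The nonlinear problem\<close>

definition flux :: "(real \<Rightarrow> real) \<Rightarrow> 'a::euclidean_space \<Rightarrow> 'a" where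
  "flux \<phi> A = \<phi> (norm A) *\<^sub>R A"

definition nonlinearity :: "(real \<Rightarrow> real) \<Rightarrow> real \<Rightarrow> real \<Rightarrow> bool" where
  "nonlinearity \<phi> \<gamma>\<^sub>1 \<gamma>\<^sub>2 \<longleftrightarrow>
     0 < \<gamma>\<^sub>1 \<and> \<gamma>\<^sub>1 \<le> \<gamma>\<^sub>2 \<and> continuous_on {0..} \<phi> \<and>
     \<phi> C1_differentiable_on {0<..} \<and> deriv \<phi> C1_differentiable_on {0<..} \<and>
     (\<forall>t\<ge>0. \<gamma>\<^sub>1 \<le> \<phi> t \<and> \<phi> t \<le> \<gamma>\<^sub>2) \<and>
     (\<forall>t>0. \<gamma>\<^sub>1 \<le> \<phi> t + t * deriv \<phi> t \<and> \<phi> t + t * deriv \<phi> t \<le> \<gamma>\<^sub>2)"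

definition C1_map :: "('a::euclidean_space \<Rightarrow> 'a) \<Rightarrow> bool" where
  "C1_map \<sigma> \<longleftrightarrow> (\<exists>D :: 'a \<Rightarrow> 'a \<Rightarrow>\<^sub>L 'a.
     (\<forall>A. (\<sigma> has_derivative blinfun_apply (D A)) (at A)) \<and> continuous_on UNIV D)"

definition b_form ::
    "(real^'n) set \<Rightarrow> (real^'n) set set \<Rightarrow> (real \<Rightarrow> real) \<Rightarrow> (real^'n \<Rightarrow> real) \<Rightarrow>
     ((real^'n) set \<Rightarrow> (real^'n \<Rightarrow> real) \<Rightarrow> real) \<Rightarrow> (real^'n \<Rightarrow> real) \<Rightarrow> real" where
  "b_form \<Omega> \<T> \<phi> u t v =
     (LINT x|lebesgue_on \<Omega>. flux \<phi> (weak_grad \<Omega> u x) \<bullet> pw_grad \<T> v x) - skeleton_pairing \<T> t v"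

definition load :: "(real^'n) set \<Rightarrow> (real^'n \<Rightarrow> real) \<Rightarrow> (real^'n \<Rightarrow> real) \<Rightarrow> real" where
  "load \<Omega> f v = (LINT x|lebesgue_on \<Omega>. f x * v x)"

end

theory Submission
  imports Defs "HOL-Computational_Algebra.Polynomial"
begin

text \<open>Let \<open>e = u - v\<^sub>C\<close>. Strong monotonicity of the flux and the test function \<open>e\<close>, whose pairing with
  \<open>t\<close> vanishes, bound \<open>\<gamma>\<^sub>1 \<parallel>\<nabla>e\<parallel>\<^sup>2\<close> by \<open>F(e) - \<integral> \<sigma>(\<nabla>v\<^sub>C) \<bullet> \<nabla>e\<close>. By density \<open>e\<close> may be replaced by a smooth
  function \<open>w\<close> with compact support in \<open>\<Omega>\<close>. Its nonconforming interpolant \<open>w\<^sub>N\<^sub>C\<close> has the elementwise mean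
  of \<open>\<nabla>w\<close> as gradient, so \<open>\<integral> \<sigma>(\<nabla>v\<^sub>C) \<bullet> \<nabla>w\<close> does not change when \<open>w\<close> is replaced by \<open>w\<^sub>N\<^sub>C\<close>, and
  \<open>\<langle>s\<^sub>0, w\<^sub>N\<^sub>C\<rangle>\<close> vanishes as for every Crouzeix--Raviart function. What remains is the residual at
  \<open>w\<^sub>N\<^sub>C\<close>, where \<open>\<parallel>w\<^sub>N\<^sub>C\<parallel>\<close> is controlled by Friedrichs' inequality for \<open>w\<close>, and \<open>F(w - w\<^sub>N\<^sub>C)\<close>, where the
  interpolation error is controlled by the Poincare inequality on the simplices.\<close>

section \<open>Square integrable functions\<close>

text \<open>Two obstacles shape the development. Weak gradients, weak divergences and traces are
  arbitrary choices of representatives, so identities between them hold almost everywhere only. And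
  the interpolant must have the facet means of w as its barycentre values. These means are written
  as volume integrals (\<open>facet_mean\<close>), which turns their two essential properties,
  dependence on the facet values of w alone and agreement from both sides of a facet, into
  statements about shrinking and shearing simplices. They require w to be C^1 up to the boundary of
  each simplex, which is why the error is replaced by a test function before it is interpolated.
  Traces proper occur only in the pairing of \<open>s0\<close> with Crouzeix--Raviart functions;
  there the chosen trace of an affine function has to be identified, by a trace inequality on prisms
  below a facet. All constants are explicit: the Poincare inequality on a convex set costs 2^n under
  the square, Friedrichs' inequality a length exceeding the diameter of \<Omega>, and squaring the
  final sum of two terms a factor 2.\<close>

lemma L2I: "f \<in> borel_measurable M \<Longrightarrow> integrable M (\<lambda>x. (norm (f x))\<^sup>2) \<Longrightarrow> f \<in> L2 M"
  by (simp add: L2_def)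

lemma L2_measurable [measurable_dest]: "f \<in> L2 M \<Longrightarrow> f \<in> borel_measurable M"
  by (simp add: L2_def)

lemma L2_integrable_sq: "f \<in> L2 M \<Longrightarrow> integrable M (\<lambda>x. (norm (f x))\<^sup>2)"
  by (simp add: L2_def)

lemma L2_norm_nonneg [simp]: "0 \<le> L2_norm M f"
  by (simp add: L2_norm_def)

lemma L2_norm_sq: "(L2_norm M f)\<^sup>2 = (LINT x|M. (norm (f x))\<^sup>2)"
  by (simp add: L2_norm_def)

lemma L2_norm_cong_AE:
  assumes "f \<in> borel_measurable M" "g \<in> borel_measurable M" "AE x in M. f x = g x"
  shows "L2_norm M f = L2_norm M g"
proof -
  have [measurable]: "f \<in> borel_measurable M" "g \<in> borel_measurable M"
    using assms by auto
  have "(LINT x|M. (norm (f x))\<^sup>2) = (LINT x|M. (norm (g x))\<^sup>2)"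
    by (rule integral_cong_AE) (use assms(3) in auto)
  then show ?thesis by (simp add: L2_norm_def)
qed

lemma L2_bounded_by:
  fixes f :: "'a \<Rightarrow> 'b::euclidean_space" and g :: "'a \<Rightarrow> 'c::euclidean_space"
  assumes "f \<in> L2 M" "g \<in> borel_measurable M" "\<And>x. x \<in> space M \<Longrightarrow> norm (g x) \<le> c * norm (f x)"
  shows "g \<in> L2 M"
proof (rule L2I[OF assms(2)])
  have [measurable]: "f \<in> borel_measurable M" "g \<in> borel_measurable M"
    using assms by (auto simp: L2_def)
  have "integrable M (\<lambda>x. c\<^sup>2 * (norm (f x))\<^sup>2)"
    using L2_integrable_sq[OF assms(1)] by simp
  then show "integrable M (\<lambda>x. (norm (g x))\<^sup>2)"
  proof (rule Bochner_Integration.integrable_bound)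
    show "AE x in M. norm ((norm (g x))\<^sup>2) \<le> norm (c\<^sup>2 * (norm (f x))\<^sup>2)"
      using power_mono[OF assms(3), of _ 2] by (auto simp: power_mult_distrib)
  qed measurable
qed

lemma L2_inner_integrable:
  fixes f g :: "'a \<Rightarrow> 'b::euclidean_space"
  assumes "f \<in> L2 M" "g \<in> L2 M"
  shows "integrable M (\<lambda>x. f x \<bullet> g x)"
proof (rule Bochner_Integration.integrable_bound)
  have [measurable]: "f \<in> borel_measurable M" "g \<in> borel_measurable M"
    using assms by (auto simp: L2_def)
  show "integrable M (\<lambda>x. (norm (f x))\<^sup>2 + (norm (g x))\<^sup>2)"
    using assms by (auto simp: L2_def)
  show "(\<lambda>x. f x \<bullet> g x) \<in> borel_measurable M" by measurable
  show "AE x in M. norm (f x \<bullet> g x) \<le> norm ((norm (f x))\<^sup>2 + (norm (g x))\<^sup>2)"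
  proof (rule AE_I2)
    fix x
    have "\<bar>f x \<bullet> g x\<bar> \<le> norm (f x) * norm (g x)" by (rule Cauchy_Schwarz_ineq2)
    also have "\<dots> \<le> (norm (f x))\<^sup>2 + (norm (g x))\<^sup>2"
      using sum_squares_bound[of "norm (f x)" "norm (g x)"]
        mult_nonneg_nonneg[OF norm_ge_zero[of "f x"] norm_ge_zero[of "g x"]] by linarith
    finally show "norm (f x \<bullet> g x) \<le> norm ((norm (f x))\<^sup>2 + (norm (g x))\<^sup>2)" by simp
  qed
qed

lemma L2_add:
  fixes f g :: "'a \<Rightarrow> 'b::euclidean_space"
  assumes "f \<in> L2 M" "g \<in> L2 M"
  shows "(\<lambda>x. f x + g x) \<in> L2 M"
proof (rule L2I)
  have [measurable]: "f \<in> borel_measurable M" "g \<in> borel_measurable M"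
    using assms by (auto simp: L2_def)
  show "(\<lambda>x. f x + g x) \<in> borel_measurable M" by measurable
  have "(norm (f x + g x))\<^sup>2 = (norm (f x))\<^sup>2 + 2 * (f x \<bullet> g x) + (norm (g x))\<^sup>2" for x
    by (simp add: power2_norm_eq_inner inner_add inner_commute)
  then show "integrable M (\<lambda>x. (norm (f x + g x))\<^sup>2)"
    using L2_inner_integrable[OF assms] L2_integrable_sq[OF assms(1)] L2_integrable_sq[OF assms(2)]
    by simp
qed

lemma L2_scaleR: 
  fixes f :: "'a \<Rightarrow> 'b::euclidean_space"
  shows "f \<in> L2 M \<Longrightarrow> (\<lambda>x. c *\<^sub>R f x) \<in> L2 M"
  by (auto simp: L2_def power_mult_distrib)

lemma L2_diff:
  fixes f g :: "'a \<Rightarrow> 'b::euclidean_space"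
  assumes "f \<in> L2 M" "g \<in> L2 M"
  shows "(\<lambda>x. f x - g x) \<in> L2 M"
  using L2_add[OF assms(1) L2_scaleR[OF assms(2), of "-1"]] by simp

lemma L2_norm_scaleR: "L2_norm M (\<lambda>x. c *\<^sub>R f x) = \<bar>c\<bar> * L2_norm M f"
  by (simp add: L2_norm_def power_mult_distrib real_sqrt_mult)

lemma L2_norm_minus_commute: "L2_norm M (\<lambda>x. f x - g x) = L2_norm M (\<lambda>x. g x - f x)"
  by (simp add: L2_norm_def norm_minus_commute)

lemma L2_norm_add_sq:
  fixes f g :: "'a \<Rightarrow> 'b::euclidean_space"
  assumes "f \<in> L2 M" "g \<in> L2 M"
  shows "(L2_norm M (\<lambda>x. f x + g x))\<^sup>2 =
     (L2_norm M f)\<^sup>2 + 2 * (LINT x|M. f x \<bullet> g x) + (L2_norm M g)\<^sup>2"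
proof -
  have "(norm (f x + g x))\<^sup>2 = (norm (f x))\<^sup>2 + 2 * (f x \<bullet> g x) + (norm (g x))\<^sup>2" for x
    by (simp add: power2_norm_eq_inner inner_add inner_commute)
  then show ?thesis
    using L2_inner_integrable[OF assms] L2_integrable_sq[OF assms(1)] L2_integrable_sq[OF assms(2)]
    by (simp add: L2_norm_sq)
qed

text \<open>The square of the norm of f + t g is a nonnegative quadratic in t.
  \<open>L2_norm\<close> is only a seminorm on functions, so b = 0 does not make g vanish and needs
  its own argument.\<close>

lemma L2_Cauchy_Schwarz:
  fixes f g :: "'a \<Rightarrow> 'b::euclidean_space"
  assumes f: "f \<in> L2 M" and g: "g \<in> L2 M"
  shows "\<bar>LINT x|M. f x \<bullet> g x\<bar> \<le> L2_norm M f * L2_norm M g"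
proof -
  define a b c where "a = L2_norm M f" and "b = L2_norm M g" and "c = (LINT x|M. f x \<bullet> g x)"
  have ab: "0 \<le> a" "0 \<le> b" by (auto simp: a_def b_def)
  have q: "0 \<le> a\<^sup>2 + 2 * t * c + t\<^sup>2 * b\<^sup>2" for t
  proof -
    have "0 \<le> (L2_norm M (\<lambda>x. f x + t *\<^sub>R g x))\<^sup>2" by simp
    also have "\<dots> = a\<^sup>2 + 2 * t * c + t\<^sup>2 * b\<^sup>2"
      unfolding L2_norm_add_sq[OF f L2_scaleR[OF g]]
      by (simp add: L2_norm_scaleR a_def b_def c_def power_mult_distrib)
    finally show ?thesis .
  qed
  have "c\<^sup>2 \<le> (a * b)\<^sup>2"
  proof (cases "b = 0")
    case True
    have "c = 0"
    proof (rule ccontr)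
      assume "c \<noteq> 0"
      \<comment> \<open>For b = 0 the quadratic is affine in t, and this t gives it the value
        -1.\<close>
      then show False using q[of "- (a\<^sup>2 + 1) / (2 * c)"] True by (simp add: field_simps)
    qed
    then show ?thesis by simp
  next
    case False
    then have "b\<^sup>2 > 0" by simp
    have "a\<^sup>2 + 2 * (- c / b\<^sup>2) * c + (- c / b\<^sup>2)\<^sup>2 * b\<^sup>2 = a\<^sup>2 - c\<^sup>2 / b\<^sup>2"
      using False by (simp add: field_simps power2_eq_square)
    then have "c\<^sup>2 / b\<^sup>2 \<le> a\<^sup>2" using q[of "- c / b\<^sup>2"] by simp
    then show ?thesis using \<open>b\<^sup>2 > 0\<close> by (simp add: pos_divide_le_eq power_mult_distrib)
  qed
  then have "\<bar>c\<bar> \<le> a * b"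
    using ab by (metis abs_le_square_iff abs_of_nonneg mult_nonneg_nonneg)
  then show ?thesis by (simp add: a_def b_def c_def)
qed

lemma L2_norm_triangle:
  fixes f g :: "'a \<Rightarrow> 'b::euclidean_space"
  assumes "f \<in> L2 M" "g \<in> L2 M"
  shows "L2_norm M (\<lambda>x. f x + g x) \<le> L2_norm M f + L2_norm M g"
proof (rule power2_le_imp_le)
  show "(L2_norm M (\<lambda>x. f x + g x))\<^sup>2 \<le> (L2_norm M f + L2_norm M g)\<^sup>2"
    using L2_Cauchy_Schwarz[OF assms] by (simp add: L2_norm_add_sq[OF assms] power2_sum)
qed simp

lemma L2_norm_triangle_diff:
  fixes f g :: "'a \<Rightarrow> 'b::euclidean_space"
  assumes "f \<in> L2 M" "g \<in> L2 M"
  shows "L2_norm M (\<lambda>x. f x - g x) \<le> L2_norm M f + L2_norm M g"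
  using L2_norm_triangle[OF assms(1) L2_scaleR[OF assms(2), of "-1"]] L2_norm_scaleR[of M "-1" g]
  by simp

lemma L2_norm_diff_abs:
  fixes f g :: "'a \<Rightarrow> 'b::euclidean_space"
  assumes "f \<in> L2 M" "g \<in> L2 M"
  shows "\<bar>L2_norm M f - L2_norm M g\<bar> \<le> L2_norm M (\<lambda>x. f x - g x)"
  using L2_norm_triangle[OF L2_diff[OF assms] assms(2)]
    L2_norm_triangle[OF L2_diff[OF assms(2,1)] assms(1)] L2_norm_minus_commute[of M f g]
  by simp

lemma L2_norm_tendsto:
  fixes f :: "'a \<Rightarrow> 'b::euclidean_space"
  assumes "\<And>k. w k \<in> L2 M" "f \<in> L2 M" "(\<lambda>k. L2_norm M (\<lambda>x. w k x - f x)) \<longlonglongrightarrow> 0"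
  shows "(\<lambda>k. L2_norm M (w k)) \<longlonglongrightarrow> L2_norm M f"
proof -
  have "(\<lambda>k. L2_norm M (w k) - L2_norm M f) \<longlonglongrightarrow> 0"
    by (rule Lim_null_comparison[OF _ assms(3)])
       (use L2_norm_diff_abs[OF assms(1,2)] in auto)
  then show ?thesis by (simp add: LIM_zero_iff)
qed

lemma L2_inner_tendsto:
  fixes f g :: "'a \<Rightarrow> 'b::euclidean_space"
  assumes "\<And>k. w k \<in> L2 M" "f \<in> L2 M" "g \<in> L2 M" "(\<lambda>k. L2_norm M (\<lambda>x. w k x - f x)) \<longlonglongrightarrow> 0"
  shows "(\<lambda>k. LINT x|M. g x \<bullet> w k x) \<longlonglongrightarrow> (LINT x|M. g x \<bullet> f x)"
proof -
  have "(\<lambda>k. (LINT x|M. g x \<bullet> w k x) - (LINT x|M. g x \<bullet> f x)) \<longlonglongrightarrow> 0"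
  proof (rule Lim_null_comparison)
    show "(\<lambda>k. L2_norm M g * L2_norm M (\<lambda>x. w k x - f x)) \<longlonglongrightarrow> 0"
      using tendsto_mult_left[OF assms(4), of "L2_norm M g"] by simp
    have "norm ((LINT x|M. g x \<bullet> w k x) - (LINT x|M. g x \<bullet> f x))
        \<le> L2_norm M g * L2_norm M (\<lambda>x. w k x - f x)" for k
      using L2_Cauchy_Schwarz[OF assms(3) L2_diff[OF assms(1,2)], of k]
        L2_inner_integrable[OF assms(3) assms(1)] L2_inner_integrable[OF assms(3) assms(2)]
      by (simp add: inner_diff_right)
    then show "\<forall>\<^sub>F k in sequentially. norm ((LINT x|M. g x \<bullet> w k x) - (LINT x|M. g x \<bullet> f x))
        \<le> L2_norm M g * L2_norm M (\<lambda>x. w k x - f x)" by simp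
  qed
  then show ?thesis by (simp add: LIM_zero_iff)
qed

lemma L2_bounded_measurable:
  fixes f :: "'a \<Rightarrow> 'b::euclidean_space"
  assumes "finite_measure M" "f \<in> borel_measurable M" "\<And>x. x \<in> space M \<Longrightarrow> norm (f x) \<le> B"
  shows "f \<in> L2 M"
proof (rule L2I[OF assms(2)])
  interpret finite_measure M by fact
  have [measurable]: "f \<in> borel_measurable M" by fact
  show "integrable M (\<lambda>x. (norm (f x))\<^sup>2)"
    by (rule integrable_const_bound[of _ "B\<^sup>2"]) (use assms(3) in \<open>auto intro!: AE_I2 power_mono\<close>)
qed

lemma L2_integrable:
  fixes f :: "'a \<Rightarrow> 'b::euclidean_space"
  assumes "finite_measure M" "f \<in> L2 M"
  shows "integrable M f"
proof -
  interpret finite_measure M by fact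
  have [measurable]: "f \<in> borel_measurable M" using assms by (auto simp: L2_def)
  show ?thesis
  proof (rule Bochner_Integration.integrable_bound)
    show "integrable M (\<lambda>x. 1 + (norm (f x))\<^sup>2)" using L2_integrable_sq[OF assms(2)] by simp
    show "AE x in M. norm (f x) \<le> norm (1 + (norm (f x))\<^sup>2)"
    proof (rule AE_I2)
      fix x
      have "norm (f x) \<le> 1 + (norm (f x))\<^sup>2"
        using sum_squares_bound[of "norm (f x)" 1] norm_ge_zero[of "f x"]
        unfolding one_power2 mult_1_right by linarith
      then show "norm (f x) \<le> norm (1 + (norm (f x))\<^sup>2)" by simp
    qed
  qed measurable
qed

lemma L2_integral_square_le:
  fixes f :: "'a \<Rightarrow> real"
  assumes "finite_measure M" "f \<in> L2 M"
  shows "(LINT x|M. f x)\<^sup>2 \<le> measure M (space M) * (LINT x|M. (f x)\<^sup>2)"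
proof -
  interpret finite_measure M by fact
  have one: "(\<lambda>x. 1::real) \<in> L2 M" by (simp add: L2_def)
  have "(LINT x|M. f x)\<^sup>2 \<le> (L2_norm M (\<lambda>x. 1::real) * L2_norm M f)\<^sup>2"
    using L2_Cauchy_Schwarz[OF one assms(2)] abs_le_square_iff by fastforce
  also have "\<dots> = measure M (space M) * (LINT x|M. (f x)\<^sup>2)"
    by (simp add: power_mult_distrib L2_norm_sq)
  finally show ?thesis .
qed

section \<open>Partial derivatives, gradients and smooth functions\<close>

lemma has_derivative_partial_deriv:
  assumes "(f has_derivative f') (at x)"
  shows "partial_deriv i f x = f' (axis i 1)"
  using frechet_derivative_at[OF assms] by (simp add: partial_deriv_def)

lemma partial_deriv_add:
  assumes "f differentiable (at x)" "g differentiable (at x)"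
  shows "partial_deriv i (\<lambda>x. f x + g x) x = partial_deriv i f x + partial_deriv i g x"
  using has_derivative_partial_deriv[OF has_derivative_add[OF
      assms[unfolded frechet_derivative_works]], of i] by (simp add: partial_deriv_def)

lemma partial_deriv_cmult:
  assumes "f differentiable (at x)"
  shows "partial_deriv i (\<lambda>x. c * f x) x = c * partial_deriv i f x"
  using has_derivative_partial_deriv[OF has_derivative_mult_right[OF
      assms[unfolded frechet_derivative_works]], of i] by (simp add: partial_deriv_def)

lemma smooth_differentiable: "smooth f \<Longrightarrow> f differentiable (at x)"
  unfolding smooth_def by (metis foldr.simps(1) id_apply)

lemma smooth_partial_deriv: "smooth f \<Longrightarrow> smooth (partial_deriv i f)"
  unfolding smooth_def
proof (intro allI)
  fix js x
  assume a: "\<forall>js x. foldr partial_deriv js f differentiable at x"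
  \<comment> \<open>\<open>foldr\<close> applies the last entry of the list first, so a preliminary
    derivative in direction i is an entry appended at the end.\<close>
  show "foldr partial_deriv js (partial_deriv i f) differentiable at x"
    using a[rule_format, of "js @ [i]" x] by simp
qed

lemma smooth_add:
  assumes "smooth f" "smooth g"
  shows "smooth (\<lambda>x. f x + g x)"
proof -
  have "foldr partial_deriv js (\<lambda>x. f x + g x)
      = (\<lambda>x. foldr partial_deriv js f x + foldr partial_deriv js g x)" for js
  proof (induction js)
    case (Cons i js)
    show ?case
      by (simp only: foldr.simps o_apply Cons.IH, rule ext, rule partial_deriv_add)
        (use assms in \<open>auto simp: smooth_def\<close>)
  qed simp
  then show ?thesis using assms by (simp add: smooth_def differentiable_add)
qed

lemma smooth_cmult:
  assumes "smooth f"
  shows "smooth (\<lambda>x. c * f x)"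
proof -
  have "foldr partial_deriv js (\<lambda>x. c * f x) = (\<lambda>x. c * foldr partial_deriv js f x)" for js
  proof (induction js)
    case (Cons i js)
    show ?case
      by (simp only: foldr.simps o_apply Cons.IH, rule ext, rule partial_deriv_cmult)
        (use assms in \<open>auto simp: smooth_def\<close>)
  qed simp
  then show ?thesis using assms by (simp add: smooth_def differentiable_mult)
qed

lemma smooth_diff: "smooth f \<Longrightarrow> smooth g \<Longrightarrow> smooth (\<lambda>x. f x - g x)"
  using smooth_add[OF _ smooth_cmult, of f g "-1"] by simp

lemma has_derivative_grad:
  assumes "f differentiable (at x)"
  shows "(f has_derivative (\<lambda>h. grad f x \<bullet> h)) (at x)"
proof -
  let ?f' = "frechet_derivative f (at x)"
  have d: "(f has_derivative ?f') (at x)" using assms by (simp add: frechet_derivative_works)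
  then have lin: "linear ?f'" using has_derivative_linear by blast
  have "?f' h = grad f x \<bullet> h" for h
  proof -
    have "?f' h = ?f' (\<Sum>i\<in>UNIV. (h $ i) *\<^sub>R axis i 1)"
      using basis_expansion[of h] by (simp add: scalar_mult_eq_scaleR)
    also have "\<dots> = (\<Sum>i\<in>UNIV. (h $ i) * partial_deriv i f x)"
      by (simp add: linear_sum[OF lin] linear_cmul[OF lin] partial_deriv_def)
    also have "\<dots> = grad f x \<bullet> h" by (simp add: grad_def inner_vec_def mult.commute)
    finally show ?thesis .
  qed
  then have "?f' = (\<lambda>h. grad f x \<bullet> h)" by auto
  then show ?thesis using d by simp
qed

lemma grad_unique:
  assumes "(f has_derivative (\<lambda>h. g \<bullet> h)) (at x)"
  shows "grad f x = g"
  using has_derivative_partial_deriv[OF assms] by (simp add: grad_def vec_eq_iff inner_axis)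

lemma smooth_has_derivative: "smooth f \<Longrightarrow> (f has_derivative (\<lambda>h. grad f x \<bullet> h)) (at x)"
  by (simp add: has_derivative_grad smooth_differentiable)

lemma smooth_continuous_grad: "smooth f \<Longrightarrow> continuous_on UNIV (grad f)"
  unfolding grad_def
  by (intro continuous_intros continuous_at_imp_continuous_on ballI
      differentiable_imp_continuous_within smooth_differentiable smooth_partial_deriv)

lemma smooth_continuous: "smooth f \<Longrightarrow> continuous_on UNIV f"
  by (intro continuous_at_imp_continuous_on ballI
      differentiable_imp_continuous_within smooth_differentiable)

section \<open>Bump functions\<close>

text \<open>Cauchy's flat function exp(-1/t), extended by 0. The polynomial factor in 1/t makes the
  family closed under differentiation, so that one derivative formula settles all orders.\<close>

definition flat_fun :: "real poly \<Rightarrow> real \<Rightarrow> real" where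
  "flat_fun p t = (if t > 0 then poly p (1/t) * exp (- (1/t)) else 0)"

lemma poly_exp_tendsto_0: "((\<lambda>y. poly p y * exp (- y)) \<longlongrightarrow> (0::real)) at_top"
proof -
  have "((\<lambda>y. \<Sum>i\<le>degree p. coeff p i * (y ^ i / exp y)) \<longlongrightarrow> (\<Sum>i\<le>degree p. coeff p i * 0)) at_top"
    by (intro tendsto_sum tendsto_mult tendsto_const tendsto_power_div_exp_0)
  then show ?thesis
    by (simp add: poly_altdef sum_distrib_right exp_minus divide_inverse mult.assoc)
qed

text \<open>Put y = 1/t, so that y' = -y^2 and (p(y) e^(-y))' = y^2 (p(y) - p'(y)) e^(-y); the
  factor \<open>[:0, 0, 1:]\<close> is y^2. At 0 the difference quotient from the right is y p(y)
  e^(-y), which tends to 0 because the exponential beats every polynomial.\<close>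

lemma flat_fun_has_derivative:
  "(flat_fun p has_real_derivative flat_fun ((p - pderiv p) * [:0, 0, 1:]) t) (at t)"
proof (cases t "0::real" rule: linorder_cases)
  case less
  have "((\<lambda>t. 0) has_real_derivative flat_fun ((p - pderiv p) * [:0, 0, 1:]) t) (at t)"
    using less by (simp add: flat_fun_def)
  then show ?thesis
    by (rule has_field_derivative_transform_within_open[of _ _ _ "{..<0}"])
       (use less in \<open>auto simp: flat_fun_def\<close>)
next
  case greater
  have "((\<lambda>t. poly p (1/t) * exp (- (1/t))) has_real_derivative
      flat_fun ((p - pderiv p) * [:0, 0, 1:]) t) (at t)"
    using greater
    by (auto intro!: derivative_eq_intros poly_DERIV[THEN DERIV_chain2]
        simp: flat_fun_def field_simps power2_eq_square)
  then show ?thesis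
    by (rule has_field_derivative_transform_within_open[of _ _ _ "{0<..}"])
       (use greater in \<open>auto simp: flat_fun_def\<close>)
next
  case equal
  have "((\<lambda>y. poly (pCons 0 p) y * exp (- y)) \<longlongrightarrow> 0) at_top" by (rule poly_exp_tendsto_0)
  then have "((\<lambda>h. poly (pCons 0 p) (1/h) * exp (- (1/h))) \<longlongrightarrow> 0) (at_right (0::real))"
    unfolding inverse_eq_divide[symmetric]
    by (rule filterlim_compose[OF _ filterlim_inverse_at_top_right])
  then have r: "((\<lambda>h. flat_fun p h / h) \<longlongrightarrow> 0) (at_right 0)"
    by (rule Lim_transform_eventually)
       (auto simp: flat_fun_def eventually_at_filter field_simps intro!: always_eventually)
  have l: "((\<lambda>h. flat_fun p h / h) \<longlongrightarrow> 0) (at_left 0)"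
    by (rule Lim_transform_eventually[of "\<lambda>_. 0"])
       (auto simp: flat_fun_def eventually_at_filter)
  have "((\<lambda>h. flat_fun p h / h) \<longlongrightarrow> 0) (at 0)"
    using r l by (simp add: filterlim_at_split)
  then show ?thesis using equal
    by (simp add: DERIV_def flat_fun_def[of _ 0])
qed

text \<open>\<open>smooth\<close> quantifies over all iterated partial derivatives. A class of
  differentiable functions that is closed under a single partial derivative obtains them all by
  induction; this one is large enough for bump functions and affine functions.\<close>

inductive_set elementary_smooth :: "(real^'n \<Rightarrow> real) set" where
  const: "(\<lambda>x. c) \<in> elementary_smooth"
| coord: "(\<lambda>x. x $ i) \<in> elementary_smooth"
| flat: "(\<lambda>x. flat_fun p (c * x $ i + d)) \<in> elementary_smooth"
| add: "f \<in> elementary_smooth \<Longrightarrow> g \<in> elementary_smooth \<Longrightarrow> (\<lambda>x. f x + g x) \<in> elementary_smooth"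
| mult: "f \<in> elementary_smooth \<Longrightarrow> g \<in> elementary_smooth \<Longrightarrow> (\<lambda>x. f x * g x) \<in> elementary_smooth"

lemma elementary_smooth_deriv:
  fixes f :: "real^'n \<Rightarrow> real"
  shows "f \<in> elementary_smooth \<Longrightarrow> (\<forall>x. f differentiable (at x)) \<and> partial_deriv j f \<in> elementary_smooth"
proof (induction rule: elementary_smooth.induct)
  case (const c)
  have "partial_deriv j (\<lambda>x. c) = (\<lambda>x. 0)"
    by (rule ext) (simp add: has_derivative_partial_deriv[OF has_derivative_const])
  then show ?case by (simp add: elementary_smooth.const)
next
  case (coord i)
  have d: "((\<lambda>x::real^'n. x $ i) has_derivative (\<lambda>h. h $ i)) (at x)" for x
    by (rule bounded_linear_imp_has_derivative) (rule bounded_linear_vec_nth)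
  have "partial_deriv j (\<lambda>x. x $ i) = (\<lambda>x. axis j 1 $ i)"
    by (rule ext) (simp add: has_derivative_partial_deriv[OF d])
  then show ?case using d by (auto simp: elementary_smooth.const differentiable_def)
next
  case (flat p c i d)
  let ?q = "(p - pderiv p) * [:0, 0, 1:]"
  have d: "((\<lambda>x::real^'n. flat_fun p (c * x $ i + d)) has_derivative
      (\<lambda>h. flat_fun ?q (c * x $ i + d) * (c * h $ i))) (at x)" for x
  proof -
    have "((\<lambda>x::real^'n. c * x $ i + d) has_derivative (\<lambda>h. c * h $ i)) (at x)"
      by (auto intro!: derivative_eq_intros bounded_linear_imp_has_derivative bounded_linear_vec_nth)
    from DERIV_compose_FDERIV[OF flat_fun_has_derivative this] show ?thesis
      by (simp add: mult.commute)
  qed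
  have "partial_deriv j (\<lambda>x. flat_fun p (c * x $ i + d))
      = (\<lambda>x. flat_fun ?q (c * x $ i + d) * (c * axis j 1 $ i))"
    by (rule ext) (simp only: has_derivative_partial_deriv[OF d])
  then show ?case using d
    by (auto simp: differentiable_def intro!: elementary_smooth.intros)
next
  case (add f g)
  then have "partial_deriv j (\<lambda>x. f x + g x) = (\<lambda>x. partial_deriv j f x + partial_deriv j g x)"
    by (auto simp: fun_eq_iff partial_deriv_add)
  then show ?case using add by (auto intro: elementary_smooth.add)
next
  case (mult f g)
  have "partial_deriv j (\<lambda>x. f x * g x) x = f x * partial_deriv j g x + partial_deriv j f x * g x" for x
  proof -
    have "(f has_derivative frechet_derivative f (at x)) (at x)"
      "(g has_derivative frechet_derivative g (at x)) (at x)"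
      using mult.IH by (simp_all add: frechet_derivative_works)
    from has_derivative_partial_deriv[OF has_derivative_mult[OF this]] show ?thesis
      by (simp add: partial_deriv_def)
  qed
  then have "partial_deriv j (\<lambda>x. f x * g x) = (\<lambda>x. f x * partial_deriv j g x + partial_deriv j f x * g x)"
    by auto
  then show ?case using mult by (auto intro!: elementary_smooth.intros)
qed

lemma elementary_smooth_imp_smooth:
  assumes "f \<in> elementary_smooth"
  shows "smooth f"
proof -
  have "foldr partial_deriv js f \<in> elementary_smooth" for js
    using assms by (induction js) (auto dest: elementary_smooth_deriv)
  then show ?thesis by (auto simp: smooth_def dest: elementary_smooth_deriv)
qed

lemma elementary_smooth_prod:
  "finite I \<Longrightarrow> (\<And>i. i \<in> I \<Longrightarrow> f i \<in> elementary_smooth) \<Longrightarrow> (\<lambda>x. \<Prod>i\<in>I. f i x) \<in> elementary_smooth"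
  by (induction I rule: finite_induct) (auto intro: elementary_smooth.intros)

lemma elementary_smooth_sum:
  "finite I \<Longrightarrow> (\<And>i. i \<in> I \<Longrightarrow> f i \<in> elementary_smooth) \<Longrightarrow> (\<lambda>x. \<Sum>i\<in>I. f i x) \<in> elementary_smooth"
  by (induction I rule: finite_induct) (auto intro: elementary_smooth.intros)

lemma smooth_affine: "smooth (\<lambda>x::real^'n. a \<bullet> x + c)"
proof -
  have "(\<lambda>x::real^'n. a \<bullet> x + c) = (\<lambda>x. (\<Sum>i\<in>UNIV. a $ i * x $ i) + c)"
    by (simp add: inner_vec_def)
  also have "\<dots> \<in> elementary_smooth"
    by (intro elementary_smooth.intros elementary_smooth_sum) auto
  finally show ?thesis by (rule elementary_smooth_imp_smooth)
qed

text \<open>A smooth function with values in [0, 1] that vanishes outside the open box between a and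
  b when k is positive. The parameter k stretches the argument of exp(-1/t), so that for growing k
  the functions converge pointwise to the indicator of the box.\<close>

definition bump :: "real \<Rightarrow> real^'n \<Rightarrow> real^'n \<Rightarrow> real^'n \<Rightarrow> real" where
  "bump k a b x = (\<Prod>i\<in>UNIV. flat_fun 1 (k * x $ i + - k * a $ i) * flat_fun 1 (- k * x $ i + k * b $ i))"

lemma smooth_bump: "smooth (bump k a b)"
proof -
  have "bump k a b \<in> elementary_smooth"
    unfolding bump_def[abs_def]
    by (intro elementary_smooth_prod elementary_smooth.mult elementary_smooth.flat finite)
  then show ?thesis by (rule elementary_smooth_imp_smooth)
qed

lemma flat_fun_1_bounds: "0 \<le> flat_fun 1 t" "flat_fun 1 t \<le> 1"
  by (auto simp: flat_fun_def)

lemma bump_nonneg: "0 \<le> bump k a b x"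
  unfolding bump_def by (intro prod_nonneg mult_nonneg_nonneg ballI flat_fun_1_bounds)

lemma bump_le_1: "bump k a b x \<le> 1"
  unfolding bump_def
  by (intro prod_le_1 conjI mult_nonneg_nonneg mult_le_one flat_fun_1_bounds ballI)

lemma bump_outside:
  assumes "k > 0" "x \<notin> box a b"
  shows "bump k a b x = 0"
proof -
  obtain i where "x $ i \<le> a $ i \<or> b $ i \<le> x $ i"
    using assms(2) by (auto simp: mem_box_cart not_less)
  then have "flat_fun 1 (k * x $ i + - k * a $ i) = 0 \<or> flat_fun 1 (- k * x $ i + k * b $ i) = 0"
    using assms(1) by (auto simp: flat_fun_def)
  then show ?thesis unfolding bump_def
    by (intro prod_zero[OF finite]) auto
qed

lemma bump_tendsto: "(\<lambda>k. bump (real (Suc k)) a b x) \<longlonglongrightarrow> indicator (box a b) x"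
proof (cases "x \<in> box a b")
  case False
  then show ?thesis by (simp add: bump_outside del: of_nat_Suc)
next
  case True
  have f: "(\<lambda>k. flat_fun 1 (real (Suc k) * s)) \<longlonglongrightarrow> 1" if "s > 0" for s
  proof -
    have "(\<lambda>k. exp (- (inverse (real (Suc k)) * (1 / s)))) \<longlonglongrightarrow> exp (- (0 * (1/s)))"
      by (intro tendsto_intros LIMSEQ_inverse_real_of_nat)
    moreover have "flat_fun 1 (real (Suc k) * s) = exp (- (inverse (real (Suc k)) * (1 / s)))" for k
      using that by (simp add: flat_fun_def field_simps del: of_nat_Suc)
    ultimately show ?thesis by simp
  qed
  have "(\<lambda>k. bump (real (Suc k)) a b x) \<longlonglongrightarrow> (\<Prod>i\<in>(UNIV::'a set). 1 * 1)"
    unfolding bump_def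
  proof (intro tendsto_prod tendsto_mult)
    fix i
    show "(\<lambda>k. flat_fun 1 (real (Suc k) * x $ i + - real (Suc k) * a $ i)) \<longlonglongrightarrow> 1"
      using f[of "x $ i - a $ i"] True by (simp add: mem_box_cart algebra_simps del: of_nat_Suc)
    show "(\<lambda>k. flat_fun 1 (- real (Suc k) * x $ i + real (Suc k) * b $ i)) \<longlonglongrightarrow> 1"
      using f[of "b $ i - x $ i"] True by (simp add: mem_box_cart algebra_simps del: of_nat_Suc)
  qed
  then show ?thesis using True by simp
qed

lemma bump_test_function:
  assumes "cbox a b \<subseteq> U" "k > 0"
  shows "bump k a b \<in> test_functions U"
proof -
  have "closure {x. bump k a b x \<noteq> 0} \<subseteq> cbox a b"
  proof (rule closure_minimal)
    show "{x. bump k a b x \<noteq> 0} \<subseteq> cbox a b"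
      using bump_outside[OF assms(2)] box_subset_cbox[of a b] by blast
  qed (rule closed_cbox)
  moreover have "compact (closure {x. bump k a b x \<noteq> 0})"
    using calculation compact_cbox compact_closure by (meson bounded_cbox bounded_subset closure_subset subset_trans)
  ultimately show ?thesis
    using assms(1) by (auto simp: test_functions_def smooth_bump)
qed

text \<open>The bump functions converge boundedly to indicators of boxes, so G has integral 0 over
  every box in U, and Lebesgue's differentiation theorem recovers G from these integrals almost
  everywhere.\<close>

lemma fundamental_lemma:
  fixes G :: "real^'n \<Rightarrow> real"
  assumes U: "open U" and G: "integrable (lebesgue_on U) G"
    and zero: "\<And>\<psi>. \<psi> \<in> test_functions U \<Longrightarrow> (LINT x|lebesgue_on U. \<psi> x * G x) = 0"
  shows "AE x in lebesgue_on U. G x = 0"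
proof -
  define H where "H x = indicator U x * G x" for x
  have Ul: "U \<in> sets lebesgue" using U by simp
  have H: "integrable lebesgue H"
    using G Ul by (simp add: integrable_restrict_space H_def[abs_def])
  have setint: "set_integrable lebesgue S H" if "S \<in> sets lebesgue" for S
    unfolding set_integrable_def using integrable_mult_indicator[OF that H] .
  have box0: "integral (cbox a b) H = 0" if ab: "cbox a b \<subseteq> U" for a b
  proof -
    have Gm[measurable]: "G \<in> borel_measurable (lebesgue_on U)" using G by auto
    have "(\<lambda>k. LINT x|lebesgue_on U. bump (real (Suc k)) a b x * G x)
        \<longlonglongrightarrow> (LINT x|lebesgue_on U. indicator (box a b) x * G x)"
    proof (rule integral_dominated_convergence)
      show "integrable (lebesgue_on U) (\<lambda>x. \<bar>G x\<bar>)" using G by simp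
      show "(\<lambda>x. indicator (box a b) x * G x) \<in> borel_measurable (lebesgue_on U)"
        by (intro borel_measurable_times Gm measurable_restrict_space1 borel_measurable_indicator) simp
      show "(\<lambda>x. bump (real (Suc k)) a b x * G x) \<in> borel_measurable (lebesgue_on U)" for k
      proof (intro borel_measurable_times Gm)
        have "bump (real (Suc k)) a b \<in> borel_measurable borel"
          by (intro borel_measurable_continuous_onI smooth_continuous smooth_bump)
        then show "bump (real (Suc k)) a b \<in> borel_measurable (lebesgue_on U)"
          by (intro measurable_restrict_space1 measurable_completion) simp
      qed
      show "AE x in lebesgue_on U. (\<lambda>k. bump (real (Suc k)) a b x * G x)
          \<longlonglongrightarrow> indicator (box a b) x * G x"
        by (intro AE_I2 tendsto_mult bump_tendsto tendsto_const)
      show "AE x in lebesgue_on U. norm (bump (real (Suc k)) a b x * G x) \<le> \<bar>G x\<bar>" for k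
        by (intro AE_I2) (simp add: abs_mult mult_left_le_one_le bump_nonneg bump_le_1)
    qed
    moreover have "(LINT x|lebesgue_on U. bump (real (Suc k)) a b x * G x) = 0" for k
      by (rule zero[OF bump_test_function[OF ab]]) simp
    ultimately have "(LINT x|lebesgue_on U. indicator (box a b) x * G x) = 0"
      by (simp add: LIMSEQ_const_iff del: of_nat_Suc)
    then have "(LINT x:box a b|lebesgue. H x) = 0"
      using Ul by (simp add: integral_restrict_space set_lebesgue_integral_def H_def algebra_simps)
    then have "integral (box a b) H = 0"
      using set_lebesgue_integral_eq_integral(2)[OF setint[of "box a b"]] by simp
    then show ?thesis by (simp add: integral_open_interval)
  qed
  have "H integrable_on cbox a b" for a b
    using set_lebesgue_integral_eq_integral(1)[OF setint[of "cbox a b"]] by simp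
  \<comment> \<open>The differentiation theorem for cubes with lower corner x, in explicit form; N
    collects the exceptional points.\<close>
  then obtain N where N: "negligible N"
    "\<And>x e. x \<notin> N \<Longrightarrow> 0 < e \<Longrightarrow> \<exists>d>0. \<forall>h. 0 < h \<and> h < d \<longrightarrow>
       norm (integral (cbox x (x + h *\<^sub>R One)) H /\<^sub>R h ^ DIM(real^'n) - H x) < e"
    using integrable_ccontinuous_explicit[of H] by metis
  have Hz: "H x = 0" if x: "x \<in> U" "x \<notin> N" for x
  proof (rule ccontr)
    assume "H x \<noteq> 0"
    then obtain d where d: "d > 0" and
      dh: "\<And>h. 0 < h \<Longrightarrow> h < d \<Longrightarrow> norm (integral (cbox x (x + h *\<^sub>R One)) H /\<^sub>R h ^ DIM(real^'n) - H x) < \<bar>H x\<bar>"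
      using N(2)[OF x(2), of "\<bar>H x\<bar>"] by auto
    obtain e where e: "e > 0" "cball x e \<subseteq> U" using U x(1) open_contains_cball by blast
    \<comment> \<open>Small enough for the convergence at x and for the cube of side h at x, whose
      diagonal is then at most e, to stay in U.\<close>
    define h where "h = min (d/2) (e / norm (One::real^'n))"
    have On: "norm (One::real^'n) > 0" by simp
    have h: "0 < h" "h < d" "h * norm (One::real^'n) \<le> e"
      using d e On by (auto simp: h_def min_def field_simps)
    have "cbox x (x + h *\<^sub>R One) \<subseteq> cball x e"
    proof
      fix y assume y: "y \<in> cbox x (x + h *\<^sub>R One)"
      have "norm (y - x) \<le> norm (h *\<^sub>R (One::real^'n))"
      proof (rule norm_le_componentwise)
        fix b :: "real^'n" assume "b \<in> Basis"
        then show "\<bar>(y - x) \<bullet> b\<bar> \<le> \<bar>(h *\<^sub>R One) \<bullet> b\<bar>"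
          using y h(1) by (auto simp: mem_box inner_diff_left inner_add_left)
      qed
      then show "y \<in> cball x e" using h by (simp add: dist_norm norm_minus_commute)
    qed
    then have "integral (cbox x (x + h *\<^sub>R One)) H = 0" using box0 e(2) by blast
    then show False using dh[OF h(1,2)] by simp
  qed
  have "AE x in lebesgue. x \<notin> N"
    using N(1) by (simp add: AE_not_in negligible_iff_null_sets)
  then have "AE x in lebesgue. x \<in> U \<longrightarrow> G x = 0"
  proof eventually_elim
    case (elim x)
    then show ?case using Hz[of x] by (auto simp: H_def)
  qed
  then show ?thesis using Ul by (simp add: AE_restrict_space_iff)
qed

section \<open>Continuously differentiable functions\<close>

lemma nn_integral_lborel_affine:
  fixes t :: "'a::euclidean_space"
  assumes [measurable]: "f \<in> borel_measurable borel" and c: "c \<noteq> 0"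
  shows "(\<integral>\<^sup>+x. f x \<partial>lborel) = ennreal (\<bar>c\<bar> ^ DIM('a)) * (\<integral>\<^sup>+x. f (t + c *\<^sub>R x) \<partial>lborel)"
  by (subst lborel_affine[OF c, of t])
     (simp add: nn_integral_density nn_integral_distr nn_integral_cmult)

lemma nn_integral_lborel_translation:
  fixes t :: "'a::euclidean_space"
  assumes "f \<in> borel_measurable borel"
  shows "(\<integral>\<^sup>+x. f (x + t) \<partial>lborel) = (\<integral>\<^sup>+x. f x \<partial>lborel)"
  using nn_integral_lborel_affine[OF assms, of 1 t] by (simp add: add.commute)

lemma lborel_integral_affine:
  fixes f :: "'a::euclidean_space \<Rightarrow> 'b::euclidean_space"
  assumes [measurable]: "f \<in> borel_measurable borel" and c: "c \<noteq> 0"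
  shows "(\<integral>x. f x \<partial>lborel) = (\<bar>c\<bar> ^ DIM('a)) *\<^sub>R (\<integral>x. f (t + c *\<^sub>R x) \<partial>lborel)"
proof -
  have "(\<integral>x. f x \<partial>lborel)
      = (\<integral>x. f x \<partial>density (distr lborel borel (\<lambda>x. t + c *\<^sub>R x)) (\<lambda>_. ennreal (\<bar>c\<bar>^DIM('a))))"
    using lborel_affine[OF c, of t] by simp
  then show ?thesis
    by (subst (asm) integral_density) (auto simp: integral_distr)
qed

lemma lborel_integral_translation:
  fixes f :: "'a::euclidean_space \<Rightarrow> 'b::euclidean_space"
  assumes "f \<in> borel_measurable borel"
  shows "(\<integral>x. f (x + t) \<partial>lborel) = (\<integral>x. f x \<partial>lborel)"
  using lborel_integral_affine[OF assms, of 1 t] by (simp add: add.commute)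

text \<open>Weaker than \<open>smooth\<close> on purpose: products, differences and shears preserve
  it by one use of the product or chain rule, with no iterated partial derivatives to follow. It is
  stated on any Euclidean space, so that simplices can be treated without coordinates.\<close>

definition has_C1_grad :: "('a::euclidean_space \<Rightarrow> real) \<Rightarrow> ('a \<Rightarrow> 'a) \<Rightarrow> bool" where
  "has_C1_grad f g \<longleftrightarrow> (\<forall>x. (f has_derivative (\<lambda>h. g x \<bullet> h)) (at x)) \<and> continuous_on UNIV g"

lemma smooth_has_C1_grad: "smooth f \<Longrightarrow> has_C1_grad f (grad f)"
  by (simp add: has_C1_grad_def smooth_has_derivative smooth_continuous_grad)

lemma has_C1_grad_grad: "has_C1_grad f g \<Longrightarrow> grad f = g"
  by (auto simp: has_C1_grad_def intro: grad_unique)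

lemma has_C1_grad_continuous:
  assumes "has_C1_grad f g"
  shows "continuous_on S f" "continuous_on S g"
proof -
  show "continuous_on S f"
    using assms unfolding has_C1_grad_def
    by (intro continuous_at_imp_continuous_on ballI) (blast intro: has_derivative_continuous)
  show "continuous_on S g"
    using assms continuous_on_subset[of UNIV g S] by (simp add: has_C1_grad_def)
qed

lemma has_C1_grad_measurable:
  assumes "has_C1_grad f g"
  shows "f \<in> borel_measurable borel" "g \<in> borel_measurable borel"
  using has_C1_grad_continuous[OF assms] by (auto intro: borel_measurable_continuous_onI)

lemma has_C1_grad_diff:
  "has_C1_grad f g \<Longrightarrow> has_C1_grad f' g' \<Longrightarrow> has_C1_grad (\<lambda>x. f x - f' x) (\<lambda>x. g x - g' x)"
  unfolding has_C1_grad_def inner_diff_left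
  by (auto intro!: has_derivative_diff[where f' = "\<lambda>h. g _ \<bullet> h"] continuous_on_diff)

lemma has_C1_grad_mult:
  assumes f: "has_C1_grad f g" and f': "has_C1_grad f' g'"
  shows "has_C1_grad (\<lambda>x. f x * f' x) (\<lambda>x. f x *\<^sub>R g' x + f' x *\<^sub>R g x)"
  unfolding has_C1_grad_def
proof (intro conjI allI)
  fix x
  have "(f has_derivative (\<lambda>h. g x \<bullet> h)) (at x)" "(f' has_derivative (\<lambda>h. g' x \<bullet> h)) (at x)"
    using assms by (auto simp: has_C1_grad_def)
  from has_derivative_mult[OF this]
  show "((\<lambda>x. f x * f' x) has_derivative (\<lambda>h. (f x *\<^sub>R g' x + f' x *\<^sub>R g x) \<bullet> h)) (at x)"
    by (simp add: inner_add_left mult.commute)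
  show "continuous_on UNIV (\<lambda>x. f x *\<^sub>R g' x + f' x *\<^sub>R g x)"
    by (intro continuous_intros has_C1_grad_continuous[OF f] has_C1_grad_continuous[OF f'])
qed

lemma has_C1_grad_affine: "has_C1_grad (\<lambda>x. a \<bullet> x + c) (\<lambda>x. a)"
  unfolding has_C1_grad_def
  by (auto intro!: derivative_eq_intros)

text \<open>The substitution fixes the hyperplane \<nu> \<bullet> x = \<beta> pointwise and moves
  all other points along \<tau>; it will carry a simplex onto its neighbour across a facet. The
  gradient is transformed by the adjoint of the linear part, which sends h to h - (\<nu> \<bullet>
  h) \<tau>.\<close>

lemma has_C1_grad_shear:
  assumes f: "has_C1_grad f g"
  shows "has_C1_grad (\<lambda>x. f (x + (\<beta> - \<nu> \<bullet> x) *\<^sub>R \<tau>))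
    (\<lambda>x. g (x + (\<beta> - \<nu> \<bullet> x) *\<^sub>R \<tau>) - (g (x + (\<beta> - \<nu> \<bullet> x) *\<^sub>R \<tau>) \<bullet> \<tau>) *\<^sub>R \<nu>)"
  unfolding has_C1_grad_def
proof (intro conjI allI)
  fix x
  define A where "A x = x + (\<beta> - \<nu> \<bullet> x) *\<^sub>R \<tau>" for x
  have "(A has_derivative (\<lambda>h. h + (- (\<nu> \<bullet> h)) *\<^sub>R \<tau>)) (at x)"
    unfolding A_def[abs_def] by (auto intro!: derivative_eq_intros)
  moreover have "(f has_derivative (\<lambda>h. g (A x) \<bullet> h)) (at (A x))"
    using f by (simp add: has_C1_grad_def)
  ultimately have "(f \<circ> A has_derivative (\<lambda>h. g (A x) \<bullet> h) \<circ> (\<lambda>h. h + (- (\<nu> \<bullet> h)) *\<^sub>R \<tau>)) (at x)"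
    by (rule diff_chain_at)
  moreover have "(\<lambda>h. g (A x) \<bullet> h) \<circ> (\<lambda>h. h + (- (\<nu> \<bullet> h)) *\<^sub>R \<tau>)
      = (\<lambda>h. (g (A x) - (g (A x) \<bullet> \<tau>) *\<^sub>R \<nu>) \<bullet> h)"
    by (auto simp: fun_eq_iff inner_diff_left inner_diff_right inner_add_right inner_commute algebra_simps)
  ultimately show "((\<lambda>x. f (x + (\<beta> - \<nu> \<bullet> x) *\<^sub>R \<tau>)) has_derivative
      (\<lambda>h. (g (x + (\<beta> - \<nu> \<bullet> x) *\<^sub>R \<tau>) - (g (x + (\<beta> - \<nu> \<bullet> x) *\<^sub>R \<tau>) \<bullet> \<tau>) *\<^sub>R \<nu>) \<bullet> h)) (at x)"
    by (simp add: A_def o_def)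
next
  have "continuous_on UNIV (\<lambda>x. g (x + (\<beta> - \<nu> \<bullet> x) *\<^sub>R \<tau>))"
    by (rule continuous_on_compose2[OF has_C1_grad_continuous(2)[OF f, of UNIV]])
       (auto intro!: continuous_intros)
  then show "continuous_on UNIV (\<lambda>x. g (x + (\<beta> - \<nu> \<bullet> x) *\<^sub>R \<tau>) - (g (x + (\<beta> - \<nu> \<bullet> x) *\<^sub>R \<tau>) \<bullet> \<tau>) *\<^sub>R \<nu>)"
    by (intro continuous_intros)
qed

lemma has_C1_grad_line:
  assumes "has_C1_grad f g"
  shows "((\<lambda>s. f (x + s *\<^sub>R a)) has_real_derivative g (x + s *\<^sub>R a) \<bullet> a) (at s)"
proof -
  have "((\<lambda>s. x + s *\<^sub>R a) has_derivative (\<lambda>h. h *\<^sub>R a)) (at s)"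
    by (auto intro!: derivative_eq_intros)
  moreover have "(f has_derivative (\<lambda>h. g (x + s *\<^sub>R a) \<bullet> h)) (at (x + s *\<^sub>R a))"
    using assms by (simp add: has_C1_grad_def)
  ultimately have "(f \<circ> (\<lambda>s. x + s *\<^sub>R a) has_derivative
      (\<lambda>h. g (x + s *\<^sub>R a) \<bullet> h) \<circ> (\<lambda>h. h *\<^sub>R a)) (at s)"
    by (rule diff_chain_at)
  then show ?thesis
    by (simp add: o_def has_field_derivative_def mult_commute_abs)
qed

lemma has_C1_grad_FTC:
  assumes f: "has_C1_grad f g" and "0 \<le> l"
  shows "f (x + l *\<^sub>R a) - f x = (LINT s|lborel. indicator {0..l} s *\<^sub>R (g (x + s *\<^sub>R a) \<bullet> a))"
    and "set_integrable lborel {0..l} (\<lambda>s. g (x + s *\<^sub>R a) \<bullet> a)"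
    and "continuous_on UNIV (\<lambda>s. g (x + s *\<^sub>R a) \<bullet> a)"
proof -
  have "continuous_on UNIV (\<lambda>s. g (x + s *\<^sub>R a))"
    by (rule continuous_on_compose2[OF has_C1_grad_continuous(2)[OF f, of UNIV]])
       (auto intro!: continuous_intros)
  then show c: "continuous_on UNIV (\<lambda>s. g (x + s *\<^sub>R a) \<bullet> a)"
    by (intro continuous_intros)
  then have c': "continuous_on {0..l} (\<lambda>s. g (x + s *\<^sub>R a) \<bullet> a)"
    using continuous_on_subset by blast
  show "set_integrable lborel {0..l} (\<lambda>s. g (x + s *\<^sub>R a) \<bullet> a)"
    by (rule borel_integrable_atLeastAtMost'[OF c'])
  show "f (x + l *\<^sub>R a) - f x = (LINT s|lborel. indicator {0..l} s *\<^sub>R (g (x + s *\<^sub>R a) \<bullet> a))"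
    by (subst integral_FTC_atLeastAtMost[OF \<open>0 \<le> l\<close> _ c', where F = "\<lambda>s. f (x + s *\<^sub>R a)"])
       (auto intro: has_field_derivative_at_within[OF has_C1_grad_line[OF f]]
             simp flip: has_real_derivative_iff_has_vector_derivative)
qed

lemma has_C1_grad_abs_bound:
  assumes f: "has_C1_grad f g" and l: "0 \<le> l"
  shows "ennreal \<bar>f (x + l *\<^sub>R a) - f x\<bar>
    \<le> (\<integral>\<^sup>+s. ennreal (norm a * norm (g (x + s *\<^sub>R a))) * indicator {0..l} s \<partial>lborel)"
proof -
  let ?h = "\<lambda>s. g (x + s *\<^sub>R a) \<bullet> a"
  have int: "integrable lborel (\<lambda>s. indicator {0..l} s *\<^sub>R ?h s)"
    using has_C1_grad_FTC(2)[OF f l] by (simp add: set_integrable_def)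
  have "ennreal \<bar>f (x + l *\<^sub>R a) - f x\<bar> \<le> (\<integral>\<^sup>+s. norm (indicator {0..l} s *\<^sub>R ?h s) \<partial>lborel)"
    using integral_norm_bound_ennreal[OF int] has_C1_grad_FTC(1)[OF f l, of x a]
    by (simp only: real_norm_def)
  also have "\<dots> \<le> (\<integral>\<^sup>+s. ennreal (norm a * norm (g (x + s *\<^sub>R a))) * indicator {0..l} s \<partial>lborel)"
  proof (rule nn_integral_mono)
    fix s
    have "\<bar>?h s\<bar> \<le> norm a * norm (g (x + s *\<^sub>R a))"
      by (metis Cauchy_Schwarz_ineq2 mult.commute)
    then show "ennreal (norm (indicator {0..l} s *\<^sub>R ?h s))
        \<le> ennreal (norm a * norm (g (x + s *\<^sub>R a))) * indicator {0..l} s"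
      by (auto split: split_indicator intro!: ennreal_leI)
  qed
  finally show ?thesis .
qed

text \<open>The fundamental theorem of calculus on the segment, followed by Cauchy--Schwarz on
  \<open>{0..l}\<close>, which contributes the factor l. The bound is a nonnegative integral, so
  that Tonelli's theorem applies to it without integrability proofs.\<close>

lemma has_C1_grad_square_bound:
  assumes f: "has_C1_grad f g" and l: "0 \<le> l"
  shows "ennreal ((f (x + l *\<^sub>R a) - f x)\<^sup>2)
    \<le> (\<integral>\<^sup>+s. ennreal (l * ((norm a)\<^sup>2 * (norm (g (x + s *\<^sub>R a)))\<^sup>2)) * indicator {0..l} s \<partial>lborel)"
proof -
  let ?h = "\<lambda>s. g (x + s *\<^sub>R a) \<bullet> a"
  let ?M = "restrict_space lborel {0..l}"
  have fin: "finite_measure ?M"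
    by (rule finite_measureI) (use l in \<open>simp add: space_restrict_space emeasure_restrict_space\<close>)
  have c: "continuous_on {0..l} ?h" using has_C1_grad_FTC(3)[OF f l] continuous_on_subset by blast
  have "?h \<in> borel_measurable borel"
    by (rule borel_measurable_continuous_onI[OF has_C1_grad_FTC(3)[OF f l]])
  then have hm: "?h \<in> borel_measurable ?M"
    by (intro measurable_restrict_space1) simp
  obtain B where B: "\<And>s. s \<in> {0..l} \<Longrightarrow> norm (?h s) \<le> B"
    using compact_imp_bounded[OF compact_continuous_image[OF c compact_Icc]]
    by (force simp: bounded_iff)
  have L2: "?h \<in> L2 ?M"
    by (rule L2_bounded_measurable[OF fin hm B]) (simp add: space_restrict_space)
  have eq: "f (x + l *\<^sub>R a) - f x = (LINT s|?M. ?h s)"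
    by (subst has_C1_grad_FTC(1)[OF f l]) (simp add: integral_restrict_space)
  have m: "measure ?M (space ?M) = l"
    using l by (simp add: space_restrict_space measure_restrict_space)
  have sqint: "integrable ?M (\<lambda>s. l * (?h s)\<^sup>2)"
    using L2_integrable_sq[OF L2] by simp
  have "(f (x + l *\<^sub>R a) - f x)\<^sup>2 \<le> (LINT s|?M. l * (?h s)\<^sup>2)"
    using L2_integral_square_le[OF fin L2] unfolding eq m by simp
  then have "ennreal ((f (x + l *\<^sub>R a) - f x)\<^sup>2) \<le> ennreal (LINT s|?M. l * (?h s)\<^sup>2)"
    by (rule ennreal_leI)
  also have "\<dots> = (\<integral>\<^sup>+s. ennreal (l * (?h s)\<^sup>2) \<partial>?M)"
    by (rule nn_integral_eq_integral[symmetric, OF sqint]) (use l in auto)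
  also have "\<dots> = (\<integral>\<^sup>+s. ennreal (l * (?h s)\<^sup>2) * indicator {0..l} s \<partial>lborel)"
    by (simp add: nn_integral_restrict_space)
  also have "\<dots> \<le> (\<integral>\<^sup>+s. ennreal (l * ((norm a)\<^sup>2 * (norm (g (x + s *\<^sub>R a)))\<^sup>2)) * indicator {0..l} s \<partial>lborel)"
  proof (rule nn_integral_mono)
    fix s
    have "(?h s)\<^sup>2 \<le> (norm a * norm (g (x + s *\<^sub>R a)))\<^sup>2"
      using Cauchy_Schwarz_ineq2[of "g (x + s *\<^sub>R a)" a]
      by (metis abs_ge_zero mult.commute power2_abs power_mono)
    then have "l * (?h s)\<^sup>2 \<le> l * ((norm a)\<^sup>2 * (norm (g (x + s *\<^sub>R a)))\<^sup>2)"
      using l by (simp add: mult_left_mono power_mult_distrib)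
    then show "ennreal (l * (?h s)\<^sup>2) * indicator {0..l} s
        \<le> ennreal (l * ((norm a)\<^sup>2 * (norm (g (x + s *\<^sub>R a)))\<^sup>2)) * indicator {0..l} s"
      by (intro mult_right_mono ennreal_leI) auto
  qed
  finally show ?thesis .
qed

lemma has_C1_grad_lipschitz:
  assumes f: "has_C1_grad f g" and S: "convex S" and M: "\<And>x. x \<in> S \<Longrightarrow> norm (g x) \<le> M"
    and x: "x \<in> S" and y: "y \<in> S"
  shows "\<bar>f x - f y\<bar> \<le> M * norm (x - y)"
proof -
  have "norm (f x - f y) \<le> M * norm (x - y)"
  proof (rule differentiable_bound[OF S _ _ x y])
    show "(f has_derivative (\<lambda>h. g z \<bullet> h)) (at z within S)" for z
      using f by (auto simp: has_C1_grad_def intro: has_derivative_at_withinI)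
    show "onorm (\<lambda>h. g z \<bullet> h) \<le> M" if "z \<in> S" for z
    proof (rule onorm_le)
      fix h
      have "norm (g z \<bullet> h) \<le> norm (g z) * norm h" by (simp add: Cauchy_Schwarz_ineq2)
      also have "\<dots> \<le> M * norm h" using M[OF that] by (rule mult_right_mono) simp
      finally show "norm (g z \<bullet> h) \<le> M * norm h" .
    qed
  qed
  then show ?thesis by simp
qed

text \<open>Translates of f have the same integral as f, so every difference quotient in direction a
  integrates to 0. Dominated convergence applies because f is Lipschitz on a ball and the quotients
  are supported in one common ball.\<close>

lemma integral_C1_grad_compact_support:
  assumes f: "has_C1_grad f g" and R: "\<And>x. x \<notin> cball 0 R \<Longrightarrow> f x = 0"
  shows "(LINT x|lborel. g x \<bullet> a) = 0"
proof -
  have fm[measurable]: "f \<in> borel_measurable borel" "g \<in> borel_measurable borel"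
    using has_C1_grad_measurable[OF f] by auto
  \<comment> \<open>No step is longer than a, so K contains the supports of all difference
    quotients, and K' also contains the segments that start in K.\<close>
  define K where "K = cball (0::'a) (R + norm a)"
  define K' where "K' = cball (0::'a) (R + 2 * norm a)"
  obtain M where M: "\<And>x. x \<in> K' \<Longrightarrow> norm (g x) \<le> M"
    using compact_imp_bounded[OF compact_continuous_image[OF has_C1_grad_continuous(2)[OF f, of K']]]
    by (force simp: bounded_iff K'_def)
  define q where "q k x = (f (x + inverse (real (Suc k)) *\<^sub>R a) - f x) * real (Suc k)" for k x
  have fint: "integrable lborel f"
  proof -
    have "integrable lborel (\<lambda>x. indicator (cball 0 R) x *\<^sub>R f x)"
      by (rule borel_integrable_compact) (auto intro: has_C1_grad_continuous[OF f])
    moreover have "(\<lambda>x. indicator (cball 0 R) x *\<^sub>R f x) = f"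
      using R by (auto simp: fun_eq_iff split: split_indicator)
    ultimately show ?thesis by simp
  qed
  have ftint: "integrable lborel (\<lambda>x. f (x + t))" for t
  proof -
    have "integrable (distr lborel borel ((+) t)) f" using fint by (simp add: lborel_distr_plus)
    then show ?thesis by (subst (asm) integrable_distr_eq) (auto simp: add.commute)
  qed
  have q0: "(LINT x|lborel. q k x) = 0" for k
    unfolding q_def using fint ftint lborel_integral_translation[OF fm(1)]
    by (simp del: of_nat_Suc)
  have "(\<lambda>k. LINT x|lborel. q k x) \<longlonglongrightarrow> (LINT x|lborel. g x \<bullet> a)"
  proof (rule integral_dominated_convergence[where w = "\<lambda>x. indicator K x *\<^sub>R (M * norm a)"])
    show "integrable lborel (\<lambda>x. indicator K x *\<^sub>R (M * norm a))"
      by (rule borel_integrable_compact) (auto simp: K_def)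
    show "AE x in lborel. (\<lambda>k. q k x) \<longlonglongrightarrow> g x \<bullet> a"
    proof (rule AE_I2)
      fix x
      have "((\<lambda>h. (f (x + (0 + h) *\<^sub>R a) - f (x + 0 *\<^sub>R a)) / h) \<longlongrightarrow> g (x + 0 *\<^sub>R a) \<bullet> a) (at 0)"
        using has_C1_grad_line[OF f, of x a 0] unfolding DERIV_def .
      then have "((\<lambda>h. (f (x + h *\<^sub>R a) - f x) / h) \<longlongrightarrow> g x \<bullet> a) (at 0)" by simp
      moreover have "filterlim (\<lambda>k. inverse (real (Suc k))) (at 0) sequentially"
        unfolding filterlim_at using LIMSEQ_inverse_real_of_nat by (auto simp del: of_nat_Suc)
      ultimately have "(\<lambda>k. (f (x + inverse (real (Suc k)) *\<^sub>R a) - f x) / inverse (real (Suc k))) \<longlonglongrightarrow> g x \<bullet> a"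
        by (rule filterlim_compose)
      then show "(\<lambda>k. q k x) \<longlonglongrightarrow> g x \<bullet> a"
        by (simp add: q_def divide_inverse del: of_nat_Suc)
    qed
    show "AE x in lborel. norm (q k x) \<le> indicator K x *\<^sub>R (M * norm a)" for k
    proof (rule AE_I2)
      fix x
      have small: "norm (inverse (real (Suc k)) *\<^sub>R a) \<le> norm a"
        by (simp add: inverse_eq_divide field_simps)
      show "norm (q k x) \<le> indicator K x *\<^sub>R (M * norm a)"
      proof (cases "x \<in> K")
        case True
        have "\<bar>f (x + inverse (real (Suc k)) *\<^sub>R a) - f x\<bar>
            \<le> M * norm (x + inverse (real (Suc k)) *\<^sub>R a - x)"
        proof (rule has_C1_grad_lipschitz[OF f _ M])
          show "convex K'" by (simp add: K'_def)
          show "x \<in> K'" using True norm_ge_zero[of a] unfolding K_def K'_def mem_cball_0 by linarith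
          show "x + inverse (real (Suc k)) *\<^sub>R a \<in> K'"
            using True small norm_triangle_ineq[of x "inverse (real (Suc k)) *\<^sub>R a"]
            by (simp add: K_def K'_def del: of_nat_Suc norm_scaleR)
        qed
        also have "\<dots> = M * norm a * inverse (real (Suc k))" by simp
        finally have "\<bar>q k x\<bar> \<le> M * norm a * inverse (real (Suc k)) * real (Suc k)"
          unfolding q_def abs_mult
          by (metis (no_types, opaque_lifting) abs_of_nat mult_right_mono of_nat_0_le_iff)
        moreover have "inverse (real (Suc k)) * real (Suc k) = 1" by simp
        ultimately have "\<bar>q k x\<bar> \<le> M * norm a"
          by (metis mult.assoc mult.right_neutral)
        then show ?thesis using True by simp
      next
        case False
        then have "norm x > R + norm a" by (simp add: K_def)
        then have "norm x > R" "norm (x + inverse (real (Suc k)) *\<^sub>R a) > R"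
          using small norm_triangle_ineq4[of "x + inverse (real (Suc k)) *\<^sub>R a" "inverse (real (Suc k)) *\<^sub>R a"]
            norm_ge_zero[of a] by (auto simp del: of_nat_Suc norm_scaleR norm_ge_zero)
        then show ?thesis using R by (simp add: q_def False del: of_nat_Suc norm_scaleR)
      qed
    qed
  qed (auto simp: q_def)
  then show ?thesis using q0 by (simp add: LIMSEQ_const_iff)
qed

section \<open>Continuous functions with compact support or on bounded sets\<close>

lemma continuous_compact_support_integrable:
  fixes F :: "'a::euclidean_space \<Rightarrow> 'b::euclidean_space"
  assumes F: "continuous_on UNIV F" and K: "compact K" "K \<subseteq> U" "\<And>x. x \<notin> K \<Longrightarrow> F x = 0"
    and U: "U \<in> sets lebesgue"
  shows "integrable (lebesgue_on U) F" "(LINT x|lebesgue_on U. F x) = (LINT x|lborel. F x)"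
    "integrable lborel F"
proof -
  have "integrable lborel (\<lambda>x. indicator K x *\<^sub>R F x)"
    by (rule borel_integrable_compact[OF K(1)]) (rule continuous_on_subset[OF F], simp)
  moreover have "(\<lambda>x. indicator K x *\<^sub>R F x) = F"
    using K by (auto simp: fun_eq_iff split: split_indicator)
  ultimately show i: "integrable lborel F" by simp
  have FU: "(\<lambda>x. indicator U x *\<^sub>R F x) = F"
    using K by (auto simp: fun_eq_iff split: split_indicator)
  have m: "F \<in> borel_measurable lborel" using i by auto
  show "integrable (lebesgue_on U) F" "(LINT x|lebesgue_on U. F x) = (LINT x|lborel. F x)"
    using i m U
    by (simp_all add: integrable_restrict_space integral_restrict_space FU integrable_completion integral_completion)
qed

lemma continuous_bounded_L2:
  fixes F :: "'a::euclidean_space \<Rightarrow> 'b::euclidean_space"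
  assumes F: "continuous_on UNIV F" and U: "U \<in> sets lebesgue" "bounded U"
  shows "F \<in> L2 (lebesgue_on U)"
proof -
  have fin: "finite_measure (lebesgue_on U)"
    by (rule finite_measure_lebesgue_on, rule bounded_set_imp_lmeasurable)
       (use U in auto)
  have c: "continuous_on (closure U) F" using F continuous_on_subset by blast
  obtain B where B: "\<And>x. x \<in> closure U \<Longrightarrow> norm (F x) \<le> B"
    using compact_imp_bounded[OF compact_continuous_image[OF c]] U(2)
    by (force simp: bounded_iff compact_closure)
  show ?thesis
  proof (rule L2_bounded_measurable[OF fin])
    show "F \<in> borel_measurable (lebesgue_on U)"
      by (intro measurable_restrict_space1 measurable_completion) (simp add: borel_measurable_continuous_onI F)
    show "norm (F x) \<le> B" if "x \<in> space (lebesgue_on U)" for x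
      using that B closure_subset[of U] by auto
  qed
qed

section \<open>Weak derivatives\<close>

lemma finite_measure_lebesgue_on_bounded:
  fixes U :: "'a::euclidean_space set"
  shows "U \<in> sets lebesgue \<Longrightarrow> bounded U \<Longrightarrow> finite_measure (lebesgue_on U)"
  by (rule finite_measure_lebesgue_on, rule bounded_set_imp_lmeasurable)

lemma L2_scaleR_integrable:
  fixes f :: "'a \<Rightarrow> real" and g :: "'a \<Rightarrow> 'b::euclidean_space"
  assumes "f \<in> L2 M" "g \<in> L2 M"
  shows "integrable M (\<lambda>x. f x *\<^sub>R g x)"
proof (rule Bochner_Integration.integrable_bound)
  have [measurable]: "f \<in> borel_measurable M" "g \<in> borel_measurable M"
    using assms by (auto simp: L2_def)
  show "integrable M (\<lambda>x. (norm (f x))\<^sup>2 + (norm (g x))\<^sup>2)"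
    using assms by (auto simp: L2_def)
  show "(\<lambda>x. f x *\<^sub>R g x) \<in> borel_measurable M" by measurable
  show "AE x in M. norm (f x *\<^sub>R g x) \<le> norm ((norm (f x))\<^sup>2 + (norm (g x))\<^sup>2)"
  proof (rule AE_I2)
    fix x
    show "norm (f x *\<^sub>R g x) \<le> norm ((norm (f x))\<^sup>2 + (norm (g x))\<^sup>2)"
      using sum_squares_bound[of "\<bar>f x\<bar>" "norm (g x)"]
        mult_nonneg_nonneg[OF abs_ge_zero[of "f x"] norm_ge_zero[of "g x"]]
      unfolding norm_scaleR real_norm_def by linarith
  qed
qed

lemma L2_mult_integrable:
  fixes f g :: "'a \<Rightarrow> real"
  shows "f \<in> L2 M \<Longrightarrow> g \<in> L2 M \<Longrightarrow> integrable M (\<lambda>x. f x * g x)"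
  using L2_scaleR_integrable[of f M g] by simp

lemma L2_inner_const:
  fixes f :: "'a \<Rightarrow> 'b::euclidean_space"
  assumes "f \<in> L2 M"
  shows "(\<lambda>x. f x \<bullet> c) \<in> L2 M"
proof (rule L2_bounded_by[OF assms, where c = "norm c"])
  have [measurable]: "f \<in> borel_measurable M" using assms by (auto simp: L2_def)
  show "(\<lambda>x. f x \<bullet> c) \<in> borel_measurable M" by measurable
  show "norm (f x \<bullet> c) \<le> norm c * norm (f x)" for x
    by (metis Cauchy_Schwarz_ineq2 mult.commute real_norm_def)
qed

lemma L2_restrict:
  fixes f :: "'a::euclidean_space \<Rightarrow> 'b::euclidean_space"
  assumes "f \<in> L2 (lebesgue_on U)" "U' \<subseteq> U" "U \<in> sets lebesgue" "U' \<in> sets lebesgue"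
  shows "f \<in> L2 (lebesgue_on U')"
proof (rule L2I)
  have "f \<in> borel_measurable (restrict_space (lebesgue_on U) U')"
    using assms(1) by (simp add: L2_def measurable_restrict_space1)
  moreover have "restrict_space (lebesgue_on U) U' = lebesgue_on U'"
    using assms by (simp add: restrict_restrict_space Int_absorb1)
  ultimately show "f \<in> borel_measurable (lebesgue_on U')" by simp
  have "integrable lebesgue (\<lambda>x. indicator U' x *\<^sub>R (indicator U x *\<^sub>R (norm (f x))\<^sup>2))"
    by (rule integrable_mult_indicator[OF assms(4)])
       (use L2_integrable_sq[OF assms(1)] assms(3) in \<open>simp add: integrable_restrict_space\<close>)
  moreover have "(\<lambda>x. indicator U' x *\<^sub>R (indicator U x *\<^sub>R (norm (f x))\<^sup>2)) = (\<lambda>x. indicator U' x *\<^sub>R (norm (f x))\<^sup>2)"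
    using assms(2) by (auto simp: fun_eq_iff split: split_indicator)
  ultimately show "integrable (lebesgue_on U') (\<lambda>x. (norm (f x))\<^sup>2)"
    using assms(4) by (simp add: integrable_restrict_space)
qed

lemma L2_cong_on:
  assumes "\<And>x. x \<in> space M \<Longrightarrow> f x = g x"
  shows "f \<in> L2 M \<longleftrightarrow> g \<in> L2 M"
  using assms measurable_cong[of M f g borel]
    Bochner_Integration.integrable_cong[of M M "\<lambda>x. (norm (f x))\<^sup>2" "\<lambda>x. (norm (g x))\<^sup>2"]
  by (auto simp: L2_def)

section \<open>Test functions\<close>

lemma test_functionsD:
  assumes "\<psi> \<in> test_functions U"
  shows "smooth \<psi>" "compact (closure {x. \<psi> x \<noteq> 0})" "closure {x. \<psi> x \<noteq> 0} \<subseteq> U"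
    "has_C1_grad \<psi> (grad \<psi>)"
    "x \<notin> closure {x. \<psi> x \<noteq> 0} \<Longrightarrow> \<psi> x = 0" "x \<notin> closure {x. \<psi> x \<noteq> 0} \<Longrightarrow> grad \<psi> x = 0"
proof -
  show *: "smooth \<psi>" "compact (closure {x. \<psi> x \<noteq> 0})" "closure {x. \<psi> x \<noteq> 0} \<subseteq> U"
    using assms by (auto simp: test_functions_def)
  show "has_C1_grad \<psi> (grad \<psi>)" using *(1) by (rule smooth_has_C1_grad)
  have out: "\<psi> x = 0" if "x \<notin> closure {x. \<psi> x \<noteq> 0}" for x
    using that closure_subset[of "{x. \<psi> x \<noteq> 0}"] by auto
  then show "x \<notin> closure {x. \<psi> x \<noteq> 0} \<Longrightarrow> \<psi> x = 0" .
  show "grad \<psi> x = 0" if "x \<notin> closure {x. \<psi> x \<noteq> 0}"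
  proof (rule grad_unique)
    have "((\<lambda>x. 0) has_derivative (\<lambda>h. 0 \<bullet> h)) (at x)" by simp
    moreover have "open (- closure {x. \<psi> x \<noteq> 0})" "x \<in> - closure {x. \<psi> x \<noteq> 0}"
      using that by auto
    ultimately show "(\<psi> has_derivative (\<lambda>h. 0 \<bullet> h)) (at x)"
    proof (rule has_derivative_transform_within_open)
      show "0 = \<psi> y" if "y \<in> - closure {x. \<psi> x \<noteq> 0}" for y
        using out[of y] that by simp
    qed
  qed
qed

lemma test_functions_L2:
  assumes "\<psi> \<in> test_functions V" "U \<in> sets lebesgue" "bounded U"
  shows "\<psi> \<in> L2 (lebesgue_on U)" "grad \<psi> \<in> L2 (lebesgue_on U)"
  using has_C1_grad_continuous[OF test_functionsD(4)[OF assms(1)], of UNIV] assms(2,3)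
  by (auto intro: continuous_bounded_L2)

lemma test_functions_mono: "U' \<subseteq> U \<Longrightarrow> test_functions U' \<subseteq> test_functions U"
  by (auto simp: test_functions_def)

lemma test_functions_diff:
  assumes "f \<in> test_functions U" "g \<in> test_functions U"
  shows "(\<lambda>x. f x - g x) \<in> test_functions U"
proof -
  let ?S = "\<lambda>f. closure {x. f x \<noteq> (0::real)}"
  have sub: "?S (\<lambda>x. f x - g x) \<subseteq> ?S f \<union> ?S g"
    unfolding closure_Un[symmetric] by (rule closure_mono) auto
  moreover have "compact (?S (\<lambda>x. f x - g x))"
    using bounded_subset[OF _ sub] assms
    by (auto simp: test_functions_def compact_eq_bounded_closed)
  ultimately show ?thesis using assms
    by (auto simp: test_functions_def smooth_diff)
qed

lemma has_weak_grad_iff: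
  assumes U: "U \<in> sets lebesgue" "bounded U" and v: "v \<in> L2 (lebesgue_on U)" and G: "G \<in> L2 (lebesgue_on U)"
  shows "has_weak_grad U v G \<longleftrightarrow> (\<forall>\<psi>\<in>test_functions U. \<forall>a.
     (LINT x|lebesgue_on U. v x * (grad \<psi> x \<bullet> a)) = - (LINT x|lebesgue_on U. \<psi> x * (G x \<bullet> a)))"
proof -
  have "(LINT x|lebesgue_on U. v x *\<^sub>R grad \<psi> x) = - (LINT x|lebesgue_on U. \<psi> x *\<^sub>R G x) \<longleftrightarrow>
    (\<forall>a. (LINT x|lebesgue_on U. v x * (grad \<psi> x \<bullet> a)) = - (LINT x|lebesgue_on U. \<psi> x * (G x \<bullet> a)))"
    if \<psi>: "\<psi> \<in> test_functions U" for \<psi>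
  proof -
    have i: "integrable (lebesgue_on U) (\<lambda>x. v x *\<^sub>R grad \<psi> x)"
      "integrable (lebesgue_on U) (\<lambda>x. \<psi> x *\<^sub>R G x)"
      using L2_scaleR_integrable[OF v test_functions_L2(2)[OF \<psi> U]]
        L2_scaleR_integrable[OF test_functions_L2(1)[OF \<psi> U] G] by auto
    have e: "(LINT x|lebesgue_on U. v x *\<^sub>R grad \<psi> x) \<bullet> a = (LINT x|lebesgue_on U. v x * (grad \<psi> x \<bullet> a))"
      "(LINT x|lebesgue_on U. \<psi> x *\<^sub>R G x) \<bullet> a = (LINT x|lebesgue_on U. \<psi> x * (G x \<bullet> a))" for a
      using i by (simp_all flip: integral_inner_left)
    have "(LINT x|lebesgue_on U. v x *\<^sub>R grad \<psi> x) = - (LINT x|lebesgue_on U. \<psi> x *\<^sub>R G x) \<longleftrightarrow>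
      (\<forall>a. (LINT x|lebesgue_on U. v x *\<^sub>R grad \<psi> x) \<bullet> a = (- (LINT x|lebesgue_on U. \<psi> x *\<^sub>R G x)) \<bullet> a)"
      by (rule vector_eq_rdot[symmetric])
    then show ?thesis by (simp only: e inner_minus_left)
  qed
  then show ?thesis by (auto simp: has_weak_grad_def)
qed

lemma has_weak_grad_unique:
  fixes G G' :: "real^'n \<Rightarrow> real^'n"
  assumes U: "open U" "bounded U"
    and G: "G \<in> L2 (lebesgue_on U)" "G' \<in> L2 (lebesgue_on U)" "has_weak_grad U v G" "has_weak_grad U v G'"
  shows "AE x in lebesgue_on U. G x = G' x"
proof -
  have Ul: "U \<in> sets lebesgue" using U by simp
  have fin: "finite_measure (lebesgue_on U)" by (rule finite_measure_lebesgue_on_bounded[OF Ul U(2)])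
  have "AE x in lebesgue_on U. \<forall>i\<in>UNIV. (G x - G' x) $ i = 0"
  proof (rule AE_finite_allI)
    fix i :: 'n
    have "AE x in lebesgue_on U. (G x - G' x) \<bullet> axis i 1 = 0"
    proof (rule fundamental_lemma[OF U(1)])
      show "integrable (lebesgue_on U) (\<lambda>x. (G x - G' x) \<bullet> axis i 1)"
        by (rule L2_integrable[OF fin L2_inner_const[OF L2_diff[OF G(1,2)]]])
      fix \<psi> assume \<psi>: "\<psi> \<in> test_functions U"
      have i: "integrable (lebesgue_on U) (\<lambda>x. \<psi> x *\<^sub>R G x)" "integrable (lebesgue_on U) (\<lambda>x. \<psi> x *\<^sub>R G' x)"
        using L2_scaleR_integrable[OF test_functions_L2(1)[OF \<psi> Ul U(2)] G(1)]
         L2_scaleR_integrable[OF test_functions_L2(1)[OF \<psi> Ul U(2)] G(2)] by auto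
      have "(LINT x|lebesgue_on U. \<psi> x *\<^sub>R G x) = (LINT x|lebesgue_on U. \<psi> x *\<^sub>R G' x)"
        using G(3)[unfolded has_weak_grad_def, rule_format, OF \<psi>]
          G(4)[unfolded has_weak_grad_def, rule_format, OF \<psi>] by simp
      then have "(LINT x|lebesgue_on U. (\<psi> x *\<^sub>R G x - \<psi> x *\<^sub>R G' x) \<bullet> axis i 1) = 0"
        using i by (subst integral_inner_left) auto
      then show "(LINT x|lebesgue_on U. \<psi> x * ((G x - G' x) \<bullet> axis i 1)) = 0"
        by (simp add: algebra_simps inner_diff_left)
    qed
    then show "AE x in lebesgue_on U. (G x - G' x) $ i = 0" by (simp add: inner_axis)
  qed simp
  then show ?thesis by eventually_elim (simp add: vec_eq_iff)
qed

lemma has_weak_div_unique: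
  fixes q :: "real^'n \<Rightarrow> real^'n"
  assumes U: "open U" "bounded U"
    and G: "d \<in> L2 (lebesgue_on U)" "d' \<in> L2 (lebesgue_on U)" "has_weak_div U q d" "has_weak_div U q d'"
  shows "AE x in lebesgue_on U. d x = d' x"
proof -
  have Ul: "U \<in> sets lebesgue" using U by simp
  have fin: "finite_measure (lebesgue_on U)" by (rule finite_measure_lebesgue_on_bounded[OF Ul U(2)])
  have "AE x in lebesgue_on U. d x - d' x = 0"
  proof (rule fundamental_lemma[OF U(1)])
    show "integrable (lebesgue_on U) (\<lambda>x. d x - d' x)"
      by (rule L2_integrable[OF fin L2_diff[OF G(1,2)]])
    fix \<psi> assume \<psi>: "\<psi> \<in> test_functions U"
    have i: "integrable (lebesgue_on U) (\<lambda>x. \<psi> x * d x)" "integrable (lebesgue_on U) (\<lambda>x. \<psi> x * d' x)"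
      using L2_mult_integrable[OF test_functions_L2(1)[OF \<psi> Ul U(2)]] G(1,2) by auto
    have "(LINT x|lebesgue_on U. \<psi> x * d x) = (LINT x|lebesgue_on U. \<psi> x * d' x)"
      using G(3)[unfolded has_weak_div_def, rule_format, OF \<psi>]
        G(4)[unfolded has_weak_div_def, rule_format, OF \<psi>] by simp
    then show "(LINT x|lebesgue_on U. \<psi> x * (d x - d' x)) = 0"
      using i by (simp add: right_diff_distrib)
  qed
  then show ?thesis by eventually_elim simp
qed

lemma H1D:
  assumes "v \<in> H1 U"
  shows "v \<in> L2 (lebesgue_on U)" "weak_grad U v \<in> L2 (lebesgue_on U)" "has_weak_grad U v (weak_grad U v)"
proof -
  obtain G where "v \<in> L2 (lebesgue_on U)" "G \<in> L2 (lebesgue_on U) \<and> has_weak_grad U v G"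
    using assms by (auto simp: H1_def)
  then show "v \<in> L2 (lebesgue_on U)" "weak_grad U v \<in> L2 (lebesgue_on U)" "has_weak_grad U v (weak_grad U v)"
    using someI[of "\<lambda>G. G \<in> L2 (lebesgue_on U) \<and> has_weak_grad U v G" G] by (auto simp: weak_grad_def)
qed

lemma H1I: "v \<in> L2 (lebesgue_on U) \<Longrightarrow> G \<in> L2 (lebesgue_on U) \<Longrightarrow> has_weak_grad U v G \<Longrightarrow> v \<in> H1 U"
  by (auto simp: H1_def)

text \<open>\<open>weak_grad\<close> is an arbitrary choice among the weak gradients; uniqueness up
  to null sets is what frees later statements from that choice.\<close>

lemma weak_grad_AE_eq:
  assumes U: "open U" "bounded U" and "v \<in> L2 (lebesgue_on U)" "G \<in> L2 (lebesgue_on U)" "has_weak_grad U v G"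
  shows "AE x in lebesgue_on U. weak_grad U v x = G x"
  using has_weak_grad_unique[OF U H1D(2) assms(4) H1D(3) assms(5)] H1I[OF assms(3-5)] by blast

lemma weak_div_AE_eq:
  assumes U: "open U" "bounded U" and "d \<in> L2 (lebesgue_on U)" "has_weak_div U q d"
  shows "AE x in lebesgue_on U. weak_div U q x = d x"
proof -
  have "weak_div U q \<in> L2 (lebesgue_on U) \<and> has_weak_div U q (weak_div U q)"
    unfolding weak_div_def by (rule someI[of _ d]) (use assms in auto)
  then show ?thesis using has_weak_div_unique[OF U] assms by blast
qed

lemma HdivD:
  assumes "q \<in> Hdiv U"
  shows "q \<in> L2 (lebesgue_on U)" "weak_div U q \<in> L2 (lebesgue_on U)" "has_weak_div U q (weak_div U q)"
proof -
  obtain d where "q \<in> L2 (lebesgue_on U)" "d \<in> L2 (lebesgue_on U) \<and> has_weak_div U q d"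
    using assms by (auto simp: Hdiv_def)
  then show "q \<in> L2 (lebesgue_on U)" "weak_div U q \<in> L2 (lebesgue_on U)" "has_weak_div U q (weak_div U q)"
    using someI[of "\<lambda>d. d \<in> L2 (lebesgue_on U) \<and> has_weak_div U q d" d] by (auto simp: weak_div_def)
qed

lemma has_weak_grad_diff:
  fixes v w :: "real^'n \<Rightarrow> real"
  assumes U: "U \<in> sets lebesgue" "bounded U"
    and v: "v \<in> L2 (lebesgue_on U)" "G \<in> L2 (lebesgue_on U)" "has_weak_grad U v G"
    and w: "w \<in> L2 (lebesgue_on U)" "H \<in> L2 (lebesgue_on U)" "has_weak_grad U w H"
  shows "has_weak_grad U (\<lambda>x. v x - w x) (\<lambda>x. G x - H x)"
  unfolding has_weak_grad_def
proof
  fix \<psi> assume \<psi>: "\<psi> \<in> test_functions U"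
  note i = L2_scaleR_integrable[OF _ test_functions_L2(2)[OF \<psi> U]]
    L2_scaleR_integrable[OF test_functions_L2(1)[OF \<psi> U]]
  show "(LINT x|lebesgue_on U. (v x - w x) *\<^sub>R grad \<psi> x) = - (LINT x|lebesgue_on U. \<psi> x *\<^sub>R (G x - H x))"
    using v(3) w(3) \<psi> i(1)[OF v(1)] i(1)[OF w(1)] i(2)[OF v(2)] i(2)[OF w(2)]
    by (simp add: has_weak_grad_def scaleR_diff_left scaleR_diff_right)
qed

lemma H1_diff:
  assumes U: "open U" "bounded U" and v: "v \<in> H1 U" and w: "w \<in> H1 U"
  shows "(\<lambda>x. v x - w x) \<in> H1 U"
    "AE x in lebesgue_on U. weak_grad U (\<lambda>x. v x - w x) x = weak_grad U v x - weak_grad U w x"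
proof -
  have Ul: "U \<in> sets lebesgue" using U by simp
  note d = L2_diff[OF H1D(1)[OF v] H1D(1)[OF w]] L2_diff[OF H1D(2)[OF v] H1D(2)[OF w]]
    has_weak_grad_diff[OF Ul U(2) H1D[OF v] H1D[OF w]]
  show "(\<lambda>x. v x - w x) \<in> H1 U" by (rule H1I[OF d])
  show "AE x in lebesgue_on U. weak_grad U (\<lambda>x. v x - w x) x = weak_grad U v x - weak_grad U w x"
    by (rule weak_grad_AE_eq[OF U d])
qed

lemma weak_grad_cong:
  assumes "\<And>x. x \<in> U \<Longrightarrow> v x = w x"
  shows "has_weak_grad U v = has_weak_grad U w" "weak_grad U v = weak_grad U w" "v \<in> H1 U \<longleftrightarrow> w \<in> H1 U"
proof -
  have "(LINT x|lebesgue_on U. v x *\<^sub>R F x) = (LINT x|lebesgue_on U. w x *\<^sub>R F x)" for F :: "real^'a \<Rightarrow> real^'a"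
    by (rule Bochner_Integration.integral_cong) (use assms in auto)
  then show *: "has_weak_grad U v = has_weak_grad U w"
    by (simp add: has_weak_grad_def fun_eq_iff)
  then show "weak_grad U v = weak_grad U w" by (simp add: weak_grad_def)
  show "v \<in> H1 U \<longleftrightarrow> w \<in> H1 U"
    using * L2_cong_on[of "lebesgue_on U" v w] assms by (simp add: H1_def)
qed

lemma integral_lebesgue_on_subset:
  fixes F :: "'a::euclidean_space \<Rightarrow> 'b::euclidean_space"
  assumes "U' \<subseteq> U" "U \<in> sets lebesgue" "U' \<in> sets lebesgue" "\<And>x. x \<in> U - U' \<Longrightarrow> F x = 0"
  shows "(LINT x|lebesgue_on U. F x) = (LINT x|lebesgue_on U'. F x)"
  using assms by (simp add: integral_restrict_space)
    (rule Bochner_Integration.integral_cong, auto split: split_indicator)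

text \<open>A test function of the smaller set is one of the larger set and vanishes on the
  difference together with its gradient.\<close>

lemma has_weak_grad_restrict:
  assumes "has_weak_grad U v G" "U' \<subseteq> U" "U \<in> sets lebesgue" "U' \<in> sets lebesgue"
  shows "has_weak_grad U' v G"
  unfolding has_weak_grad_def
proof
  fix \<psi> assume \<psi>: "\<psi> \<in> test_functions U'"
  then have \<psi>': "\<psi> \<in> test_functions U" using test_functions_mono assms by blast
  have z: "\<psi> x = 0 \<and> grad \<psi> x = 0" if "x \<in> U - U'" for x
    using test_functionsD(3)[OF \<psi>] test_functionsD(5,6)[OF \<psi>, of x] that by blast
  show "(LINT x|lebesgue_on U'. v x *\<^sub>R grad \<psi> x) = - (LINT x|lebesgue_on U'. \<psi> x *\<^sub>R G x)"
    using assms(1)[unfolded has_weak_grad_def, rule_format, OF \<psi>'] z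
    by (subst (1 2) integral_lebesgue_on_subset[OF assms(2-4), symmetric]) auto
qed

lemma has_weak_div_restrict:
  fixes q :: "real^'n \<Rightarrow> real^'n"
  assumes "has_weak_div U q d" "U' \<subseteq> U" "U \<in> sets lebesgue" "U' \<in> sets lebesgue"
  shows "has_weak_div U' q d"
  unfolding has_weak_div_def
proof
  fix \<psi> assume \<psi>: "\<psi> \<in> test_functions U'"
  then have \<psi>': "\<psi> \<in> test_functions U" using test_functions_mono assms by blast
  have z: "\<psi> x = 0 \<and> grad \<psi> x = 0" if "x \<in> U - U'" for x
    using test_functionsD(3)[OF \<psi>] test_functionsD(5,6)[OF \<psi>, of x] that by blast
  show "(LINT x|lebesgue_on U'. q x \<bullet> grad \<psi> x) = - (LINT x|lebesgue_on U'. \<psi> x * d x)"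
    using assms(1)[unfolded has_weak_div_def, rule_format, OF \<psi>'] z
    by (subst (1 2) integral_lebesgue_on_subset[OF assms(2-4), symmetric]) auto
qed

text \<open>Integration by parts: the product of w with a test function is C^1 with compact support,
  so its gradient integrates to 0.\<close>

lemma has_weak_grad_C1:
  assumes U: "open U" "bounded U" and w: "has_C1_grad w g"
  shows "has_weak_grad U w g"
proof -
  have Ul: "U \<in> sets lebesgue" using U by simp
  have L: "w \<in> L2 (lebesgue_on U)" "g \<in> L2 (lebesgue_on U)"
    using continuous_bounded_L2[OF has_C1_grad_continuous(1)[OF w] Ul U(2)]
      continuous_bounded_L2[OF has_C1_grad_continuous(2)[OF w] Ul U(2)] by auto
  have "(LINT x|lebesgue_on U. w x * (grad \<psi> x \<bullet> a)) = - (LINT x|lebesgue_on U. \<psi> x * (g x \<bullet> a))"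
    if \<psi>: "\<psi> \<in> test_functions U" for \<psi> a
  proof -
    let ?K = "closure {x. \<psi> x \<noteq> 0}"
    note \<psi>D = test_functionsD[OF \<psi>]
    obtain R where R: "?K \<subseteq> cball 0 R"
      using compact_imp_bounded[OF \<psi>D(2)] by (force simp: bounded_iff)
    let ?F = "\<lambda>x. (w x *\<^sub>R grad \<psi> x + \<psi> x *\<^sub>R g x) \<bullet> a"
    have C1: "has_C1_grad (\<lambda>x. w x * \<psi> x) (\<lambda>x. w x *\<^sub>R grad \<psi> x + \<psi> x *\<^sub>R g x)"
      by (rule has_C1_grad_mult[OF w \<psi>D(4)])
    have "(LINT x|lborel. ?F x) = 0"
    proof (rule integral_C1_grad_compact_support[OF C1, of R])
      show "w x * \<psi> x = 0" if "x \<notin> cball 0 R" for x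
      proof -
        have "x \<notin> ?K" using R that by blast
        from \<psi>D(5)[OF this] show ?thesis by (simp only: mult_zero_right)
      qed
    qed
    moreover have "(LINT x|lebesgue_on U. ?F x) = (LINT x|lborel. ?F x)"
    proof (rule continuous_compact_support_integrable(2)[OF _ \<psi>D(2,3) _ Ul])
      show "continuous_on UNIV ?F"
        by (intro continuous_on_inner continuous_on_add continuous_on_scaleR continuous_on_const
            has_C1_grad_continuous[OF w] has_C1_grad_continuous[OF \<psi>D(4)])
      show "?F x = 0" if "x \<notin> ?K" for x
        by (simp only: \<psi>D(5,6)[OF that]) simp
    qed
    ultimately have "(LINT x|lebesgue_on U. w x * (grad \<psi> x \<bullet> a) + \<psi> x * (g x \<bullet> a)) = 0"
      by (simp add: inner_add_left)
    moreover have "integrable (lebesgue_on U) (\<lambda>x. w x * (grad \<psi> x \<bullet> a))"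
      "integrable (lebesgue_on U) (\<lambda>x. \<psi> x * (g x \<bullet> a))"
      using L test_functions_L2[OF \<psi> Ul U(2)] by (auto intro!: L2_mult_integrable L2_inner_const)
    ultimately show ?thesis by simp
  qed
  then show ?thesis using has_weak_grad_iff[OF Ul U(2) L] by blast
qed

lemma C1_H1:
  assumes U: "open U" "bounded U" and w: "has_C1_grad w g"
  shows "w \<in> H1 U" "AE x in lebesgue_on U. weak_grad U w x = g x"
    "w \<in> L2 (lebesgue_on U)" "g \<in> L2 (lebesgue_on U)"
proof -
  have Ul: "U \<in> sets lebesgue" using U by simp
  show L: "w \<in> L2 (lebesgue_on U)" "g \<in> L2 (lebesgue_on U)"
    using continuous_bounded_L2[OF has_C1_grad_continuous(1)[OF w] Ul U(2)]
      continuous_bounded_L2[OF has_C1_grad_continuous(2)[OF w] Ul U(2)] by auto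
  show "w \<in> H1 U" "AE x in lebesgue_on U. weak_grad U w x = g x"
    using H1I[OF L has_weak_grad_C1[OF assms]] weak_grad_AE_eq[OF U L has_weak_grad_C1[OF assms]] by auto
qed

section \<open>Approximation by smooth functions\<close>

lemma H1_norm_tendstoD:
  fixes w :: "nat \<Rightarrow> real^'n \<Rightarrow> real"
  assumes U: "open U" "bounded U" and v: "v \<in> H1 U" and w: "\<And>k. has_C1_grad (w k) (g k)"
    and lim: "(\<lambda>k. H1_norm U (\<lambda>x. w k x - v x)) \<longlonglongrightarrow> 0"
  shows "(\<lambda>k. L2_norm (lebesgue_on U) (\<lambda>x. w k x - v x)) \<longlonglongrightarrow> 0"
    "(\<lambda>k. L2_norm (lebesgue_on U) (\<lambda>x. g k x - weak_grad U v x)) \<longlonglongrightarrow> 0"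
proof -
  show "(\<lambda>k. L2_norm (lebesgue_on U) (\<lambda>x. w k x - v x)) \<longlonglongrightarrow> 0"
    by (rule Lim_null_comparison[OF _ lim]) (simp add: H1_norm_def real_le_rsqrt)
  have "(\<lambda>k. L2_norm (lebesgue_on U) (weak_grad U (\<lambda>x. w k x - v x))) \<longlonglongrightarrow> 0"
    by (rule Lim_null_comparison[OF _ lim]) (simp add: H1_norm_def real_le_rsqrt)
  moreover have "L2_norm (lebesgue_on U) (weak_grad U (\<lambda>x. w k x - v x))
     = L2_norm (lebesgue_on U) (\<lambda>x. g k x - weak_grad U v x)" for k
  proof (rule L2_norm_cong_AE)
    note C = C1_H1[OF U w[of k]]
    show "weak_grad U (\<lambda>x. w k x - v x) \<in> borel_measurable (lebesgue_on U)"
      using H1D(2)[OF H1_diff(1)[OF U C(1) v]] by (rule L2_measurable)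
    show "(\<lambda>x. g k x - weak_grad U v x) \<in> borel_measurable (lebesgue_on U)"
      using L2_diff[OF C(4) H1D(2)[OF v]] by (rule L2_measurable)
    show "AE x in lebesgue_on U. weak_grad U (\<lambda>x. w k x - v x) x = g k x - weak_grad U v x"
      using H1_diff(2)[OF U C(1) v] C(2) by eventually_elim simp
  qed
  ultimately show "(\<lambda>k. L2_norm (lebesgue_on U) (\<lambda>x. g k x - weak_grad U v x)) \<longlonglongrightarrow> 0" by simp
qed

lemma H10D:
  assumes U: "open U" "bounded U" and v: "v \<in> H10 U"
  obtains w where "\<And>k. w k \<in> test_functions U"
    "(\<lambda>k. L2_norm (lebesgue_on U) (\<lambda>x. w k x - v x)) \<longlonglongrightarrow> 0"
    "(\<lambda>k. L2_norm (lebesgue_on U) (\<lambda>x. grad (w k) x - weak_grad U v x)) \<longlonglongrightarrow> 0"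
proof -
  obtain w where w: "\<And>k. w k \<in> test_functions U" "(\<lambda>k. H1_norm U (\<lambda>x. w k x - v x)) \<longlonglongrightarrow> 0"
    and vH: "v \<in> H1 U"
    using v by (auto simp: H10_def)
  show ?thesis
    using that[OF w(1) H1_norm_tendstoD[OF U vH test_functionsD(4)[OF w(1)] w(2)]] .
qed

lemma H10_H1: "v \<in> H10 U \<Longrightarrow> v \<in> H1 U"
  by (simp add: H10_def)

lemma L2_limit_diff:
  fixes f g :: "'a \<Rightarrow> 'b::euclidean_space"
  assumes "\<And>k. v k \<in> L2 M" "f \<in> L2 M" "(\<lambda>k. L2_norm M (\<lambda>x. v k x - f x)) \<longlonglongrightarrow> 0"
    and "\<And>k. w k \<in> L2 M" "g \<in> L2 M" "(\<lambda>k. L2_norm M (\<lambda>x. w k x - g x)) \<longlonglongrightarrow> 0"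
  shows "(\<lambda>k. L2_norm M (\<lambda>x. (v k x - w k x) - (f x - g x))) \<longlonglongrightarrow> 0"
proof (rule Lim_null_comparison)
  show "(\<lambda>k. L2_norm M (\<lambda>x. v k x - f x) + L2_norm M (\<lambda>x. w k x - g x)) \<longlonglongrightarrow> 0"
    using tendsto_add[OF assms(3,6)] by simp
  have "L2_norm M (\<lambda>x. (v k x - w k x) - (f x - g x))
      \<le> L2_norm M (\<lambda>x. v k x - f x) + L2_norm M (\<lambda>x. w k x - g x)" for k
    using L2_norm_triangle_diff[OF L2_diff[OF assms(1,2)] L2_diff[OF assms(4,5)], of k k]
    by (simp add: algebra_simps)
  then show "\<forall>\<^sub>F k in sequentially. norm (L2_norm M (\<lambda>x. (v k x - w k x) - (f x - g x)))
      \<le> L2_norm M (\<lambda>x. v k x - f x) + L2_norm M (\<lambda>x. w k x - g x)" by simp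
qed

text \<open>The limit of the gradients is stated for the gradient chosen for u - v itself, which
  agrees with the difference of the gradients chosen for u and v almost everywhere only.\<close>

lemma H10_diff_approx:
  fixes u v :: "real^'n \<Rightarrow> real"
  assumes U: "open U" "bounded U" and u: "u \<in> H10 U" and v: "v \<in> H10 U"
  obtains w where "\<And>k. w k \<in> test_functions U"
    "(\<lambda>k. L2_norm (lebesgue_on U) (\<lambda>x. w k x - (u x - v x))) \<longlonglongrightarrow> 0"
    "(\<lambda>k. L2_norm (lebesgue_on U) (\<lambda>x. grad (w k) x - weak_grad U (\<lambda>x. u x - v x) x)) \<longlonglongrightarrow> 0"
proof -
  have Ul: "U \<in> sets lebesgue" using U by simp
  obtain p where p: "\<And>k. p k \<in> test_functions U"
    "(\<lambda>k. L2_norm (lebesgue_on U) (\<lambda>x. p k x - u x)) \<longlonglongrightarrow> 0"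
    "(\<lambda>k. L2_norm (lebesgue_on U) (\<lambda>x. grad (p k) x - weak_grad U u x)) \<longlonglongrightarrow> 0"
    using H10D[OF U u] by blast
  obtain q where q: "\<And>k. q k \<in> test_functions U"
    "(\<lambda>k. L2_norm (lebesgue_on U) (\<lambda>x. q k x - v x)) \<longlonglongrightarrow> 0"
    "(\<lambda>k. L2_norm (lebesgue_on U) (\<lambda>x. grad (q k) x - weak_grad U v x)) \<longlonglongrightarrow> 0"
    using H10D[OF U v] by blast
  note uH = H1D[OF H10_H1[OF u]] and vH = H1D[OF H10_H1[OF v]]
  note d = H1_diff[OF U H10_H1[OF u] H10_H1[OF v]]
  show ?thesis
  proof (rule that[of "\<lambda>k x. p k x - q k x"])
    show "(\<lambda>x. p k x - q k x) \<in> test_functions U" for k by (rule test_functions_diff[OF p(1) q(1)])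
    show "(\<lambda>k. L2_norm (lebesgue_on U) (\<lambda>x. p k x - q k x - (u x - v x))) \<longlonglongrightarrow> 0"
      by (rule L2_limit_diff[OF _ _ p(2) _ _ q(2)]) (use test_functions_L2(1)[OF p(1) Ul U(2)] test_functions_L2(1)[OF q(1) Ul U(2)] uH vH in auto)
    have lim: "(\<lambda>k. L2_norm (lebesgue_on U) (\<lambda>x. grad (p k) x - grad (q k) x - (weak_grad U u x - weak_grad U v x))) \<longlonglongrightarrow> 0"
      by (rule L2_limit_diff[OF _ _ p(3) _ _ q(3)])
         (use test_functions_L2(2)[OF p(1) Ul U(2)] test_functions_L2(2)[OF q(1) Ul U(2)] uH vH in auto)
    have g: "grad (\<lambda>x. p k x - q k x) = (\<lambda>x. grad (p k) x - grad (q k) x)" for k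
      by (rule has_C1_grad_grad[OF has_C1_grad_diff[OF test_functionsD(4)[OF p(1)] test_functionsD(4)[OF q(1)]]])
    have "L2_norm (lebesgue_on U) (\<lambda>x. grad (p k) x - grad (q k) x - (weak_grad U u x - weak_grad U v x))
      = L2_norm (lebesgue_on U) (\<lambda>x. grad (\<lambda>x. p k x - q k x) x - weak_grad U (\<lambda>x. u x - v x) x)" for k
    proof (rule L2_norm_cong_AE)
      have t: "grad (p k) \<in> L2 (lebesgue_on U)" "grad (q k) \<in> L2 (lebesgue_on U)"
        using test_functions_L2(2)[OF p(1) Ul U(2)] test_functions_L2(2)[OF q(1) Ul U(2)] by auto
      show "(\<lambda>x. grad (p k) x - grad (q k) x - (weak_grad U u x - weak_grad U v x)) \<in> borel_measurable (lebesgue_on U)"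
        by (intro L2_measurable L2_diff t uH vH)
      show "(\<lambda>x. grad (\<lambda>x. p k x - q k x) x - weak_grad U (\<lambda>x. u x - v x) x) \<in> borel_measurable (lebesgue_on U)"
        unfolding g by (intro L2_measurable L2_diff t H1D(2) d(1))
      show "AE x in lebesgue_on U. grad (p k) x - grad (q k) x - (weak_grad U u x - weak_grad U v x)
        = grad (\<lambda>x. p k x - q k x) x - weak_grad U (\<lambda>x. u x - v x) x"
        using d(2) by eventually_elim (simp add: g)
    qed
    then show "(\<lambda>k. L2_norm (lebesgue_on U) (\<lambda>x. grad (\<lambda>x. p k x - q k x) x - weak_grad U (\<lambda>x. u x - v x) x)) \<longlonglongrightarrow> 0"
      using lim by simp
  qed
qed

section \<open>Simplices and their facets\<close>

text \<open>The part h of \<nu>' orthogonal to \<nu> is a direction of the hyperplane, along which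
  \<nu>' is constant. Hence h is orthogonal to itself, and \<nu>' is a multiple of \<nu>.\<close>

lemma unit_normal_unique:
  fixes \<nu> \<nu>' :: "'a::euclidean_space"
  assumes n: "norm \<nu> = 1" "norm \<nu>' = 1" and sub: "{x. \<nu> \<bullet> x = \<beta>} \<subseteq> {x. \<nu>' \<bullet> x = \<beta>'}"
  shows "\<nu>' = \<nu> \<and> \<beta>' = \<beta> \<or> \<nu>' = - \<nu> \<and> \<beta>' = - \<beta>"
proof -
  have nn: "\<nu> \<bullet> \<nu> = 1" "\<nu>' \<bullet> \<nu>' = 1" using n by (auto simp: norm_eq_1)
  define c where "c = \<nu>' \<bullet> \<nu>"
  define h where "h = \<nu>' - c *\<^sub>R \<nu>"
  have h: "\<nu> \<bullet> h = 0" by (simp add: h_def inner_diff_right nn c_def inner_commute)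
  have "\<beta> *\<^sub>R \<nu> \<in> {x. \<nu> \<bullet> x = \<beta>}" "\<beta> *\<^sub>R \<nu> + h \<in> {x. \<nu> \<bullet> x = \<beta>}"
    by (auto simp: nn inner_add_right h)
  then have m: "\<nu>' \<bullet> (\<beta> *\<^sub>R \<nu>) = \<beta>'" "\<nu>' \<bullet> (\<beta> *\<^sub>R \<nu> + h) = \<beta>'" using sub by blast+
  then have "\<nu>' \<bullet> h = 0" by (simp add: inner_add_right)
  then have "h \<bullet> h = 0" using h by (subst h_def) (simp add: inner_diff_left)
  then have \<nu>': "\<nu>' = c *\<^sub>R \<nu>" by (simp add: h_def)
  have "c * c = 1" using nn by (simp add: \<nu>')
  then have "c = 1 \<or> c = - 1" by (simp add: square_eq_1_iff)
  moreover have "\<beta>' = c * \<beta>" using m(1) by (simp add: c_def mult.commute)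
  ultimately show ?thesis using \<nu>' by auto
qed

text \<open>C is the vertex set of a full-dimensional simplex, P one of its vertices and \<nu> the
  unit normal of the opposite facet. The strict inequality in \<open>apex\<close> makes \<nu> point
  outwards.\<close>

locale simplex_facet =
  fixes C :: "'a::euclidean_space set" and P \<nu> :: 'a and \<beta> :: real
  assumes indep: "\<not> affine_dependent C" and card_C: "card C = Suc DIM('a)" and P: "P \<in> C"
    and norm_normal: "norm \<nu> = 1"
    and on_hyperplane: "x \<in> C \<Longrightarrow> x \<noteq> P \<Longrightarrow> \<nu> \<bullet> x = \<beta>"
    and apex: "\<nu> \<bullet> P < \<beta>"
begin

abbreviation T :: "'a set" where "T \<equiv> convex hull C"
abbreviation E :: "'a set" where "E \<equiv> convex hull (C - {P})"

lemma finite_C: "finite C" using indep by (rule aff_independent_finite)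

lemma card_base: "card (C - {P}) = DIM('a)" using card_C P finite_C by simp

lemma base_nonempty: "C - {P} \<noteq> {}"
  using card_base DIM_positive[where 'a='a] by (metis card.empty less_irrefl)

lemma compact_T: "compact T" and compact_E: "compact E"
  using finite_C by (auto intro: finite_imp_compact_convex_hull)

lemma normal_normal: "\<nu> \<bullet> \<nu> = 1" using norm_normal by (simp add: norm_eq_1)

lemma aff_dim_T: "aff_dim T = DIM('a)"
  using aff_dim_affine_independent[OF indep] card_C by (simp add: aff_dim_convex_hull)

lemma aff_dim_E: "aff_dim E = int DIM('a) - 1"
  using aff_dim_affine_independent[OF affine_independent_Diff[OF indep], of "{P}"] card_base
  by (simp add: aff_dim_convex_hull)

lemma E_facet: "E facet_of T"
  using facet_of_convex_hull_affine_independent[OF indep, of E] P base_nonempty by auto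

lemma E_subset_T: "E \<subseteq> T" by (rule hull_mono) auto

lemma on_E: "x \<in> E \<Longrightarrow> \<nu> \<bullet> x = \<beta>"
  using hull_minimal[of "C - {P}" "{x. \<nu> \<bullet> x = \<beta>}" convex] on_hyperplane
  by (auto simp: convex_hyperplane)

lemma on_T: "x \<in> T \<Longrightarrow> \<nu> \<bullet> x \<le> \<beta>"
  using hull_minimal[of C "{x. \<nu> \<bullet> x \<le> \<beta>}" convex] on_hyperplane apex
  by (force simp: convex_halfspace_le)

lemma affine_hull_E: "affine hull E = {x. \<nu> \<bullet> x = \<beta>}"
proof -
  have "E \<subseteq> {x. \<nu> \<bullet> x = \<beta>}" using on_E by blast
  moreover have "aff_dim E = aff_dim {x. \<nu> \<bullet> x = \<beta>}"
  proof -
    have "\<nu> \<noteq> 0" using norm_normal by auto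
    then show ?thesis using aff_dim_E by simp
  qed
  ultimately have "affine hull E = affine hull {x. \<nu> \<bullet> x = \<beta>}"
    using aff_dim_eq_full_gen by blast
  then show ?thesis by (simp add: affine_hyperplane hull_same)
qed

lemma affine_hull_base: "affine hull (C - {P}) = {x. \<nu> \<bullet> x = \<beta>}"
  using affine_hull_E by simp

lemma interior_T: "interior T = rel_interior T" "interior T \<noteq> {}"
proof -
  show "interior T = rel_interior T" using aff_dim_T by (simp add: interior_rel_interior_gen)
  then show "interior T \<noteq> {}" using rel_interior_eq_empty[of T] P by (auto simp: hull_inc)
qed

lemma cone: "x \<in> T \<longleftrightarrow> (\<exists>r\<in>{0..1}. \<exists>y\<in>E. x = P + r *\<^sub>R (y - P))"
proof -
  have "T = convex hull (insert P (C - {P}))" using P by (simp add: insert_absorb)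
  then have "x \<in> T \<longleftrightarrow> (\<exists>u\<ge>0. \<exists>v\<ge>0. \<exists>b. u + v = 1 \<and> b \<in> E \<and> x = u *\<^sub>R P + v *\<^sub>R b)"
    by (simp only: convex_hull_insert[OF base_nonempty] mem_Collect_eq)
  also have "\<dots> \<longleftrightarrow> (\<exists>r\<in>{0..1}. \<exists>y\<in>E. x = P + r *\<^sub>R (y - P))"
  proof safe
    fix u v :: real and b assume "0 \<le> u" "0 \<le> v" "u + v = 1" "b \<in> E"
    then show "\<exists>r\<in>{0..1}. \<exists>y\<in>E. u *\<^sub>R P + v *\<^sub>R b = P + r *\<^sub>R (y - P)"
      by (intro bexI[of _ v] bexI[of _ b]) (auto simp: algebra_simps simp flip: scaleR_add_left)
  next
    fix r y assume "r \<in> {0..1::real}" "y \<in> E"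
    then show "\<exists>u\<ge>0. \<exists>v\<ge>0. \<exists>b. u + v = 1 \<and> b \<in> E \<and> P + r *\<^sub>R (y - P) = u *\<^sub>R P + v *\<^sub>R b"
      by (intro exI[of _ "1 - r"] conjI exI[of _ r] exI[of _ y]) (auto simp: algebra_simps)
  qed
  finally show ?thesis .
qed

text \<open>A competitor is constant on E, because points of E also belong to T and the inequality
  can be read in both directions. It is therefore \<nu> or its negative, and the apex excludes the
  latter.\<close>

lemma outer_normal_eq: "outer_normal T E = \<nu>"
  unfolding outer_normal_def
proof (rule the_equality)
  show "norm \<nu> = 1 \<and> (\<forall>x\<in>E. \<forall>y\<in>T. \<nu> \<bullet> y \<le> \<nu> \<bullet> x)"
    using norm_normal on_E on_T by auto
next
  fix \<nu>' assume \<nu>': "norm \<nu>' = 1 \<and> (\<forall>x\<in>E. \<forall>y\<in>T. \<nu>' \<bullet> y \<le> \<nu>' \<bullet> x)"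
  obtain x0 where "x0 \<in> C - {P}" using base_nonempty by blast
  then have x0: "x0 \<in> E" by (rule hull_inc)
  have "E \<subseteq> {x. \<nu>' \<bullet> x = \<nu>' \<bullet> x0}"
    using \<nu>' x0 E_subset_T by (auto intro!: antisym)
  then have "affine hull E \<subseteq> {x. \<nu>' \<bullet> x = \<nu>' \<bullet> x0}"
    by (rule hull_minimal) (rule affine_hyperplane)
  then have "\<nu>' = \<nu> \<or> \<nu>' = - \<nu> \<and> \<nu>' \<bullet> x0 = - \<beta>"
    using unit_normal_unique[OF norm_normal, of \<nu>' \<beta> "\<nu>' \<bullet> x0"] \<nu>' by (auto simp: affine_hull_base)
  moreover have "\<nu>' \<bullet> P \<le> \<nu>' \<bullet> x0" using \<nu>' x0 P by (simp add: hull_inc)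
  ultimately show "\<nu>' = \<nu>" using apex by auto
qed

lemma barycenter_E: "barycenter E = (\<Sum>z\<in>C - {P}. z) /\<^sub>R real DIM('a)"
proof -
  have "{z. z extreme_point_of E} = C - {P}"
    using extreme_point_of_convex_hull_affine_independent[OF affine_independent_Diff[OF indep], of _ "{P}"] by blast
  then show ?thesis by (simp add: barycenter_def card_base)
qed

lemma barycenter_in_E: "barycenter E \<in> E"
proof -
  have "(\<Sum>z\<in>C - {P}. (1 / real DIM('a)) *\<^sub>R z) \<in> E"
    by (rule convex_sum[OF _ convex_convex_hull]) (use finite_C card_base in \<open>auto simp: hull_inc\<close>)
  then show ?thesis by (simp add: barycenter_E scaleR_sum_right divide_inverse)
qed

text \<open>Central projection from the apex maps a point near \<open>x0\<close> to a point of the hyperplane near \<open>x0\<close>.\<close>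
lemma half_ball:
  assumes x0: "x0 \<in> rel_interior E"
  obtains r where "r > 0" "\<And>x. x \<in> ball x0 r \<Longrightarrow> \<nu> \<bullet> x \<le> \<beta> \<Longrightarrow> x \<in> T"
proof -
  obtain e where e: "e > 0" "ball x0 e \<inter> affine hull E \<subseteq> E" and x0E: "x0 \<in> E"
    using x0 by (auto simp: mem_rel_interior_ball)
  \<comment> \<open>t is the affine function with value 1 at P and 0 on the hyperplane; where t is
    less than 1, y x is the point of the hyperplane on the line through P and x.\<close>
  define t where "t x = (\<beta> - \<nu> \<bullet> x) / (\<beta> - \<nu> \<bullet> P)" for x
  define y where "y x = (x - t x *\<^sub>R P) /\<^sub>R (1 - t x)" for x
  have d: "\<beta> - \<nu> \<bullet> P > 0" using apex by simp
  have t0: "t x0 = 0" by (simp add: t_def on_E[OF x0E])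
  have "isCont t x0" unfolding t_def using d by (intro continuous_intros) auto
  then have yc: "isCont y x0" unfolding y_def using t0 by (intro continuous_intros) auto
  have y0: "y x0 = x0" by (simp add: y_def t0)
  have "(y \<longlongrightarrow> y x0) (nhds x0)"
    using yc by (simp add: isCont_def tendsto_at_iff_tendsto_nhds)
  from topological_tendstoD[OF this open_ball, of x0 e]
  have "eventually (\<lambda>x. y x \<in> ball x0 e) (nhds x0)" using y0 e(1) by simp
  moreover have "eventually (\<lambda>x. t x < 1) (nhds x0)"
    using \<open>isCont t x0\<close> t0 unfolding isCont_def tendsto_at_iff_tendsto_nhds
    by (auto intro: order_tendstoD)
  ultimately have "eventually (\<lambda>x. y x \<in> ball x0 e \<and> t x < 1) (nhds x0)"
    by eventually_elim simp
  then obtain r where r: "r > 0" "\<And>x. dist x x0 < r \<Longrightarrow> y x \<in> ball x0 e \<and> t x < 1"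
    unfolding eventually_nhds_metric by blast
  show ?thesis
  proof (rule that[OF r(1)])
    fix x assume x: "x \<in> ball x0 r" "\<nu> \<bullet> x \<le> \<beta>"
    have t: "0 \<le> t x" "t x < 1" and yb: "y x \<in> ball x0 e"
      using r(2)[of x] x d by (auto simp: dist_commute t_def)
    have "\<nu> \<bullet> (x - t x *\<^sub>R P) = (1 - t x) * \<beta>"
      using d by (simp add: inner_diff_right t_def field_simps)
    then have "\<nu> \<bullet> y x = \<beta>" using t by (simp add: y_def)
    then have "y x \<in> E" using e(2) yb by (auto simp: affine_hull_base)
    moreover have "x = P + (1 - t x) *\<^sub>R (y x - P)"
    proof -
      have "(1 - t x) *\<^sub>R y x = x - t x *\<^sub>R P" using t by (simp add: y_def)
      then show ?thesis by (simp add: scaleR_diff_right scaleR_diff_left)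
    qed
    ultimately show "x \<in> T" unfolding cone using t by (intro bexI[of _ "1 - t x"] bexI[of _ "y x"]) auto
  qed
qed

end

lemma simplex_facet_exists:
  fixes T :: "'a::euclidean_space set"
  assumes T: "int DIM('a) simplex T" and E: "E facet_of T"
  obtains C P \<nu> \<beta> where "simplex_facet C P \<nu> \<beta>" "T = convex hull C" "E = convex hull (C - {P})"
proof -
  obtain C where C: "finite C" "\<not> affine_dependent C" "card C = Suc DIM('a)" "T = convex hull C"
    using T by (auto simp: simplex)
  obtain P where P: "P \<in> C" "E = convex hull (C - {P})"
    using E facet_of_convex_hull_affine_independent[OF C(2), of E] C(4) by auto
  have "int (card (C - {P})) = aff_dim (C - {P}) + 1"
    using aff_dim_affine_independent[OF affine_independent_Diff[OF C(2)], of "{P}"] by simp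
  then have "aff_dim (C - {P}) = DIM('a) - 1" using C P by simp
  then obtain a b where ab: "a \<noteq> 0" "affine hull (C - {P}) = {x. a \<bullet> x = b}"
    using aff_dim_eq_hyperplane[of "C - {P}"] by auto
  have "P \<notin> affine hull (C - {P})" using C(2) P(1) by (auto simp: affine_dependent_def)
  then have Pb: "a \<bullet> P \<noteq> b" using ab by auto
  \<comment> \<open>Normalises a and turns it away from P.\<close>
  define s where "s = (if a \<bullet> P < b then 1 else -1) / norm a"
  have "simplex_facet C P (s *\<^sub>R a) (s * b)"
  proof
    show "norm (s *\<^sub>R a) = 1" using ab(1) by (simp add: s_def)
    show "(s *\<^sub>R a) \<bullet> x = s * b" if "x \<in> C" "x \<noteq> P" for x
      using that hull_inc[of x "C - {P}" affine] ab by auto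
    show "(s *\<^sub>R a) \<bullet> P < s * b"
      using Pb ab(1) by (auto simp: s_def field_simps divide_simps not_less)
  qed (use C P in auto)
  then show ?thesis using that C(4) P(2) by blast
qed

section \<open>Triangulations\<close>

text \<open>A Lipschitz domain lies on one side of its boundary only. If a frontier point x were
  interior to the closure, the point y at distance s/2 below x would be a limit of points of
  \<Omega>, and these lie above the graph; the Lipschitz bound on the graph forbids this.\<close>

lemma lipschitz_domain_interior_closure:
  fixes \<Omega> :: "'a::euclidean_space set"
  assumes "lipschitz_domain \<Omega>"
  shows "interior (closure \<Omega>) = \<Omega>"
proof
  show "\<Omega> \<subseteq> interior (closure \<Omega>)"
  proof -
    have "open \<Omega>" using assms by (simp add: lipschitz_domain_def)
    then show ?thesis by (rule interior_maximal[OF closure_subset])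
  qed
  show "interior (closure \<Omega>) \<subseteq> \<Omega>"
  proof (rule ccontr)
    assume "\<not> interior (closure \<Omega>) \<subseteq> \<Omega>"
    then obtain x where x: "x \<in> interior (closure \<Omega>)" "x \<notin> \<Omega>" by blast
    have "open \<Omega>" using assms by (simp add: lipschitz_domain_def)
    then have "x \<in> frontier \<Omega>"
      using x interior_subset[of "closure \<Omega>"] by (auto simp: frontier_def interior_open)
    then obtain e g L r where g: "norm e = 1" "r > 0" "L-lipschitz_on {z. z \<bullet> e = 0} g"
      "\<And>y. y \<in> ball x r \<Longrightarrow> y \<in> \<Omega> \<longleftrightarrow> y \<bullet> e > (g (y - (y \<bullet> e) *\<^sub>R e) :: real)"
      using assms unfolding lipschitz_domain_def by metis
    have ee: "e \<bullet> e = 1" using g(1) by (simp add: norm_eq_1)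
    have L: "0 \<le> L" using g(3) by (rule lipschitz_on_nonneg)
    obtain s0 where s0: "s0 > 0" "ball x s0 \<subseteq> closure \<Omega>"
      using x(1) by (auto simp: mem_interior)
    define s where "s = min s0 r"
    have s: "s > 0" "ball x s \<subseteq> closure \<Omega>" "ball x s \<subseteq> ball x r" using s0 g(2) by (auto simp: s_def)
    define p where "p y = y - (y \<bullet> e) *\<^sub>R e" for y
    have p0: "p y \<bullet> e = 0" for y by (simp add: p_def inner_diff_left ee)
    have pdist: "norm (p z - p y) \<le> norm (z - y)" for y z
    proof -
      have "(norm (p z - p y))\<^sup>2 = (norm (z - y))\<^sup>2 - ((z - y) \<bullet> e)\<^sup>2"
        unfolding p_def power2_norm_eq_inner
        by (simp add: ee algebra_simps inner_commute power2_eq_square)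
      then have "(norm (p z - p y))\<^sup>2 \<le> (norm (z - y))\<^sup>2" by simp
      then show ?thesis by (rule power2_le_imp_le) simp
    qed
    define y where "y = x - (s/2) *\<^sub>R e"
    \<comment> \<open>A point within \<epsilon> of y is at most \<epsilon> higher than y, and the
      graph is there at most L \<epsilon> lower than at x. Together this gains s/4, less than the
      drop of s/2.\<close>
    define \<epsilon> where "\<epsilon> = s / 4 / (1 + L)"
    have \<epsilon>: "\<epsilon> > 0" using s L by (simp add: \<epsilon>_def)
    have \<epsilon>L: "(1 + L) * \<epsilon> = s / 4"
      using L nonzero_mult_div_cancel_left[of "1 + L" "s / 4"] by (simp only: \<epsilon>_def times_divide_eq_right)
    then have \<epsilon>4: "\<epsilon> \<le> s / 4" using L \<epsilon> by (metis add_increasing2 less_eq_real_def mult_le_cancel_right1 order_refl not_less add.commute)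
    have dxy: "dist x y = s / 2" using s g(1) by (simp add: y_def dist_norm)
    then have "y \<in> closure \<Omega>" using s by auto
    then obtain z where z: "z \<in> \<Omega>" "dist z y < \<epsilon>" using \<epsilon> by (metis closure_approachable)
    have "dist x z < r"
      using dist_triangle[of x z y] dxy z(2) \<epsilon>4 s by (auto simp: dist_commute s_def)
    then have zg: "z \<bullet> e > g (p z)" using g(4)[of z] z(1) by (simp add: p_def)
    have xg: "x \<bullet> e \<le> g (p x)" using g(4)[of x] g(2) x(2) by (simp add: p_def)
    have py: "p y = p x" by (simp add: p_def y_def inner_diff_left ee algebra_simps)
    have "dist (g (p z)) (g (p x)) \<le> L * dist (p z) (p x)"
      by (rule lipschitz_onD[OF g(3)]) (simp_all add: p0)
    also have "\<dots> \<le> L * norm (z - y)"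
      using pdist[of z y] L by (simp add: py dist_norm mult_left_mono)
    also have "\<dots> \<le> L * \<epsilon>" using z(2) L by (simp add: dist_norm mult_left_mono)
    finally have 1: "g (p z) \<ge> g (p x) - L * \<epsilon>" by (simp add: dist_real_def)
    have "z \<bullet> e = y \<bullet> e + (z - y) \<bullet> e" by (simp add: inner_diff_left)
    also have "(z - y) \<bullet> e \<le> norm (z - y) * norm e" by (rule norm_cauchy_schwarz)
    finally have "z \<bullet> e \<le> x \<bullet> e - s / 2 + \<epsilon>"
      using z(2) by (simp add: y_def inner_diff_left ee g(1) dist_norm)
    then have "s / 2 < (1 + L) * \<epsilon>" using zg xg 1 by (simp add: algebra_simps)
    then show False using \<epsilon>L s by simp
  qed
qed

section \<open>Geometry of a conforming triangulation\<close>

locale triangulated_domain =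
  fixes \<Omega> :: "(real^'n) set" and \<T> :: "(real^'n) set set"
  assumes bounded_domain: "bounded \<Omega>" and lipschitz: "lipschitz_domain \<Omega>"
    and regular: "regular_triangulation \<Omega> \<T>"
begin

lemma open_domain: "open \<Omega>" using lipschitz by (simp add: lipschitz_domain_def)

lemma domain_sets [simp]: "\<Omega> \<in> sets lebesgue" using open_domain by simp

lemma finite_triangulation: "finite \<T>"
  using regular by (simp add: regular_triangulation_def triangulation_def)

lemma simplexT: "T \<in> \<T> \<Longrightarrow> int CARD('n) simplex T"
  using regular by (simp add: regular_triangulation_def)

lemma UnionT: "\<Union>\<T> = closure \<Omega>"
  using regular by (simp add: regular_triangulation_def)

lemma faces: "T \<in> \<T> \<Longrightarrow> T' \<in> \<T> \<Longrightarrow> T \<inter> T' face_of T"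
  using regular by (simp add: regular_triangulation_def triangulation_def)

lemma convexT: "T \<in> \<T> \<Longrightarrow> convex T" using simplexT convex_simplex by blast
lemma compactT: "T \<in> \<T> \<Longrightarrow> compact T" using simplexT compact_simplex by blast
lemma boundedT: "T \<in> \<T> \<Longrightarrow> bounded T" using compactT compact_imp_bounded by blast
lemma aff_dimT: "T \<in> \<T> \<Longrightarrow> aff_dim T = int CARD('n)" using simplexT aff_dim_simplex by blast

text \<open>The simplices fill the closure of \<Omega>, so this is where it matters that a Lipschitz
  domain has no slits.\<close>

lemma interiorT_subset: "T \<in> \<T> \<Longrightarrow> interior T \<subseteq> \<Omega>"
  using UnionT lipschitz_domain_interior_closure[OF lipschitz] by (metis Sup_upper interior_mono)

lemma rel_interiorT: "T \<in> \<T> \<Longrightarrow> rel_interior T = interior T"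
  using aff_dimT by (simp add: interior_rel_interior_gen)

lemma interiorT_nonempty: "T \<in> \<T> \<Longrightarrow> interior T \<noteq> {}"
  using rel_interior_eq_empty[OF convexT] rel_interiorT aff_dimT by (metis aff_dim_empty int_ops(1) of_nat_0_le_iff neg_0_le_iff_le not_one_le_zero)

lemma closure_interiorT: "T \<in> \<T> \<Longrightarrow> closure (interior T) = T"
  using convex_closure_interior[OF convexT interiorT_nonempty] compactT
  by (simp add: compact_imp_closed)

lemma not_proper_subset:
  assumes "T \<in> \<T>" "T' \<in> \<T>" "T \<inter> T' = T"
  shows "T = T'"
proof (rule ccontr)
  assume ne: "T \<noteq> T'"
  have "T face_of T'" using faces[OF assms(2,1)] assms(3) by (simp add: Int_commute)
  then have "aff_dim T < aff_dim T'" using face_of_aff_dim_lt convexT assms(2) ne by blast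
  then show False using aff_dimT assms by simp
qed

text \<open>The common part is a face of T that meets the relative interior of T, hence all of T;
  and a full-dimensional simplex is not a proper face of another one.\<close>

lemma interiors_disjoint:
  assumes "T \<in> \<T>" "T' \<in> \<T>" "x \<in> interior T" "x \<in> T'"
  shows "T = T'"
proof -
  have "x \<in> T" using assms(3) interior_subset by blast
  then have "(T \<inter> T') \<inter> rel_interior T \<noteq> {}" using assms rel_interiorT by auto
  then have "T \<subseteq> T \<inter> T'" using subset_of_face_of[OF faces[OF assms(1,2)] subset_refl] by simp
  then show ?thesis using not_proper_subset[OF assms(1,2)] by blast
qed

lemma negligible_skeleton: "negligible (\<Omega> - (\<Union>T\<in>\<T>. interior T))"
proof (rule negligible_subset)
  show "negligible (\<Union>T\<in>\<T>. frontier T)"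
    by (intro negligible_Union) (auto simp: finite_triangulation negligible_convex_frontier convexT)
  have "\<Omega> \<subseteq> \<Union>\<T>" using UnionT closure_subset by auto
  then show "\<Omega> - (\<Union>T\<in>\<T>. interior T) \<subseteq> (\<Union>T\<in>\<T>. frontier T)"
    using compactT by (fastforce simp: frontier_def compact_imp_closed)
qed

lemma facet_data:
  assumes "T \<in> \<T>" "E facet_of T"
  obtains C P \<nu> \<beta> where "simplex_facet C P \<nu> \<beta>" "T = convex hull C" "E = convex hull (C - {P})"
  using simplex_facet_exists[of T E] simplexT assms by (metis DIM_cart DIM_real mult.right_neutral)

text \<open>E spans a single hyperplane, so the normals agree up to sign. With equal signs both
  simplices would fill the same half ball at a relative interior point of E, and their interiors
  would overlap.\<close>

lemma opposite_normals:
  assumes T: "T1 \<in> \<T>" "T2 \<in> \<T>" "T1 \<noteq> T2"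
    and 1: "simplex_facet C1 Q1 \<nu>1 \<beta>1" "T1 = convex hull C1" "E = convex hull (C1 - {Q1})"
    and 2: "simplex_facet C2 Q2 \<nu>2 \<beta>2" "T2 = convex hull C2" "E = convex hull (C2 - {Q2})"
  shows "\<nu>2 = - \<nu>1 \<and> \<beta>2 = - \<beta>1"
proof -
  interpret f1: simplex_facet C1 Q1 \<nu>1 \<beta>1 by (rule 1)
  interpret f2: simplex_facet C2 Q2 \<nu>2 \<beta>2 by (rule 2)
  have hull: "{x. \<nu>1 \<bullet> x = \<beta>1} = {x. \<nu>2 \<bullet> x = \<beta>2}"
    using f1.affine_hull_E f2.affine_hull_E 1 2 by metis
  have "\<not> (\<nu>2 = \<nu>1 \<and> \<beta>2 = \<beta>1)"
  proof
    assume eq: "\<nu>2 = \<nu>1 \<and> \<beta>2 = \<beta>1"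
    have "E \<noteq> {}" using f1.base_nonempty 1(3) by simp
    then obtain x0 where x0: "x0 \<in> rel_interior E"
      using rel_interior_eq_empty[of E] 1(3) convex_convex_hull by blast
    obtain r1 where r1: "r1 > 0" "\<And>x. x \<in> ball x0 r1 \<Longrightarrow> \<nu>1 \<bullet> x \<le> \<beta>1 \<Longrightarrow> x \<in> T1"
      using f1.half_ball x0 1 by metis
    obtain r2 where r2: "r2 > 0" "\<And>x. x \<in> ball x0 r2 \<Longrightarrow> \<nu>1 \<bullet> x \<le> \<beta>1 \<Longrightarrow> x \<in> T2"
      using f2.half_ball x0 2 eq by metis
    define r where "r = min r1 r2"
    have r: "r > 0" using r1 r2 by (simp add: r_def)
    have x0b: "\<nu>1 \<bullet> x0 = \<beta>1" using f1.on_E x0 1(3) rel_interior_subset by blast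
    define S where "S = ball x0 r \<inter> {x. \<nu>1 \<bullet> x < \<beta>1}"
    have "open S" by (auto simp: S_def open_halfspace_lt)
    moreover have "S \<subseteq> T1" "S \<subseteq> T2" using r1 r2 by (auto simp: S_def r_def)
    ultimately have "S \<subseteq> interior T1" "S \<subseteq> T2" by (auto simp: interior_maximal)
    moreover have "x0 - (r/2) *\<^sub>R \<nu>1 \<in> S"
      using r f1.norm_normal f1.normal_normal x0b by (auto simp: S_def dist_norm inner_diff_right)
    ultimately show False using interiors_disjoint[OF T(1,2)] T(3) by blast
  qed
  then show ?thesis
    using unit_normal_unique[OF f1.norm_normal f2.norm_normal, of \<beta>1 \<beta>2] hull by auto
qed

text \<open>Three simplices on one facet would give three pairwise opposite unit normals.\<close>

lemma at_most_two:
  assumes "T1 \<in> \<T>" "T2 \<in> \<T>" "T3 \<in> \<T>" "E facet_of T1" "E facet_of T2" "E facet_of T3"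
    "T1 \<noteq> T2" "T1 \<noteq> T3"
  shows "T2 = T3"
proof (rule ccontr)
  assume ne: "T2 \<noteq> T3"
  obtain C1 Q1 \<nu>1 \<beta>1 where 1: "simplex_facet C1 Q1 \<nu>1 \<beta>1" "T1 = convex hull C1" "E = convex hull (C1 - {Q1})"
    using facet_data assms by metis
  obtain C2 Q2 \<nu>2 \<beta>2 where 2: "simplex_facet C2 Q2 \<nu>2 \<beta>2" "T2 = convex hull C2" "E = convex hull (C2 - {Q2})"
    using facet_data assms by metis
  obtain C3 Q3 \<nu>3 \<beta>3 where 3: "simplex_facet C3 Q3 \<nu>3 \<beta>3" "T3 = convex hull C3" "E = convex hull (C3 - {Q3})"
    using facet_data assms by metis
  have "\<nu>2 = - \<nu>1" "\<nu>3 = - \<nu>1" "\<nu>3 = - \<nu>2"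
    using opposite_normals[OF assms(1,2,7) 1 2] opposite_normals[OF assms(1,3,8) 1 3]
      opposite_normals[OF assms(2,3) ne 2 3] by auto
  then have "\<nu>1 = 0" by (metis add.inverse_inverse add_eq_0_iff double_zero scaleR_2 scaleR_half_double scaleR_zero_right)
  then show False using simplex_facet.norm_normal[OF 1(1)] by simp
qed

text \<open>A point z slightly outside T, in normal direction from a relative interior point x0 of
  E, still lies in \<Omega> and hence in another simplex T'. For z close to x0 this T' contains x0
  as well, so the common face of T and T' contains E; being a proper face of T, it has no larger
  dimension and equals E.\<close>

lemma second_neighbour:
  assumes T: "T \<in> \<T>" and E: "E facet_of T" and nb: "\<not> E \<subseteq> frontier \<Omega>"
  obtains T' where "T' \<in> \<T>" "T' \<noteq> T" "E facet_of T'"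
proof -
  obtain C P \<nu> \<beta> where 1: "simplex_facet C P \<nu> \<beta>" "T = convex hull C" "E = convex hull (C - {P})"
    using facet_data[OF T E] by metis
  interpret f: simplex_facet C P \<nu> \<beta> by (rule 1)
  have cE: "convex E" by (simp add: 1)
  have "E \<subseteq> closure \<Omega>" using E T UnionT facet_of_imp_subset by blast
  then obtain x where x: "x \<in> E" "x \<in> \<Omega>"
    using nb open_domain by (auto simp: frontier_def interior_open)
  then have "x \<in> closure (rel_interior E)"
    using convex_closure_rel_interior[OF cE] closure_subset by blast
  then obtain x0 where x0: "x0 \<in> rel_interior E" "x0 \<in> \<Omega>"
    using x(2) open_domain by (meson closure_iff_nhds_not_empty disjoint_iff order_refl)
  have x0E: "x0 \<in> E" using x0 rel_interior_subset by blast
  \<comment> \<open>The simplices that miss x0 form a closed union, so a whole ball around x0 avoids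
    them.\<close>
  define \<S> where "\<S> = {T'\<in>\<T>. x0 \<notin> T'}"
  have "closed (\<Union>\<S>)"
    using finite_triangulation compactT by (intro closed_Union) (auto simp: \<S>_def compact_imp_closed)
  then have "open (\<Omega> - \<Union>\<S>)" using open_domain by (rule open_Diff[rotated])
  moreover have "x0 \<in> \<Omega> - \<Union>\<S>" using x0 by (auto simp: \<S>_def)
  ultimately obtain r where r: "r > 0" "ball x0 r \<subseteq> \<Omega> - \<Union>\<S>" using open_contains_ball by blast
  define z where "z = x0 + (r/2) *\<^sub>R \<nu>"
  have "z \<in> ball x0 r" using r f.norm_normal by (simp add: z_def dist_norm)
  then have "z \<in> \<Omega>" "z \<notin> \<Union>\<S>" using r by auto
  then have "z \<in> \<Union>\<T>" using UnionT closure_subset[of \<Omega>] by (metis subsetD)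
  then obtain T' where T': "T' \<in> \<T>" "z \<in> T'" "x0 \<in> T'"
    using \<open>z \<notin> \<Union>\<S>\<close> by (auto simp: \<S>_def)
  have "\<nu> \<bullet> z > \<beta>" using f.on_E x0E 1 r f.normal_normal by (simp add: z_def inner_add_right)
  then have "z \<notin> T" using f.on_T[of z] 1 by auto
  then have ne: "T' \<noteq> T" using T' by blast
  define F where "F = T \<inter> T'"
  have F: "F face_of T" "F face_of T'" using faces[OF T T'(1)] faces[OF T'(1) T] by (auto simp: F_def Int_commute)
  have ET: "E \<subseteq> T" using E facet_of_imp_subset by blast
  have "E \<subseteq> F"
    by (rule subset_of_face_of[OF F(1) ET]) (use x0 x0E ET T' in \<open>auto simp: F_def\<close>)
  then have EF: "E face_of F"
    using face_of_subset[OF facet_of_imp_face_of[OF E]] F(1) face_of_imp_subset by blast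
  have "F \<noteq> T" using not_proper_subset[OF T T'(1)] ne by (auto simp: F_def)
  then have "aff_dim F < aff_dim T" using face_of_aff_dim_lt[OF convexT[OF T] F(1)] by simp
  moreover have "aff_dim E = aff_dim T - 1" "E \<noteq> {}" using E by (auto simp: facet_of_def)
  moreover have "E \<noteq> F \<Longrightarrow> aff_dim E < aff_dim F"
    using face_of_aff_dim_lt[OF face_of_imp_convex[OF F(1)] EF] by simp
  ultimately have "E = F" by linarith
  then have "E facet_of T'"
    using F(2) \<open>E \<noteq> {}\<close> \<open>aff_dim E = aff_dim T - 1\<close> aff_dimT T T'(1) by (simp add: facet_of_def)
  then show ?thesis using that T'(1) ne by blast
qed

end

section \<open>Friedrichs and Poincare inequalities\<close>

lemma nn_integral_lebesgue_on_borel: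
  fixes S :: "'a::euclidean_space set"
  assumes [measurable]: "F \<in> borel_measurable borel" "S \<in> sets borel"
  shows "(\<integral>\<^sup>+x. F x \<partial>lebesgue_on S) = (\<integral>\<^sup>+x. F x * indicator S x \<partial>lborel)"
  by (simp add: nn_integral_restrict_space nn_integral_completion)

lemma integral_lebesgue_on_borel:
  fixes S :: "'a::euclidean_space set" and F :: "'a \<Rightarrow> 'b::euclidean_space"
  assumes [measurable]: "F \<in> borel_measurable borel" "S \<in> sets borel"
  shows "(LINT x|lebesgue_on S. F x) = (LINT x|lborel. indicator S x *\<^sub>R F x)"
  by (simp add: integral_restrict_space integral_completion)

text \<open>A walk of length D in a fixed direction leaves the domain, and w vanishes there, so w is
  controlled by the integral of its gradient along the walk. Under the square, one factor D comes
  from Cauchy--Schwarz on the segment and one from integrating over its length after the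
  translations are undone.\<close>

lemma Friedrichs:
  fixes \<Omega> :: "(real^'n) set"
  assumes \<Omega>: "open \<Omega>" "bounded \<Omega>" and D: "D > 0" "\<And>x y. x \<in> \<Omega> \<Longrightarrow> y \<in> \<Omega> \<Longrightarrow> dist x y < D"
    and w: "w \<in> test_functions \<Omega>"
  shows "L2_norm (lebesgue_on \<Omega>) w \<le> D * L2_norm (lebesgue_on \<Omega>) (grad w)"
proof -
  note wD = test_functionsD[OF w]
  have Ul: "\<Omega> \<in> sets lebesgue" using \<Omega> by simp
  have [measurable]: "w \<in> borel_measurable borel" "grad w \<in> borel_measurable borel"
    using has_C1_grad_measurable[OF wD(4)] by auto
  define e :: "real^'n" where "e = axis undefined 1"
  have e: "norm e = 1" by (simp add: e_def)
  have pt: "ennreal ((w x)\<^sup>2) \<le> (\<integral>\<^sup>+s. ennreal (D * (norm (grad w (x + s *\<^sub>R e)))\<^sup>2) * indicator {0..D} s \<partial>lborel)" for x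
  proof (cases "x \<in> \<Omega>")
    case True
    have "dist (x + D *\<^sub>R e) x = D" using D e by (simp add: dist_norm)
    then have "x + D *\<^sub>R e \<notin> \<Omega>" using D(2)[of "x + D *\<^sub>R e" x] True by auto
    then have "w (x + D *\<^sub>R e) = 0" using wD(3) wD(5)[of "x + D *\<^sub>R e"] by blast
    then show ?thesis
      using has_C1_grad_square_bound[OF wD(4), of D x e] D e by simp
  next
    case False
    then have "w x = 0" using wD(3) wD(5)[of x] by blast
    then show ?thesis by simp
  qed
  have sq: "continuous_on UNIV (\<lambda>x. (w x)\<^sup>2)" "continuous_on UNIV (\<lambda>x. (norm (grad w x))\<^sup>2)"
    by (intro continuous_intros has_C1_grad_continuous[OF wD(4)])+
  have z: "(w x)\<^sup>2 = 0" "(norm (grad w x))\<^sup>2 = 0" if "x \<notin> closure {x. w x \<noteq> 0}" for x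
    using wD(5,6)[OF that] by simp_all
  note i1 = continuous_compact_support_integrable[OF sq(1) wD(2,3) z(1) Ul]
  note i2 = continuous_compact_support_integrable[OF sq(2) wD(2,3) z(2) Ul]
  have "ennreal (LINT x|lborel. (w x)\<^sup>2) = (\<integral>\<^sup>+x. ennreal ((w x)\<^sup>2) \<partial>lborel)"
    by (rule nn_integral_eq_integral[symmetric, OF i1(3)]) (simp, intro AE_I2, simp)
  also have "\<dots> \<le> (\<integral>\<^sup>+x. \<integral>\<^sup>+s. ennreal (D * (norm (grad w (x + s *\<^sub>R e)))\<^sup>2) * indicator {0..D} s \<partial>lborel \<partial>lborel)"
    by (rule nn_integral_mono) (rule pt)
  also have "\<dots> = (\<integral>\<^sup>+s. \<integral>\<^sup>+x. ennreal (D * (norm (grad w (x + s *\<^sub>R e)))\<^sup>2) * indicator {0..D} s \<partial>lborel \<partial>lborel)"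
    by (rule lborel_pair.Fubini') measurable
  also have "\<dots> = (\<integral>\<^sup>+s. (\<integral>\<^sup>+x. ennreal (D * (norm (grad w x))\<^sup>2) \<partial>lborel) * indicator {0..D} s \<partial>lborel)"
  proof (rule nn_integral_cong)
    fix s :: real
    have "(\<integral>\<^sup>+x. ennreal (D * (norm (grad w (x + s *\<^sub>R e)))\<^sup>2) * indicator {0..D} s \<partial>lborel)
      = (\<integral>\<^sup>+x. ennreal (D * (norm (grad w (x + s *\<^sub>R e)))\<^sup>2) \<partial>lborel) * indicator {0..D} s"
      by (rule nn_integral_multc) measurable
    also have "(\<integral>\<^sup>+x. ennreal (D * (norm (grad w (x + s *\<^sub>R e)))\<^sup>2) \<partial>lborel)
      = (\<integral>\<^sup>+x. ennreal (D * (norm (grad w x))\<^sup>2) \<partial>lborel)"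
      by (rule nn_integral_lborel_translation) measurable
    finally show "(\<integral>\<^sup>+x. ennreal (D * (norm (grad w (x + s *\<^sub>R e)))\<^sup>2) * indicator {0..D} s \<partial>lborel)
      = (\<integral>\<^sup>+x. ennreal (D * (norm (grad w x))\<^sup>2) \<partial>lborel) * indicator {0..D} s" .
  qed
  also have "\<dots> = (\<integral>\<^sup>+x. ennreal (D * (norm (grad w x))\<^sup>2) \<partial>lborel) * ennreal D"
    using D by (subst nn_integral_cmult) auto
  also have "(\<integral>\<^sup>+x. ennreal (D * (norm (grad w x))\<^sup>2) \<partial>lborel) = ennreal (LINT x|lborel. D * (norm (grad w x))\<^sup>2)"
    by (rule nn_integral_eq_integral) (use i2(3) D in auto)
  also have "\<dots> * ennreal D = ennreal (D * (LINT x|lborel. (norm (grad w x))\<^sup>2) * D)"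
    using D by (simp add: ennreal_mult)
  finally have "(LINT x|lborel. (w x)\<^sup>2) \<le> D * (LINT x|lborel. (norm (grad w x))\<^sup>2) * D"
    by (rule ennreal_le_iff[THEN iffD1, rotated]) (use D in \<open>simp add: integral_nonneg_AE\<close>)
  then have "(L2_norm (lebesgue_on \<Omega>) w)\<^sup>2 \<le> (D * L2_norm (lebesgue_on \<Omega>) (grad w))\<^sup>2"
  proof -
    have aux: "a \<le> D * b * D \<Longrightarrow> a \<le> D\<^sup>2 * b" for a b
      by (simp add: power2_eq_square mult_ac)
    assume "(LINT x|lborel. (w x)\<^sup>2) \<le> D * (LINT x|lborel. (norm (grad w x))\<^sup>2) * D"
    from aux[OF this] show ?thesis using i1(2) i2(2) by (simp add: L2_norm_sq power_mult_distrib)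
  qed
  then show ?thesis by (rule power2_le_imp_le) (use D in simp)
qed

text \<open>The substitution costs c^(-n), which is at most 2^n; this is the origin of the factor
  2^n in the Poincare inequality.\<close>

lemma nn_integral_lborel_affine_le:
  fixes t :: "'a::euclidean_space"
  assumes [measurable]: "F \<in> borel_measurable borel" and c: "1/2 \<le> c"
  shows "(\<integral>\<^sup>+x. F (t + c *\<^sub>R x) \<partial>lborel) \<le> ennreal (2 ^ DIM('a)) * (\<integral>\<^sup>+x. F x \<partial>lborel)"
proof -
  let ?n = "DIM('a)"
  let ?I = "\<integral>\<^sup>+x. F (t + c *\<^sub>R x) \<partial>lborel"
  have "1 \<le> (2 * c) ^ ?n" using c by (intro one_le_power) simp
  then have "ennreal 1 * ?I \<le> ennreal ((2 * c) ^ ?n) * ?I"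
    by (intro mult_right_mono ennreal_leI) auto
  also have "ennreal ((2 * c) ^ ?n) = ennreal (2 ^ ?n) * ennreal (\<bar>c\<bar> ^ ?n)"
    using c by (simp add: power_mult_distrib ennreal_mult)
  also have "\<dots> * ?I = ennreal (2 ^ ?n) * (\<integral>\<^sup>+x. F x \<partial>lborel)"
    using c by (subst nn_integral_lborel_affine[of F c t]) (auto simp: mult.assoc)
  finally show ?thesis by simp
qed

text \<open>The deviation of w from its mean is bounded by the average of (w y - w x)^2 over pairs
  of points, and each such difference by the gradient on the segment, which convexity keeps in S.
  After Tonelli the position s on the segment is fixed, and the point at this position replaces
  whichever end point has weight at least 1/2.\<close>

lemma Poincare_convex:
  fixes S :: "'a::euclidean_space set"
  assumes S: "open S" "bounded S" "convex S" "S \<noteq> {}" and h: "\<And>x y. x \<in> S \<Longrightarrow> y \<in> S \<Longrightarrow> dist x y \<le> h"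
    and w: "has_C1_grad w g"
  defines "M \<equiv> lebesgue_on S"
  shows "(L2_norm M (\<lambda>x. w x - (LINT y|M. w y) / measure lebesgue S))\<^sup>2
    \<le> 2 ^ DIM('a) * h\<^sup>2 * (L2_norm M g)\<^sup>2"
proof -
  let ?n = "DIM('a)"
  have Sl: "S \<in> sets lebesgue" and Sb[measurable]: "S \<in> sets borel" using S by auto
  have [measurable]: "w \<in> borel_measurable borel" "g \<in> borel_measurable borel"
    using has_C1_grad_measurable[OF w] by auto
  have fin: "finite_measure M" unfolding M_def by (rule finite_measure_lebesgue_on_bounded[OF Sl S(2)])
  interpret M: finite_measure M by (rule fin)
  define A where "A = measure lebesgue S"
  have em: "emeasure lborel S = ennreal A"
  proof -
    have "emeasure lebesgue S = ennreal A"
      unfolding A_def by (rule emeasure_eq_measure2[OF bounded_set_imp_lmeasurable[OF S(2) Sl]])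
    then show ?thesis by simp
  qed
  have A: "A > 0"
  proof -
    have "\<not> negligible S" using S(1,4) open_not_negligible by blast
    then show ?thesis unfolding A_def
      using bounded_set_imp_lmeasurable[OF S(2) Sl] by (metis negligible_iff_measure0 zero_less_measure_iff)
  qed
  have mM: "measure M (space M) = A" using Sl by (simp add: M_def A_def measure_restrict_space)
  have wL: "w \<in> L2 M" "g \<in> L2 M"
    unfolding M_def using continuous_bounded_L2[OF has_C1_grad_continuous(1)[OF w] Sl S(2)]
      continuous_bounded_L2[OF has_C1_grad_continuous(2)[OF w] Sl S(2)] by auto
  have oneL: "(\<lambda>x. c) \<in> L2 M" for c :: real by (rule L2_bounded_measurable[OF fin, where B = "\<bar>c\<bar>"]) auto
  define m where "m = (LINT y|M. w y) / A"
  define G where "G x = ennreal ((norm (g x))\<^sup>2) * indicator S x" for x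
  have Gm[measurable]: "G \<in> borel_measurable borel" unfolding G_def by measurable
  define J where "J = (\<integral>\<^sup>+x. G x \<partial>lborel)"
  \<comment> \<open>Cauchy--Schwarz for w y - w x as a function of y, whose mean is m - w x.\<close>
  have Jensen: "ennreal A * ennreal ((w x - m)\<^sup>2) \<le> (\<integral>\<^sup>+y. ennreal ((w y - w x)\<^sup>2) * indicator S y \<partial>lborel)" for x
  proof -
    have d: "(\<lambda>y. w y - w x) \<in> L2 M" by (rule L2_diff[OF wL(1) oneL])
    have "(LINT y|M. w y - w x) = A * (m - w x)"
      using L2_integrable[OF fin wL(1)] A mM by (simp add: m_def algebra_simps)
    then have "(A * (m - w x))\<^sup>2 \<le> A * (LINT y|M. (w y - w x)\<^sup>2)"
      using L2_integral_square_le[OF fin d] mM by simp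
    then have "A * (w x - m)\<^sup>2 \<le> (LINT y|M. (w y - w x)\<^sup>2)"
      using A by (simp add: power_mult_distrib power2_eq_square power2_commute[of m "w x"] mult.assoc)
         (simp add: algebra_simps)
    then have "ennreal (A * (w x - m)\<^sup>2) \<le> ennreal (LINT y|M. (w y - w x)\<^sup>2)" by (rule ennreal_leI)
    also have "\<dots> = (\<integral>\<^sup>+y. ennreal ((w y - w x)\<^sup>2) \<partial>M)"
      by (rule nn_integral_eq_integral[symmetric]) (use L2_integrable_sq[OF d] in auto)
    also have "\<dots> = (\<integral>\<^sup>+y. ennreal ((w y - w x)\<^sup>2) * indicator S y \<partial>lborel)"
      unfolding M_def by (rule nn_integral_lebesgue_on_borel) measurable
    finally show ?thesis using A by (simp add: ennreal_mult)
  qed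
  have seg: "ennreal ((w y - w x)\<^sup>2) * indicator S y * indicator S x
      \<le> (\<integral>\<^sup>+s. ennreal (h\<^sup>2) * (G (x + s *\<^sub>R (y - x)) * indicator S y * indicator S x) * indicator {0..1} s \<partial>lborel)" for x y
  proof (cases "x \<in> S \<and> y \<in> S")
    case True
    have "ennreal ((w y - w x)\<^sup>2)
        \<le> (\<integral>\<^sup>+s. ennreal (1 * ((norm (y - x))\<^sup>2 * (norm (g (x + s *\<^sub>R (y - x))))\<^sup>2)) * indicator {0..1} s \<partial>lborel)"
      using has_C1_grad_square_bound[OF w, of 1 x "y - x"] by simp
    also have "\<dots> \<le> (\<integral>\<^sup>+s. ennreal (h\<^sup>2) * G (x + s *\<^sub>R (y - x)) * indicator {0..1} s \<partial>lborel)"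
    proof (rule nn_integral_mono)
      fix s :: real
      have "ennreal (1 * ((norm (y - x))\<^sup>2 * (norm (g (x + s *\<^sub>R (y - x))))\<^sup>2)) \<le> ennreal (h\<^sup>2) * G (x + s *\<^sub>R (y - x))"
        if s: "s \<in> {0..1}"
      proof -
        have "(1 - s) *\<^sub>R x + s *\<^sub>R y \<in> S" using True S(3) s by (intro convexD) auto
        then have "x + s *\<^sub>R (y - x) \<in> S" by (simp add: algebra_simps)
        moreover have "(norm (y - x))\<^sup>2 \<le> h\<^sup>2"
          using h[of y x] True by (intro power_mono) (auto simp: dist_norm)
        ultimately show ?thesis
          by (simp add: G_def flip: ennreal_mult) (intro ennreal_leI mult_right_mono, auto)
      qed
      then show "ennreal (1 * ((norm (y - x))\<^sup>2 * (norm (g (x + s *\<^sub>R (y - x))))\<^sup>2)) * indicator {0..1} s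
        \<le> ennreal (h\<^sup>2) * G (x + s *\<^sub>R (y - x)) * indicator {0..1} s"
        by (auto split: split_indicator)
    qed
    finally show ?thesis using True by simp
  next
    case False
    then show ?thesis by (auto split: split_indicator)
  qed
  \<comment> \<open>For s \<le> 1/2 the weight of x is at least 1/2, so x is substituted and y only
    contributes the measure of S; for larger s the roles are exchanged.\<close>
  have half: "(\<integral>\<^sup>+x. \<integral>\<^sup>+y. G (x + s *\<^sub>R (y - x)) * indicator S y * indicator S x \<partial>lborel \<partial>lborel)
      \<le> ennreal (2 ^ ?n) * J * ennreal A" for s
  proof (cases "s \<le> 1/2")
    case True
    have "(\<integral>\<^sup>+x. \<integral>\<^sup>+y. G (x + s *\<^sub>R (y - x)) * indicator S y * indicator S x \<partial>lborel \<partial>lborel)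
      = (\<integral>\<^sup>+y. \<integral>\<^sup>+x. G (x + s *\<^sub>R (y - x)) * indicator S y * indicator S x \<partial>lborel \<partial>lborel)"
      by (rule lborel_pair.Fubini') measurable
    also have "\<dots> \<le> (\<integral>\<^sup>+y. ennreal (2 ^ ?n) * J * indicator S y \<partial>lborel)"
    proof (rule nn_integral_mono)
      fix y
      have "(\<integral>\<^sup>+x. G (x + s *\<^sub>R (y - x)) * indicator S y * indicator S x \<partial>lborel)
         \<le> (\<integral>\<^sup>+x. G (s *\<^sub>R y + (1 - s) *\<^sub>R x) * indicator S y \<partial>lborel)"
        by (rule nn_integral_mono) (auto split: split_indicator simp: algebra_simps)
      also have "\<dots> = (\<integral>\<^sup>+x. G (s *\<^sub>R y + (1 - s) *\<^sub>R x) \<partial>lborel) * indicator S y"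
        by (rule nn_integral_multc) measurable
      also have "\<dots> \<le> ennreal (2 ^ ?n) * J * indicator S y"
        unfolding J_def by (intro mult_right_mono nn_integral_lborel_affine_le) (use True in auto)
      finally show "(\<integral>\<^sup>+x. G (x + s *\<^sub>R (y - x)) * indicator S y * indicator S x \<partial>lborel)
        \<le> ennreal (2 ^ ?n) * J * indicator S y" .
    qed
    also have "\<dots> = ennreal (2 ^ ?n) * J * ennreal A" by (subst nn_integral_cmult) (auto simp: em)
    finally show ?thesis .
  next
    case False
    have "(\<integral>\<^sup>+x. \<integral>\<^sup>+y. G (x + s *\<^sub>R (y - x)) * indicator S y * indicator S x \<partial>lborel \<partial>lborel)
      \<le> (\<integral>\<^sup>+x. ennreal (2 ^ ?n) * J * indicator S x \<partial>lborel)"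
    proof (rule nn_integral_mono)
      fix x
      have "(\<integral>\<^sup>+y. G (x + s *\<^sub>R (y - x)) * indicator S y * indicator S x \<partial>lborel)
         \<le> (\<integral>\<^sup>+y. G ((1 - s) *\<^sub>R x + s *\<^sub>R y) * indicator S x \<partial>lborel)"
        by (rule nn_integral_mono) (auto split: split_indicator simp: algebra_simps)
      also have "\<dots> = (\<integral>\<^sup>+y. G ((1 - s) *\<^sub>R x + s *\<^sub>R y) \<partial>lborel) * indicator S x"
        by (rule nn_integral_multc) measurable
      also have "\<dots> \<le> ennreal (2 ^ ?n) * J * indicator S x"
        unfolding J_def by (intro mult_right_mono nn_integral_lborel_affine_le) (use False in auto)
      finally show "(\<integral>\<^sup>+y. G (x + s *\<^sub>R (y - x)) * indicator S y * indicator S x \<partial>lborel)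
        \<le> ennreal (2 ^ ?n) * J * indicator S x" .
    qed
    also have "\<dots> = ennreal (2 ^ ?n) * J * ennreal A" by (subst nn_integral_cmult) (auto simp: em)
    finally show ?thesis .
  qed
  have fub: "(\<integral>\<^sup>+x. \<integral>\<^sup>+y. \<integral>\<^sup>+s. ennreal (h\<^sup>2) * (G (x + s *\<^sub>R (y - x)) * indicator S y * indicator S x) * indicator {0..1} s \<partial>lborel \<partial>lborel \<partial>lborel)
     = (\<integral>\<^sup>+s. \<integral>\<^sup>+x. \<integral>\<^sup>+y. ennreal (h\<^sup>2) * (G (x + s *\<^sub>R (y - x)) * indicator S y * indicator S x) * indicator {0..1} s \<partial>lborel \<partial>lborel \<partial>lborel)"
    (is "?L = ?R")
  proof -
    have "?L = (\<integral>\<^sup>+x. \<integral>\<^sup>+s. \<integral>\<^sup>+y. ennreal (h\<^sup>2) * (G (x + s *\<^sub>R (y - x)) * indicator S y * indicator S x) * indicator {0..1} s \<partial>lborel \<partial>lborel \<partial>lborel)"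
      by (rule nn_integral_cong, rule lborel_pair.Fubini') measurable
    also have "\<dots> = ?R" by (rule lborel_pair.Fubini') measurable
    finally show ?thesis .
  qed
  have "ennreal A * (\<integral>\<^sup>+x. ennreal ((w x - m)\<^sup>2) * indicator S x \<partial>lborel)
      = (\<integral>\<^sup>+x. ennreal A * ennreal ((w x - m)\<^sup>2) * indicator S x \<partial>lborel)"
    by (subst nn_integral_cmult[symmetric]) (auto simp: mult.assoc)
  also have "\<dots> \<le> (\<integral>\<^sup>+x. (\<integral>\<^sup>+y. ennreal ((w y - w x)\<^sup>2) * indicator S y \<partial>lborel) * indicator S x \<partial>lborel)"
    by (intro nn_integral_mono mult_right_mono Jensen) auto
  also have "\<dots> = (\<integral>\<^sup>+x. \<integral>\<^sup>+y. ennreal ((w y - w x)\<^sup>2) * indicator S y * indicator S x \<partial>lborel \<partial>lborel)"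
    by (intro nn_integral_cong nn_integral_multc[symmetric]) measurable
  also have "\<dots> \<le> ?L"
    unfolding fub[symmetric] by (intro nn_integral_mono) (rule seg)
  finally have 1: "ennreal A * (\<integral>\<^sup>+x. ennreal ((w x - m)\<^sup>2) * indicator S x \<partial>lborel)
     \<le> (\<integral>\<^sup>+s. \<integral>\<^sup>+x. \<integral>\<^sup>+y. ennreal (h\<^sup>2) * (G (x + s *\<^sub>R (y - x)) * indicator S y * indicator S x) * indicator {0..1} s \<partial>lborel \<partial>lborel \<partial>lborel)"
    unfolding fub .
  also have "\<dots> \<le> (\<integral>\<^sup>+s. ennreal (h\<^sup>2) * (ennreal (2 ^ ?n) * J * ennreal A) * indicator {0..1} s \<partial>(lborel :: real measure))"
  proof (rule nn_integral_mono)
    fix s :: real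
    have "(\<integral>\<^sup>+x. \<integral>\<^sup>+y. ennreal (h\<^sup>2) * (G (x + s *\<^sub>R (y - x)) * indicator S y * indicator S x) * indicator {0..1} s \<partial>lborel \<partial>lborel)
      = ennreal (h\<^sup>2) * (\<integral>\<^sup>+x. \<integral>\<^sup>+y. G (x + s *\<^sub>R (y - x)) * indicator S y * indicator S x \<partial>lborel \<partial>lborel) * indicator {0..1} s"
      by (simp add: nn_integral_cmult nn_integral_multc)
    also have "\<dots> \<le> ennreal (h\<^sup>2) * (ennreal (2 ^ ?n) * J * ennreal A) * indicator {0..1} s"
      by (intro mult_right_mono mult_left_mono half) auto
    finally show "(\<integral>\<^sup>+x. \<integral>\<^sup>+y. ennreal (h\<^sup>2) * (G (x + s *\<^sub>R (y - x)) * indicator S y * indicator S x) * indicator {0..1} s \<partial>lborel \<partial>lborel)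
      \<le> ennreal (h\<^sup>2) * (ennreal (2 ^ ?n) * J * ennreal A) * indicator {0..1} s" .
  qed
  also have "\<dots> = ennreal A * (ennreal (h\<^sup>2) * ennreal (2 ^ ?n) * J)"
    by (subst nn_integral_cmult) (auto simp: mult_ac)
  finally have "(\<integral>\<^sup>+x. ennreal ((w x - m)\<^sup>2) * indicator S x \<partial>lborel) \<le> ennreal (h\<^sup>2) * ennreal (2 ^ ?n) * J"
    using A by (subst (asm) ennreal_mult_le_mult_iff) auto
  moreover have "J = ennreal ((L2_norm M g)\<^sup>2)"
  proof -
    have "ennreal (LINT x|M. (norm (g x))\<^sup>2) = (\<integral>\<^sup>+x. ennreal ((norm (g x))\<^sup>2) \<partial>M)"
      by (rule nn_integral_eq_integral[symmetric]) (use L2_integrable_sq[OF wL(2)] in auto)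
    also have "\<dots> = J" unfolding J_def G_def M_def by (rule nn_integral_lebesgue_on_borel) measurable
    finally show ?thesis by (simp add: L2_norm_sq)
  qed
  moreover have "(\<integral>\<^sup>+x. ennreal ((w x - m)\<^sup>2) * indicator S x \<partial>lborel) = ennreal ((L2_norm M (\<lambda>x. w x - m))\<^sup>2)"
  proof -
    have "ennreal (LINT x|M. (w x - m)\<^sup>2) = (\<integral>\<^sup>+x. ennreal ((w x - m)\<^sup>2) \<partial>M)"
      by (rule nn_integral_eq_integral[symmetric]) (use L2_integrable_sq[OF L2_diff[OF wL(1) oneL]] in auto)
    also have "\<dots> = (\<integral>\<^sup>+x. ennreal ((w x - m)\<^sup>2) * indicator S x \<partial>lborel)"
      unfolding M_def by (rule nn_integral_lebesgue_on_borel) measurable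
    finally show ?thesis by (simp add: L2_norm_sq)
  qed
  ultimately have "ennreal ((L2_norm M (\<lambda>x. w x - m))\<^sup>2) \<le> ennreal (h\<^sup>2 * 2 ^ ?n * (L2_norm M g)\<^sup>2)"
    by (simp add: ennreal_mult)
  then have "(L2_norm M (\<lambda>x. w x - m))\<^sup>2 \<le> h\<^sup>2 * 2 ^ ?n * (L2_norm M g)\<^sup>2"
    by (rule ennreal_le_iff[THEN iffD1, rotated]) simp
  then show ?thesis by (simp add: m_def A_def mult_ac)
qed

section \<open>Affine changes of variables\<close>

text \<open>A linear change of variables in which two measures, of the unit ball and of its
  preimage, take the place of the determinant. Multiplication by the ball measure, written as an
  integral of the indicator B over y, gives a double integral; a translation moves y into F, and the
  integrals separate.\<close>

lemma nn_integral_linear_aux: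
  fixes L :: "'a::euclidean_space \<Rightarrow> 'a"
  assumes L: "linear L" "inj L" and [measurable]: "F \<in> borel_measurable borel"
  shows "(\<integral>\<^sup>+x. F (L x) \<partial>lborel) * emeasure lborel (ball (0::'a) 1)
    = emeasure lborel (L -` ball 0 1) * (\<integral>\<^sup>+x. F x \<partial>lborel)"
proof -
  have Lm[measurable]: "L \<in> borel_measurable borel"
    using L(1) by (intro borel_measurable_continuous_onI linear_continuous_on linear_conv_bounded_linear[THEN iffD1])
  define B :: "'a \<Rightarrow> ennreal" where "B = indicator (ball 0 1)"
  have Bm[measurable]: "B \<in> borel_measurable borel" unfolding B_def by (intro borel_measurable_indicator) simp
  have Bsym: "B (- x) = B x" for x by (simp add: B_def indicator_def)
  have BI: "(\<integral>\<^sup>+y. B (y - t) \<partial>lborel) = emeasure lborel (ball (0::'a) 1)" for t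
    using nn_integral_lborel_translation[OF Bm, of "- t"] nn_integral_indicator[of "ball (0::'a) 1" lborel]
    by (simp add: B_def)
  have "(\<integral>\<^sup>+x. F (L x) \<partial>lborel) * emeasure lborel (ball (0::'a) 1)
      = (\<integral>\<^sup>+x. F (L x) * emeasure lborel (ball (0::'a) 1) \<partial>lborel)"
    by (rule nn_integral_multc[symmetric]) measurable
  also have "\<dots> = (\<integral>\<^sup>+x. \<integral>\<^sup>+y. F (L x) * B (y - L x) \<partial>lborel \<partial>lborel)"
    by (intro nn_integral_cong) (simp add: nn_integral_cmult BI)
  also have "\<dots> = (\<integral>\<^sup>+y. \<integral>\<^sup>+x. F (L x) * B (y - L x) \<partial>lborel \<partial>lborel)"
    by (rule lborel_pair.Fubini') measurable
  also have "\<dots> = (\<integral>\<^sup>+y. \<integral>\<^sup>+x. F (y + L x) * B (L x) \<partial>lborel \<partial>lborel)"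
  proof (rule nn_integral_cong)
    fix y
    \<comment> \<open>Translating x by a preimage z of y turns L x into y + L x and y - L x into - L
      x; the unit ball is symmetric.\<close>
    obtain z where z: "L z = y"
      using linear_injective_imp_surjective[OF L] by (metis surjD)
    have "(\<integral>\<^sup>+x. F (L (x + z)) * B (y - L (x + z)) \<partial>lborel) = (\<integral>\<^sup>+x. F (L x) * B (y - L x) \<partial>lborel)"
      by (rule nn_integral_lborel_translation) measurable
    then show "(\<integral>\<^sup>+x. F (L x) * B (y - L x) \<partial>lborel) = (\<integral>\<^sup>+x. F (y + L x) * B (L x) \<partial>lborel)"
      by (simp add: linear_add[OF L(1)] z Bsym add.commute)
  qed
  also have "\<dots> = (\<integral>\<^sup>+x. \<integral>\<^sup>+y. F (y + L x) * B (L x) \<partial>lborel \<partial>lborel)"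
    by (rule lborel_pair.Fubini') measurable
  also have "\<dots> = (\<integral>\<^sup>+x. (\<integral>\<^sup>+y. F y \<partial>lborel) * B (L x) \<partial>lborel)"
    by (intro nn_integral_cong) (simp add: nn_integral_multc nn_integral_lborel_translation)
  also have "\<dots> = (\<integral>\<^sup>+y. F y \<partial>lborel) * (\<integral>\<^sup>+x. B (L x) \<partial>lborel)"
    by (rule nn_integral_cmult) measurable
  also have "(\<integral>\<^sup>+x. B (L x) \<partial>lborel) = (\<integral>\<^sup>+x. indicator (L -` ball 0 1) x \<partial>lborel)"
    by (intro nn_integral_cong) (simp add: B_def indicator_def)
  also have "\<dots> = emeasure lborel (L -` ball 0 1)"
    using measurable_sets_borel[OF Lm, of "ball 0 1"] by (intro nn_integral_indicator) simp
  finally show ?thesis by (simp add: mult.commute)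
qed

text \<open>The factor c, a ratio of the measures of the unit ball and of its preimage, is never
  evaluated: in the applications it cancels against the factor by which the measure of the domain of
  integration changes.\<close>

lemma lborel_affine_pushforward:
  fixes L :: "'a::euclidean_space \<Rightarrow> 'a"
  assumes L: "linear L" "inj L"
  obtains c where "c > 0"
    "\<And>F :: 'a \<Rightarrow> real. F \<in> borel_measurable borel \<Longrightarrow> (\<integral>x. F (L x + t) \<partial>lborel) = c * (\<integral>x. F x \<partial>lborel)"
proof -
  let ?B = "ball (0::'a) 1"
  let ?b = "measure lborel ?B"
  let ?l = "measure lborel (L -` ?B)"
  have bl: "bounded_linear L" using L(1) by (simp add: linear_conv_bounded_linear)
  have op: "open (L -` ?B)" using bl by (intro open_vimage linear_continuous_on) auto
  \<comment> \<open>L is bounded below, so the preimage of the ball is bounded; being also open and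
    nonempty, it has finite positive measure.\<close>
  obtain k where k: "k > 0" "\<And>x. k * norm x \<le> norm (L x)"
    using linear_inj_bounded_below_pos[OF L] by (metis mult.commute)
  have bd: "bounded (L -` ?B)"
  proof (rule boundedI)
    fix x assume "x \<in> L -` ?B"
    then have "k * norm x \<le> 1" using k(2)[of x] by simp
    then show "norm x \<le> 1 / k" using k(1) by (simp add: field_simps)
  qed
  have ne: "L -` ?B \<noteq> {}" 
  proof -
    have "0 \<in> L -` ?B" using linear_0[OF L(1)] by simp
    then show ?thesis by blast
  qed
  have pos: "measure lborel U > 0" "emeasure lborel U = ennreal (measure lborel U)"
    if U: "open U" "bounded U" "U \<noteq> {}" for U :: "'a set"
  proof -
    have lm: "U \<in> lmeasurable" by (rule bounded_set_imp_lmeasurable) (use U in auto)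
    have "\<not> negligible U" using U open_not_negligible by blast
    then have "measure lebesgue U \<noteq> 0" using negligible_iff_measure0[OF lm] by simp
    then show "measure lborel U > 0" using U(1) by (simp add: measure_completion zero_less_measure_iff)
    have "emeasure lebesgue U = ennreal (measure lebesgue U)" by (rule emeasure_eq_measure2[OF lm])
    then show "emeasure lborel U = ennreal (measure lborel U)" using U(1) by (simp add: measure_completion)
  qed
  have b: "?b > 0" "emeasure lborel ?B = ennreal ?b" using pos[of ?B] by auto
  have l: "?l > 0" "emeasure lborel (L -` ?B) = ennreal ?l" using pos[OF op bd ne] by auto
  define c where "c = ?l / ?b"
  have c: "c > 0" using b l by (simp add: c_def)
  have Lm[measurable]: "L \<in> borel_measurable borel"
    using bl by (intro borel_measurable_continuous_onI linear_continuous_on)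
  have nn: "(\<integral>\<^sup>+x. F (L x + t) \<partial>lborel) = ennreal c * (\<integral>\<^sup>+x. F x \<partial>lborel)"
    if [measurable]: "F \<in> borel_measurable borel" for F
  proof -
    have "(\<integral>\<^sup>+x. F (L x + t) \<partial>lborel) * ennreal ?b = ennreal ?l * (\<integral>\<^sup>+x. F (x + t) \<partial>lborel)"
      using nn_integral_linear_aux[OF L, of "\<lambda>x. F (x + t)"] b l by simp
    also have "\<dots> = (ennreal c * (\<integral>\<^sup>+x. F x \<partial>lborel)) * ennreal ?b"
      using b l by (simp add: nn_integral_lborel_translation c_def mult_ac flip: ennreal_mult)
    finally have "ennreal ?b * (\<integral>\<^sup>+x. F (L x + t) \<partial>lborel) = ennreal ?b * (ennreal c * (\<integral>\<^sup>+x. F x \<partial>lborel))"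
      by (simp add: mult.commute)
    then show ?thesis using b(1)
      ennreal_mult_le_mult_iff[of "ennreal ?b"] by (intro antisym) (metis ennreal_eq_0_iff ennreal_neq_top not_le order_refl)+
  qed
  have eq: "distr lborel borel (\<lambda>x. L x + t) = density lborel (\<lambda>_. ennreal c)"
  proof (rule measure_eqI)
    fix S assume "S \<in> sets (distr lborel borel (\<lambda>x. L x + t))"
    then have [measurable]: "S \<in> sets borel" by simp
    have "emeasure (distr lborel borel (\<lambda>x. L x + t)) S = (\<integral>\<^sup>+x. indicator S x \<partial>distr lborel borel (\<lambda>x. L x + t))"
      by simp
    also have "\<dots> = (\<integral>\<^sup>+x. indicator S (L x + t) \<partial>lborel)" by (rule nn_integral_distr) measurable
    also have "\<dots> = ennreal c * emeasure lborel S" by (simp add: nn)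
    also have "\<dots> = emeasure (density lborel (\<lambda>_. ennreal c)) S"
      by (simp add: emeasure_density nn_integral_cmult)
    finally show "emeasure (distr lborel borel (\<lambda>x. L x + t)) S = emeasure (density lborel (\<lambda>_. ennreal c)) S" .
  qed simp
  show ?thesis
  proof (rule that[OF c])
    fix F :: "'a \<Rightarrow> real" assume [measurable]: "F \<in> borel_measurable borel"
    have "(\<integral>x. F (L x + t) \<partial>lborel) = (\<integral>x. F x \<partial>distr lborel borel (\<lambda>x. L x + t))"
      by (rule integral_distr[symmetric]) measurable
    also have "\<dots> = c * (\<integral>x. F x \<partial>lborel)"
      unfolding eq using c by (subst integral_density) auto
    finally show "(\<integral>x. F (L x + t) \<partial>lborel) = c * (\<integral>x. F x \<partial>lborel)" .
  qed
qed

section \<open>Facet means\<close>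

text \<open>By the divergence theorem for the field \<open>w(x) (x - P)\<close>, which is tangential on all facets of the
  simplex through \<open>P\<close>, this is the mean value of \<open>w\<close> over the facet opposite to \<open>P\<close>. Since it is
  a volume integral, it makes sense for \<open>w\<close> in \<open>H\<^sup>1\<close> and no surface integrals are needed.\<close>
definition facet_mean :: "'a::euclidean_space set \<Rightarrow> 'a \<Rightarrow> ('a \<Rightarrow> real) \<Rightarrow> ('a \<Rightarrow> 'a) \<Rightarrow> real" where
  "facet_mean T P w g = (LINT x|lborel. indicator T x * (real DIM('a) * w x + g x \<bullet> (x - P)))
     / (real DIM('a) * measure lborel T)"

lemma compact_indicator_integrable:
  fixes F :: "'a::euclidean_space \<Rightarrow> real"
  assumes "compact K" "continuous_on K F"
  shows "integrable lborel (\<lambda>x. indicator K x * F x)"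
  using borel_integrable_compact[OF assms] by simp

context simplex_facet
begin

lemma measure_T_pos: "measure lborel T > 0"
proof -
  have lm: "T \<in> lmeasurable" using compact_T by (simp add: lmeasurable_compact)
  have "\<not> negligible T"
    using interior_T(2) open_not_negligible[of "interior T"] negligible_subset[OF _ interior_subset] by auto
  then have "measure lebesgue T \<noteq> 0" using negligible_iff_measure0[OF lm] by simp
  then show ?thesis using compact_T by (simp add: zero_less_measure_iff compact_imp_closed)
qed

lemma T_borel [measurable]: "T \<in> sets borel"
  using compact_T by (simp add: compact_imp_closed)

lemma norm_bound_T:
  obtains h where "h > 0" "\<And>x y. x \<in> T \<Longrightarrow> y \<in> T \<Longrightarrow> norm (x - y) \<le> h"
proof -
  obtain b where "b > 0" "\<And>x. x \<in> T \<Longrightarrow> norm x \<le> b"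
    using compact_imp_bounded[OF compact_T] by (auto simp: bounded_pos)
  then show ?thesis using that[of "2 * b"] norm_triangle_ineq4
    by (smt (verit) zero_less_mult_iff)
qed

lemma shrunk_integral:
  fixes g :: "'a \<Rightarrow> real"
  assumes [measurable]: "g \<in> borel_measurable borel" and l: "0 < l" "l \<le> 1"
  defines "Tl \<equiv> (\<lambda>x. P + l *\<^sub>R (x - P)) ` T"
  shows "(LINT x|lborel. indicator Tl x * g x) = l ^ DIM('a) * (LINT x|lborel. indicator T x * g (P + l *\<^sub>R (x - P)))"
    and "Tl \<subseteq> T" and "Tl \<in> sets borel"
proof -
  have "compact Tl" unfolding Tl_def by (intro compact_continuous_image compact_T continuous_intros)
  then show [measurable]: "Tl \<in> sets borel" by (simp add: compact_imp_closed)
  have PT: "P \<in> T" using P by (simp add: hull_inc)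
  show "Tl \<subseteq> T"
  proof
    fix y assume "y \<in> Tl"
    then obtain x where x: "x \<in> T" "y = P + l *\<^sub>R (x - P)" by (auto simp: Tl_def)
    have "(1 - l) *\<^sub>R P + l *\<^sub>R x \<in> T" using x PT l by (intro convexD[OF convex_convex_hull]) auto
    then show "y \<in> T" by (simp add: x(2) algebra_simps)
  qed
  have ind: "indicator Tl ((1 - l) *\<^sub>R P + l *\<^sub>R x) = (indicator T x :: real)" for x
  proof -
    have e: "(1 - l) *\<^sub>R P + l *\<^sub>R x = P + l *\<^sub>R (x - P)" by (simp add: algebra_simps)
    have "P + l *\<^sub>R (x - P) \<in> Tl \<longleftrightarrow> x \<in> T"
      using l(1) by (auto simp: Tl_def)
    then show ?thesis unfolding e by (simp add: indicator_def)
  qed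
  have "(LINT x|lborel. indicator Tl x * g x)
      = \<bar>l\<bar> ^ DIM('a) *\<^sub>R (LINT x|lborel. indicator Tl ((1 - l) *\<^sub>R P + l *\<^sub>R x) * g ((1 - l) *\<^sub>R P + l *\<^sub>R x))"
    by (rule lborel_integral_affine) (use l in auto)
  also have "\<dots> = l ^ DIM('a) * (LINT x|lborel. indicator T x * g ((1 - l) *\<^sub>R P + l *\<^sub>R x))"
    using l by (simp add: ind)
  also have "(\<lambda>x. indicator T x * g ((1 - l) *\<^sub>R P + l *\<^sub>R x)) = (\<lambda>x. indicator T x * g (P + l *\<^sub>R (x - P)))"
    by (simp add: algebra_simps)
  finally show "(LINT x|lborel. indicator Tl x * g x) = l ^ DIM('a) * (LINT x|lborel. indicator T x * g (P + l *\<^sub>R (x - P)))" .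
qed

text \<open>The integral is the derivative at \<open>l = 1\<close> of the integral of \<open>w\<close> over the simplex shrunk towards
  \<open>P\<close> by the factor \<open>l\<close>; the difference quotients vanish in the limit because \<open>w\<close> is of order \<open>1 - l\<close>
  on the removed layer.\<close>
lemma facet_mean_zero:
  assumes w: "has_C1_grad w g" and w0: "\<And>x. x \<in> E \<Longrightarrow> w x = 0"
  shows "facet_mean T P w g = 0"
proof -
  let ?n = "DIM('a)"
  have [measurable]: "w \<in> borel_measurable borel" "g \<in> borel_measurable borel"
    using has_C1_grad_measurable[OF w] by auto
  obtain h where h: "h > 0" "\<And>x y. x \<in> T \<Longrightarrow> y \<in> T \<Longrightarrow> norm (x - y) \<le> h" using norm_bound_T by blast
  obtain M where M: "M > 0" "\<And>x. x \<in> T \<Longrightarrow> norm (g x) \<le> M"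
    using compact_imp_bounded[OF compact_continuous_image[OF has_C1_grad_continuous(2)[OF w] compact_T]]
    by (auto simp: bounded_pos)
  obtain W where W: "W > 0" "\<And>x. x \<in> T \<Longrightarrow> \<bar>w x\<bar> \<le> W"
    using compact_imp_bounded[OF compact_continuous_image[OF has_C1_grad_continuous(1)[OF w] compact_T]]
    by (auto simp: bounded_pos)
  have lip: "\<bar>w x - w y\<bar> \<le> M * norm (x - y)" if "x \<in> T" "y \<in> T" for x y
    by (rule has_C1_grad_lipschitz[OF w convex_convex_hull M(2) that])
  have PT: "P \<in> T" using P by (simp add: hull_inc)
  \<comment> \<open>The double successor keeps l k strictly between 0 and 1 also for k = 0.\<close>
  define l where "l k = 1 - inverse (real (Suc (Suc k)))" for k
  have l: "0 < l k" "l k < 1" "l k \<le> 1" for k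
    by (simp_all add: l_def inverse_eq_divide field_simps)
  have l1: "l \<longlonglongrightarrow> 1"
    using tendsto_diff[OF tendsto_const LIMSEQ_Suc[OF LIMSEQ_inverse_real_of_nat], of 1] by (simp add: l_def[abs_def])
  define Tl where "Tl k = (\<lambda>x. P + l k *\<^sub>R (x - P)) ` T" for k
  note Tl = shrunk_integral[OF _ l(1,3), folded Tl_def]
  have Tlm[measurable]: "Tl k \<in> sets borel" for k by (rule Tl(3)[of "\<lambda>_. 0"]) simp
  have Tls: "Tl k \<subseteq> T" for k by (rule Tl(2)[of "\<lambda>_. 0"]) simp
  \<comment> \<open>The difference quotient at s = 1 of s^n w(P + s (x - P)), where s^n is the
    Jacobian of the shrinking.\<close>
  define q where "q k x = (w x - l k ^ ?n * w (P + l k *\<^sub>R (x - P))) / (1 - l k)" for k x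
  have inT: "P + l k *\<^sub>R (x - P) \<in> T" if "x \<in> T" for x k using Tls that by (auto simp: Tl_def)
  have qb: "\<bar>q k x\<bar> \<le> real ?n * W + M * h" if x: "x \<in> T" for k x
  proof -
    let ?y = "P + l k *\<^sub>R (x - P)"
    have "w x - l k ^ ?n * w ?y = (1 - l k ^ ?n) * w x + l k ^ ?n * (w x - w ?y)"
      by (simp add: algebra_simps)
    then have "\<bar>w x - l k ^ ?n * w ?y\<bar> \<le> (1 - l k ^ ?n) * \<bar>w x\<bar> + l k ^ ?n * \<bar>w x - w ?y\<bar>"
      using l(1,2)[of k] abs_triangle_ineq[of "(1 - l k ^ ?n) * w x" "l k ^ ?n * (w x - w ?y)"]
      by (simp add: abs_mult power_le_one)
    also have "\<dots> \<le> (real ?n * (1 - l k)) * W + 1 * (M * (h * (1 - l k)))"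
    proof (intro add_mono mult_mono)
      show "1 - l k ^ ?n \<le> real ?n * (1 - l k)"
        using Bernoulli_inequality[of "l k - 1" ?n] l(1)[of k] by (simp add: algebra_simps)
      show "\<bar>w x\<bar> \<le> W" by (rule W(2)[OF x])
      show "l k ^ ?n \<le> 1" using l(1,2)[of k] by (simp add: power_le_one)
      have "x - ?y = (1 - l k) *\<^sub>R (x - P)" by (simp add: algebra_simps)
      then have "norm (x - ?y) = (1 - l k) * norm (x - P)" using l(2)[of k] by simp
      also have "\<dots> \<le> (1 - l k) * h" using l(2)[of k] h(2)[OF x PT] by (intro mult_left_mono) auto
      finally have "M * norm (x - ?y) \<le> M * (h * (1 - l k))" using M(1) by (simp add: mult.commute)
      then show "\<bar>w x - w ?y\<bar> \<le> M * (h * (1 - l k))" using lip[OF x inT[OF x], of k] by linarith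
    qed (use l(1,2)[of k] W M h in \<open>auto simp: power_le_one\<close>)
    also have "\<dots> = (real ?n * W + M * h) * (1 - l k)" by (simp add: algebra_simps)
    finally show ?thesis using l(2)[of k] by (simp add: q_def pos_divide_le_eq)
  qed
  have lim: "(\<lambda>k. LINT x|lborel. indicator T x * q k x)
      \<longlonglongrightarrow> (LINT x|lborel. indicator T x * (real ?n * w x + g x \<bullet> (x - P)))"
  proof (rule integral_dominated_convergence[where w = "\<lambda>x. indicator T x * (real ?n * W + M * h)"])
    show "integrable lborel (\<lambda>x. indicator T x * (real ?n * W + M * h))"
      by (rule compact_indicator_integrable[OF compact_T]) (rule continuous_on_const)
    show "AE x in lborel. norm (indicator T x * q k x) \<le> indicator T x * (real ?n * W + M * h)" for k
      using qb by (intro AE_I2) (auto split: split_indicator)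
    show "AE x in lborel. (\<lambda>k. indicator T x * q k x) \<longlonglongrightarrow> indicator T x * (real ?n * w x + g x \<bullet> (x - P))"
    proof (intro AE_I2 tendsto_mult tendsto_const)
      fix x
      have "((\<lambda>s. s ^ ?n * w (P + s *\<^sub>R (x - P))) has_real_derivative
          (real ?n * 1 ^ (?n - 1) * w (P + 1 *\<^sub>R (x - P)) + (g (P + 1 *\<^sub>R (x - P)) \<bullet> (x - P)) * 1 ^ ?n)) (at 1)"
        by (rule DERIV_mult[OF _ has_C1_grad_line[OF w]]) (auto intro!: derivative_eq_intros)
      then have "((\<lambda>s. (s ^ ?n * w (P + s *\<^sub>R (x - P)) - w x) / (s - 1)) \<longlongrightarrow> real ?n * w x + g x \<bullet> (x - P)) (at 1)"
        by (simp add: has_field_derivative_iff)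
      moreover have "filterlim l (at 1) sequentially"
        unfolding filterlim_at using l1 l(2) by (auto intro!: always_eventually simp: less_imp_neq)
      ultimately have "(\<lambda>k. (l k ^ ?n * w (P + l k *\<^sub>R (x - P)) - w x) / (l k - 1)) \<longlonglongrightarrow> real ?n * w x + g x \<bullet> (x - P)"
        by (rule filterlim_compose)
      moreover have "(l k ^ ?n * w (P + l k *\<^sub>R (x - P)) - w x) / (l k - 1) = q k x" for k
        unfolding q_def by (metis minus_diff_eq minus_divide_divide)
      ultimately show "(\<lambda>k. q k x) \<longlonglongrightarrow> real ?n * w x + g x \<bullet> (x - P)" by simp
    qed
  qed (auto simp: q_def)
  \<comment> \<open>On its segment from P to a point y of E, such a point lies beyond the fraction l
    k. It is thus within (1 - l k) h of y, where w vanishes.\<close>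
  have small: "\<bar>w x\<bar> \<le> M * h * (1 - l k)" if x: "x \<in> T - Tl k" for x k
  proof -
    obtain r y where ry: "r \<in> {0..1}" "y \<in> E" "x = P + r *\<^sub>R (y - P)" using x cone by blast
    have yT: "y \<in> T" using ry E_subset_T by blast
    have "r > l k"
    proof (rule ccontr)
      assume "\<not> l k < r"
      define z where "z = P + (r / l k) *\<^sub>R (y - P)"
      have "z \<in> T" unfolding z_def cone
        using ry(1,2) l(1)[of k] \<open>\<not> l k < r\<close> by (intro bexI[of _ "r / l k"] bexI[of _ y]) auto
      moreover have "x = P + l k *\<^sub>R (z - P)" using l(1)[of k] by (simp add: z_def ry(3))
      ultimately show False using x by (auto simp: Tl_def)
    qed
    have "x - y = (r - 1) *\<^sub>R (y - P)" by (simp add: ry(3) algebra_simps)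
    then have "norm (x - y) = (1 - r) * norm (y - P)" using ry(1) by simp
    also have "\<dots> \<le> (1 - l k) * h"
      using \<open>r > l k\<close> ry(1) h(1) h(2)[OF yT PT] by (intro mult_mono) auto
    finally have "M * norm (x - y) \<le> M * h * (1 - l k)" using M(1) by (simp add: mult_ac)
    moreover have "\<bar>w x - w y\<bar> \<le> M * norm (x - y)" using lip x yT by blast
    ultimately show ?thesis using w0[OF ry(2)] by simp
  qed
  \<comment> \<open>The integral of q is that of w over the removed layer, divided by 1 - l. There w
    is of order 1 - l, which cancels the denominator, and the measure of the layer is left over as a
    factor that tends to 0.\<close>
  have qi: "\<bar>LINT x|lborel. indicator T x * q k x\<bar> \<le> M * h * ((1 - l k ^ ?n) * measure lborel T)" for k
  proof -
    have i1: "integrable lborel (\<lambda>x. indicator T x * w x)"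
      by (rule compact_indicator_integrable[OF compact_T has_C1_grad_continuous(1)[OF w]])
    have i2: "integrable lborel (\<lambda>x. indicator T x * w (P + l k *\<^sub>R (x - P)))"
      by (rule compact_indicator_integrable[OF compact_T])
         (intro continuous_on_compose2[OF has_C1_grad_continuous(1)[OF w, of UNIV]] continuous_intros, auto)
    have cTl: "compact (Tl k)" unfolding Tl_def by (intro compact_continuous_image compact_T continuous_intros)
    have i3: "integrable lborel (\<lambda>x. indicator (Tl k) x * w x)"
      by (rule compact_indicator_integrable[OF cTl has_C1_grad_continuous(1)[OF w]])
    have j1: "integrable lborel (\<lambda>x. indicator T x * (1::real))" "integrable lborel (\<lambda>x. indicator (Tl k) x * (1::real))"
      by (rule compact_indicator_integrable[OF compact_T] compact_indicator_integrable[OF cTl], rule continuous_on_const)+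
    have "(LINT x|lborel. indicator T x * q k x)
       = (LINT x|lborel. (indicator T x * w x - l k ^ ?n * (indicator T x * w (P + l k *\<^sub>R (x - P)))) / (1 - l k))"
      by (rule Bochner_Integration.integral_cong) (auto simp: q_def algebra_simps)
    also have "\<dots> = ((LINT x|lborel. indicator T x * w x) - (LINT x|lborel. indicator (Tl k) x * w x)) / (1 - l k)"
      using i1 i2 Tl(1)[of w k] by simp
    also have "\<dots> = (LINT x|lborel. (indicator T x * w x - indicator (Tl k) x * w x)) / (1 - l k)"
      using i1 i3 by simp
    finally have e: "\<bar>LINT x|lborel. indicator T x * q k x\<bar>
       = \<bar>LINT x|lborel. (indicator T x * w x - indicator (Tl k) x * w x)\<bar> / (1 - l k)"
      using l(2)[of k] by simp
    have "\<bar>LINT x|lborel. (indicator T x * w x - indicator (Tl k) x * w x)\<bar>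
        \<le> (LINT x|lborel. \<bar>indicator T x * w x - indicator (Tl k) x * w x\<bar>)"
      using integral_norm_bound[of lborel "\<lambda>x. indicator T x * w x - indicator (Tl k) x * w x"] by simp
    also have "\<dots> \<le> (LINT x|lborel. (M * h * (1 - l k)) * (indicator T x * 1 - indicator (Tl k) x * 1))"
    proof (rule integral_mono)
      show "integrable lborel (\<lambda>x. \<bar>indicator T x * w x - indicator (Tl k) x * w x\<bar>)"
        using i1 i3 by simp
      show "integrable lborel (\<lambda>x. (M * h * (1 - l k)) * (indicator T x * 1 - indicator (Tl k) x * 1))"
        by (rule integrable_mult_right) (use j1 in \<open>rule Bochner_Integration.integrable_diff\<close>)
      show "\<bar>indicator T x * w x - indicator (Tl k) x * w x\<bar> \<le> (M * h * (1 - l k)) * (indicator T x * 1 - indicator (Tl k) x * 1)" for x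
        using small[of x k] Tls[of k] by (auto split: split_indicator)
    qed
    also have "\<dots> = (M * h * (1 - l k)) * ((1 - l k ^ ?n) * measure lborel T)"
    proof -
      have "(LINT x|lborel. indicator T x * 1) = measure lborel T" by simp
      moreover have "(LINT x|lborel. indicator (Tl k) x * 1) = l k ^ ?n * measure lborel T"
        using Tl(1)[of "\<lambda>_. 1" k] by simp
      ultimately have "(LINT x|lborel. indicator T x * 1 - indicator (Tl k) x * (1::real)) = (1 - l k ^ ?n) * measure lborel T"
        unfolding Bochner_Integration.integral_diff[OF j1] by (simp add: left_diff_distrib)
      then show ?thesis unfolding integral_mult_right_zero by simp
    qed
    finally show ?thesis unfolding e using l(2)[of k] by (simp add: pos_divide_le_eq mult_ac)
  qed
  have "(\<lambda>k. M * h * ((1 - l k ^ ?n) * measure lborel T)) \<longlonglongrightarrow> M * h * ((1 - 1 ^ ?n) * measure lborel T)"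
    by (intro tendsto_intros l1)
  then have "(\<lambda>k. M * h * ((1 - l k ^ ?n) * measure lborel T)) \<longlonglongrightarrow> 0" by simp
  then have "(\<lambda>k. LINT x|lborel. indicator T x * q k x) \<longlonglongrightarrow> 0"
    by (rule Lim_null_comparison[rotated]) (use qi in auto)
  then have "(LINT x|lborel. indicator T x * (real ?n * w x + g x \<bullet> (x - P))) = 0"
    using lim LIMSEQ_unique by blast
  then show ?thesis by (simp add: facet_mean_def)
qed

lemma facet_mean_integrable:
  assumes w: "has_C1_grad w g"
  shows "integrable lborel (\<lambda>x. indicator T x * w x)"
    "integrable lborel (\<lambda>x. indicator T x * (g x \<bullet> (x - a)))"
    "integrable lborel (\<lambda>x. indicator T x * (real DIM('a) * w x + g x \<bullet> (x - a)))"
  by (intro compact_indicator_integrable[OF compact_T] continuous_intros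
      has_C1_grad_continuous[OF w])+

lemma facet_mean_diff:
  assumes w: "has_C1_grad w g" and v: "has_C1_grad v g'"
  shows "facet_mean T P (\<lambda>x. w x - v x) (\<lambda>x. g x - g' x) = facet_mean T P w g - facet_mean T P v g'"
proof -
  let ?n = "real DIM('a)"
  have "(LINT x|lborel. indicator T x * (?n * (w x - v x) + (g x - g' x) \<bullet> (x - P)))
    = (LINT x|lborel. indicator T x * (?n * w x + g x \<bullet> (x - P)) - indicator T x * (?n * v x + g' x \<bullet> (x - P)))"
    by (rule Bochner_Integration.integral_cong) (auto simp: algebra_simps inner_diff_left)
  also have "\<dots> = (LINT x|lborel. indicator T x * (?n * w x + g x \<bullet> (x - P)))
      - (LINT x|lborel. indicator T x * (?n * v x + g' x \<bullet> (x - P)))"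
    by (rule Bochner_Integration.integral_diff) (rule facet_mean_integrable[OF w] facet_mean_integrable[OF v])+
  finally show ?thesis by (simp add: facet_mean_def diff_divide_distrib)
qed

text \<open>By linearity, the vanishing for zero facet values shows that only the values on E count,
  although the formula integrates over T.\<close>

lemma facet_mean_cong_on_E:
  assumes w: "has_C1_grad w g" and v: "has_C1_grad v g'" and eq: "\<And>x. x \<in> E \<Longrightarrow> w x = v x"
  shows "facet_mean T P w g = facet_mean T P v g'"
  using facet_mean_zero[OF has_C1_grad_diff[OF w v]] facet_mean_diff[OF w v] eq by simp

text \<open>The right-hand side is the value at the barycentre of \<open>E\<close> of an affine function that does not depend
  on the facet.\<close>
lemma facet_mean_eq_affine:
  assumes w: "has_C1_grad w g"
  defines "c \<equiv> (\<Sum>z\<in>C. z) /\<^sub>R real (Suc DIM('a))"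
  defines "A \<equiv> measure lborel T"
  shows "facet_mean T P w g = ((LINT x|lborel. indicator T x *\<^sub>R g x) /\<^sub>R A) \<bullet> (barycenter E - c)
    + (LINT x|lborel. indicator T x * w x) / A
    + (LINT x|lborel. indicator T x * (g x \<bullet> (x - c))) / (real DIM('a) * A)"
proof -
  let ?n = "real DIM('a)"
  have n: "?n > 0" by simp
  have A: "A > 0" unfolding A_def by (rule measure_T_pos)
  have gi: "integrable lborel (\<lambda>x. indicator T x *\<^sub>R g x)"
    by (rule borel_integrable_compact[OF compact_T has_C1_grad_continuous(2)[OF w]])
  let ?W = "LINT x|lborel. indicator T x * w x"
  let ?K = "LINT x|lborel. indicator T x * (g x \<bullet> (x - c))"
  let ?G = "LINT x|lborel. indicator T x *\<^sub>R g x"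
  have "(LINT x|lborel. indicator T x * (?n * w x + g x \<bullet> (x - P)))
     = (LINT x|lborel. ?n * (indicator T x * w x) + (indicator T x * (g x \<bullet> (x - c)) + (indicator T x *\<^sub>R g x) \<bullet> (c - P)))"
    by (rule Bochner_Integration.integral_cong) (auto simp: algebra_simps inner_diff_right)
  also have "\<dots> = ?n * ?W + (?K + ?G \<bullet> (c - P))"
    using facet_mean_integrable[OF w] gi by (simp del: inner_scaleR_left)
  finally have fm: "facet_mean T P w g = (?n * ?W + (?K + ?G \<bullet> (c - P))) / (?n * A)"
    by (simp add: facet_mean_def A_def)
  have sum: "(\<Sum>z\<in>C. z) = P + (\<Sum>z\<in>C - {P}. z)" by (rule sum.remove[OF finite_C P])
  have c1: "real (Suc DIM('a)) *\<^sub>R c = (\<Sum>z\<in>C. z)" by (simp add: c_def)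
  have b1: "?n *\<^sub>R barycenter E = (\<Sum>z\<in>C - {P}. z)" by (simp add: barycenter_E)
  \<comment> \<open>The centroid c divides the segment from P to the barycentre of E in the ratio n
    : 1.\<close>
  have "?n *\<^sub>R (barycenter E - c) = c - P"
    using c1 b1 sum by (simp add: scaleR_diff_right algebra_simps)
  then have "?n * (?G \<bullet> (barycenter E - c)) = ?G \<bullet> (c - P)" by (metis inner_scaleR_right)
  then show ?thesis unfolding fm using n A by (simp add: field_simps)
qed

end

text \<open>The affine map A that fixes the common hyperplane pointwise and sends Q1 to Q2 maps the
  first simplex onto the second. The formula for \<open>facet_mean\<close> is invariant under it,
  and w composed with A has the same values as w on the common facet, which alone determine the
  facet mean.\<close>

lemma facet_mean_neighbours:
  fixes C1 C2 :: "'a::euclidean_space set"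
  assumes f1: "simplex_facet C1 Q1 \<nu>1 \<beta>1" and f2: "simplex_facet C2 Q2 \<nu>2 \<beta>2"
    and E: "convex hull (C1 - {Q1}) = convex hull (C2 - {Q2})" and w: "has_C1_grad w g"
  shows "facet_mean (convex hull C1) Q1 w g = facet_mean (convex hull C2) Q2 w g"
proof -
  interpret f1: simplex_facet C1 Q1 \<nu>1 \<beta>1 by (rule f1)
  interpret f2: simplex_facet C2 Q2 \<nu>2 \<beta>2 by (rule f2)
  let ?T1 = "convex hull C1" and ?T2 = "convex hull C2"
  let ?n = "real DIM('a)"
  have base: "C1 - {Q1} = C2 - {Q2}"
  proof -
    have ext: "{x. x extreme_point_of (convex hull (C - {Q}))} = C - {Q}"
      if "\<not> affine_dependent C" for C :: "'a set" and Q
    proof (rule set_eqI)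
      fix x
      show "x \<in> {x. x extreme_point_of (convex hull (C - {Q}))} \<longleftrightarrow> x \<in> C - {Q}"
        using extreme_point_of_convex_hull_affine_independent[OF affine_independent_Diff[OF that], of x "{Q}"]
        by (simp only: mem_Collect_eq)
    qed
    have "C1 - {Q1} = {x. x extreme_point_of (convex hull (C1 - {Q1}))}"
      by (rule ext[OF f1.indep, symmetric])
    also have "\<dots> = {x. x extreme_point_of (convex hull (C2 - {Q2}))}"
      unfolding E ..
    also have "\<dots> = C2 - {Q2}" by (rule ext[OF f2.indep])
    finally show ?thesis .
  qed
  have "{x. \<nu>1 \<bullet> x = \<beta>1} = {x. \<nu>2 \<bullet> x = \<beta>2}"
    using f1.affine_hull_E f2.affine_hull_E E by metis
  moreover have "\<nu>2 \<bullet> Q2 \<noteq> \<beta>2" using f2.apex by simp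
  ultimately have Q2: "\<nu>1 \<bullet> Q2 \<noteq> \<beta>1" by blast
  \<comment> \<open>d is the height of the simplex over the facet; dividing by it makes A move Q1 by
    exactly Q2 - Q1.\<close>
  define d where "d = \<beta>1 - \<nu>1 \<bullet> Q1"
  have d: "d > 0" using f1.apex by (simp add: d_def)
  define \<tau> where "\<tau> = (Q2 - Q1) /\<^sub>R d"
  define A where "A x = x + (\<beta>1 - \<nu>1 \<bullet> x) *\<^sub>R \<tau>" for x
  define L where "L h = h - (\<nu>1 \<bullet> h) *\<^sub>R \<tau>" for h
  have AL: "A x = L x + \<beta>1 *\<^sub>R \<tau>" for x by (simp add: A_def L_def algebra_simps)
  have linL: "linear L" unfolding L_def by (intro linearI) (auto simp: algebra_simps inner_add_right)
  \<comment> \<open>Otherwise A would map the whole space into the hyperplane, but its value Q2 is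
    not there.\<close>
  have \<nu>\<tau>: "\<nu>1 \<bullet> \<tau> \<noteq> 1"
  proof
    assume "\<nu>1 \<bullet> \<tau> = 1"
    moreover have "d * (\<nu>1 \<bullet> \<tau>) = \<nu>1 \<bullet> Q2 - \<nu>1 \<bullet> Q1"
      using d by (simp add: \<tau>_def inner_diff_right)
    ultimately show False using Q2 by (simp add: d_def)
  qed
  have injL: "inj L"
  proof (rule linear_injective_0[OF linL, THEN iffD2], intro allI impI)
    fix h assume "L h = 0"
    then have h: "h = (\<nu>1 \<bullet> h) *\<^sub>R \<tau>" by (simp add: L_def)
    then have "\<nu>1 \<bullet> h = (\<nu>1 \<bullet> h) * (\<nu>1 \<bullet> \<tau>)" by (metis inner_scaleR_right)
    then have "\<nu>1 \<bullet> h = 0" using \<nu>\<tau> by simp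
    then show "h = 0" using h by simp
  qed
  have AQ: "A Q1 = Q2" using d by (simp add: A_def \<tau>_def flip: d_def)
  have Ahyp: "A x = x" if "\<nu>1 \<bullet> x = \<beta>1" for x using that by (simp add: A_def)
  have "A ` C1 = insert (A Q1) (A ` (C1 - {Q1}))" using f1.P by blast
  also have "A ` (C1 - {Q1}) = C1 - {Q1}" using Ahyp f1.on_hyperplane by force
  also have "insert (A Q1) (C1 - {Q1}) = C2" using base f2.P AQ by auto
  finally have AC: "A ` C1 = C2" .
  have AT: "A ` ?T1 = ?T2"
  proof -
    have "A ` ?T1 = (\<lambda>x. x + \<beta>1 *\<^sub>R \<tau>) ` (L ` ?T1)" by (simp add: image_image AL)
    also have "\<dots> = convex hull ((\<lambda>x. x + \<beta>1 *\<^sub>R \<tau>) ` (L ` C1))"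
      using convex_hull_linear_image[OF linL, of C1] convex_hull_translation[of "\<beta>1 *\<^sub>R \<tau>" "L ` C1"]
      by (simp add: add.commute)
    also have "\<dots> = ?T2" by (simp add: image_image flip: AL AC)
    finally show ?thesis .
  qed
  have injA: "inj A" using injL by (auto simp: inj_def AL)
  have ind: "indicator ?T2 (A x) = (indicator ?T1 x :: real)" for x
    using AT injA by (auto simp: indicator_def inj_def)
  obtain k where k: "k > 0" "\<And>F :: 'a \<Rightarrow> real. F \<in> borel_measurable borel \<Longrightarrow>
      (\<integral>x. F (L x + \<beta>1 *\<^sub>R \<tau>) \<partial>lborel) = k * (\<integral>x. F x \<partial>lborel)"
    using lborel_affine_pushforward[OF linL injL, of "\<beta>1 *\<^sub>R \<tau>"] by metis
  have cov: "(LINT x|lborel. indicator ?T1 x * F (A x)) = k * (LINT x|lborel. indicator ?T2 x * F x)"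
    if [measurable]: "F \<in> borel_measurable borel" for F :: "'a \<Rightarrow> real"
  proof -
    have "(LINT x|lborel. indicator ?T2 (A x) * F (A x)) = k * (LINT x|lborel. indicator ?T2 x * F x)"
      unfolding AL by (rule k(2)[of "\<lambda>x. indicator ?T2 x * F x"]) measurable
    then show ?thesis by (simp add: ind)
  qed
  have meas: "measure lborel ?T1 = k * measure lborel ?T2"
    using cov[of "\<lambda>_. 1"] by simp
  have [measurable]: "w \<in> borel_measurable borel" "g \<in> borel_measurable borel"
    using has_C1_grad_measurable[OF w] by auto
  define g' where "g' x = g (A x) - (g (A x) \<bullet> \<tau>) *\<^sub>R \<nu>1" for x
  have wA: "has_C1_grad (\<lambda>x. w (A x)) g'"
    using has_C1_grad_shear[OF w, of \<beta>1 \<nu>1 \<tau>] by (simp add: A_def g'_def[abs_def])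
  have "facet_mean ?T1 Q1 (\<lambda>x. w (A x)) g'
      = (LINT x|lborel. indicator ?T1 x * (?n * w (A x) + g (A x) \<bullet> (A x - Q2))) / (?n * measure lborel ?T1)"
  proof -
    \<comment> \<open>The adjoint in g' moves to the other side of the inner product, and L (x - Q1)
      is A x - A Q1.\<close>
    have "g' x \<bullet> (x - Q1) = g (A x) \<bullet> (A x - Q2)" for x
    proof -
      have "A x - Q2 = L x - L Q1" by (simp add: AL flip: AQ)
      also have "\<dots> = L (x - Q1)" by (simp add: linear_diff[OF linL])
      finally have AL': "A x - Q2 = L (x - Q1)" .
      have "g' x \<bullet> (x - Q1) = g (A x) \<bullet> L (x - Q1)"
        by (simp add: g'_def L_def inner_diff_left inner_diff_right algebra_simps)
      then show ?thesis by (simp only: AL')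
    qed
    then show ?thesis by (simp add: facet_mean_def)
  qed
  also have "\<dots> = k * (LINT x|lborel. indicator ?T2 x * (?n * w x + g x \<bullet> (x - Q2))) / (?n * (k * measure lborel ?T2))"
    using cov[of "\<lambda>x. ?n * w x + g x \<bullet> (x - Q2)"] meas by simp
  also have "\<dots> = facet_mean ?T2 Q2 w g"
    using k(1) by (simp add: facet_mean_def)
  finally have "facet_mean ?T1 Q1 (\<lambda>x. w (A x)) g' = facet_mean ?T2 Q2 w g" .
  moreover have "facet_mean ?T1 Q1 w g = facet_mean ?T1 Q1 (\<lambda>x. w (A x)) g'"
    by (rule f1.facet_mean_cong_on_E[OF w wA]) (simp add: Ahyp f1.on_E)
  ultimately show ?thesis by simp
qed

section \<open>Side measures\<close>

text \<open>The barycentric coordinate of a: the equation of the hyperplane through the other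
  vertices, scaled to the value 1 at a.\<close>

lemma vertex_functional:
  fixes C :: "'a::euclidean_space set"
  assumes C: "\<not> affine_dependent C" "card C = Suc DIM('a)" and a: "a \<in> C"
  obtains d e where "d \<bullet> a + e = 1" "\<And>c. c \<in> C \<Longrightarrow> c \<noteq> a \<Longrightarrow> d \<bullet> c + e = 0"
proof -
  have fin: "finite C" using C(1) by (rule aff_independent_finite)
  have "int (card (C - {a})) = aff_dim (C - {a}) + 1"
    using aff_dim_affine_independent[OF affine_independent_Diff[OF C(1)], of "{a}"] by simp
  then have "aff_dim (C - {a}) = DIM('a) - 1" using C fin a by simp
  then obtain q b where q: "q \<noteq> 0" "affine hull (C - {a}) = {x. q \<bullet> x = b}"
    using aff_dim_eq_hyperplane[of "C - {a}"] by auto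
  have "a \<notin> affine hull (C - {a})" using C(1) a by (auto simp: affine_dependent_def)
  then have "q \<bullet> a - b \<noteq> 0" using q by auto
  moreover have 0: "q \<bullet> c - b = 0" if "c \<in> C" "c \<noteq> a" for c
    using that hull_inc[of c "C - {a}" affine] q by auto
  moreover have "(q /\<^sub>R (q \<bullet> a - b)) \<bullet> x + - b / (q \<bullet> a - b) = (q \<bullet> x - b) / (q \<bullet> a - b)" for x
    by (simp add: divide_inverse left_diff_distrib mult.commute)
  ultimately show ?thesis
    by (intro that[of "q /\<^sub>R (q \<bullet> a - b)" "- b / (q \<bullet> a - b)"]) (simp_all add: divide_inverse mult.commute flip: left_diff_distrib)
qed

context simplex_facet
begin

definition proj :: "'a \<Rightarrow> 'a" where "proj x = x + (\<beta> - \<nu> \<bullet> x) *\<^sub>R \<nu>"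

lemma proj_on: "\<nu> \<bullet> proj x = \<beta>"
  by (simp add: proj_def inner_add_right normal_normal)

lemma proj_shift: "proj (x + s *\<^sub>R \<nu>) = proj x"
  by (simp add: proj_def inner_add_right normal_normal algebra_simps)

lemma proj_continuous: "continuous_on S proj"
  unfolding proj_def by (intro continuous_intros)

lemma proj_measurable [measurable]: "proj \<in> borel_measurable borel"
  by (intro borel_measurable_continuous_onI proj_continuous)

lemma closest_point_proj: "closest_point (affine hull E) x = proj x"
proof -
  have "proj x = closest_point {y. \<nu> \<bullet> y = \<beta>} x"
  proof (rule closest_point_unique)
    show "convex {y. \<nu> \<bullet> y = \<beta>}" by (rule convex_hyperplane)
    show "closed {y. \<nu> \<bullet> y = \<beta>}" by (rule closed_hyperplane)
    show "proj x \<in> {y. \<nu> \<bullet> y = \<beta>}" by (simp add: proj_on)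
    show "\<forall>z\<in>{y. \<nu> \<bullet> y = \<beta>}. dist x (proj x) \<le> dist x z"
    proof
      fix z assume z: "z \<in> {y. \<nu> \<bullet> y = \<beta>}"
      have "dist x (proj x) = \<bar>\<nu> \<bullet> (x - z)\<bar>"
        using z by (simp add: dist_norm proj_def norm_normal inner_diff_right abs_minus_commute)
      also have "\<dots> \<le> dist x z"
        using Cauchy_Schwarz_ineq2[of \<nu> "x - z"] by (simp add: norm_normal dist_norm)
      finally show "dist x (proj x) \<le> dist x z" .
    qed
  qed
  then show ?thesis by (simp only: affine_hull_E)
qed

lemma slab_eq: "slab E = {y. proj y \<in> E \<and> \<bar>\<nu> \<bullet> y - \<beta>\<bar> \<le> 1/2}"
  unfolding slab_def closest_point_proj
  by (simp add: dist_norm proj_def norm_normal abs_minus_commute)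

text \<open>Convexity makes the frontier of the slab a null set, on which
  \<open>slab_exhaustion\<close> relies.\<close>

lemma slab_convex: "convex (slab E)"
proof -
  have "proj (u *\<^sub>R x + v *\<^sub>R y) = u *\<^sub>R proj x + v *\<^sub>R proj y" if "u + v = 1" for u v x y
  proof -
    have "\<beta> = u * \<beta> + v * \<beta>" using that by (metis distrib_right mult_1)
    then have "\<beta> - \<nu> \<bullet> (u *\<^sub>R x + v *\<^sub>R y) = u * (\<beta> - \<nu> \<bullet> x) + v * (\<beta> - \<nu> \<bullet> y)"
      by (simp add: inner_add_right algebra_simps)
    then show ?thesis
      by (simp only: proj_def scaleR_add_left scaleR_add_right scaleR_scaleR add_ac)
  qed
  then have "convex {y. proj y \<in> E}"
    by (intro convexI) (simp add: convexD[OF convex_convex_hull[of "C - {P}"]])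
  moreover have "convex ({y. \<nu> \<bullet> y \<le> \<beta> + 1/2} \<inter> {y. \<nu> \<bullet> y \<ge> \<beta> - 1/2})"
    by (intro convex_Int convex_halfspace_le convex_halfspace_ge)
  moreover have "slab E = {y. proj y \<in> E} \<inter> ({y. \<nu> \<bullet> y \<le> \<beta> + 1/2} \<inter> {y. \<nu> \<bullet> y \<ge> \<beta> - 1/2})"
  proof -
    have "\<bar>\<nu> \<bullet> y - \<beta>\<bar> \<le> 1/2 \<longleftrightarrow> \<nu> \<bullet> y \<le> \<beta> + 1/2 \<and> \<nu> \<bullet> y \<ge> \<beta> - 1/2" for y by linarith
    then show ?thesis unfolding slab_eq by blast
  qed
  ultimately show ?thesis by (simp add: convex_Int)
qed

lemma slab_compact: "compact (slab E)"
proof -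
  have "closed (proj -` E \<inter> {y. \<bar>\<nu> \<bullet> y - \<beta>\<bar> \<le> 1/2})"
    using compact_E proj_continuous
    by (intro closed_Int closed_vimage closed_Collect_le continuous_intros) (auto simp: compact_imp_closed)
  moreover have "slab E = proj -` E \<inter> {y. \<bar>\<nu> \<bullet> y - \<beta>\<bar> \<le> 1/2}" by (auto simp: slab_eq)
  ultimately have "closed (slab E)" by simp
  moreover have "bounded (slab E)"
  proof -
    obtain b where b: "\<And>x. x \<in> E \<Longrightarrow> norm x \<le> b"
      using compact_imp_bounded[OF compact_E] by (auto simp: bounded_iff)
    have "norm x \<le> b + 1/2" if "x \<in> slab E" for x
    proof -
      have "x = proj x - (\<beta> - \<nu> \<bullet> x) *\<^sub>R \<nu>" by (simp add: proj_def)
      then have "norm x \<le> norm (proj x) + norm ((\<beta> - \<nu> \<bullet> x) *\<^sub>R \<nu>)" using norm_triangle_ineq4 by metis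
      then show ?thesis using that b[of "proj x"] by (simp add: slab_eq norm_normal abs_minus_commute)
    qed
    then show ?thesis by (auto simp: bounded_iff)
  qed
  ultimately show ?thesis by (simp add: compact_eq_bounded_closed)
qed

lemma slab_borel [measurable]: "slab E \<in> sets borel"
  using slab_compact by (simp add: compact_imp_closed)

definition side_area :: real where "side_area = measure lborel (slab E)"

lemma side_measure_eq: "side_measure E = distr (lebesgue_on (slab E)) borel proj"
  unfolding side_measure_def closest_point_proj[abs_def] ..

lemma proj_measurable_slab: "proj \<in> lebesgue_on (slab E) \<rightarrow>\<^sub>M borel"
  by (intro measurable_restrict_space1 measurable_completion) simp

lemma finite_side_measure: "finite_measure (side_measure E)"
  unfolding side_measure_eq
  by (intro finite_measure.finite_measure_distr proj_measurable_slab finite_measure_lebesgue_on_bounded)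
     (auto intro: compact_imp_bounded slab_compact)

text \<open>Surface integrals become volume integrals over the slab of functions that are constant
  along \<nu>, so that from here on only Lebesgue measure has to be handled.\<close>

lemma integral_side_measure:
  fixes f :: "'a \<Rightarrow> real"
  assumes "f \<in> borel_measurable borel"
  shows "(LINT x|side_measure E. f x) = (LINT x|lborel. indicator (slab E) x * f (proj x))"
proof -
  have "(LINT x|side_measure E. f x) = (LINT x|lebesgue_on (slab E). f (proj x))"
    unfolding side_measure_eq by (rule integral_distr[OF proj_measurable_slab assms])
  also have "\<dots> = (LINT x|lborel. indicator (slab E) x *\<^sub>R f (proj x))"
    by (rule integral_lebesgue_on_borel) (use assms in measurable)
  finally show ?thesis by simp
qed

lemma slab_integrable:
  fixes f :: "'a \<Rightarrow> real"
  assumes "continuous_on UNIV f"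
  shows "integrable lborel (\<lambda>x. indicator (slab E) x * f (proj x))"
  by (rule compact_indicator_integrable[OF slab_compact])
     (rule continuous_on_compose2[OF assms proj_continuous], simp)

text \<open>The barycentric coordinates of the vertices of \<open>E\<close> have equal integrals, because the affine map
  that swaps two vertices of \<open>E\<close> and fixes the others and \<open>\<nu>\<close> maps the slab onto itself.\<close>
lemma integral_affine_side:
  "(LINT x|lborel. indicator (slab E) x * (q \<bullet> proj x + r)) = side_area * (q \<bullet> barycenter E + r)"
proof -
  have "\<forall>a\<in>C. \<exists>d e. d \<bullet> a + e = 1 \<and> (\<forall>c\<in>C. c \<noteq> a \<longrightarrow> d \<bullet> c + e = 0)"
  proof
    fix a assume a: "a \<in> C"
    obtain d e where "d \<bullet> a + e = 1" "\<And>c. c \<in> C \<Longrightarrow> c \<noteq> a \<Longrightarrow> d \<bullet> c + e = 0"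
      using vertex_functional[OF indep card_C a] by blast
    then show "\<exists>d e. d \<bullet> a + e = 1 \<and> (\<forall>c\<in>C. c \<noteq> a \<longrightarrow> d \<bullet> c + e = 0)" by blast
  qed
  then obtain d e where de: "\<And>a. a \<in> C \<Longrightarrow> d a \<bullet> a + e a = 1"
    "\<And>a c. a \<in> C \<Longrightarrow> c \<in> C \<Longrightarrow> c \<noteq> a \<Longrightarrow> d a \<bullet> c + e a = 0" by metis
  define l where "l a x = d a \<bullet> x + e a" for a x
  define V where "V = C - {P}"
  have finV: "finite V" using finite_C by (simp add: V_def)
  have l1: "l a a = 1" if "a \<in> V" for a using that de by (simp add: l_def V_def)
  have l0: "l a c = 0" if "a \<in> V" "c \<in> V" "c \<noteq> a" for a c using that de by (simp add: l_def V_def)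
  have lc: "continuous_on UNIV (l a)" for a unfolding l_def by (intro continuous_intros)
  define I where "I a = (LINT x|lborel. indicator (slab E) x * l a (proj x))" for a
  have Ieq: "I a = I b" if ab: "a \<in> V" "b \<in> V" "a \<noteq> b" for a b
  proof -
    \<comment> \<open>The difference of the two coordinates is 1 at a, -1 at b and 0 at the other
      vertices of E, so A swaps a and b and fixes the rest. Evaluation at the projection makes A
      commute with shifts along \<nu>.\<close>
    define m where "m x = l a (proj x) - l b (proj x)" for x
    define D where "D = d a - d b"
    define A where "A x = x + m x *\<^sub>R (b - a)" for x
    define L where "L h = h + (D \<bullet> (h - (\<nu> \<bullet> h) *\<^sub>R \<nu>)) *\<^sub>R (b - a)" for h
    have perp: "\<nu> \<bullet> (b - a) = 0" using ab on_hyperplane by (simp add: inner_diff_right V_def)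
    have Dab: "D \<bullet> (b - a) = - 2"
    proof -
      have "D \<bullet> (b - a) = (l a b - l b b) - (l a a - l b a)"
        by (simp add: D_def l_def inner_diff_left inner_diff_right)
      then show ?thesis using ab l1 l0 by simp
    qed
    have mlin: "m x = m 0 + D \<bullet> (x - (\<nu> \<bullet> x) *\<^sub>R \<nu>)" for x
      by (simp add: m_def D_def l_def proj_def inner_diff_left inner_diff_right inner_add_right algebra_simps)
    have AL: "A x = L x + m 0 *\<^sub>R (b - a)" for x
      unfolding A_def L_def by (subst mlin) (simp add: algebra_simps)
    have linL: "linear L"
      unfolding L_def by (intro linearI) (auto simp: algebra_simps inner_add_right inner_diff_right)
    have LL: "L (L h) = h" for h
    proof -
      define s where "s = D \<bullet> (h - (\<nu> \<bullet> h) *\<^sub>R \<nu>)"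
      have Lh: "L h = h + s *\<^sub>R (b - a)" by (simp add: L_def s_def)
      have "\<nu> \<bullet> L h = \<nu> \<bullet> h" by (simp add: Lh inner_add_right perp)
      then have "D \<bullet> (L h - (\<nu> \<bullet> L h) *\<^sub>R \<nu>) = s + s * (D \<bullet> (b - a))"
        by (simp add: Lh s_def inner_add_right inner_diff_right)
      then have "D \<bullet> (L h - (\<nu> \<bullet> L h) *\<^sub>R \<nu>) = - s" by (simp add: Dab)
      then show ?thesis by (simp add: L_def[of "L h"]) (simp add: Lh)
    qed
    have injL: "inj L" using LL by (metis injI)
    have projA: "proj (A x) = proj x + m x *\<^sub>R (b - a)" "\<nu> \<bullet> A x = \<nu> \<bullet> x" for x
      by (simp_all add: proj_def A_def inner_add_right perp)
    have mA: "m (A x) = - m x" for x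
    proof -
      have "m (A x) = m x + m x * (D \<bullet> (b - a))"
        by (simp add: m_def[of "A x"] projA l_def D_def inner_add_right inner_diff_left algebra_simps)
           (simp add: m_def l_def)
      then show ?thesis by (simp add: Dab)
    qed
    have AA: "A (A x) = x" for x by (simp add: A_def[of "A x"] mA) (simp add: A_def)
    have AE: "A y \<in> E" if "y \<in> E" for y
    proof -
      have "V \<subseteq> {y. A y \<in> E}"
      proof
        fix c assume c: "c \<in> V"
        have "proj c = c" using c by (simp add: proj_def V_def on_hyperplane)
        then have "m c = l a c - l b c" by (simp add: m_def)
        then have "A c = (if c = a then b else if c = b then a else c)"
          using ab l1 l0 c by (simp add: A_def)
        then have "A c \<in> V" using ab c by auto
        then show "c \<in> {y. A y \<in> E}" by (simp add: V_def hull_inc)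
      qed
      moreover have "convex {y. A y \<in> E}"
      proof -
        have "A (u *\<^sub>R x + v *\<^sub>R y) = u *\<^sub>R A x + v *\<^sub>R A y" if "u + v = 1" for u v x y
        proof -
          have "m 0 *\<^sub>R (b - a) = u *\<^sub>R (m 0 *\<^sub>R (b - a)) + v *\<^sub>R (m 0 *\<^sub>R (b - a))"
            using that by (metis scaleR_add_left scaleR_one)
          then show ?thesis
            by (simp only: AL linear_add[OF linL] linear_cmul[OF linL] scaleR_add_right) (simp add: algebra_simps)
        qed
        then show ?thesis
          by (intro convexI) (simp add: convexD[OF convex_convex_hull[of "C - {P}"]])
      qed
      ultimately have "E \<subseteq> {y. A y \<in> E}" unfolding V_def by (rule hull_minimal)
      then show ?thesis using that by blast
    qed
    have Aproj: "A (proj x) = proj (A x)" for x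
    proof -
      have "proj (proj x) = proj x" by (simp add: proj_def inner_add_right normal_normal)
      then have "m (proj x) = m x" by (simp add: m_def)
      then show ?thesis by (simp only: projA A_def[of "proj x"])
    qed
    have Asl: "A x \<in> slab E" if "x \<in> slab E" for x
      using that AE[of "proj x"] by (simp add: slab_eq projA(2) flip: Aproj)
    have ind: "indicator (slab E) (A x) = (indicator (slab E) x :: real)" for x
    proof -
      have "A x \<in> slab E \<longleftrightarrow> x \<in> slab E"
        using Asl[of x] Asl[of "A x"] unfolding AA by blast
      then show ?thesis by (simp add: indicator_def)
    qed
    obtain k where k: "k > 0" "\<And>F :: 'a \<Rightarrow> real. F \<in> borel_measurable borel \<Longrightarrow>
        (\<integral>x. F (L x + m 0 *\<^sub>R (b - a)) \<partial>lborel) = k * (\<integral>x. F x \<partial>lborel)"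
      using lborel_affine_pushforward[OF linL injL, of "m 0 *\<^sub>R (b - a)"] by metis
    have cov: "(LINT x|lborel. indicator (slab E) x * F (A x)) = k * (LINT x|lborel. indicator (slab E) x * F x)"
      if [measurable]: "F \<in> borel_measurable borel" for F :: "'a \<Rightarrow> real"
    proof -
      have "(LINT x|lborel. indicator (slab E) (A x) * F (A x)) = k * (LINT x|lborel. indicator (slab E) x * F x)"
        unfolding AL by (rule k(2)[of "\<lambda>x. indicator (slab E) x * F x"]) measurable
      then show ?thesis by (simp add: ind)
    qed
    have meas: "side_area = k * side_area" using cov[of "\<lambda>_. 1"] by (simp add: side_area_def)
    have [measurable]: "l c \<in> borel_measurable borel" for c by (intro borel_measurable_continuous_onI lc)
    have "l a (proj (A x)) = l b (proj x)" for x
    proof -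
      have "l a (proj (A x)) = l a (proj x) + m x * (l a b - l a a)"
        by (simp add: projA l_def inner_add_right inner_diff_right algebra_simps)
      then show ?thesis using ab l1 l0 by (simp add: m_def)
    qed
    then have Ib: "I b = k * I a" using cov[of "\<lambda>x. l a (proj x)"] by (simp add: I_def)
    \<comment> \<open>The constant function shows that \<open>side_area\<close> equals k times
      itself, so k = 1 unless the slab is a null set, in which case all the integrals
      vanish.\<close>
    show ?thesis
    proof (cases "side_area = 0")
      case True
      then have "emeasure lborel (slab E) = 0"
        using emeasure_bounded_finite[OF compact_imp_bounded[OF slab_compact]]
        by (auto simp: side_area_def measure_def enn2real_eq_0_iff)
      then have "AE x in lborel. x \<notin> slab E" by (intro AE_not_in) (simp add: null_sets_def)
      then have "AE x in lborel. indicator (slab E) x * l c (proj x) = 0" for c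
        by eventually_elim simp
      then have "I c = 0" for c unfolding I_def by (rule integral_eq_zero_AE)
      then show ?thesis by simp
    next
      case False
      then show ?thesis using meas Ib by simp
    qed
  qed
  \<comment> \<open>Both sides are affine in y and agree at the vertices of E.\<close>
  have expand: "u \<bullet> y + s = (\<Sum>a\<in>V. (u \<bullet> a + s) * l a y)" if y: "y \<in> E" for u s y
  proof -
    define w where "w = u - (\<Sum>a\<in>V. (u \<bullet> a + s) *\<^sub>R d a)"
    define t where "t = s - (\<Sum>a\<in>V. (u \<bullet> a + s) * e a)"
    have eq: "u \<bullet> y + s - (\<Sum>a\<in>V. (u \<bullet> a + s) * l a y) = w \<bullet> y + t" for y
      by (simp add: w_def t_def l_def inner_diff_left inner_sum_left sum.distrib distrib_left)
    have "V \<subseteq> {y. w \<bullet> y = - t}"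
    proof
      fix c assume c: "c \<in> V"
      have "(\<Sum>a\<in>V. (u \<bullet> a + s) * l a c) = (\<Sum>a\<in>V. if a = c then u \<bullet> c + s else 0)"
        by (rule sum.cong) (use l1 l0 c in auto)
      also have "\<dots> = u \<bullet> c + s" using finV c by simp
      finally show "c \<in> {y. w \<bullet> y = - t}" using eq[of c] by simp
    qed
    then have "E \<subseteq> {y. w \<bullet> y = - t}" unfolding V_def by (rule hull_minimal) (rule convex_hyperplane)
    then show ?thesis using eq[of y] y by auto
  qed
  have Vne: "V \<noteq> {}" using base_nonempty by (simp add: V_def)
  have cardV: "card V = DIM('a)" using card_base by (simp add: V_def)
  have int: "(LINT x|lborel. indicator (slab E) x * (u \<bullet> proj x + s)) = (\<Sum>a\<in>V. (u \<bullet> a + s) * I a)" for u s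
  proof -
    have "(LINT x|lborel. indicator (slab E) x * (u \<bullet> proj x + s))
      = (LINT x|lborel. (\<Sum>a\<in>V. (u \<bullet> a + s) * (indicator (slab E) x * l a (proj x))))"
    proof (rule Bochner_Integration.integral_cong)
      fix x
      show "indicator (slab E) x * (u \<bullet> proj x + s) = (\<Sum>a\<in>V. (u \<bullet> a + s) * (indicator (slab E) x * l a (proj x)))"
        using expand[of "proj x" u s] by (simp add: slab_eq indicator_def)
    qed simp
    also have "\<dots> = (\<Sum>a\<in>V. (u \<bullet> a + s) * I a)"
      using slab_integrable[OF lc] by (simp add: I_def)
    finally show ?thesis .
  qed
  obtain a0 where a0: "a0 \<in> V" using Vne by blast
  have Ia: "I a = I a0" if "a \<in> V" for a using Ieq[OF that a0] by (cases "a = a0") auto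
  have "side_area = (\<Sum>a\<in>V. I a)" using int[of 0 1] by (simp add: side_area_def)
  also have "\<dots> = real DIM('a) * I a0" using Ia cardV by simp
  finally have area: "side_area = real DIM('a) * I a0" .
  have "(\<Sum>a\<in>V. (q \<bullet> a + r) * I a) = (\<Sum>a\<in>V. (q \<bullet> a + r) * I a0)"
    by (rule sum.cong) (simp_all add: Ia)
  also have "\<dots> = (q \<bullet> (\<Sum>a\<in>V. a) + real DIM('a) * r) * I a0"
    by (simp add: sum_distrib_right[symmetric] sum.distrib inner_sum_right cardV)
  also have "(\<Sum>a\<in>V. a) = real DIM('a) *\<^sub>R barycenter E" by (simp add: barycenter_E V_def)
  finally show ?thesis using int[of q r] area by (simp add: algebra_simps)
qed

text \<open>Lebesgue measure is the product of the side measure and the length in normal direction, which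
  by Tonelli's theorem follows from translation invariance alone.\<close>
lemma prism_nn_integral:
  fixes G :: "'a \<Rightarrow> ennreal"
  assumes [measurable]: "G \<in> borel_measurable borel" "F \<in> sets borel"
  shows "(\<integral>\<^sup>+x. (\<integral>\<^sup>+s. G (proj x - s *\<^sub>R \<nu>) * indicator {0..\<delta>} s \<partial>lborel)
        * (indicator F (proj x) * indicator {-1/2..1/2} (\<nu> \<bullet> x - \<beta>)) \<partial>lborel)
    = (\<integral>\<^sup>+x. G x * (indicator F (proj x) * indicator {0..\<delta>} (\<beta> - \<nu> \<bullet> x)) \<partial>lborel)"
proof -
  define J :: "'a \<Rightarrow> ennreal" where "J x = indicator F (proj x)" for x
  have [measurable]: "J \<in> borel_measurable borel" unfolding J_def by measurable
  define K :: "real \<Rightarrow> ennreal" where "K = indicator {-1/2..1/2}"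
  define I :: "real \<Rightarrow> ennreal" where "I = indicator {0..\<delta>}"
  have [measurable]: "K \<in> borel_measurable borel" "I \<in> borel_measurable borel"
    unfolding K_def I_def by measurable
  have "(\<integral>\<^sup>+x. (\<integral>\<^sup>+s. G (proj x - s *\<^sub>R \<nu>) * I s \<partial>lborel) * (J x * K (\<nu> \<bullet> x - \<beta>)) \<partial>lborel)
    = (\<integral>\<^sup>+x. (\<integral>\<^sup>+s. G (x - s *\<^sub>R \<nu>) * I (s + (\<beta> - \<nu> \<bullet> x)) \<partial>lborel) * (J x * K (\<nu> \<bullet> x - \<beta>)) \<partial>lborel)"
  proof (rule nn_integral_cong)
    fix x
    have "(\<integral>\<^sup>+s. G (proj x - s *\<^sub>R \<nu>) * I s \<partial>lborel)
      = (\<integral>\<^sup>+s. G (proj x - (s + (\<beta> - \<nu> \<bullet> x)) *\<^sub>R \<nu>) * I (s + (\<beta> - \<nu> \<bullet> x)) \<partial>lborel)"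
      by (rule nn_integral_lborel_translation[symmetric, of "\<lambda>s. G (proj x - s *\<^sub>R \<nu>) * I s"]) measurable
    then show "(\<integral>\<^sup>+s. G (proj x - s *\<^sub>R \<nu>) * I s \<partial>lborel) * (J x * K (\<nu> \<bullet> x - \<beta>))
      = (\<integral>\<^sup>+s. G (x - s *\<^sub>R \<nu>) * I (s + (\<beta> - \<nu> \<bullet> x)) \<partial>lborel) * (J x * K (\<nu> \<bullet> x - \<beta>))"
      by (simp add: proj_def scaleR_add_left algebra_simps)
  qed
  also have "\<dots> = (\<integral>\<^sup>+x. \<integral>\<^sup>+s. G (x - s *\<^sub>R \<nu>) * I (s + (\<beta> - \<nu> \<bullet> x)) * (J x * K (\<nu> \<bullet> x - \<beta>)) \<partial>lborel \<partial>lborel)"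
    by (intro nn_integral_cong nn_integral_multc[symmetric]) measurable
  also have "\<dots> = (\<integral>\<^sup>+s. \<integral>\<^sup>+x. G (x - s *\<^sub>R \<nu>) * I (s + (\<beta> - \<nu> \<bullet> x)) * (J x * K (\<nu> \<bullet> x - \<beta>)) \<partial>lborel \<partial>lborel)"
    by (rule lborel_pair.Fubini') measurable
  \<comment> \<open>After the shift of x by s \<nu> the variable s occurs in K only, and the
    integral of K is 1 because the slab has thickness 1.\<close>
  also have "\<dots> = (\<integral>\<^sup>+s. \<integral>\<^sup>+x. G x * I (\<beta> - \<nu> \<bullet> x) * (J x * K (s + (\<nu> \<bullet> x - \<beta>))) \<partial>lborel \<partial>lborel)"
  proof (rule nn_integral_cong)
    fix s :: real
    have J: "J (x + s *\<^sub>R \<nu>) = J x" for x by (simp add: J_def proj_shift)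
    have "(\<integral>\<^sup>+x. G (x - s *\<^sub>R \<nu>) * I (s + (\<beta> - \<nu> \<bullet> x)) * (J x * K (\<nu> \<bullet> x - \<beta>)) \<partial>lborel)
      = (\<integral>\<^sup>+x. G (x + s *\<^sub>R \<nu> - s *\<^sub>R \<nu>) * I (s + (\<beta> - \<nu> \<bullet> (x + s *\<^sub>R \<nu>))) * (J (x + s *\<^sub>R \<nu>) * K (\<nu> \<bullet> (x + s *\<^sub>R \<nu>) - \<beta>)) \<partial>lborel)"
      by (rule nn_integral_lborel_translation[symmetric, of "\<lambda>x. G (x - s *\<^sub>R \<nu>) * I (s + (\<beta> - \<nu> \<bullet> x)) * (J x * K (\<nu> \<bullet> x - \<beta>))"]) measurable
    also have "\<dots> = (\<integral>\<^sup>+x. G x * I (\<beta> - \<nu> \<bullet> x) * (J x * K (s + (\<nu> \<bullet> x - \<beta>))) \<partial>lborel)"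
      by (simp add: J inner_add_right normal_normal algebra_simps)
    finally show "(\<integral>\<^sup>+x. G (x - s *\<^sub>R \<nu>) * I (s + (\<beta> - \<nu> \<bullet> x)) * (J x * K (\<nu> \<bullet> x - \<beta>)) \<partial>lborel)
      = (\<integral>\<^sup>+x. G x * I (\<beta> - \<nu> \<bullet> x) * (J x * K (s + (\<nu> \<bullet> x - \<beta>))) \<partial>lborel)" .
  qed
  also have "\<dots> = (\<integral>\<^sup>+x. \<integral>\<^sup>+s. G x * I (\<beta> - \<nu> \<bullet> x) * (J x * K (s + (\<nu> \<bullet> x - \<beta>))) \<partial>lborel \<partial>lborel)"
    by (rule lborel_pair.Fubini') measurable
  also have "\<dots> = (\<integral>\<^sup>+x. G x * (J x * I (\<beta> - \<nu> \<bullet> x)) \<partial>lborel)"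
  proof (rule nn_integral_cong)
    fix x
    have "(\<integral>\<^sup>+s. K (s + (\<nu> \<bullet> x - \<beta>)) \<partial>lborel) = (\<integral>\<^sup>+s. K s \<partial>lborel)"
      by (rule nn_integral_lborel_translation) measurable
    also have "\<dots> = 1" by (simp add: K_def)
    finally have K1: "(\<integral>\<^sup>+s. K (s + (\<nu> \<bullet> x - \<beta>)) \<partial>lborel) = 1" .
    have "(\<integral>\<^sup>+s. G x * I (\<beta> - \<nu> \<bullet> x) * (J x * K (s + (\<nu> \<bullet> x - \<beta>))) \<partial>lborel)
      = (\<integral>\<^sup>+s. (G x * I (\<beta> - \<nu> \<bullet> x) * J x) * K (s + (\<nu> \<bullet> x - \<beta>)) \<partial>lborel)"
      by (simp add: mult.assoc)
    also have "\<dots> = (G x * I (\<beta> - \<nu> \<bullet> x) * J x) * (\<integral>\<^sup>+s. K (s + (\<nu> \<bullet> x - \<beta>)) \<partial>lborel)"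
      by (rule nn_integral_cmult) measurable
    finally show "(\<integral>\<^sup>+s. G x * I (\<beta> - \<nu> \<bullet> x) * (J x * K (s + (\<nu> \<bullet> x - \<beta>))) \<partial>lborel) = G x * (J x * I (\<beta> - \<nu> \<bullet> x))"
      by (simp add: K1 mult_ac)
  qed
  finally show ?thesis by (simp add: J_def K_def I_def)
qed

text \<open>A trace inequality. On a normal line the value at the foot is at most the value at depth
  s plus the integral of the gradient down to depth \<delta>. Averaging over s and integrating over
  F produces volume integrals over the prism below F, which \<open>sub\<close> places inside
  T.\<close>

lemma prism_trace_bound:
  assumes w: "has_C1_grad w g" and \<delta>: "\<delta> > 0" and [measurable]: "F \<in> sets borel"
    and sub: "\<And>x. proj x \<in> F \<Longrightarrow> 0 \<le> \<beta> - \<nu> \<bullet> x \<Longrightarrow> \<beta> - \<nu> \<bullet> x \<le> \<delta> \<Longrightarrow> x \<in> T"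
  shows "ennreal \<delta> * (\<integral>\<^sup>+x. ennreal \<bar>w (proj x)\<bar> * (indicator F (proj x) * indicator {-1/2..1/2} (\<nu> \<bullet> x - \<beta>)) \<partial>lborel)
    \<le> (\<integral>\<^sup>+x. ennreal \<bar>w x\<bar> * indicator T x \<partial>lborel) + ennreal \<delta> * (\<integral>\<^sup>+x. ennreal (norm (g x)) * indicator T x \<partial>lborel)"
proof -
  have [measurable]: "w \<in> borel_measurable borel" "g \<in> borel_measurable borel"
    using has_C1_grad_measurable[OF w] by auto
  define H :: "'a \<Rightarrow> ennreal" where "H x = indicator F (proj x) * indicator {-1/2..1/2} (\<nu> \<bullet> x - \<beta>)" for x
  have Hm[measurable]: "H \<in> borel_measurable borel" unfolding H_def by measurable
  have line: "ennreal \<delta> * ennreal \<bar>w y\<bar> \<le> (\<integral>\<^sup>+s. ennreal \<bar>w (y - s *\<^sub>R \<nu>)\<bar> * indicator {0..\<delta>} s \<partial>lborel)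
      + ennreal \<delta> * (\<integral>\<^sup>+s. ennreal (norm (g (y - s *\<^sub>R \<nu>))) * indicator {0..\<delta>} s \<partial>lborel)" for y
  proof -
    let ?D = "\<integral>\<^sup>+s. ennreal (norm (g (y - s *\<^sub>R \<nu>))) * indicator {0..\<delta>} s \<partial>lborel"
    have pt: "ennreal \<bar>w y\<bar> \<le> ennreal \<bar>w (y - s *\<^sub>R \<nu>)\<bar> + ?D" if s: "s \<in> {0..\<delta>}" for s
    proof -
      have "ennreal \<bar>w y\<bar> \<le> ennreal (\<bar>w (y - s *\<^sub>R \<nu>)\<bar> + \<bar>w (y + s *\<^sub>R (- \<nu>)) - w y\<bar>)"
        by (rule ennreal_leI) simp
      also have "\<dots> = ennreal \<bar>w (y - s *\<^sub>R \<nu>)\<bar> + ennreal \<bar>w (y + s *\<^sub>R (- \<nu>)) - w y\<bar>"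
        by (rule ennreal_plus) auto
      also have "ennreal \<bar>w (y + s *\<^sub>R (- \<nu>)) - w y\<bar>
          \<le> (\<integral>\<^sup>+r. ennreal (norm (- \<nu>) * norm (g (y + r *\<^sub>R (- \<nu>)))) * indicator {0..s} r \<partial>lborel)"
        by (rule has_C1_grad_abs_bound[OF w]) (use s in auto)
      also have "\<dots> \<le> ?D"
        by (rule nn_integral_mono) (use s in \<open>auto split: split_indicator simp: norm_normal\<close>)
      finally show ?thesis by (simp add: add_left_mono)
    qed
    have "ennreal \<delta> * ennreal \<bar>w y\<bar> = (\<integral>\<^sup>+s. ennreal \<bar>w y\<bar> * indicator {0..\<delta>} s \<partial>lborel)"
      using \<delta> by (simp add: nn_integral_cmult mult.commute)
    also have "\<dots> \<le> (\<integral>\<^sup>+s. ennreal \<bar>w (y - s *\<^sub>R \<nu>)\<bar> * indicator {0..\<delta>} s + ?D * indicator {0..\<delta>} s \<partial>lborel)"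
      by (rule nn_integral_mono) (use pt in \<open>auto split: split_indicator\<close>)
    also have "\<dots> = (\<integral>\<^sup>+s. ennreal \<bar>w (y - s *\<^sub>R \<nu>)\<bar> * indicator {0..\<delta>} s \<partial>lborel) + (\<integral>\<^sup>+s. ?D * indicator {0..\<delta>} s \<partial>lborel)"
      by (rule nn_integral_add) measurable
    also have "(\<integral>\<^sup>+s. ?D * indicator {0..\<delta>} s \<partial>lborel) = ?D * emeasure lborel {0..\<delta>}"
      by (rule nn_integral_cmult_indicator) simp
    also have "\<dots> = ennreal \<delta> * ?D"
      using \<delta> by (simp add: mult.commute)
    finally show ?thesis .
  qed
  have prism: "(\<integral>\<^sup>+x. (\<integral>\<^sup>+s. G (proj x - s *\<^sub>R \<nu>) * indicator {0..\<delta>} s \<partial>lborel) * H x \<partial>lborel)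
      \<le> (\<integral>\<^sup>+x. G x * indicator T x \<partial>lborel)"
    if [measurable]: "G \<in> borel_measurable borel" for G
  proof -
    have "(\<integral>\<^sup>+x. (\<integral>\<^sup>+s. G (proj x - s *\<^sub>R \<nu>) * indicator {0..\<delta>} s \<partial>lborel) * H x \<partial>lborel)
      = (\<integral>\<^sup>+x. G x * (indicator F (proj x) * indicator {0..\<delta>} (\<beta> - \<nu> \<bullet> x)) \<partial>lborel)"
      unfolding H_def by (rule prism_nn_integral) measurable
    also have "\<dots> \<le> (\<integral>\<^sup>+x. G x * indicator T x \<partial>lborel)"
      by (intro nn_integral_mono mult_left_mono) (auto split: split_indicator simp: sub)
    finally show ?thesis .
  qed
  have "ennreal \<delta> * (\<integral>\<^sup>+x. ennreal \<bar>w (proj x)\<bar> * H x \<partial>lborel)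
      = (\<integral>\<^sup>+x. ennreal \<delta> * ennreal \<bar>w (proj x)\<bar> * H x \<partial>lborel)"
    by (subst nn_integral_cmult[symmetric]) (auto simp: mult.assoc)
  also have "\<dots> \<le> (\<integral>\<^sup>+x. ((\<integral>\<^sup>+s. ennreal \<bar>w (proj x - s *\<^sub>R \<nu>)\<bar> * indicator {0..\<delta>} s \<partial>lborel)
      + ennreal \<delta> * (\<integral>\<^sup>+s. ennreal (norm (g (proj x - s *\<^sub>R \<nu>))) * indicator {0..\<delta>} s \<partial>lborel)) * H x \<partial>lborel)"
    by (intro nn_integral_mono mult_right_mono line) auto
  also have "\<dots> = (\<integral>\<^sup>+x. (\<integral>\<^sup>+s. ennreal \<bar>w (proj x - s *\<^sub>R \<nu>)\<bar> * indicator {0..\<delta>} s \<partial>lborel) * H x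
      + ennreal \<delta> * ((\<integral>\<^sup>+s. ennreal (norm (g (proj x - s *\<^sub>R \<nu>))) * indicator {0..\<delta>} s \<partial>lborel) * H x) \<partial>lborel)"
    by (simp add: distrib_right mult.assoc)
  also have "\<dots> = (\<integral>\<^sup>+x. (\<integral>\<^sup>+s. ennreal \<bar>w (proj x - s *\<^sub>R \<nu>)\<bar> * indicator {0..\<delta>} s \<partial>lborel) * H x \<partial>lborel)
      + ennreal \<delta> * (\<integral>\<^sup>+x. (\<integral>\<^sup>+s. ennreal (norm (g (proj x - s *\<^sub>R \<nu>))) * indicator {0..\<delta>} s \<partial>lborel) * H x \<partial>lborel)"
    by (subst nn_integral_add) (auto simp: nn_integral_cmult)
  also have "\<dots> \<le> (\<integral>\<^sup>+x. ennreal \<bar>w x\<bar> * indicator T x \<partial>lborel) + ennreal \<delta> * (\<integral>\<^sup>+x. ennreal (norm (g x)) * indicator T x \<partial>lborel)"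
    by (intro add_mono mult_left_mono prism) auto
  finally show ?thesis by (simp add: H_def)
qed

text \<open>Normal lines from points near the boundary of E may leave T at once, so in general no
  prism over all of E fits into T. One does fit over a copy of E shrunk towards a relative interior
  point z.\<close>

definition shrunk_side :: "real \<Rightarrow> 'a \<Rightarrow> 'a set" where
  "shrunk_side l z = (\<lambda>y. z + l *\<^sub>R (y - z)) ` E"

lemma shrunk_side_compact: "compact (shrunk_side l z)"
  unfolding shrunk_side_def by (intro compact_continuous_image compact_E continuous_intros)

lemma shrunk_side_prism:
  assumes z: "z \<in> rel_interior E" and l: "0 < l" "l < 1"
  obtains \<delta> where "\<delta> > 0"
    "\<And>x. proj x \<in> shrunk_side l z \<Longrightarrow> 0 \<le> \<beta> - \<nu> \<bullet> x \<Longrightarrow> \<beta> - \<nu> \<bullet> x \<le> \<delta> \<Longrightarrow> x \<in> T"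
proof -
  obtain r where r: "r > 0" "\<And>x. x \<in> ball z r \<Longrightarrow> \<nu> \<bullet> x \<le> \<beta> \<Longrightarrow> x \<in> T"
    using half_ball[OF z] by metis
  have zE: "\<nu> \<bullet> z = \<beta>" using z rel_interior_subset on_E by blast
  show ?thesis
  proof (rule that[of "(1 - l) * (r / 2)"])
    show "(1 - l) * (r / 2) > 0" using l r by simp
    fix x assume x: "proj x \<in> shrunk_side l z" "0 \<le> \<beta> - \<nu> \<bullet> x" "\<beta> - \<nu> \<bullet> x \<le> (1 - l) * (r / 2)"
    obtain y where y: "y \<in> E" "proj x = z + l *\<^sub>R (y - z)" using x(1) by (auto simp: shrunk_side_def)
    \<comment> \<open>x is the convex combination of y with weight l and of the point at depth t
      below z with weight 1 - l; its depth is (1 - l) t, which explains the choice of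
      \<delta>.\<close>
    define t where "t = (\<beta> - \<nu> \<bullet> x) / (1 - l)"
    have t: "0 \<le> t" "t \<le> r / 2" using x l by (auto simp: t_def pos_divide_le_eq mult.commute)
    have "z - t *\<^sub>R \<nu> \<in> T"
      by (rule r(2)) (use t r(1) in \<open>auto simp: dist_norm norm_normal inner_diff_right normal_normal zE\<close>)
    then have "l *\<^sub>R y + (1 - l) *\<^sub>R (z - t *\<^sub>R \<nu>) \<in> T"
      using y(1) E_subset_T l by (intro convexD[OF convex_convex_hull]) auto
    moreover have "l *\<^sub>R y + (1 - l) *\<^sub>R (z - t *\<^sub>R \<nu>) = proj x - ((1 - l) * t) *\<^sub>R \<nu>"
      by (simp add: y(2) algebra_simps)
    moreover have "(1 - l) * t = \<beta> - \<nu> \<bullet> x" using l by (simp add: t_def)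
    moreover have "proj x - (\<beta> - \<nu> \<bullet> x) *\<^sub>R \<nu> = x" by (simp add: proj_def)
    ultimately show "x \<in> T" by (simp only:)
  qed
qed

text \<open>The frontier of the slab is a null set. At an interior point, the projection y can be
  moved a little further away from z inside E, so y belongs to every copy of E shrunk by a factor
  close enough to 1.\<close>

lemma slab_exhaustion:
  assumes z: "z \<in> E"
  shows "AE x in lborel. x \<in> slab E \<longrightarrow> (\<exists>k. proj x \<in> shrunk_side (1 - inverse (real (Suc (Suc k)))) z)"
proof -
  have "negligible (frontier (slab E))" by (rule negligible_convex_frontier[OF slab_convex])
  then have "AE x in lebesgue. x \<notin> frontier (slab E)"
    by (simp add: AE_not_in negligible_iff_null_sets)
  then have ae: "AE x in lborel. x \<notin> frontier (slab E)" by (simp add: AE_completion_iff)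
  have "\<exists>k. proj x \<in> shrunk_side (1 - inverse (real (Suc (Suc k)))) z"
    if x: "x \<in> slab E" "x \<notin> frontier (slab E)" for x
  proof -
    define y where "y = proj x"
    have "x \<in> interior (slab E)" using x closure_subset by (auto simp: frontier_def)
    then obtain r where r: "r > 0" "ball x r \<subseteq> slab E" by (auto simp: mem_interior)
    have "z \<in> E" by (rule z)
    define e where "e = (r / 2) / (1 + norm (y - z))"
    have e: "e > 0" using r by (simp add: e_def add_pos_nonneg)
    have "e * norm (y - z) < r"
    proof -
      have "e * norm (y - z) \<le> e * (1 + norm (y - z))" using e by simp
      also have "\<dots> = r / 2"
      proof -
        have "1 + norm (y - z) \<noteq> 0" using norm_ge_zero[of "y - z"] by linarith
        from left_inverse[OF this] show ?thesis by (simp only: e_def divide_inverse mult.assoc mult_1_right)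
      qed
      finally show ?thesis using r by simp
    qed
    then have "x + e *\<^sub>R (y - z) \<in> slab E" using r e by (auto simp: dist_norm)
    moreover have perp: "\<nu> \<bullet> (y - z) = 0" using on_E[OF z] by (simp add: y_def inner_diff_right proj_on)
    moreover have "proj (x + e *\<^sub>R (y - z)) = y + e *\<^sub>R (y - z)"
    proof -
      have "proj (x + e *\<^sub>R (y - z)) = proj x + e *\<^sub>R (y - z)"
        by (simp add: proj_def inner_add_right perp)
      then show ?thesis by (simp only: y_def[symmetric])
    qed
    ultimately have ye: "y + e *\<^sub>R (y - z) \<in> E" by (simp add: slab_eq)
    obtain k where k: "inverse (real (Suc k)) < e / (1 + e)" using reals_Archimedean[of "e / (1 + e)"] e by auto
    define l where "l = 1 - inverse (real (Suc (Suc k)))"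
    have "inverse (real (Suc (Suc k))) \<le> inverse (real (Suc k))" by (rule le_imp_inverse_le) auto
    then have l: "l > 1 / (1 + e)" using k e by (simp add: l_def field_simps)
    then have l0: "l > 0" using e by (smt (verit) divide_pos_pos)
    have l1: "l < 1" by (simp add: l_def)
    \<comment> \<open>The fraction c of the admissible move leads to the point that the contraction
      by l sends back to y; c \<le> 1 holds because l > 1 / (1 + e).\<close>
    define c where "c = (1 / l - 1) / e"
    have c: "0 \<le> c" "c \<le> 1" using l l0 l1 e by (auto simp: c_def field_simps)
    have yE: "y \<in> E" using x(1) by (simp add: slab_eq y_def)
    have "(1 - c) *\<^sub>R y + c *\<^sub>R (y + e *\<^sub>R (y - z)) \<in> E"
      by (rule convexD[OF convex_convex_hull yE ye]) (use c in auto)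
    moreover have "(1 - c) *\<^sub>R y + c *\<^sub>R (y + e *\<^sub>R (y - z)) = y + (c * e) *\<^sub>R (y - z)"
      by (simp add: algebra_simps)
    ultimately have "y + (c * e) *\<^sub>R (y - z) \<in> E" by simp
    moreover have ce: "c * e = 1 / l - 1" using e by (simp add: c_def)
    moreover have "y = z + l *\<^sub>R (y + (c * e) *\<^sub>R (y - z) - z)"
    proof -
      have "y + (c * e) *\<^sub>R (y - z) - z = (1 + c * e) *\<^sub>R (y - z)" by (simp add: algebra_simps)
      also have "1 + c * e = 1 / l" by (simp add: ce)
      finally show ?thesis using l0 by simp
    qed
    ultimately have "y \<in> shrunk_side l z" unfolding shrunk_side_def by blast
    then show ?thesis by (auto simp: l_def y_def)
  qed
  note ex = this
  from ae show ?thesis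
  proof (rule AE_mp, intro AE_I2 impI)
    fix x assume "x \<notin> frontier (slab E)" "x \<in> slab E"
    then show "\<exists>k. proj x \<in> shrunk_side (1 - inverse (real (Suc (Suc k)))) z" by (rule ex[rotated])
  qed
qed

end

section \<open>Traces of piecewise affine functions\<close>

lemma nn_integral_norm_le_L2_norm:
  fixes f :: "'a \<Rightarrow> 'b::euclidean_space"
  assumes fin: "finite_measure M" and f: "f \<in> L2 M"
  shows "(\<integral>\<^sup>+x. ennreal (norm (f x)) \<partial>M) \<le> ennreal (sqrt (measure M (space M)) * L2_norm M f)"
proof -
  have [measurable]: "f \<in> borel_measurable M" using f by (rule L2_measurable)
  have n: "(\<lambda>x. norm (f x)) \<in> L2 M"
    using f by (auto simp: L2_def)
  have "(LINT x|M. norm (f x))\<^sup>2 \<le> (sqrt (measure M (space M)) * L2_norm M f)\<^sup>2"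
    using L2_integral_square_le[OF fin n] by (simp add: power_mult_distrib L2_norm_sq)
  then have "(LINT x|M. norm (f x)) \<le> sqrt (measure M (space M)) * L2_norm M f"
    by (rule power2_le_imp_le) simp
  moreover have "(\<integral>\<^sup>+x. ennreal (norm (f x)) \<partial>M) = ennreal (LINT x|M. norm (f x))"
    by (rule nn_integral_eq_integral) (use L2_integrable[OF fin n] in auto)
  ultimately show ?thesis by (simp add: ennreal_leI)
qed

context simplex_facet
begin

lemma interior_T_AE: "AE x in lborel. x \<in> T \<longleftrightarrow> x \<in> interior T"
proof -
  have "AE x in lebesgue. x \<notin> frontier T"
    using negligible_convex_frontier[OF convex_convex_hull, of C]
    by (intro AE_not_in) (simp add: negligible_iff_null_sets)
  then have "AE x in lborel. x \<notin> frontier T" by (simp add: AE_completion_iff)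
  then show ?thesis
  proof eventually_elim
    case (elim x)
    then show ?case using compact_T interior_subset[of T] by (auto simp: frontier_def compact_imp_closed)
  qed
qed

lemma nn_integral_T_le_L2_norm:
  obtains K where "\<And>f :: 'a \<Rightarrow> 'b::euclidean_space. continuous_on UNIV f \<Longrightarrow>
    (\<integral>\<^sup>+x. ennreal (norm (f x)) * indicator T x \<partial>lborel) \<le> ennreal (K * L2_norm (lebesgue_on (interior T)) f)"
proof
  let ?M = "lebesgue_on (interior T)"
  have b: "bounded (interior T)" using compact_T bounded_subset[OF compact_imp_bounded interior_subset] by blast
  fix f :: "'a \<Rightarrow> 'b::euclidean_space" assume c: "continuous_on UNIV f"
  have [measurable]: "f \<in> borel_measurable borel" using c by (rule borel_measurable_continuous_onI)
  have "(\<integral>\<^sup>+x. ennreal (norm (f x)) * indicator T x \<partial>lborel) = (\<integral>\<^sup>+x. ennreal (norm (f x)) * indicator (interior T) x \<partial>lborel)"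
    by (rule nn_integral_cong_AE) (use interior_T_AE in \<open>eventually_elim, simp add: indicator_def\<close>)
  also have "\<dots> = (\<integral>\<^sup>+x. ennreal (norm (f x)) \<partial>?M)"
    by (rule nn_integral_lebesgue_on_borel[symmetric]) auto
  also have "\<dots> \<le> ennreal (sqrt (measure ?M (space ?M)) * L2_norm ?M f)"
    by (rule nn_integral_norm_le_L2_norm)
       (use b c in \<open>auto intro!: finite_measure_lebesgue_on_bounded continuous_bounded_L2\<close>)
  finally show "(\<integral>\<^sup>+x. ennreal (norm (f x)) * indicator T x \<partial>lborel) \<le> ennreal (sqrt (measure ?M (space ?M)) * L2_norm ?M f)" .
qed

lemma nn_integral_side_measure:
  assumes [measurable]: "h \<in> borel_measurable borel"
  shows "(\<integral>\<^sup>+x. h x \<partial>side_measure E) = (\<integral>\<^sup>+x. h (proj x) * indicator (slab E) x \<partial>lborel)"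
proof -
  have "(\<integral>\<^sup>+x. h x \<partial>side_measure E) = (\<integral>\<^sup>+x. h (proj x) \<partial>lebesgue_on (slab E))"
    unfolding side_measure_eq by (rule nn_integral_distr[OF proj_measurable_slab]) measurable
  also have "\<dots> = (\<integral>\<^sup>+x. h (proj x) * indicator (slab E) x \<partial>lborel)"
    by (rule nn_integral_lebesgue_on_borel) measurable
  finally show ?thesis .
qed

lemma continuous_L2_side:
  fixes f :: "'a \<Rightarrow> real"
  assumes f: "continuous_on UNIV f"
  shows "f \<in> L2 (side_measure E)"
proof (rule L2I)
  have fm: "f \<in> borel_measurable borel" using f by (rule borel_measurable_continuous_onI)
  then show "f \<in> borel_measurable (side_measure E)" by (simp add: side_measure_eq)
  have "(\<lambda>x. f (proj x)) \<in> L2 (lebesgue_on (slab E))"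
    by (rule continuous_bounded_L2[OF continuous_on_compose2[OF f proj_continuous]])
       (auto intro: compact_imp_bounded slab_compact)
  then have "integrable (lebesgue_on (slab E)) (\<lambda>x. (norm (f (proj x)))\<^sup>2)" by (rule L2_integrable_sq)
  then show "integrable (side_measure E) (\<lambda>x. (norm (f x))\<^sup>2)"
    unfolding side_measure_eq using fm by (subst integrable_distr_eq[OF proj_measurable_slab]) auto
qed

text \<open>The prism inequality bounds the L^1 norm of f on a shrunk side by quantities that tend
  to 0, and the shrunk sides exhaust E up to a null set. This is what makes the trace on a side
  unique.\<close>

lemma side_trace_zero:
  assumes w: "\<And>k. has_C1_grad (w k) (g k)"
    and w0: "(\<lambda>k. L2_norm (lebesgue_on (interior T)) (w k)) \<longlonglongrightarrow> 0"
    and g0: "(\<lambda>k. L2_norm (lebesgue_on (interior T)) (g k)) \<longlonglongrightarrow> 0"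
    and f: "f \<in> L2 (side_measure E)"
    and lim: "(\<lambda>k. L2_norm (side_measure E) (\<lambda>x. w k x - f x)) \<longlonglongrightarrow> 0"
  shows "AE x in lborel. x \<in> slab E \<longrightarrow> f (proj x) = 0"
proof -
  obtain K1 where K1: "\<And>f :: 'a \<Rightarrow> real. continuous_on UNIV f \<Longrightarrow>
    (\<integral>\<^sup>+x. ennreal (norm (f x)) * indicator T x \<partial>lborel) \<le> ennreal (K1 * L2_norm (lebesgue_on (interior T)) f)"
    using nn_integral_T_le_L2_norm[where 'b = real] by blast
  obtain K2 where K2: "\<And>f :: 'a \<Rightarrow> 'a. continuous_on UNIV f \<Longrightarrow>
    (\<integral>\<^sup>+x. ennreal (norm (f x)) * indicator T x \<partial>lborel) \<le> ennreal (K2 * L2_norm (lebesgue_on (interior T)) f)"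
    using nn_integral_T_le_L2_norm[where 'b = 'a] by blast
  define K3 where "K3 = sqrt (measure (side_measure E) (space (side_measure E)))"
  have fm[measurable]: "f \<in> borel_measurable borel"
    using L2_measurable[OF f] by (simp add: side_measure_eq)
  have wm[measurable]: "w k \<in> borel_measurable borel" for k using has_C1_grad_measurable[OF w] by auto
  obtain z where z: "z \<in> rel_interior E"
    using rel_interior_eq_empty[OF convex_convex_hull, of "C - {P}"] base_nonempty by auto
  have part: "AE x in lborel. x \<in> slab E \<longrightarrow> proj x \<in> shrunk_side l z \<longrightarrow> f (proj x) = 0"
    if l: "0 < l" "l < 1" for l
  proof -
    let ?F = "shrunk_side l z"
    have Fb[measurable]: "?F \<in> sets borel" using shrunk_side_compact by (simp add: compact_imp_closed)
    obtain \<delta> where \<delta>: "\<delta> > 0"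
      "\<And>x. proj x \<in> ?F \<Longrightarrow> 0 \<le> \<beta> - \<nu> \<bullet> x \<Longrightarrow> \<beta> - \<nu> \<bullet> x \<le> \<delta> \<Longrightarrow> x \<in> T"
      using shrunk_side_prism[OF z l] by metis
    define H :: "'a \<Rightarrow> ennreal" where "H x = indicator ?F (proj x) * indicator {-1/2..1/2} (\<nu> \<bullet> x - \<beta>)" for x
    have Hm[measurable]: "H \<in> borel_measurable borel" unfolding H_def by measurable
    have FE: "?F \<subseteq> E"
    proof
      fix x assume "x \<in> ?F"
      then obtain y where y: "y \<in> E" "x = z + l *\<^sub>R (y - z)" by (auto simp: shrunk_side_def)
      have "z \<in> E" using z rel_interior_subset by blast
      then have "(1 - l) *\<^sub>R z + l *\<^sub>R y \<in> E" using y(1) l by (intro convexD[OF convex_convex_hull]) auto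
      then show "x \<in> E" by (simp add: y(2) algebra_simps)
    qed
    have H1: "H x \<le> indicator (slab E) x" for x
    proof (cases "proj x \<in> ?F \<and> \<nu> \<bullet> x - \<beta> \<in> {-1/2..1/2}")
      case True
      then have "\<bar>\<nu> \<bullet> x - \<beta>\<bar> \<le> 1/2" unfolding atLeastAtMost_iff by linarith
      then have "x \<in> slab E" using True FE unfolding slab_eq by blast
      then show ?thesis by (simp add: H_def indicator_def)
    qed (auto simp: H_def)
    let ?X = "\<integral>\<^sup>+x. ennreal \<bar>f (proj x)\<bar> * H x \<partial>lborel"
    \<comment> \<open>The absolute values make the bound nonnegative, as nothing is known about the
      signs of K1 and K2.\<close>
    define \<epsilon> where "\<epsilon> k = \<bar>K1 * L2_norm (lebesgue_on (interior T)) (w k)\<bar>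
      + \<delta> * \<bar>K2 * L2_norm (lebesgue_on (interior T)) (g k)\<bar>
      + \<delta> * \<bar>K3 * L2_norm (side_measure E) (\<lambda>x. w k x - f x)\<bar>" for k
    have "ennreal \<delta> * ?X \<le> ennreal (\<epsilon> k)" for k
    proof -
      have "ennreal \<bar>f (proj x)\<bar> \<le> ennreal \<bar>w k (proj x)\<bar> + ennreal \<bar>w k (proj x) - f (proj x)\<bar>" for x
      proof -
        have "ennreal \<bar>f (proj x)\<bar> \<le> ennreal (\<bar>w k (proj x)\<bar> + \<bar>w k (proj x) - f (proj x)\<bar>)"
          by (rule ennreal_leI) simp
        then show ?thesis by simp
      qed
      then have "?X \<le> (\<integral>\<^sup>+x. (ennreal \<bar>w k (proj x)\<bar> + ennreal \<bar>w k (proj x) - f (proj x)\<bar>) * H x \<partial>lborel)"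
        by (intro nn_integral_mono mult_right_mono) auto
      also have "\<dots> = (\<integral>\<^sup>+x. ennreal \<bar>w k (proj x)\<bar> * H x \<partial>lborel) + (\<integral>\<^sup>+x. ennreal \<bar>w k (proj x) - f (proj x)\<bar> * H x \<partial>lborel)"
        by (simp add: distrib_right nn_integral_add)
      finally have 1: "ennreal \<delta> * ?X \<le> ennreal \<delta> * (\<integral>\<^sup>+x. ennreal \<bar>w k (proj x)\<bar> * H x \<partial>lborel)
          + ennreal \<delta> * (\<integral>\<^sup>+x. ennreal \<bar>w k (proj x) - f (proj x)\<bar> * H x \<partial>lborel)"
        by (simp add: mult_left_mono flip: distrib_left)
      have "ennreal \<delta> * (\<integral>\<^sup>+x. ennreal \<bar>w k (proj x)\<bar> * H x \<partial>lborel)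
          \<le> (\<integral>\<^sup>+x. ennreal \<bar>w k x\<bar> * indicator T x \<partial>lborel) + ennreal \<delta> * (\<integral>\<^sup>+x. ennreal (norm (g k x)) * indicator T x \<partial>lborel)"
        unfolding H_def by (rule prism_trace_bound[OF w \<delta>(1) Fb \<delta>(2)])
      also have "\<dots> \<le> ennreal \<bar>K1 * L2_norm (lebesgue_on (interior T)) (w k)\<bar>
          + ennreal \<delta> * ennreal \<bar>K2 * L2_norm (lebesgue_on (interior T)) (g k)\<bar>"
      proof (intro add_mono mult_left_mono)
        show "(\<integral>\<^sup>+x. ennreal \<bar>w k x\<bar> * indicator T x \<partial>lborel) \<le> ennreal \<bar>K1 * L2_norm (lebesgue_on (interior T)) (w k)\<bar>"
          using K1[OF has_C1_grad_continuous(1)[OF w, of UNIV k]] by (auto intro: order_trans[OF _ ennreal_leI])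
        show "(\<integral>\<^sup>+x. ennreal (norm (g k x)) * indicator T x \<partial>lborel) \<le> ennreal \<bar>K2 * L2_norm (lebesgue_on (interior T)) (g k)\<bar>"
          using K2[OF has_C1_grad_continuous(2)[OF w, of UNIV k]] by (auto intro: order_trans[OF _ ennreal_leI])
      qed auto
      finally have 2: "ennreal \<delta> * (\<integral>\<^sup>+x. ennreal \<bar>w k (proj x)\<bar> * H x \<partial>lborel)
          \<le> ennreal \<bar>K1 * L2_norm (lebesgue_on (interior T)) (w k)\<bar>
          + ennreal \<delta> * ennreal \<bar>K2 * L2_norm (lebesgue_on (interior T)) (g k)\<bar>" .
      have "(\<integral>\<^sup>+x. ennreal \<bar>w k (proj x) - f (proj x)\<bar> * H x \<partial>lborel)
          \<le> (\<integral>\<^sup>+x. ennreal \<bar>w k (proj x) - f (proj x)\<bar> * indicator (slab E) x \<partial>lborel)"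
        by (intro nn_integral_mono mult_left_mono H1) auto
      also have "\<dots> = (\<integral>\<^sup>+x. ennreal \<bar>w k x - f x\<bar> \<partial>side_measure E)"
        by (rule nn_integral_side_measure[symmetric]) measurable
      also have "\<dots> \<le> ennreal (K3 * L2_norm (side_measure E) (\<lambda>x. w k x - f x))"
        using nn_integral_norm_le_L2_norm[OF finite_side_measure L2_diff[OF continuous_L2_side[OF has_C1_grad_continuous(1)[OF w]] f], of k]
        by (simp add: K3_def)
      also have "\<dots> \<le> ennreal \<bar>K3 * L2_norm (side_measure E) (\<lambda>x. w k x - f x)\<bar>"
        by (rule ennreal_leI) simp
      finally have 3: "(\<integral>\<^sup>+x. ennreal \<bar>w k (proj x) - f (proj x)\<bar> * H x \<partial>lborel)
          \<le> ennreal \<bar>K3 * L2_norm (side_measure E) (\<lambda>x. w k x - f x)\<bar>" .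
      have "ennreal \<delta> * ?X \<le> ennreal \<bar>K1 * L2_norm (lebesgue_on (interior T)) (w k)\<bar>
          + ennreal \<delta> * ennreal \<bar>K2 * L2_norm (lebesgue_on (interior T)) (g k)\<bar>
          + ennreal \<delta> * ennreal \<bar>K3 * L2_norm (side_measure E) (\<lambda>x. w k x - f x)\<bar>"
        using 1 add_mono[OF 2 mult_left_mono[OF 3, of "ennreal \<delta>"]] by (auto intro: order_trans)
      also have "\<dots> = ennreal (\<epsilon> k)"
        using \<delta>(1) by (simp add: \<epsilon>_def ennreal_mult ennreal_plus del: ennreal_plus[symmetric])
      finally show ?thesis .
    qed
    moreover have "(\<lambda>k. ennreal (\<epsilon> k)) \<longlonglongrightarrow> ennreal 0"
    proof (rule tendsto_ennrealI)
      have "\<epsilon> \<longlonglongrightarrow> \<bar>K1 * 0\<bar> + \<delta> * \<bar>K2 * 0\<bar> + \<delta> * \<bar>K3 * 0\<bar>"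
        unfolding \<epsilon>_def[abs_def] by (intro tendsto_intros w0 g0 lim)
      then show "\<epsilon> \<longlonglongrightarrow> 0" by simp
    qed
    ultimately have "ennreal \<delta> * ?X \<le> 0"
      by (intro tendsto_lowerbound[where F = sequentially]) auto
    then have "?X = 0" using \<delta>(1) by simp
    then have "AE x in lborel. ennreal \<bar>f (proj x)\<bar> * H x = 0"
      by (subst (asm) nn_integral_0_iff_AE) auto
    then show ?thesis
    proof eventually_elim
      case (elim x)
      then show ?case by (auto simp: H_def slab_eq abs_le_iff split: split_indicator_asm)
    qed
  qed
  have "AE x in lborel. \<forall>k. x \<in> slab E \<longrightarrow> proj x \<in> shrunk_side (1 - inverse (real (Suc (Suc k)))) z \<longrightarrow> f (proj x) = 0"
    by (intro AE_all_countable[THEN iffD2] allI part) (auto simp: inverse_eq_divide field_simps)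
  moreover have "z \<in> E" using z rel_interior_subset by blast
  note slab_exhaustion[OF this]
  ultimately show ?thesis by eventually_elim blast
qed

end

lemma H1_norm_zero:
  fixes U :: "(real^'n) set"
  assumes U: "open U" "bounded U" and v: "\<And>x. x \<in> U \<Longrightarrow> v x = 0"
  shows "H1_norm U v = 0"
proof -
  have c: "has_C1_grad (\<lambda>x::real^'n. 0) (\<lambda>x. 0)"
    using has_C1_grad_affine[of "0::real^'n" 0] by simp
  have "L2_norm (lebesgue_on U) v = L2_norm (lebesgue_on U) (\<lambda>_. 0::real)"
    unfolding L2_norm_def by (intro arg_cong[where f = sqrt] Bochner_Integration.integral_cong) (auto simp: v)
  moreover have "weak_grad U v = weak_grad U (\<lambda>_. 0)" by (rule weak_grad_cong(2)) (simp add: v)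
  moreover have "L2_norm (lebesgue_on U) (weak_grad U (\<lambda>_. 0)) = L2_norm (lebesgue_on U) (\<lambda>_. 0::real^'n)"
    by (rule L2_norm_cong_AE) (use C1_H1[OF U c] H1D(2) L2_measurable in auto)
  ultimately show ?thesis by (simp add: H1_norm_def L2_norm_def)
qed

lemma is_trace_affine:
  fixes T :: "(real^'n) set"
  assumes T: "int CARD('n) simplex T" and v: "\<And>x. x \<in> interior T \<Longrightarrow> v x = a \<bullet> x + c"
  shows "is_trace T v (\<lambda>x. a \<bullet> x + c)"
proof -
  let ?p = "\<lambda>x. a \<bullet> x + c"
  have b: "bounded (interior T)"
    using compact_simplex[OF T] bounded_subset[OF compact_imp_bounded interior_subset] by blast
  have C1: "has_C1_grad ?p (\<lambda>x. a)" by (rule has_C1_grad_affine)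
  show ?thesis
    unfolding is_trace_def
  proof (intro conjI allI impI exI[of _ "\<lambda>k. ?p"])
    show "v \<in> H1 (interior T)"
      using weak_grad_cong(3)[of "interior T" v ?p] v C1_H1(1)[OF open_interior b C1] by simp
    show "smooth ?p" by (rule smooth_affine)
    show "(\<lambda>k. H1_norm (interior T) (\<lambda>x. ?p x - v x)) \<longlonglongrightarrow> 0"
      by (subst H1_norm_zero[OF open_interior b]) (auto simp: v)
    fix E assume E: "E facet_of T"
    obtain C P \<nu> \<beta> where d: "simplex_facet C P \<nu> \<beta>" "T = convex hull C" "E = convex hull (C - {P})"
      using simplex_facet_exists[of T E] T E by (metis DIM_cart DIM_real mult.right_neutral)
    interpret f: simplex_facet C P \<nu> \<beta> by (rule d)
    show "?p \<in> L2 (side_measure E)"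
      unfolding d(3) by (rule f.continuous_L2_side) (intro continuous_intros)
    show "(\<lambda>k. L2_norm (side_measure E) (\<lambda>x. ?p x - ?p x)) \<longlonglongrightarrow> 0" by (simp add: L2_norm_def)
  qed
qed

text \<open>\<open>trace_on\<close> is an arbitrary choice among the traces. The smooth functions
  that define it, minus the affine function, tend to 0 in H^1, so uniqueness of traces identifies it
  with the affine function almost everywhere on E, and the integral of the latter only sees the
  barycentre.\<close>

lemma integral_trace_affine:
  fixes C :: "(real^'n) set"
  assumes f: "simplex_facet C P \<nu> \<beta>" and T: "T = convex hull C" and E: "E = convex hull (C - {P})"
    and v: "\<And>x. x \<in> interior T \<Longrightarrow> v x = a \<bullet> x + c"
  shows "(LINT x|side_measure E. k * trace_on T v x) = k * (measure lborel (slab E) * (a \<bullet> barycenter E + c))"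
proof -
  interpret f: simplex_facet C P \<nu> \<beta> by (rule f)
  let ?p = "\<lambda>x. a \<bullet> x + c"
  let ?U = "interior T"
  have U: "open ?U" "bounded ?U"
    using f.compact_T bounded_subset[OF compact_imp_bounded interior_subset] T by auto
  have C1: "has_C1_grad ?p (\<lambda>x. a)" by (rule has_C1_grad_affine)
  have simpT: "int CARD('n) simplex T"
    unfolding simplex_def using f.indep f.card_C T by (intro exI[of _ C]) simp
  have ET: "E facet_of T" using f.E_facet T E by simp
  define g where "g = trace_on T v"
  \<comment> \<open>The choice is meaningful because the affine function itself is a trace.\<close>
  have "is_trace T v g"
    unfolding g_def trace_on_def by (rule someI[of "is_trace T v"]) (rule is_trace_affine[OF simpT v])
  then obtain w where vH: "v \<in> H1 ?U" and g: "g \<in> L2 (side_measure E)" and w: "\<And>k. smooth (w k)"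
    and lim: "(\<lambda>k. H1_norm ?U (\<lambda>x. w k x - v x)) \<longlonglongrightarrow> 0"
    and limE: "(\<lambda>k. L2_norm (side_measure E) (\<lambda>x. w k x - g x)) \<longlonglongrightarrow> 0"
    using ET by (auto simp: is_trace_def)
  note wC = smooth_has_C1_grad[OF w]
  note l = H1_norm_tendstoD[OF U vH wC lim]
  have wv: "weak_grad ?U v = weak_grad ?U ?p" by (rule weak_grad_cong(2)) (rule v)
  have "AE x in lborel. x \<in> slab E \<longrightarrow> (g (f.proj x) - ?p (f.proj x)) = 0"
    unfolding E
  proof (rule f.side_trace_zero[of "\<lambda>k x. w k x - ?p x" "\<lambda>k x. grad (w k) x - a"])
    show "has_C1_grad (\<lambda>x. w k x - ?p x) (\<lambda>x. grad (w k) x - a)" for k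
      by (rule has_C1_grad_diff[OF wC C1])
    have "L2_norm (lebesgue_on ?U) (\<lambda>x. w k x - v x) = L2_norm (lebesgue_on ?U) (\<lambda>x. w k x - ?p x)" for k
      unfolding L2_norm_def by (intro arg_cong[where f = sqrt] Bochner_Integration.integral_cong) (auto simp: v)
    then show "(\<lambda>k. L2_norm (lebesgue_on (interior (convex hull C))) (\<lambda>x. w k x - ?p x)) \<longlonglongrightarrow> 0"
      using l(1) T by simp
    have "L2_norm (lebesgue_on ?U) (\<lambda>x. grad (w k) x - weak_grad ?U v x) = L2_norm (lebesgue_on ?U) (\<lambda>x. grad (w k) x - a)" for k
    proof (rule L2_norm_cong_AE)
      show "(\<lambda>x. grad (w k) x - weak_grad ?U v x) \<in> borel_measurable (lebesgue_on ?U)"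
        by (rule L2_measurable[OF L2_diff[OF C1_H1(4)[OF U wC] H1D(2)[OF vH]]])
      show "(\<lambda>x. grad (w k) x - a) \<in> borel_measurable (lebesgue_on ?U)"
        by (rule L2_measurable[OF C1_H1(4)[OF U has_C1_grad_diff[OF wC C1]]])
      show "AE x in lebesgue_on ?U. grad (w k) x - weak_grad ?U v x = grad (w k) x - a"
        using C1_H1(2)[OF U C1] unfolding wv by eventually_elim simp
    qed
    then show "(\<lambda>k. L2_norm (lebesgue_on (interior (convex hull C))) (\<lambda>x. grad (w k) x - a)) \<longlonglongrightarrow> 0"
      using l(2) T by simp
    show "(\<lambda>x. g x - ?p x) \<in> L2 (side_measure (convex hull (C - {P})))"
      by (rule L2_diff[OF g[unfolded E] f.continuous_L2_side[OF has_C1_grad_continuous(1)[OF C1]]])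
    show "(\<lambda>k. L2_norm (side_measure (convex hull (C - {P}))) (\<lambda>x. w k x - ?p x - (g x - ?p x))) \<longlonglongrightarrow> 0"
      using limE by (simp add: E)
  qed
  then have ae: "AE x in lborel. indicator (slab E) x * (k * g (f.proj x)) = k * (indicator (slab E) x * ?p (f.proj x))"
    by eventually_elim (auto split: split_indicator)
  have gm[measurable]: "g \<in> borel_measurable borel"
    using L2_measurable[OF g] by (simp add: E f.side_measure_eq)
  have "(LINT x|side_measure E. k * g x) = (LINT x|lborel. indicator (slab E) x * (k * g (f.proj x)))"
    unfolding E by (rule f.integral_side_measure) measurable
  also have "\<dots> = (LINT x|lborel. k * (indicator (slab E) x * ?p (f.proj x)))"
  proof (rule integral_cong_AE[OF _ _ ae])
    have [measurable]: "slab E \<in> sets borel" unfolding E by (rule f.slab_borel)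
    show "(\<lambda>x. indicator (slab E) x * (k * g (f.proj x))) \<in> borel_measurable lborel"
      "(\<lambda>x. k * (indicator (slab E) x * ?p (f.proj x))) \<in> borel_measurable lborel" by measurable
  qed
  also have "\<dots> = k * (measure lborel (slab E) * (a \<bullet> barycenter E + c))"
    unfolding E using f.integral_affine_side[of a c] by (simp add: f.side_area_def)
  finally show ?thesis by (simp add: g_def)
qed

section \<open>Broken spaces\<close>

context triangulated_domain
begin

abbreviation M :: "(real^'n) measure" where "M \<equiv> lebesgue_on \<Omega>"
abbreviation MT :: "(real^'n) set \<Rightarrow> (real^'n) measure" where "MT T \<equiv> lebesgue_on (interior T)"

lemma bounded_interiorT: "T \<in> \<T> \<Longrightarrow> bounded (interior T)"
  using boundedT bounded_subset interior_subset by blast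

lemma finite_MT: "T \<in> \<T> \<Longrightarrow> finite_measure (MT T)"
  by (rule finite_measure_lebesgue_on_bounded) (auto simp: bounded_interiorT)

lemma L2_piece: 
  fixes f :: "real^'n \<Rightarrow> 'b::euclidean_space"
  shows "f \<in> L2 M \<Longrightarrow> T \<in> \<T> \<Longrightarrow> f \<in> L2 (MT T)"
  by (rule L2_restrict[OF _ interiorT_subset domain_sets]) auto

lemma pieces_cover: "AE x in lebesgue. x \<in> \<Omega> \<longrightarrow> (\<exists>T\<in>\<T>. x \<in> interior T)"
proof -
  have "AE x in lebesgue. x \<notin> \<Omega> - (\<Union>T\<in>\<T>. interior T)"
    using negligible_skeleton by (intro AE_not_in) (simp add: negligible_iff_null_sets)
  then show ?thesis by eventually_elim auto
qed

lemma AE_pieces: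
  assumes "\<And>T. T \<in> \<T> \<Longrightarrow> AE x in MT T. Q x"
  shows "AE x in M. Q x"
proof -
  have "AE x in lebesgue. x \<in> interior T \<longrightarrow> Q x" if "T \<in> \<T>" for T
    using assms[OF that] by (simp add: AE_restrict_space_iff)
  then have "AE x in lebesgue. \<forall>T\<in>\<T>. x \<in> interior T \<longrightarrow> Q x"
    by (intro AE_finite_allI finite_triangulation)
  then have "AE x in lebesgue. x \<in> \<Omega> \<longrightarrow> Q x"
    using pieces_cover by eventually_elim blast
  then show ?thesis by (simp add: AE_restrict_space_iff)
qed

lemma sum_indicator_pieces:
  fixes F :: "(real^'n) set \<Rightarrow> 'b::real_vector"
  assumes "T \<in> \<T>" "x \<in> interior T"
  shows "(\<Sum>T\<in>\<T>. indicator (interior T) x *\<^sub>R F T) = F T"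
    "(\<Sum>T\<in>\<T>. if x \<in> interior T then F T else 0) = F T"
proof -
  have i: "x \<in> interior T' \<longleftrightarrow> T' = T" if "T' \<in> \<T>" for T'
    using interiors_disjoint[OF assms(1) that assms(2)] interior_subset assms(2) by blast
  have "(\<Sum>T\<in>\<T>. if x \<in> interior T then F T else 0) = (\<Sum>T'\<in>\<T>. if T' = T then F T' else 0)"
    by (rule sum.cong) (auto simp: i)
  then show 2: "(\<Sum>T\<in>\<T>. if x \<in> interior T then F T else 0) = F T"
    using assms(1) finite_triangulation by simp
  have "(\<Sum>T\<in>\<T>. indicator (interior T) x *\<^sub>R F T) = (\<Sum>T\<in>\<T>. if x \<in> interior T then F T else 0)"
    by (rule sum.cong) (auto simp: indicator_def)
  then show "(\<Sum>T\<in>\<T>. indicator (interior T) x *\<^sub>R F T) = F T" using 2 by simp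
qed

lemma indicator_pieces:
  "AE x in lebesgue. indicator \<Omega> x *\<^sub>R F x = (\<Sum>T\<in>\<T>. indicator (interior T) x *\<^sub>R (F x :: 'b::real_vector))"
  using pieces_cover
proof eventually_elim
  case (elim x)
  show ?case
  proof (cases "x \<in> \<Omega>")
    case True
    then obtain T where "T \<in> \<T>" "x \<in> interior T" using elim by blast
    then show ?thesis using sum_indicator_pieces(1)[of T x "\<lambda>_. F x"] True by simp
  next
    case False
    then have "x \<notin> interior T" if "T \<in> \<T>" for T using interiorT_subset that by blast
    then show ?thesis using False by simp
  qed
qed

lemma measurable_pieces:
  fixes F :: "real^'n \<Rightarrow> 'b::euclidean_space"
  assumes "\<And>T. T \<in> \<T> \<Longrightarrow> F \<in> borel_measurable (MT T)"
  shows "F \<in> borel_measurable M"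
proof -
  have "(\<lambda>x. \<Sum>T\<in>\<T>. indicator (interior T) x *\<^sub>R F x) \<in> borel_measurable lebesgue"
    using assms by (intro borel_measurable_sum) (simp add: borel_measurable_restrict_space_iff)
  then have "(\<lambda>x. indicator \<Omega> x *\<^sub>R F x) \<in> borel_measurable lebesgue"
    by (rule borel_measurable_AE) (use indicator_pieces[of F] in \<open>eventually_elim, simp\<close>)
  then show ?thesis by (simp add: borel_measurable_restrict_space_iff)
qed

lemma integrable_pieces:
  fixes F :: "real^'n \<Rightarrow> 'b::euclidean_space"
  assumes F: "\<And>T. T \<in> \<T> \<Longrightarrow> integrable (MT T) F"
  shows "integrable M F" "(LINT x|M. F x) = (\<Sum>T\<in>\<T>. LINT x|MT T. F x)"
proof -
  have "F \<in> borel_measurable M" using F by (intro measurable_pieces) auto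
  then have m: "(\<lambda>x. indicator \<Omega> x *\<^sub>R F x) \<in> borel_measurable lebesgue"
    by (simp add: borel_measurable_restrict_space_iff)
  have i: "integrable lebesgue (\<lambda>x. indicator (interior T) x *\<^sub>R F x)" if "T \<in> \<T>" for T
    using F[OF that] by (simp add: integrable_restrict_space)
  then have s: "integrable lebesgue (\<lambda>x. \<Sum>T\<in>\<T>. indicator (interior T) x *\<^sub>R F x)"
    by (rule Bochner_Integration.integrable_sum)
  have ae: "AE x in lebesgue. (\<Sum>T\<in>\<T>. indicator (interior T) x *\<^sub>R F x) = indicator \<Omega> x *\<^sub>R F x"
    using indicator_pieces[of F] by eventually_elim simp
  have "integrable lebesgue (\<lambda>x. indicator \<Omega> x *\<^sub>R F x)"
    by (rule integrable_cong_AE_imp[OF s m]) (use ae in \<open>eventually_elim, simp\<close>)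
  then show "integrable M F" by (simp add: integrable_restrict_space)
  have "(LINT x|M. F x) = (LINT x|lebesgue. indicator \<Omega> x *\<^sub>R F x)"
    by (simp add: integral_restrict_space)
  also have "\<dots> = (LINT x|lebesgue. (\<Sum>T\<in>\<T>. indicator (interior T) x *\<^sub>R F x))"
    by (rule integral_cong_AE[OF m]) (use s ae in \<open>auto elim: eventually_mono\<close>)
  also have "\<dots> = (\<Sum>T\<in>\<T>. LINT x|lebesgue. indicator (interior T) x *\<^sub>R F x)"
    by (rule Bochner_Integration.integral_sum[OF i])
  also have "\<dots> = (\<Sum>T\<in>\<T>. LINT x|MT T. F x)"
    by (simp add: integral_restrict_space)
  finally show "(LINT x|M. F x) = (\<Sum>T\<in>\<T>. LINT x|MT T. F x)" .
qed

lemma integrable_piece: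
  fixes F :: "real^'n \<Rightarrow> 'b::euclidean_space"
  assumes "integrable M F" "T \<in> \<T>"
  shows "integrable (MT T) F"
proof -
  have "integrable lebesgue (\<lambda>x. indicator (interior T) x *\<^sub>R (indicator \<Omega> x *\<^sub>R F x))"
    using assms(1) by (intro integrable_mult_indicator[of "interior T" lebesgue]) (simp_all add: integrable_restrict_space)
  moreover have "(\<lambda>x. indicator (interior T) x *\<^sub>R (indicator \<Omega> x *\<^sub>R F x)) = (\<lambda>x. indicator (interior T) x *\<^sub>R F x)"
    using interiorT_subset[OF assms(2)] by (auto simp: fun_eq_iff split: split_indicator)
  ultimately show ?thesis by (simp add: integrable_restrict_space)
qed

lemma integral_pieces:
  fixes F :: "real^'n \<Rightarrow> 'b::euclidean_space"
  assumes "integrable M F"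
  shows "(LINT x|M. F x) = (\<Sum>T\<in>\<T>. LINT x|MT T. F x)"
  by (rule integrable_pieces(2)) (rule integrable_piece[OF assms])

lemma L2_pieces:
  fixes F :: "real^'n \<Rightarrow> 'b::euclidean_space"
  assumes "\<And>T. T \<in> \<T> \<Longrightarrow> F \<in> L2 (MT T)"
  shows "F \<in> L2 M"
  using assms by (intro L2I measurable_pieces integrable_pieces) (auto simp: L2_def)

lemma L2_norm_pieces:
  fixes F :: "real^'n \<Rightarrow> 'b::euclidean_space"
  assumes "F \<in> L2 M"
  shows "(L2_norm M F)\<^sup>2 = (\<Sum>T\<in>\<T>. (L2_norm (MT T) F)\<^sup>2)"
  unfolding L2_norm_sq by (rule integral_pieces[OF L2_integrable_sq[OF assms]])

lemma pw_grad_on: "T \<in> \<T> \<Longrightarrow> x \<in> interior T \<Longrightarrow> pw_grad \<T> v x = weak_grad (interior T) v x"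
  unfolding pw_grad_def by (rule sum_indicator_pieces(2))

lemma mesh_size_on: "T \<in> \<T> \<Longrightarrow> x \<in> interior T \<Longrightarrow> mesh_size \<T> x = diameter T"
  unfolding mesh_size_def by (rule sum_indicator_pieces(2))

lemma pw_grad_L2:
  assumes "v \<in> H1_pw \<T>"
  shows "pw_grad \<T> v \<in> L2 M"
proof (rule L2_pieces)
  fix T assume T: "T \<in> \<T>"
  have "weak_grad (interior T) v \<in> L2 (MT T)" using assms T by (auto simp: H1_pw_def intro: H1D)
  then show "pw_grad \<T> v \<in> L2 (MT T)"
    using L2_cong_on[of "MT T" "pw_grad \<T> v" "weak_grad (interior T) v"] pw_grad_on[OF T] by simp
qed

lemma H1_imp_H1_pw:
  assumes v: "v \<in> H1 \<Omega>"
  shows "v \<in> H1_pw \<T>" "\<And>T. T \<in> \<T> \<Longrightarrow> AE x in MT T. weak_grad (interior T) v x = weak_grad \<Omega> v x"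
    "AE x in M. pw_grad \<T> v x = weak_grad \<Omega> v x"
proof -
  have *: "v \<in> H1 (interior T) \<and> (AE x in MT T. weak_grad (interior T) v x = weak_grad \<Omega> v x)" if T: "T \<in> \<T>" for T
  proof -
    note l = L2_piece[OF H1D(1)[OF v] T] L2_piece[OF H1D(2)[OF v] T]
      has_weak_grad_restrict[OF H1D(3)[OF v] interiorT_subset[OF T] domain_sets]
    show ?thesis
      using H1I[OF l(1,2)] weak_grad_AE_eq[OF open_interior bounded_interiorT[OF T] l(1,2)] l(3) by auto
  qed
  then show "v \<in> H1_pw \<T>" "\<And>T. T \<in> \<T> \<Longrightarrow> AE x in MT T. weak_grad (interior T) v x = weak_grad \<Omega> v x"
    by (auto simp: H1_pw_def)
  show "AE x in M. pw_grad \<T> v x = weak_grad \<Omega> v x"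
  proof (rule AE_pieces)
    fix T assume T: "T \<in> \<T>"
    have "AE x in MT T. x \<in> interior T" by (rule AE_I2) simp
    then show "AE x in MT T. pw_grad \<T> v x = weak_grad \<Omega> v x"
      using *[OF T, THEN conjunct2] by eventually_elim (simp add: pw_grad_on[OF T])
  qed
qed

section \<open>Piecewise affine and Crouzeix--Raviart functions\<close>

definition affine_data :: "(real^'n \<Rightarrow> real) \<Rightarrow> ((real^'n) set \<Rightarrow> real^'n) \<Rightarrow> ((real^'n) set \<Rightarrow> real) \<Rightarrow> bool" where
  "affine_data v a c \<longleftrightarrow> (\<forall>T\<in>\<T>. \<forall>x\<in>interior T. v x = a T \<bullet> x + c T)"

lemma P1_affine_data:
  assumes "v \<in> P1 \<T>"
  obtains a c where "affine_data v a c"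
  using assms unfolding P1_def affine_data_def mem_Collect_eq by metis

lemma affine_data_P1: "affine_data v a c \<Longrightarrow> v \<in> P1 \<T>"
  unfolding P1_def affine_data_def by blast

lemma affine_data_piece:
  assumes d: "affine_data v a c" and T: "T \<in> \<T>"
  shows "v \<in> H1 (interior T)" "AE x in MT T. weak_grad (interior T) v x = a T" "v \<in> L2 (MT T)"
    "AE x in MT T. pw_grad \<T> v x = a T"
proof -
  have v: "v x = a T \<bullet> x + c T" if "x \<in> interior T" for x
    using d T that by (auto simp: affine_data_def)
  note C = C1_H1[OF open_interior bounded_interiorT[OF T] has_C1_grad_affine[of "a T" "c T"]]
  show H: "v \<in> H1 (interior T)" using weak_grad_cong(3)[of "interior T" v "\<lambda>x. a T \<bullet> x + c T"] v C by simp
  then show "v \<in> L2 (MT T)" by (rule H1D)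
  have "weak_grad (interior T) v = weak_grad (interior T) (\<lambda>x. a T \<bullet> x + c T)"
    by (rule weak_grad_cong(2)) (rule v)
  then show w: "AE x in MT T. weak_grad (interior T) v x = a T" using C(2) by simp
  have "AE x in MT T. x \<in> interior T" by (rule AE_I2) simp
  then show "AE x in MT T. pw_grad \<T> v x = a T"
    using w by eventually_elim (simp add: pw_grad_on[OF T])
qed

lemma affine_data_L2:
  assumes "affine_data v a c"
  shows "v \<in> L2 M" "v \<in> H1_pw \<T>" "pw_grad \<T> v \<in> L2 M"
  using affine_data_piece[OF assms] by (auto intro!: L2_pieces pw_grad_L2 simp: H1_pw_def)

lemma one_sided_value_affine:
  assumes d: "affine_data v a c" and T: "T \<in> \<T>" and x: "x \<in> T"
  shows "one_sided_value T v x = a T \<bullet> x + c T"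
  unfolding one_sided_value_def
proof (rule tendsto_Lim)
  have "x islimpt interior T"
  proof (cases "x \<in> interior T")
    case True
    then show ?thesis by (simp add: interior_limit_point)
  next
    case False
    then show ?thesis using x closure_interiorT[OF T] by (auto simp: closure_def)
  qed
  then show "\<not> trivial_limit (at x within interior T)" by (simp add: trivial_limit_within)
  have "((\<lambda>y. a T \<bullet> y + c T) \<longlongrightarrow> a T \<bullet> x + c T) (at x within interior T)"
    by (intro tendsto_intros)
  then show "(v \<longlongrightarrow> a T \<bullet> x + c T) (at x within interior T)"
    by (rule Lim_transform_eventually)
       (use d T in \<open>auto simp: affine_data_def eventually_at_filter\<close>)
qed

lemma barycenter_in_facet:
  assumes "T \<in> \<T>" "E facet_of T"
  shows "barycenter E \<in> T"
proof -
  obtain C P \<nu> \<beta> where f: "simplex_facet C P \<nu> \<beta>" "T = convex hull C" "E = convex hull (C - {P})"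
    using facet_data[OF assms] by metis
  interpret simplex_facet C P \<nu> \<beta> by (rule f)
  show ?thesis using barycenter_in_E E_subset_T f by auto
qed

text \<open>The barycentre of a facet lies in the closure of the interior of T, so the one-sided
  limit there is the value of the affine piece. Membership becomes a condition on the
  coefficients.\<close>

lemma CR10_iff:
  assumes d: "affine_data v a c"
  shows "v \<in> CR10 \<Omega> \<T> \<longleftrightarrow>
    (\<forall>T\<in>\<T>. \<forall>T'\<in>\<T>. \<forall>E. E facet_of T \<and> E facet_of T' \<and> \<not> E \<subseteq> frontier \<Omega> \<longrightarrow>
      a T \<bullet> barycenter E + c T = a T' \<bullet> barycenter E + c T') \<and>
    (\<forall>T\<in>\<T>. \<forall>E. E facet_of T \<and> E \<subseteq> frontier \<Omega> \<longrightarrow> a T \<bullet> barycenter E + c T = 0)"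
proof -
  have val: "one_sided_value T v (barycenter E) = a T \<bullet> barycenter E + c T" if "T \<in> \<T>" "E facet_of T" for T E
    using one_sided_value_affine[OF d that(1)] barycenter_in_facet[OF that] by simp
  have "(\<forall>E\<in>sides \<T>. \<not> E \<subseteq> frontier \<Omega> \<longrightarrow> (\<forall>T\<in>\<T>. \<forall>T'\<in>\<T>. E facet_of T \<and> E facet_of T' \<longrightarrow>
        one_sided_value T v (barycenter E) = one_sided_value T' v (barycenter E)))
    \<longleftrightarrow> (\<forall>T\<in>\<T>. \<forall>T'\<in>\<T>. \<forall>E. E facet_of T \<and> E facet_of T' \<and> \<not> E \<subseteq> frontier \<Omega> \<longrightarrow>
      a T \<bullet> barycenter E + c T = a T' \<bullet> barycenter E + c T')" (is "?L1 \<longleftrightarrow> ?R1")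
  proof (intro iffI ballI allI impI)
    fix T T' E assume L: "?L1" and T: "T \<in> \<T>" "T' \<in> \<T>" and E: "E facet_of T \<and> E facet_of T' \<and> \<not> E \<subseteq> frontier \<Omega>"
    have "E \<in> sides \<T>" unfolding sides_def using T E by blast
    then have "one_sided_value T v (barycenter E) = one_sided_value T' v (barycenter E)"
      using L[rule_format, of E T T'] T E by blast
    then show "a T \<bullet> barycenter E + c T = a T' \<bullet> barycenter E + c T'"
      using val[OF T(1) E[THEN conjunct1]] val[OF T(2) E[THEN conjunct2, THEN conjunct1]] by argo
  next
    fix E T T' assume R: "?R1" and F: "\<not> E \<subseteq> frontier \<Omega>" and T: "T \<in> \<T>" "T' \<in> \<T>" and E: "E facet_of T \<and> E facet_of T'"
    have "a T \<bullet> barycenter E + c T = a T' \<bullet> barycenter E + c T'"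
      using R[rule_format, of T T' E] F T E by blast
    then show "one_sided_value T v (barycenter E) = one_sided_value T' v (barycenter E)"
      using val[OF T(1) E[THEN conjunct1]] val[OF T(2) E[THEN conjunct2]] by argo
  qed
  moreover have "(\<forall>E\<in>sides \<T>. E \<subseteq> frontier \<Omega> \<longrightarrow> (\<forall>T\<in>\<T>. E facet_of T \<longrightarrow> one_sided_value T v (barycenter E) = 0))
    \<longleftrightarrow> (\<forall>T\<in>\<T>. \<forall>E. E facet_of T \<and> E \<subseteq> frontier \<Omega> \<longrightarrow> a T \<bullet> barycenter E + c T = 0)" (is "?L2 \<longleftrightarrow> ?R2")
  proof (intro iffI ballI allI impI)
    fix T E assume L: "?L2" and T: "T \<in> \<T>" and E: "E facet_of T \<and> E \<subseteq> frontier \<Omega>"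
    have "E \<in> sides \<T>" unfolding sides_def using T E by blast
    then have "one_sided_value T v (barycenter E) = 0"
      using L[rule_format, of E T] T E by blast
    then show "a T \<bullet> barycenter E + c T = 0"
      using val[OF T E[THEN conjunct1]] by argo
  next
    fix E T assume R: "?R2" and F: "E \<subseteq> frontier \<Omega>" and T: "T \<in> \<T>" and E: "E facet_of T"
    have "a T \<bullet> barycenter E + c T = 0" using R[rule_format, of T E] F T E by blast
    then show "one_sided_value T v (barycenter E) = 0" using val[OF T E] by argo
  qed
  ultimately show ?thesis
    unfolding CR10_def mem_Collect_eq using affine_data_P1[OF d] by (simp only: simp_thms)
qed

text \<open>Over a side an affine function integrates to the area times its barycentre value. On an
  interior side the two barycentre values agree while the outer normals are opposite, and on a
  boundary side the value is 0; so the double sum over simplices and facets vanishes once it is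
  rearranged by sides.\<close>

lemma skeleton_pairing_CR10:
  assumes v: "v \<in> CR10 \<Omega> \<T>"
  shows "skeleton_pairing \<T> (embed_P0 \<mu> s) v = 0"
proof -
  have "v \<in> P1 \<T>" using v by (simp add: CR10_def)
  then obtain a c where d: "affine_data v a c" by (rule P1_affine_data)
  note CR = v[unfolded CR10_iff[OF d]]
  define X where "X T E = (outer_normal T E \<bullet> \<mu> E) * s E * (measure lborel (slab E) * (a T \<bullet> barycenter E + c T))" for T E
  have pair: "(LINT x|side_measure E. ((outer_normal T E \<bullet> \<mu> E) * s E) * trace_on T v x) = X T E"
    if TE: "T \<in> \<T>" "E facet_of T" for T E
  proof -
    obtain C P \<nu> \<beta> where f: "simplex_facet C P \<nu> \<beta>" "T = convex hull C" "E = convex hull (C - {P})"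
      using facet_data[OF TE] by metis
    show ?thesis unfolding X_def
      by (rule integral_trace_affine[OF f]) (use d TE in \<open>auto simp: affine_data_def\<close>)
  qed
  have zero: "(\<Sum>T | T \<in> \<T> \<and> E facet_of T. X T E) = 0" for E
  proof (cases "E \<subseteq> frontier \<Omega>")
    case True
    then show ?thesis using CR by (intro sum.neutral) (auto simp: X_def)
  next
    case False
    show ?thesis
    proof (cases "\<exists>T\<in>\<T>. E facet_of T")
      case ex: True
      then obtain T1 where T1: "T1 \<in> \<T>" "E facet_of T1" by blast
      obtain T2 where T2: "T2 \<in> \<T>" "T2 \<noteq> T1" "E facet_of T2"
        using second_neighbour[OF T1 False] by blast
      have set: "{T. T \<in> \<T> \<and> E facet_of T} = {T1, T2}"
        using T1 T2 at_most_two[of T1 T2 _ E] by blast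
      obtain C1 Q1 \<nu>1 \<beta>1 where 1: "simplex_facet C1 Q1 \<nu>1 \<beta>1" "T1 = convex hull C1" "E = convex hull (C1 - {Q1})"
        using facet_data[OF T1] by metis
      obtain C2 Q2 \<nu>2 \<beta>2 where 2: "simplex_facet C2 Q2 \<nu>2 \<beta>2" "T2 = convex hull C2" "E = convex hull (C2 - {Q2})"
        using facet_data[OF T2(1,3)] by metis
      have "outer_normal T2 E = - outer_normal T1 E"
        using opposite_normals[OF T1(1) T2(1) T2(2)[symmetric] 1 2]
          simplex_facet.outer_normal_eq[OF 1(1)] simplex_facet.outer_normal_eq[OF 2(1)] 1 2 by metis
      moreover have "a T1 \<bullet> barycenter E + c T1 = a T2 \<bullet> barycenter E + c T2"
        using CR T1 T2 False by blast
      ultimately have "X T1 E + X T2 E = 0" by (simp add: X_def)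
      then show ?thesis unfolding set using T2(2) by simp
    next
      case False
      then show ?thesis by (intro sum.neutral) auto
    qed
  qed
  have fin: "finite (sides \<T>)"
  proof -
    have "sides \<T> = (\<Union>T\<in>\<T>. {E. E facet_of T})" by (auto simp: sides_def)
    moreover have "finite {E. E facet_of T}" if "T \<in> \<T>" for T
      by (rule finite_polytope_facets[OF simplex_imp_polytope[OF simplexT[OF that]]])
    ultimately show ?thesis using finite_triangulation by simp
  qed
  have "skeleton_pairing \<T> (embed_P0 \<mu> s) v = (\<Sum>T\<in>\<T>. \<Sum>E | E facet_of T. X T E)"
    unfolding skeleton_pairing_def embed_P0_def by (intro sum.cong refl pair) simp_all
  also have "\<dots> = (\<Sum>T\<in>\<T>. \<Sum>E | E \<in> sides \<T> \<and> E facet_of T. X T E)"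
    by (intro sum.cong) (auto simp: sides_def)
  also have "\<dots> = (\<Sum>E\<in>sides \<T>. \<Sum>T | T \<in> \<T> \<and> E facet_of T. X T E)"
    by (rule sum.swap_restrict[OF finite_triangulation fin])
  also have "\<dots> = 0" by (simp add: zero)
  finally show ?thesis .
qed

section \<open>The dual norm of the residual\<close>

lemma CR10_zero: "(\<lambda>x. 0) \<in> CR10 \<Omega> \<T>"
proof -
  have "affine_data (\<lambda>x. 0) (\<lambda>T. 0) (\<lambda>T. 0)" by (simp add: affine_data_def)
  from CR10_iff[OF this] show ?thesis by simp
qed

lemma CR10_cmult:
  assumes "v \<in> CR10 \<Omega> \<T>"
  shows "(\<lambda>x. k * v x) \<in> CR10 \<Omega> \<T>" "AE x in M. pw_grad \<T> (\<lambda>x. k * v x) x = k *\<^sub>R pw_grad \<T> v x"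
    "v \<in> L2 M" "pw_grad \<T> v \<in> L2 M"
proof -
  have "v \<in> P1 \<T>" using assms by (simp add: CR10_def)
  then obtain a c where d: "affine_data v a c" by (rule P1_affine_data)
  have d': "affine_data (\<lambda>x. k * v x) (\<lambda>T. k *\<^sub>R a T) (\<lambda>T. k * c T)"
    using d by (auto simp: affine_data_def algebra_simps)
  have e: "(k *\<^sub>R a T) \<bullet> y + k * c T = k * (a T \<bullet> y + c T)" for T y by (simp add: algebra_simps)
  show "(\<lambda>x. k * v x) \<in> CR10 \<Omega> \<T>"
    unfolding CR10_iff[OF d'] e using assms[unfolded CR10_iff[OF d]] by (metis mult_zero_right)
  show "v \<in> L2 M" "pw_grad \<T> v \<in> L2 M" using affine_data_L2[OF d] by auto
  show "AE x in M. pw_grad \<T> (\<lambda>x. k * v x) x = k *\<^sub>R pw_grad \<T> v x"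
  proof (rule AE_pieces)
    fix T assume T: "T \<in> \<T>"
    show "AE x in MT T. pw_grad \<T> (\<lambda>x. k * v x) x = k *\<^sub>R pw_grad \<T> v x"
      using affine_data_piece(4)[OF d T] affine_data_piece(4)[OF d' T] by eventually_elim simp
  qed
qed

text \<open>A supremum of reals is informative only for sets bounded above, so \<open>bound\<close>
  comes first; homogeneity then extends the estimate from the unit ball to all v. S stands for the
  flux of the discrete gradient, and the formula for R is the residual after the pairing with the
  sides has vanished.\<close>

lemma residual_bound:
  fixes f :: "real^'n \<Rightarrow> real" and S :: "real^'n \<Rightarrow> real^'n"
  assumes f: "f \<in> L2 M" and S: "S \<in> L2 M"
    and R: "\<And>v. v \<in> CR10 \<Omega> \<T> \<Longrightarrow> R v = (LINT x|M. f x * v x) - (LINT x|M. S x \<bullet> pw_grad \<T> v x)"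
  shows "0 \<le> CR_dual_norm \<Omega> \<T> R"
    and "v \<in> CR10 \<Omega> \<T> \<Longrightarrow> R v \<le> CR_dual_norm \<Omega> \<T> R * Y_norm \<Omega> \<T> v"
proof -
  have Y: "L2_norm M v \<le> Y_norm \<Omega> \<T> v" "L2_norm M (pw_grad \<T> v) \<le> Y_norm \<Omega> \<T> v" for v
    by (auto simp: Y_norm_def real_le_rsqrt)
  have bound: "\<bar>R v\<bar> \<le> (L2_norm M f + L2_norm M S) * Y_norm \<Omega> \<T> v" if v: "v \<in> CR10 \<Omega> \<T>" for v
  proof -
    have "\<bar>LINT x|M. f x * v x\<bar> \<le> L2_norm M f * L2_norm M v"
      using L2_Cauchy_Schwarz[OF f CR10_cmult(3)[OF v]] by (simp add: inner_real_def)
    moreover have "\<bar>LINT x|M. S x \<bullet> pw_grad \<T> v x\<bar> \<le> L2_norm M S * L2_norm M (pw_grad \<T> v)"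
      by (rule L2_Cauchy_Schwarz[OF S CR10_cmult(4)[OF v]])
    moreover have "L2_norm M f * L2_norm M v \<le> L2_norm M f * Y_norm \<Omega> \<T> v"
      "L2_norm M S * L2_norm M (pw_grad \<T> v) \<le> L2_norm M S * Y_norm \<Omega> \<T> v"
      using Y by (auto intro: mult_left_mono)
    ultimately show ?thesis unfolding R[OF v] by (simp add: distrib_right)
  qed
  let ?S = "{v \<in> CR10 \<Omega> \<T>. Y_norm \<Omega> \<T> v \<le> 1}"
  have bdd: "bdd_above (R ` ?S)"
  proof (rule bdd_aboveI2)
    fix v assume v: "v \<in> ?S"
    have "R v \<le> (L2_norm M f + L2_norm M S) * Y_norm \<Omega> \<T> v" using bound[of v] v by simp
    also have "\<dots> \<le> (L2_norm M f + L2_norm M S) * 1" using v by (intro mult_left_mono) auto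
    finally show "R v \<le> L2_norm M f + L2_norm M S" by simp
  qed
  have up: "R v \<le> CR_dual_norm \<Omega> \<T> R" if "v \<in> ?S" for v
    unfolding CR_dual_norm_def by (rule cSUP_upper[OF that bdd])
  have Yh: "Y_norm \<Omega> \<T> (\<lambda>x. k * v x) = \<bar>k\<bar> * Y_norm \<Omega> \<T> v" if v: "v \<in> CR10 \<Omega> \<T>" for k v
  proof -
    have "L2_norm M (pw_grad \<T> (\<lambda>x. k * v x)) = L2_norm M (\<lambda>x. k *\<^sub>R pw_grad \<T> v x)"
      using CR10_cmult(4)[OF CR10_cmult(1)[OF v]] L2_scaleR[OF CR10_cmult(4)[OF v]] CR10_cmult(2)[OF v]
      by (intro L2_norm_cong_AE L2_measurable)
    then show ?thesis
      using L2_norm_scaleR[of M k v] L2_norm_scaleR[of M k "pw_grad \<T> v"]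
      by (simp add: Y_norm_def power_mult_distrib real_sqrt_mult flip: distrib_left)
  qed
  have Rh: "R (\<lambda>x. k * v x) = k * R v" if v: "v \<in> CR10 \<Omega> \<T>" for k v
  proof -
    have "(LINT x|M. S x \<bullet> pw_grad \<T> (\<lambda>x. k * v x) x) = (LINT x|M. k * (S x \<bullet> pw_grad \<T> v x))"
    proof (rule integral_cong_AE)
      have [measurable]: "S \<in> borel_measurable M" "pw_grad \<T> v \<in> borel_measurable M"
        "pw_grad \<T> (\<lambda>x. k * v x) \<in> borel_measurable M"
        using S CR10_cmult(4)[OF v] CR10_cmult(4)[OF CR10_cmult(1)[OF v]] by (auto intro: L2_measurable)
      show "(\<lambda>x. S x \<bullet> pw_grad \<T> (\<lambda>x. k * v x) x) \<in> borel_measurable M"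
        "(\<lambda>x. k * (S x \<bullet> pw_grad \<T> v x)) \<in> borel_measurable M" by measurable
      show "AE x in M. S x \<bullet> pw_grad \<T> (\<lambda>x. k * v x) x = k * (S x \<bullet> pw_grad \<T> v x)"
        using CR10_cmult(2)[OF v, of k] by eventually_elim simp
    qed
    moreover have "(LINT x|M. f x * (k * v x)) = k * (LINT x|M. f x * v x)"
      by (simp add: mult.left_commute flip: integral_mult_right_zero)
    ultimately show ?thesis by (simp add: R[OF v] R[OF CR10_cmult(1)[OF v]] right_diff_distrib)
  qed
  have "R (\<lambda>x. 0) = 0" using Rh[OF CR10_zero, of 0] by simp
  moreover have "Y_norm \<Omega> \<T> (\<lambda>x. 0) = 0" using Yh[OF CR10_zero, of 0] by simp
  ultimately show pos: "0 \<le> CR_dual_norm \<Omega> \<T> R" using up[of "\<lambda>x. 0"] CR10_zero by simp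
  show "R v \<le> CR_dual_norm \<Omega> \<T> R * Y_norm \<Omega> \<T> v" if v: "v \<in> CR10 \<Omega> \<T>"
  proof (cases "Y_norm \<Omega> \<T> v = 0")
    case True
    then show ?thesis using bound[OF v] by simp
  next
    case False
    have "Y_norm \<Omega> \<T> v \<ge> 0" by (simp add: Y_norm_def)
    then have y: "Y_norm \<Omega> \<T> v > 0" using False by simp
    have "R (\<lambda>x. inverse (Y_norm \<Omega> \<T> v) * v x) \<le> CR_dual_norm \<Omega> \<T> R"
      by (rule up) (use CR10_cmult(1)[OF v] Yh[OF v] y in simp)
    then have "inverse (Y_norm \<Omega> \<T> v) * R v \<le> CR_dual_norm \<Omega> \<T> R" by (simp only: Rh[OF v])
    then show ?thesis using y by (simp add: field_simps)
  qed
qed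

end

section \<open>The nonlinearity\<close>

text \<open>The derivative of t (\<phi> t - \<gamma>1) is \<phi> t + t \<phi>' t - \<gamma>1,
  nonnegative by the bounds on \<phi>. These concern positive t only, so s = 0 is separate and uses
  \<phi> t \<ge> \<gamma>1.\<close>

lemma nonlinearity_shifted_mono:
  assumes \<phi>: "nonlinearity \<phi> \<gamma>1 \<gamma>2" and st: "0 \<le> s" "s \<le> t"
  shows "s * (\<phi> s - \<gamma>1) \<le> t * (\<phi> t - \<gamma>1)"
proof (cases "s = 0")
  case True
  then show ?thesis using \<phi> st by (simp add: nonlinearity_def)
next
  case False
  have D: "(\<phi> has_real_derivative deriv \<phi> r) (at r)" if "r > 0" for r
  proof -
    obtain D where "\<forall>x\<in>{0<..}. (\<phi> has_vector_derivative D x) (at x)"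
      using \<phi> by (auto simp: nonlinearity_def C1_differentiable_on_def)
    then have "(\<phi> has_real_derivative D r) (at r)"
      using that by (simp add: has_real_derivative_iff_has_vector_derivative)
    then show ?thesis using DERIV_imp_deriv by metis
  qed
  show ?thesis
  proof (rule DERIV_nonneg_imp_nondecreasing[OF st(2)])
    fix r assume r: "s \<le> r" "r \<le> t"
    then have r0: "r > 0" using st False by simp
    have "((\<lambda>r. r * (\<phi> r - \<gamma>1)) has_real_derivative (\<phi> r - \<gamma>1 + r * deriv \<phi> r)) (at r)"
      by (auto intro!: derivative_eq_intros D[OF r0])
    moreover have "\<gamma>1 \<le> \<phi> r + r * deriv \<phi> r" using \<phi> r0 unfolding nonlinearity_def by blast
    then have "0 \<le> \<phi> r - \<gamma>1 + r * deriv \<phi> r" by linarith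
    ultimately show "\<exists>y. ((\<lambda>r. r * (\<phi> r - \<gamma>1)) has_real_derivative y) (at r) \<and> 0 \<le> y" by blast
  qed
qed

text \<open>Subtracting \<gamma>1 times the identity leaves a radial field with the nonnegative
  factor \<phi> - \<gamma>1. By Cauchy--Schwarz for A \<bullet> B, its monotonicity reduces to that
  of t (\<phi> t - \<gamma>1) on the half line.\<close>

lemma flux_monotone:
  fixes A B :: "'a::euclidean_space"
  assumes \<phi>: "nonlinearity \<phi> \<gamma>1 \<gamma>2"
  shows "\<gamma>1 * (norm (A - B))\<^sup>2 \<le> (flux \<phi> A - flux \<phi> B) \<bullet> (A - B)"
proof -
  define a b where "a = norm A" and "b = norm B"
  define p q where "p = \<phi> a - \<gamma>1" and "q = \<phi> b - \<gamma>1"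
  have ab: "0 \<le> a" "0 \<le> b" by (auto simp: a_def b_def)
  have pq: "0 \<le> p" "0 \<le> q" using \<phi> ab by (auto simp: nonlinearity_def p_def q_def)
  have AA: "A \<bullet> A = a\<^sup>2" "B \<bullet> B = b\<^sup>2" by (simp_all add: a_def b_def power2_norm_eq_inner)
  have "(flux \<phi> A - flux \<phi> B) \<bullet> (A - B) - \<gamma>1 * (norm (A - B))\<^sup>2
      = p * a\<^sup>2 + q * b\<^sup>2 - (p + q) * (A \<bullet> B)"
    unfolding power2_norm_eq_inner
    by (simp add: flux_def p_def q_def inner_diff_left inner_diff_right AA inner_commute[of B A] algebra_simps
        flip: a_def b_def)
  moreover have "(p + q) * (A \<bullet> B) \<le> (p + q) * (a * b)"
    using pq norm_cauchy_schwarz[of A B] by (intro mult_left_mono) (auto simp: a_def b_def)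
  moreover have "0 \<le> (a * p - b * q) * (a - b)"
  proof (cases "a \<le> b")
    case True
    then have "a * p \<le> b * q" using nonlinearity_shifted_mono[OF \<phi> ab(1) True] by (simp add: p_def q_def)
    then show ?thesis using True by (simp add: mult_nonpos_nonpos)
  next
    case False
    then have "b * q \<le> a * p" using nonlinearity_shifted_mono[OF \<phi> ab(2), of a] by (simp add: p_def q_def)
    then show ?thesis using False by simp
  qed
  moreover have "(a * p - b * q) * (a - b) = p * a\<^sup>2 + q * b\<^sup>2 - (p + q) * (a * b)"
    by (simp add: algebra_simps power2_eq_square)
  ultimately show ?thesis by linarith
qed

text \<open>The bound \<gamma>2 gives linear growth, and the C^1 property gives
  measurability.\<close>

lemma flux_L2:
  fixes G :: "'a \<Rightarrow> 'b::euclidean_space"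
  assumes \<phi>: "nonlinearity \<phi> \<gamma>1 \<gamma>2" and C1: "C1_map (flux \<phi> :: 'b \<Rightarrow> 'b)" and G: "G \<in> L2 M"
  shows "(\<lambda>x. flux \<phi> (G x)) \<in> L2 M"
proof (rule L2_bounded_by[OF G])
  have "continuous_on UNIV (flux \<phi> :: 'b \<Rightarrow> 'b)"
    using C1 unfolding C1_map_def
    by (meson continuous_at_imp_continuous_on has_derivative_continuous)
  then have "(flux \<phi> :: 'b \<Rightarrow> 'b) \<in> borel_measurable borel" by (rule borel_measurable_continuous_onI)
  then show "(\<lambda>x. flux \<phi> (G x)) \<in> borel_measurable M"
    using L2_measurable[OF G] by (rule measurable_compose[rotated])
  show "norm (flux \<phi> (G x)) \<le> \<gamma>2 * norm (G x)" for x
  proof -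
    have "0 < \<gamma>1" "\<gamma>1 \<le> \<phi> (norm (G x))" "\<phi> (norm (G x)) \<le> \<gamma>2" using \<phi> by (auto simp: nonlinearity_def)
    then show ?thesis by (simp add: flux_def mult_right_mono)
  qed
qed

section \<open>Nonconforming interpolation\<close>

context triangulated_domain
begin

definition centroid :: "(real^'n) set \<Rightarrow> real^'n" where
  "centroid T = (\<Sum>z | z extreme_point_of T. z) /\<^sub>R real (Suc CARD('n))"

definition mean_grad :: "(real^'n \<Rightarrow> real) \<Rightarrow> (real^'n) set \<Rightarrow> real^'n" where
  "mean_grad w T = (LINT x|MT T. grad w x) /\<^sub>R measure lebesgue (interior T)"

text \<open>The value at the centroid. The second term corrects the mean of w so that the values at
  the barycentres of all facets become the facet means; \<open>facet_mean_eq_affine\<close> dictates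
  it.\<close>

definition interp_const :: "(real^'n \<Rightarrow> real) \<Rightarrow> (real^'n) set \<Rightarrow> real" where
  "interp_const w T = (LINT x|MT T. w x) / measure lebesgue (interior T)
    + (LINT x|MT T. grad w x \<bullet> (x - centroid T)) / (real CARD('n) * measure lebesgue (interior T))"

definition interp :: "(real^'n \<Rightarrow> real) \<Rightarrow> real^'n \<Rightarrow> real" where
  "interp w x = (\<Sum>T\<in>\<T>. if x \<in> interior T then mean_grad w T \<bullet> (x - centroid T) + interp_const w T else 0)"

lemma interp_data:
  "affine_data (interp w) (mean_grad w) (\<lambda>T. interp_const w T - mean_grad w T \<bullet> centroid T)"
  unfolding affine_data_def interp_def
  by (intro ballI, subst sum_indicator_pieces(2)) (auto simp: inner_diff_right)

lemma measure_interior_pos: "T \<in> \<T> \<Longrightarrow> 0 < measure lebesgue (interior T)"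
proof -
  assume T: "T \<in> \<T>"
  have lm: "interior T \<in> lmeasurable" by (rule bounded_set_imp_lmeasurable) (auto simp: bounded_interiorT[OF T])
  have "\<not> negligible (interior T)" using open_not_negligible[OF open_interior interiorT_nonempty[OF T]] .
  then show ?thesis using negligible_iff_measure0[OF lm] by (simp add: zero_less_measure_iff)
qed

lemma interp_barycenter:
  assumes T: "T \<in> \<T>" and f: "simplex_facet C P \<nu> \<beta>" "T = convex hull C" "E = convex hull (C - {P})"
    and w: "smooth w"
  shows "mean_grad w T \<bullet> barycenter E + (interp_const w T - mean_grad w T \<bullet> centroid T) = facet_mean T P w (grad w)"
proof -
  interpret f: simplex_facet C P \<nu> \<beta> by (rule f)
  note C1 = smooth_has_C1_grad[OF w]
  have [measurable]: "w \<in> borel_measurable borel" "grad w \<in> borel_measurable borel"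
    using has_C1_grad_measurable[OF C1] by auto
  \<comment> \<open>The interpolant is built from integrals over the open simplex,
    \<open>facet_mean\<close> from integrals over the closed one; the frontier is a null
    set.\<close>
  have conv: "(LINT x|MT T. F x) = (LINT x|lborel. indicator (convex hull C) x *\<^sub>R F x)"
    if [measurable]: "F \<in> borel_measurable borel" for F :: "real^'n \<Rightarrow> 'b::euclidean_space"
  proof -
    have "(LINT x|MT T. F x) = (LINT x|lborel. indicator (interior T) x *\<^sub>R F x)"
      by (rule integral_lebesgue_on_borel) auto
    also have "\<dots> = (LINT x|lborel. indicator (convex hull C) x *\<^sub>R F x)"
    proof (rule integral_cong_AE)
      show "AE x in lborel. indicator (interior T) x *\<^sub>R F x = indicator (convex hull C) x *\<^sub>R F x"
        using f.interior_T_AE unfolding f(2) by eventually_elim (simp add: indicator_def)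
      have [measurable]: "interior T \<in> sets borel" by simp
      show "(\<lambda>x. indicator (interior T) x *\<^sub>R F x) \<in> borel_measurable lborel"
        "(\<lambda>x. indicator (convex hull C) x *\<^sub>R F x) \<in> borel_measurable lborel" by measurable
    qed
    finally show ?thesis .
  qed
  have ext: "{z. z extreme_point_of T} = C"
    unfolding f(2) using extreme_point_of_convex_hull_affine_independent[OF f.indep] by simp
  have cent: "centroid T = (\<Sum>z\<in>C. z) /\<^sub>R real (Suc DIM(real^'n))" by (simp add: centroid_def ext)
  define A where "A = measure lborel T"
  have meas: "measure lebesgue (interior T) = A"
  proof -
    have "measure lebesgue (interior T) = (LINT x|MT T. 1)" by (simp add: measure_restrict_space)
    also have "\<dots> = A" using conv[of "\<lambda>_. 1::real"] by (simp add: A_def f(2))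
    finally show ?thesis .
  qed
  have fm: "facet_mean T P w (grad w) = ((LINT x|lborel. indicator T x *\<^sub>R grad w x) /\<^sub>R A) \<bullet> (barycenter E - centroid T)
    + (LINT x|lborel. indicator T x * w x) / A
    + (LINT x|lborel. indicator T x * (grad w x \<bullet> (x - centroid T))) / (real DIM(real^'n) * A)"
    using f.facet_mean_eq_affine[OF C1] unfolding A_def f(2,3) cent[unfolded f(2)] .
  have "mean_grad w T = (LINT x|lborel. indicator T x *\<^sub>R grad w x) /\<^sub>R A"
    using conv[of "grad w"] by (simp add: mean_grad_def meas flip: f(2))
  moreover have "interp_const w T = (LINT x|lborel. indicator T x * w x) / A
    + (LINT x|lborel. indicator T x * (grad w x \<bullet> (x - centroid T))) / (real DIM(real^'n) * A)"
  proof -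
    have "(LINT x|MT T. w x) = (LINT x|lborel. indicator T x * w x)"
      using conv[of w] by (simp flip: f(2))
    moreover have "(LINT x|MT T. grad w x \<bullet> (x - centroid T)) = (LINT x|lborel. indicator T x * (grad w x \<bullet> (x - centroid T)))"
      using conv[of "\<lambda>x. grad w x \<bullet> (x - centroid T)"] by (simp flip: f(2) add: inner_diff_right)
    ultimately show ?thesis by (simp add: interp_const_def meas)
  qed
  ultimately show ?thesis unfolding fm by (simp only: inner_diff_right)
qed

text \<open>The barycentre values are facet means. These agree from both sides of an interior side
  and vanish on a boundary side, where w is 0.\<close>

lemma interp_CR10:
  assumes w: "w \<in> test_functions \<Omega>"
  shows "interp w \<in> CR10 \<Omega> \<T>"
  unfolding CR10_iff[OF interp_data]
proof (intro conjI ballI allI impI)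
  note wD = test_functionsD[OF w]
  fix T T' E
  assume T: "T \<in> \<T>" "T' \<in> \<T>" and E: "E facet_of T \<and> E facet_of T' \<and> \<not> E \<subseteq> frontier \<Omega>"
  obtain C P \<nu> \<beta> where 1: "simplex_facet C P \<nu> \<beta>" "T = convex hull C" "E = convex hull (C - {P})"
    using facet_data[of T E] T E by metis
  obtain C' P' \<nu>' \<beta>' where 2: "simplex_facet C' P' \<nu>' \<beta>'" "T' = convex hull C'" "E = convex hull (C' - {P'})"
    using facet_data[of T' E] T E by metis
  show "mean_grad w T \<bullet> barycenter E + (interp_const w T - mean_grad w T \<bullet> centroid T)
    = mean_grad w T' \<bullet> barycenter E + (interp_const w T' - mean_grad w T' \<bullet> centroid T')"
    unfolding interp_barycenter[OF T(1) 1 wD(1)] interp_barycenter[OF T(2) 2 wD(1)]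
    unfolding 1(2) 2(2)
    by (rule facet_mean_neighbours[OF 1(1) 2(1) _ wD(4)]) (use 1(3) 2(3) in simp)
next
  note wD = test_functionsD[OF w]
  fix T E
  assume T: "T \<in> \<T>" and E: "E facet_of T \<and> E \<subseteq> frontier \<Omega>"
  obtain C P \<nu> \<beta> where 1: "simplex_facet C P \<nu> \<beta>" "T = convex hull C" "E = convex hull (C - {P})"
    using facet_data[of T E] T E by metis
  have "w x = 0" if "x \<in> E" for x
  proof -
    have "x \<notin> \<Omega>" using that E open_domain by (auto simp: frontier_def interior_open)
    then have "x \<notin> closure {x. w x \<noteq> 0}" using wD(3) by blast
    then show ?thesis by (rule wD(5))
  qed
  then show "mean_grad w T \<bullet> barycenter E + (interp_const w T - mean_grad w T \<bullet> centroid T) = 0"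
    unfolding interp_barycenter[OF T 1 wD(1)] unfolding 1(2)
    using simplex_facet.facet_mean_zero[OF 1(1) wD(4)] 1(3) by simp
qed

section \<open>Stability and error of the interpolation\<close>

lemma L2_norm_const_MT:
  fixes c :: "'b::euclidean_space"
  assumes "T \<in> \<T>"
  shows "(\<lambda>x. c) \<in> L2 (MT T)" "L2_norm (MT T) (\<lambda>x. c) = norm c * sqrt (measure lebesgue (interior T))"
  using finite_MT[OF assms] 
  by (auto intro: L2_bounded_measurable simp: L2_norm_def measure_restrict_space real_sqrt_mult mult.commute)

text \<open>Pair the gradient with its own mean, which is its orthogonal projection to the constant
  fields, and cancel one factor.\<close>

lemma interp_gradient:
  assumes T: "T \<in> \<T>" and w: "smooth w"
  shows "norm (mean_grad w T) * sqrt (measure lebesgue (interior T)) \<le> L2_norm (MT T) (grad w)"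
proof -
  let ?A = "measure lebesgue (interior T)"
  let ?G = "mean_grad w T"
  have A: "?A > 0" by (rule measure_interior_pos[OF T])
  note C = C1_H1[OF open_interior bounded_interiorT[OF T] smooth_has_C1_grad[OF w]]
  have "?G \<bullet> ?G * ?A = (LINT x|MT T. grad w x) \<bullet> ?G" using A by (simp add: mean_grad_def)
  also have "\<dots> = (LINT x|MT T. grad w x \<bullet> ?G)"
    using L2_integrable[OF finite_MT[OF T] C(4)] by simp
  also have "\<dots> \<le> L2_norm (MT T) (grad w) * (norm ?G * sqrt ?A)"
    using L2_Cauchy_Schwarz[OF C(4) L2_norm_const_MT(1)[OF T, of ?G]] by (simp add: L2_norm_const_MT(2)[OF T])
  finally have "(norm ?G * sqrt ?A) * (norm ?G * sqrt ?A) \<le> L2_norm (MT T) (grad w) * (norm ?G * sqrt ?A)"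
    using A by (simp add: dot_square_norm power2_eq_square algebra_simps)
  then show ?thesis
    using A by (cases "norm ?G = 0") (auto simp: mult_le_cancel_right)
qed

lemma dist_le_diameter: "T \<in> \<T> \<Longrightarrow> x \<in> T \<Longrightarrow> y \<in> T \<Longrightarrow> dist x y \<le> diameter T"
  using diameter_bounded_bound[OF boundedT] by blast

lemma centroid_in: assumes T: "T \<in> \<T>" shows "centroid T \<in> T"
proof -
  obtain C where C: "finite C" "\<not> affine_dependent C" "int (card C) = int CARD('n) + 1" "T = convex hull C"
    using simplexT[OF T] by (auto simp: simplex)
  have ext: "{z. z extreme_point_of T} = C"
    unfolding C(4) using extreme_point_of_convex_hull_affine_independent[OF C(2)] by simp
  have card: "card C = Suc CARD('n)" using C(3) by simp
  have "(\<Sum>z\<in>C. (1 / real (Suc CARD('n))) *\<^sub>R z) \<in> convex hull C"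
    by (rule convex_sum[OF C(1) convex_convex_hull]) (use card in \<open>auto simp: hull_inc\<close>)
  moreover have "centroid T = (\<Sum>z\<in>C. (1 / real (Suc CARD('n))) *\<^sub>R z)"
    unfolding centroid_def ext by (simp add: scaleR_sum_right divide_inverse)
  ultimately show ?thesis by (simp only: C(4))
qed

text \<open>The error on T consists of w - m, the linear term around the centroid and the constant
  K. In units of the diameter times the norm of the gradient, Poincare's inequality bounds the first
  by 2^n, stability of the mean gradient the second by 1, and Cauchy--Schwarz the third by
  1.\<close>

lemma interp_estimate:
  assumes T: "T \<in> \<T>" and w: "smooth w"
  shows "L2_norm (MT T) (\<lambda>x. w x - interp w x) \<le> (2 ^ CARD('n) + 2) * diameter T * L2_norm (MT T) (grad w)"
    "(\<lambda>x. w x - interp w x) \<in> L2 (MT T)"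
proof -
  let ?A = "measure lebesgue (interior T)"
  let ?G = "mean_grad w T"
  let ?g = "L2_norm (MT T) (grad w)"
  let ?h = "diameter T"
  define m where "m = (LINT x|MT T. w x) / ?A"
  define K where "K = (LINT x|MT T. grad w x \<bullet> (x - centroid T)) / (real CARD('n) * ?A)"
  have A: "?A > 0" by (rule measure_interior_pos[OF T])
  have h0: "?h \<ge> 0" by (rule diameter_ge_0[OF boundedT[OF T]])
  note C = C1_H1[OF open_interior bounded_interiorT[OF T] smooth_has_C1_grad[OF w]]
  have xc: "norm (x - centroid T) \<le> ?h" if "x \<in> interior T" for x
    using dist_le_diameter[OF T _ centroid_in[OF T]] that interior_subset[of T] by (auto simp: dist_norm)
  have cL: "(\<lambda>x. x - centroid T) \<in> L2 (MT T)"
    by (rule continuous_bounded_L2) (auto intro!: continuous_intros bounded_interiorT[OF T])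
  have cN: "L2_norm (MT T) (\<lambda>x. x - centroid T) \<le> ?h * sqrt ?A"
  proof (rule power2_le_imp_le)
    have "(L2_norm (MT T) (\<lambda>x. x - centroid T))\<^sup>2 \<le> (LINT x|MT T. ?h\<^sup>2)"
      unfolding L2_norm_sq
    proof (rule integral_mono)
      show "integrable (MT T) (\<lambda>x. (norm (x - centroid T))\<^sup>2)" by (rule L2_integrable_sq[OF cL])
      show "integrable (MT T) (\<lambda>x. ?h\<^sup>2)" using finite_MT[OF T] by (simp add: finite_measure.integrable_const)
      show "(norm (x - centroid T))\<^sup>2 \<le> ?h\<^sup>2" if "x \<in> space (MT T)" for x
        using xc[of x] that by (intro power_mono) auto
    qed
    then show "(L2_norm (MT T) (\<lambda>x. x - centroid T))\<^sup>2 \<le> (?h * sqrt ?A)\<^sup>2"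
      by (simp add: power_mult_distrib measure_restrict_space mult.commute)
  qed (use h0 in auto)
  have GL: "(\<lambda>x. ?G \<bullet> (x - centroid T)) \<in> L2 (MT T)"
    using L2_inner_const[OF cL, of ?G] by (simp add: inner_commute)
  have GN: "L2_norm (MT T) (\<lambda>x. ?G \<bullet> (x - centroid T)) \<le> ?h * ?g"
  proof -
    have "L2_norm (MT T) (\<lambda>x. ?G \<bullet> (x - centroid T)) \<le> L2_norm (MT T) (\<lambda>x. norm ?G * ?h)"
    proof (rule power2_le_imp_le)
      show "(L2_norm (MT T) (\<lambda>x. ?G \<bullet> (x - centroid T)))\<^sup>2 \<le> (L2_norm (MT T) (\<lambda>x. norm ?G * ?h))\<^sup>2"
        unfolding L2_norm_sq
      proof (rule integral_mono)
        show "integrable (MT T) (\<lambda>x. (norm (?G \<bullet> (x - centroid T)))\<^sup>2)" by (rule L2_integrable_sq[OF GL])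
        show "integrable (MT T) (\<lambda>x. (norm (norm ?G * ?h))\<^sup>2)"
          by (rule L2_integrable_sq[OF L2_norm_const_MT(1)[OF T]])
        show "(norm (?G \<bullet> (x - centroid T)))\<^sup>2 \<le> (norm (norm ?G * ?h))\<^sup>2" if "x \<in> space (MT T)" for x
        proof (rule power_mono)
          have "norm (?G \<bullet> (x - centroid T)) \<le> norm ?G * norm (x - centroid T)"
            by (simp add: Cauchy_Schwarz_ineq2)
          also have "\<dots> \<le> norm ?G * ?h" using xc[of x] that by (intro mult_left_mono) auto
          finally show "norm (?G \<bullet> (x - centroid T)) \<le> norm (norm ?G * ?h)" using h0 by simp
        qed simp
      qed
    qed simp
    also have "\<dots> = ?h * (norm ?G * sqrt ?A)"
      using h0 by (simp add: L2_norm_const_MT(2)[OF T])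
    also have "\<dots> \<le> ?h * ?g" by (intro mult_left_mono interp_gradient[OF T w] h0)
    finally show ?thesis .
  qed
  have KN: "L2_norm (MT T) (\<lambda>x. K) \<le> ?h * ?g"
  proof -
    have "\<bar>LINT x|MT T. grad w x \<bullet> (x - centroid T)\<bar> \<le> ?g * (?h * sqrt ?A)"
      using L2_Cauchy_Schwarz[OF C(4) cL] cN mult_left_mono[OF cN L2_norm_nonneg[of "MT T" "grad w"]]
      by linarith
    then have "\<bar>K\<bar> \<le> ?g * (?h * sqrt ?A) / (real CARD('n) * ?A)"
      using A by (simp add: K_def abs_mult divide_right_mono)
    \<comment> \<open>The factor 1/n from the facet mean is bounded by 1.\<close>
    also have "\<dots> \<le> ?g * (?h * sqrt ?A) / (1 * ?A)"
      using A h0 by (intro divide_left_mono mult_right_mono) (auto simp: Suc_leI)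
    finally have "\<bar>K\<bar> * sqrt ?A \<le> ?g * (?h * sqrt ?A) / ?A * sqrt ?A"
      using A by (intro mult_right_mono) auto
    also have "\<dots> = ?h * ?g" using A by (simp add: field_simps)
    finally show ?thesis by (simp add: L2_norm_const_MT(2)[OF T])
  qed
  have mL: "(\<lambda>x. w x - m) \<in> L2 (MT T)" by (rule L2_diff[OF C(3) L2_norm_const_MT(1)[OF T]])
  have mN: "L2_norm (MT T) (\<lambda>x. w x - m) \<le> 2 ^ CARD('n) * (?h * ?g)"
  proof (rule power2_le_imp_le)
    have "(L2_norm (MT T) (\<lambda>x. w x - m))\<^sup>2 \<le> 2 ^ DIM(real^'n) * ?h\<^sup>2 * ?g\<^sup>2"
      unfolding m_def
    proof (rule Poincare_convex[OF open_interior bounded_interiorT[OF T] _ interiorT_nonempty[OF T] _ smooth_has_C1_grad[OF w]])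
      show "convex (interior T)" using convexT[OF T] by (rule convex_interior)
      show "dist x y \<le> ?h" if "x \<in> interior T" "y \<in> interior T" for x y
        using dist_le_diameter[OF T] that interior_subset by blast
    qed
    \<comment> \<open>Enlarging 2^n to its square avoids the root 2^(n/2) in the constant.\<close>
    also have "\<dots> \<le> (2 ^ CARD('n))\<^sup>2 * ?h\<^sup>2 * ?g\<^sup>2"
    proof (intro mult_right_mono)
      have "(1::real) \<le> 2 ^ CARD('n)" by simp
      then show "2 ^ DIM(real^'n) \<le> ((2::real) ^ CARD('n))\<^sup>2" by (simp add: power2_eq_square)
    qed auto
    finally show "(L2_norm (MT T) (\<lambda>x. w x - m))\<^sup>2 \<le> (2 ^ CARD('n) * (?h * ?g))\<^sup>2"
      by (simp only: power_mult_distrib mult.assoc)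
  qed (use h0 in auto)
  have GK: "(\<lambda>x. ?G \<bullet> (x - centroid T) + K) \<in> L2 (MT T)"
    by (rule L2_add[OF GL L2_norm_const_MT(1)[OF T]])
  have on: "w x - interp w x = (w x - m) - (?G \<bullet> (x - centroid T) + K)" if "x \<in> interior T" for x
  proof -
    have "interp w x = ?G \<bullet> (x - centroid T) + interp_const w T"
      unfolding interp_def by (rule sum_indicator_pieces(2)[OF T that])
    moreover have "interp_const w T = m + K" by (simp add: interp_const_def m_def K_def)
    ultimately show ?thesis by simp
  qed
  show "(\<lambda>x. w x - interp w x) \<in> L2 (MT T)"
    using L2_cong_on[of "MT T" "\<lambda>x. w x - interp w x" "\<lambda>x. (w x - m) - (?G \<bullet> (x - centroid T) + K)"]
      L2_diff[OF mL GK] on by simp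
  have "L2_norm (MT T) (\<lambda>x. w x - interp w x) = L2_norm (MT T) (\<lambda>x. (w x - m) - (?G \<bullet> (x - centroid T) + K))"
    unfolding L2_norm_def by (intro arg_cong[where f = sqrt] Bochner_Integration.integral_cong) (auto simp: on)
  also have "\<dots> \<le> L2_norm (MT T) (\<lambda>x. w x - m) + L2_norm (MT T) (\<lambda>x. ?G \<bullet> (x - centroid T) + K)"
    by (rule L2_norm_triangle_diff[OF mL GK])
  also have "L2_norm (MT T) (\<lambda>x. ?G \<bullet> (x - centroid T) + K) \<le> L2_norm (MT T) (\<lambda>x. ?G \<bullet> (x - centroid T)) + L2_norm (MT T) (\<lambda>x. K)"
    by (rule L2_norm_triangle[OF GL L2_norm_const_MT(1)[OF T]])
  finally have "L2_norm (MT T) (\<lambda>x. w x - interp w x) \<le> 2 ^ CARD('n) * (?h * ?g) + (?h * ?g + ?h * ?g)"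
    using mN GN KN by linarith
  also have "\<dots> = (2 ^ CARD('n) + 2) * ?h * ?g" by (simp add: algebra_simps)
  finally show "L2_norm (MT T) (\<lambda>x. w x - interp w x) \<le> (2 ^ CARD('n) + 2) * diameter T * L2_norm (MT T) (grad w)" .
qed

lemma diameterT_le: "T \<in> \<T> \<Longrightarrow> diameter T \<le> diameter \<Omega>"
  using diameter_subset[of T "closure \<Omega>"] UnionT bounded_domain
  by (auto simp: diameter_closure)

lemma mesh_L2:
  assumes f: "f \<in> L2 M"
  shows "(\<lambda>x. mesh_size \<T> x * f x) \<in> L2 M"
    "(L2_norm M (\<lambda>x. mesh_size \<T> x * f x))\<^sup>2 = (\<Sum>T\<in>\<T>. (diameter T * L2_norm (MT T) f)\<^sup>2)"
proof -
  have on: "mesh_size \<T> x * f x = diameter T *\<^sub>R f x" if "T \<in> \<T>" "x \<in> interior T" for T x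
    using mesh_size_on[OF that] by simp
  show L: "(\<lambda>x. mesh_size \<T> x * f x) \<in> L2 M"
  proof (rule L2_pieces)
    fix T assume T: "T \<in> \<T>"
    show "(\<lambda>x. mesh_size \<T> x * f x) \<in> L2 (MT T)"
      using L2_cong_on[of "MT T" "\<lambda>x. mesh_size \<T> x * f x" "\<lambda>x. diameter T *\<^sub>R f x"]
        L2_scaleR[OF L2_piece[OF f T]] on[OF T] by simp
  qed
  have "L2_norm (MT T) (\<lambda>x. mesh_size \<T> x * f x) = diameter T * L2_norm (MT T) f" if T: "T \<in> \<T>" for T
  proof -
    have "L2_norm (MT T) (\<lambda>x. mesh_size \<T> x * f x) = L2_norm (MT T) (\<lambda>x. diameter T *\<^sub>R f x)"
      unfolding L2_norm_def
      by (intro arg_cong[where f = sqrt] Bochner_Integration.integral_cong) (auto simp: mesh_size_on[OF T])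
    then show ?thesis using L2_norm_scaleR[of "MT T" "diameter T" f] diameter_ge_0[OF boundedT[OF T]] by simp
  qed
  then show "(L2_norm M (\<lambda>x. mesh_size \<T> x * f x))\<^sup>2 = (\<Sum>T\<in>\<T>. (diameter T * L2_norm (MT T) f)\<^sup>2)"
    unfolding L2_norm_pieces[OF L] by (intro sum.cong) auto
qed

lemma interp_L2:
  assumes w: "w \<in> test_functions \<Omega>"
  shows "w \<in> L2 M" "grad w \<in> L2 M" "interp w \<in> L2 M" "pw_grad \<T> (interp w) \<in> L2 M"
  using test_functions_L2[OF w domain_sets bounded_domain] affine_data_L2[OF interp_data, of w] by auto

lemma interp_error:
  assumes w: "w \<in> test_functions \<Omega>"
  shows "L2_norm M (\<lambda>x. w x - interp w x) \<le> (2 ^ CARD('n) + 2) * diameter \<Omega> * L2_norm M (grad w)"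
proof (rule power2_le_imp_le)
  let ?k = "(2 ^ CARD('n) + 2) * diameter \<Omega>"
  have d0: "diameter \<Omega> \<ge> 0" by (rule diameter_ge_0[OF bounded_domain])
  note L = interp_L2[OF w]
  have "(L2_norm M (\<lambda>x. w x - interp w x))\<^sup>2 = (\<Sum>T\<in>\<T>. (L2_norm (MT T) (\<lambda>x. w x - interp w x))\<^sup>2)"
    by (rule L2_norm_pieces[OF L2_diff[OF L(1,3)]])
  also have "\<dots> \<le> (\<Sum>T\<in>\<T>. (?k * L2_norm (MT T) (grad w))\<^sup>2)"
  proof (intro sum_mono power_mono)
    fix T assume T: "T \<in> \<T>"
    have "L2_norm (MT T) (\<lambda>x. w x - interp w x) \<le> (2 ^ CARD('n) + 2) * diameter T * L2_norm (MT T) (grad w)"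
      by (rule interp_estimate(1)[OF T test_functionsD(1)[OF w]])
    also have "\<dots> \<le> ?k * L2_norm (MT T) (grad w)"
      by (intro mult_right_mono mult_left_mono diameterT_le[OF T]) auto
    finally show "L2_norm (MT T) (\<lambda>x. w x - interp w x) \<le> ?k * L2_norm (MT T) (grad w)" .
  qed simp
  also have "\<dots> = (?k * L2_norm M (grad w))\<^sup>2"
    by (simp add: power_mult_distrib L2_norm_pieces[OF L(2)] sum_distrib_left)
  finally show "(L2_norm M (\<lambda>x. w x - interp w x))\<^sup>2 \<le> (?k * L2_norm M (grad w))\<^sup>2" .
  show "0 \<le> ?k * L2_norm M (grad w)" using d0 by simp
qed

lemma interp_pw_grad:
  assumes w: "w \<in> test_functions \<Omega>"
  shows "L2_norm M (pw_grad \<T> (interp w)) \<le> L2_norm M (grad w)"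
proof (rule power2_le_imp_le)
  note L = interp_L2[OF w]
  have "(L2_norm (MT T) (pw_grad \<T> (interp w)))\<^sup>2 \<le> (L2_norm (MT T) (grad w))\<^sup>2" if T: "T \<in> \<T>" for T
  proof (rule power_mono)
    have "L2_norm (MT T) (pw_grad \<T> (interp w)) = L2_norm (MT T) (\<lambda>x. mean_grad w T)"
      using L2_measurable[OF L2_piece[OF L(4) T]] L2_measurable[OF L2_norm_const_MT(1)[OF T]]
        affine_data_piece(4)[OF interp_data[of w] T]
      by (rule L2_norm_cong_AE)
    then show "L2_norm (MT T) (pw_grad \<T> (interp w)) \<le> L2_norm (MT T) (grad w)"
      using interp_gradient[OF T test_functionsD(1)[OF w]] by (simp add: L2_norm_const_MT(2)[OF T])
  qed simp
  then show "(L2_norm M (pw_grad \<T> (interp w)))\<^sup>2 \<le> (L2_norm M (grad w))\<^sup>2"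
    unfolding L2_norm_pieces[OF L(4)] L2_norm_pieces[OF L(2)] by (rule sum_mono)
qed simp

text \<open>The diameter of T is kept with f when Cauchy--Schwarz is applied to the sum over the
  simplices; this produces the mesh-weighted norm of f.\<close>

lemma interp_load:
  assumes w: "w \<in> test_functions \<Omega>" and f: "f \<in> L2 M"
  shows "(LINT x|M. f x * (w x - interp w x))
    \<le> (2 ^ CARD('n) + 2) * L2_norm M (\<lambda>x. mesh_size \<T> x * f x) * L2_norm M (grad w)"
proof -
  let ?k = "(2::real) ^ CARD('n) + 2"
  note L = interp_L2[OF w]
  have "(LINT x|M. f x * (w x - interp w x)) = (\<Sum>T\<in>\<T>. LINT x|MT T. f x * (w x - interp w x))"
    by (rule integral_pieces[OF L2_mult_integrable[OF f L2_diff[OF L(1,3)]]])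
  also have "\<dots> \<le> (\<Sum>T\<in>\<T>. ?k * ((diameter T * L2_norm (MT T) f) * L2_norm (MT T) (grad w)))"
  proof (rule sum_mono)
    fix T assume T: "T \<in> \<T>"
    have "(LINT x|MT T. f x * (w x - interp w x)) \<le> L2_norm (MT T) f * L2_norm (MT T) (\<lambda>x. w x - interp w x)"
      using L2_Cauchy_Schwarz[OF L2_piece[OF f T] L2_piece[OF L2_diff[OF L(1,3)] T]]
      by (simp add: inner_real_def abs_le_iff)
    also have "\<dots> \<le> L2_norm (MT T) f * (?k * diameter T * L2_norm (MT T) (grad w))"
      by (intro mult_left_mono interp_estimate(1)[OF T test_functionsD(1)[OF w]]) simp
    finally show "(LINT x|MT T. f x * (w x - interp w x)) \<le> ?k * ((diameter T * L2_norm (MT T) f) * L2_norm (MT T) (grad w))"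
      by (simp only: mult_ac)
  qed
  also have "\<dots> = ?k * (\<Sum>T\<in>\<T>. (diameter T * L2_norm (MT T) f) * L2_norm (MT T) (grad w))"
    by (simp only: sum_distrib_left)
  also have "\<dots> \<le> ?k * (L2_norm M (\<lambda>x. mesh_size \<T> x * f x) * L2_norm M (grad w))"
  proof (rule mult_left_mono[OF power2_le_imp_le])
    show "(\<Sum>T\<in>\<T>. (diameter T * L2_norm (MT T) f) * L2_norm (MT T) (grad w))\<^sup>2
      \<le> (L2_norm M (\<lambda>x. mesh_size \<T> x * f x) * L2_norm M (grad w))\<^sup>2"
      using Cauchy_Schwarz_ineq_sum[of "\<lambda>T. diameter T * L2_norm (MT T) f" "\<lambda>T. L2_norm (MT T) (grad w)" \<T>]
      by (simp only: power_mult_distrib[of "L2_norm M _"] mesh_L2(2)[OF f] L2_norm_pieces[OF L(2)])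
  qed simp_all
  finally show ?thesis by (simp add: mult.assoc)
qed

lemma interp_flux:
  fixes S :: "real^'n \<Rightarrow> real^'n"
  assumes w: "w \<in> test_functions \<Omega>" and S: "S \<in> L2 M"
    and const: "\<And>T. T \<in> \<T> \<Longrightarrow> \<exists>c. AE x in MT T. S x = c"
  shows "(LINT x|M. S x \<bullet> pw_grad \<T> (interp w) x) = (LINT x|M. S x \<bullet> grad w x)"
proof -
  note L = interp_L2[OF w]
  have "(LINT x|MT T. S x \<bullet> pw_grad \<T> (interp w) x) = (LINT x|MT T. S x \<bullet> grad w x)" if T: "T \<in> \<T>" for T
  proof -
    obtain c where c: "AE x in MT T. S x = c" using const[OF T] by blast
    have [measurable]: "S \<in> borel_measurable (MT T)" "grad w \<in> borel_measurable (MT T)"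
      "pw_grad \<T> (interp w) \<in> borel_measurable (MT T)"
      using L2_piece[OF S T] L2_piece[OF L(2) T] L2_piece[OF L(4) T] by (auto intro: L2_measurable)
    have "(LINT x|MT T. S x \<bullet> pw_grad \<T> (interp w) x) = (LINT x|MT T. c \<bullet> mean_grad w T)"
    proof (rule integral_cong_AE)
      show "AE x in MT T. S x \<bullet> pw_grad \<T> (interp w) x = c \<bullet> mean_grad w T"
        using c affine_data_piece(4)[OF interp_data[of w] T] by eventually_elim simp
    qed measurable
    also have "\<dots> = c \<bullet> (LINT x|MT T. grad w x)"
      using measure_interior_pos[OF T] by (simp add: mean_grad_def measure_restrict_space)
    also have "\<dots> = (LINT x|MT T. c \<bullet> grad w x)"
      using L2_integrable[OF finite_MT[OF T] L2_piece[OF L(2) T]] by simp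
    also have "\<dots> = (LINT x|MT T. S x \<bullet> grad w x)"
    proof (rule integral_cong_AE)
      show "AE x in MT T. c \<bullet> grad w x = S x \<bullet> grad w x" using c by eventually_elim simp
    qed measurable
    finally show ?thesis .
  qed
  then show ?thesis
    unfolding integral_pieces[OF L2_inner_integrable[OF S L(4)]] integral_pieces[OF L2_inner_integrable[OF S L(2)]]
    by (intro sum.cong) auto
qed

section \<open>From test functions to the error estimate\<close>

lemma residual_test_function:
  fixes S :: "real^'n \<Rightarrow> real^'n"
  assumes w: "w \<in> test_functions \<Omega>" and f: "f \<in> L2 M" and S: "S \<in> L2 M"
    and const: "\<And>T. T \<in> \<T> \<Longrightarrow> \<exists>c. AE x in MT T. S x = c"
    and R: "\<And>v. v \<in> CR10 \<Omega> \<T> \<Longrightarrow> R v = (LINT x|M. f x * v x) - (LINT x|M. S x \<bullet> pw_grad \<T> v x)"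
  shows "(LINT x|M. f x * w x) - (LINT x|M. S x \<bullet> grad w x)
    \<le> (CR_dual_norm \<Omega> \<T> R * ((2 ^ CARD('n) + 4) * (diameter \<Omega> + 1))
        + (2 ^ CARD('n) + 2) * L2_norm M (\<lambda>x. mesh_size \<T> x * f x)) * L2_norm M (grad w)"
proof -
  let ?k = "(2::real) ^ CARD('n) + 2"
  \<comment> \<open>Friedrichs' inequality asks for a positive length strictly above all distances
    in \<Omega>; hence the added 1.\<close>
  let ?D = "diameter \<Omega> + 1"
  let ?g = "L2_norm M (grad w)"
  note L = interp_L2[OF w]
  have d0: "diameter \<Omega> \<ge> 0" by (rule diameter_ge_0[OF bounded_domain])
  have Fr: "L2_norm M w \<le> ?D * ?g"
  proof (rule Friedrichs[OF open_domain bounded_domain _ _ w])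
    show "?D > 0" using d0 by simp
    show "dist x y < ?D" if "x \<in> \<Omega>" "y \<in> \<Omega>" for x y
      using diameter_bounded_bound[OF bounded_domain that] by simp
  qed
  have "interp w = (\<lambda>x. w x - (w x - interp w x))" by auto
  then have "L2_norm M (interp w) \<le> L2_norm M w + L2_norm M (\<lambda>x. w x - interp w x)"
    using L2_norm_triangle_diff[OF L(1) L2_diff[OF L(1,3)]] by simp
  also have "\<dots> \<le> ?D * ?g + ?k * diameter \<Omega> * ?g" by (intro add_mono Fr interp_error[OF w])
  finally have iN: "L2_norm M (interp w) \<le> ?D * ?g + ?k * diameter \<Omega> * ?g" .
  have "Y_norm \<Omega> \<T> (interp w) \<le> L2_norm M (interp w) + L2_norm M (pw_grad \<T> (interp w))"
    unfolding Y_norm_def by (rule sqrt_sum_squares_le_sum) auto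
  also have "\<dots> \<le> (?D * ?g + ?k * diameter \<Omega> * ?g) + ?g" by (intro add_mono iN interp_pw_grad[OF w])
  also have "\<dots> \<le> ((2 ^ CARD('n) + 4) * ?D) * ?g"
  proof -
    \<comment> \<open>The three terms stem from Friedrichs' inequality, the interpolation error and
      the piecewise gradient; the right-hand side is a common bound in product form.\<close>
    have "?D + ?k * diameter \<Omega> + 1 \<le> (2 ^ CARD('n) + 4) * ?D"
      using d0 by (simp add: algebra_simps)
    from mult_right_mono[OF this, of ?g] show ?thesis by (simp add: algebra_simps)
  qed
  finally have Y: "Y_norm \<Omega> \<T> (interp w) \<le> ((2 ^ CARD('n) + 4) * ?D) * ?g" .
  note rb = residual_bound[OF f S R]
  have "(LINT x|M. f x * w x) = (LINT x|M. f x * interp w x) + (LINT x|M. f x * (w x - interp w x))"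
    using L2_mult_integrable[OF f L(1)] L2_mult_integrable[OF f L(3)] by (simp add: right_diff_distrib)
  then have "(LINT x|M. f x * w x) - (LINT x|M. S x \<bullet> grad w x)
      = R (interp w) + (LINT x|M. f x * (w x - interp w x))"
    using R[OF interp_CR10[OF w]] interp_flux[OF w S const] by simp
  also have "\<dots> \<le> CR_dual_norm \<Omega> \<T> R * (((2 ^ CARD('n) + 4) * ?D) * ?g)
      + ?k * L2_norm M (\<lambda>x. mesh_size \<T> x * f x) * ?g"
  proof (rule add_mono)
    have "R (interp w) \<le> CR_dual_norm \<Omega> \<T> R * Y_norm \<Omega> \<T> (interp w)"
      by (rule rb(2)[OF _ interp_CR10[OF w]])
    also have "\<dots> \<le> CR_dual_norm \<Omega> \<T> R * (((2 ^ CARD('n) + 4) * ?D) * ?g)"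
      by (rule mult_left_mono[OF Y rb(1)])
    finally show "R (interp w) \<le> CR_dual_norm \<Omega> \<T> R * (((2 ^ CARD('n) + 4) * ?D) * ?g)" .
  qed (rule interp_load[OF w f])
  finally show ?thesis by (simp add: algebra_simps)
qed

text \<open>Green's formulas on the simplices add up to the integral of q \<bullet> \<nabla>e + (div
  q) e over \<Omega>, because the local weak derivatives are restrictions of the global ones up to
  null sets. This integral is 0 for test functions by definition of the weak divergence, and it
  passes to the limit.\<close>

lemma skeleton_pairing_H10:
  assumes t: "t \<in> H_minus_half_skeleton \<Omega> \<T>" and e: "e \<in> H1 \<Omega>"
    and w: "\<And>k. w k \<in> test_functions \<Omega>"
    and lim: "(\<lambda>k. L2_norm M (\<lambda>x. w k x - e x)) \<longlonglongrightarrow> 0"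
      "(\<lambda>k. L2_norm M (\<lambda>x. grad (w k) x - weak_grad \<Omega> e x)) \<longlonglongrightarrow> 0"
  shows "skeleton_pairing \<T> t e = 0"
proof -
  obtain q where q: "q \<in> Hdiv \<Omega>" and tq: "\<And>T v. T \<in> \<T> \<Longrightarrow> v \<in> H1 (interior T) \<Longrightarrow> t T v = normal_trace T q v"
    using t by (auto simp: H_minus_half_skeleton_def)
  note qD = HdivD[OF q] and eD = H1D[OF e]
  let ?F = "\<lambda>x. q x \<bullet> weak_grad \<Omega> e x + weak_div \<Omega> q x * e x"
  have int: "integrable M (\<lambda>x. q x \<bullet> weak_grad \<Omega> e x)" "integrable M (\<lambda>x. weak_div \<Omega> q x * e x)"
    using L2_inner_integrable[OF qD(1) eD(2)] L2_mult_integrable[OF qD(2) eD(1)] by auto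
  have "t T e = (LINT x|MT T. ?F x)" if T: "T \<in> \<T>" for T
  proof -
    have eT: "e \<in> H1 (interior T)" using H1_imp_H1_pw(1)[OF e] T by (simp add: H1_pw_def)
    note b = open_interior bounded_interiorT[OF T]
    have dT: "weak_div \<Omega> q \<in> L2 (MT T)" "has_weak_div (interior T) q (weak_div \<Omega> q)"
      using L2_piece[OF qD(2) T] has_weak_div_restrict[OF qD(3) interiorT_subset[OF T] domain_sets] by auto
    have "weak_div (interior T) q \<in> L2 (MT T) \<and> has_weak_div (interior T) q (weak_div (interior T) q)"
      unfolding weak_div_def by (rule someI[of _ "weak_div \<Omega> q"]) (use dT in simp)
    then have [measurable]: "weak_div (interior T) q \<in> borel_measurable (MT T)" by (auto intro: L2_measurable)
    have [measurable]: "q \<in> borel_measurable (MT T)" "e \<in> borel_measurable (MT T)"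
      "weak_grad (interior T) e \<in> borel_measurable (MT T)" "weak_grad \<Omega> e \<in> borel_measurable (MT T)"
      "weak_div \<Omega> q \<in> borel_measurable (MT T)"
      using L2_piece[OF qD(1) T] L2_piece[OF eD(1) T] H1D(2)[OF eT] L2_piece[OF eD(2) T] dT(1)
      by (auto intro: L2_measurable)
    have "normal_trace T q e = (LINT x|MT T. ?F x)"
      unfolding normal_trace_def
    proof (rule integral_cong_AE)
      show "AE x in MT T. q x \<bullet> weak_grad (interior T) e x + weak_div (interior T) q x * e x = ?F x"
        using H1_imp_H1_pw(2)[OF e T] weak_div_AE_eq[OF b dT] by eventually_elim simp
    qed measurable
    then show ?thesis using tq[OF T eT] by simp
  qed
  then have "skeleton_pairing \<T> t e = (\<Sum>T\<in>\<T>. LINT x|MT T. ?F x)"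
    unfolding skeleton_pairing_def by (rule sum.cong[OF refl])
  also have "\<dots> = (LINT x|M. ?F x)"
    by (rule integral_pieces[symmetric]) (use int in simp)
  also have "\<dots> = (LINT x|M. q x \<bullet> weak_grad \<Omega> e x) + (LINT x|M. weak_div \<Omega> q x * e x)"
    using int by simp
  also have "\<dots> = 0"
  proof -
    note wL = test_functions_L2[OF w domain_sets bounded_domain]
    have "(\<lambda>k. (LINT x|M. q x \<bullet> grad (w k) x) + (LINT x|M. weak_div \<Omega> q x \<bullet> w k x))
      \<longlonglongrightarrow> (LINT x|M. q x \<bullet> weak_grad \<Omega> e x) + (LINT x|M. weak_div \<Omega> q x \<bullet> e x)"
      by (intro tendsto_add L2_inner_tendsto[OF wL(2) eD(2) qD(1) lim(2)] L2_inner_tendsto[OF wL(1) eD(1) qD(2) lim(1)])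
    moreover have "(LINT x|M. q x \<bullet> grad (w k) x) + (LINT x|M. weak_div \<Omega> q x \<bullet> w k x) = 0" for k
      using qD(3)[unfolded has_weak_div_def, rule_format, OF w[of k]] by (simp add: inner_real_def mult.commute)
    ultimately show ?thesis by (simp add: LIMSEQ_const_iff inner_real_def)
  qed
  finally show ?thesis .
qed

lemma error_estimate:
  assumes \<phi>: "nonlinearity \<phi> \<gamma>1 \<gamma>2" and C1: "C1_map (flux \<phi> :: real^'n \<Rightarrow> real^'n)"
    and f: "f \<in> L2 M" and u: "u \<in> H10 \<Omega>" and t: "t \<in> H_minus_half_skeleton \<Omega> \<T>"
    and sol: "\<And>v. v \<in> H1_pw \<T> \<Longrightarrow> b_form \<Omega> \<T> \<phi> u t v = load \<Omega> f v"
    and vC: "vC \<in> S10 \<Omega> \<T>"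
  shows "\<gamma>1 * L2_norm M (weak_grad \<Omega> (\<lambda>x. u x - vC x))
    \<le> CR_dual_norm \<Omega> \<T> (\<lambda>v. load \<Omega> f v - b_form \<Omega> \<T> \<phi> vC (embed_P0 \<mu> s0) v)
        * ((2 ^ CARD('n) + 4) * (diameter \<Omega> + 1))
      + (2 ^ CARD('n) + 2) * L2_norm M (\<lambda>x. mesh_size \<T> x * f x)" (is "_ \<le> ?K")
proof -
  have v10: "vC \<in> H10 \<Omega>" and vP: "vC \<in> P1 \<T>" using vC by (auto simp: S10_def)
  define e where "e = (\<lambda>x. u x - vC x)"
  note uH = H10_H1[OF u] and vH = H10_H1[OF v10]
  note eH = H1_diff[OF open_domain bounded_domain uH vH, folded e_def]
  note eD = H1D[OF eH(1)]
  obtain w where w: "\<And>k. w k \<in> test_functions \<Omega>"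
    and lim: "(\<lambda>k. L2_norm M (\<lambda>x. w k x - e x)) \<longlonglongrightarrow> 0"
      "(\<lambda>k. L2_norm M (\<lambda>x. grad (w k) x - weak_grad \<Omega> e x)) \<longlonglongrightarrow> 0"
    using H10_diff_approx[OF open_domain bounded_domain u v10] unfolding e_def by blast
  note wL = test_functions_L2[OF w domain_sets bounded_domain]
  define S where "S x = flux \<phi> (weak_grad \<Omega> vC x)" for x
  define U where "U x = flux \<phi> (weak_grad \<Omega> u x)" for x
  have SL: "S \<in> L2 M" unfolding S_def by (rule flux_L2[OF \<phi> C1 H1D(2)[OF vH]])
  have UL: "U \<in> L2 M" unfolding U_def by (rule flux_L2[OF \<phi> C1 H1D(2)[OF uH]])
  define R where "R = (\<lambda>v. load \<Omega> f v - b_form \<Omega> \<T> \<phi> vC (embed_P0 \<mu> s0) v)"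
  have R: "R v = (LINT x|M. f x * v x) - (LINT x|M. S x \<bullet> pw_grad \<T> v x)" if "v \<in> CR10 \<Omega> \<T>" for v
    using skeleton_pairing_CR10[OF that] by (simp add: R_def load_def b_form_def S_def)
  \<comment> \<open>On T the gradient of the discrete function is constant almost everywhere, hence
    so is its flux.\<close>
  have const: "\<exists>c. AE x in MT T. S x = c" if T: "T \<in> \<T>" for T
  proof -
    obtain a c where d: "affine_data vC a c" using P1_affine_data[OF vP] .
    have "AE x in MT T. S x = flux \<phi> (a T)"
      using H1_imp_H1_pw(2)[OF vH T] affine_data_piece(2)[OF d T] by eventually_elim (simp add: S_def)
    then show ?thesis by blast
  qed
  let ?n = "L2_norm M (weak_grad \<Omega> e)"
  \<comment> \<open>Needed for the final cancellation: if the gradient of the error has norm 0, the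
    claim is just that the bound is nonnegative.\<close>
  have pos: "0 \<le> ?K"
    using residual_bound(1)[OF f SL R] diameter_ge_0[OF bounded_domain] by (simp add: R_def)
  \<comment> \<open>The equation is tested with the piecewise gradient of e, which agrees with the
    global one almost everywhere.\<close>
  have pw: "(LINT x|M. U x \<bullet> weak_grad \<Omega> e x) = (LINT x|M. f x * e x)"
  proof -
    note epw = H1_imp_H1_pw[OF eH(1)]
    have [measurable]: "U \<in> borel_measurable M" "weak_grad \<Omega> e \<in> borel_measurable M" "pw_grad \<T> e \<in> borel_measurable M"
      using UL eD(2) pw_grad_L2[OF epw(1)] by (auto intro: L2_measurable)
    have "(LINT x|M. U x \<bullet> weak_grad \<Omega> e x) = (LINT x|M. U x \<bullet> pw_grad \<T> e x)"
    proof (rule integral_cong_AE)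
      show "AE x in M. U x \<bullet> weak_grad \<Omega> e x = U x \<bullet> pw_grad \<T> e x"
        using epw(3) by eventually_elim simp
    qed measurable
    also have "\<dots> = (LINT x|M. f x * e x)"
      using sol[OF epw(1)] skeleton_pairing_H10[OF t eH(1) w lim] by (simp add: b_form_def load_def U_def)
    finally show ?thesis .
  qed
  have "\<gamma>1 * ?n\<^sup>2 = (LINT x|M. \<gamma>1 * (norm (weak_grad \<Omega> e x))\<^sup>2)"
    by (simp add: L2_norm_sq)
  also have "\<dots> \<le> (LINT x|M. (U x - S x) \<bullet> weak_grad \<Omega> e x)"
  proof (rule integral_mono_AE)
    show "integrable M (\<lambda>x. \<gamma>1 * (norm (weak_grad \<Omega> e x))\<^sup>2)" using L2_integrable_sq[OF eD(2)] by simp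
    show "integrable M (\<lambda>x. (U x - S x) \<bullet> weak_grad \<Omega> e x)"
      by (rule L2_inner_integrable[OF L2_diff[OF UL SL] eD(2)])
    show "AE x in M. \<gamma>1 * (norm (weak_grad \<Omega> e x))\<^sup>2 \<le> (U x - S x) \<bullet> weak_grad \<Omega> e x"
      using eH(2) by eventually_elim (simp add: U_def S_def flux_monotone[OF \<phi>])
  qed
  also have "\<dots> = (LINT x|M. f x * e x) - (LINT x|M. S x \<bullet> weak_grad \<Omega> e x)"
    using L2_inner_integrable[OF UL eD(2)] L2_inner_integrable[OF SL eD(2)] pw by (simp add: inner_diff_left)
  also have "\<dots> \<le> ?K * ?n"
  proof (rule LIMSEQ_le)
    have "(\<lambda>k. (LINT x|M. f x \<bullet> w k x) - (LINT x|M. S x \<bullet> grad (w k) x))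
      \<longlonglongrightarrow> (LINT x|M. f x \<bullet> e x) - (LINT x|M. S x \<bullet> weak_grad \<Omega> e x)"
      by (intro tendsto_diff L2_inner_tendsto[OF wL(1) eD(1) f lim(1)] L2_inner_tendsto[OF wL(2) eD(2) SL lim(2)])
    then show "(\<lambda>k. (LINT x|M. f x * w k x) - (LINT x|M. S x \<bullet> grad (w k) x))
      \<longlonglongrightarrow> (LINT x|M. f x * e x) - (LINT x|M. S x \<bullet> weak_grad \<Omega> e x)"
      by (simp add: inner_real_def)
    show "(\<lambda>k. ?K * L2_norm M (grad (w k))) \<longlonglongrightarrow> ?K * ?n"
      by (intro tendsto_mult_left L2_norm_tendsto[OF wL(2) eD(2) lim(2)])
    show "\<exists>N. \<forall>k\<ge>N. (LINT x|M. f x * w k x) - (LINT x|M. S x \<bullet> grad (w k) x) \<le> ?K * L2_norm M (grad (w k))"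
      using residual_test_function[OF w f SL const R] by (auto simp: R_def)
  qed
  finally have "\<gamma>1 * ?n * ?n \<le> ?K * ?n" by (simp only: power2_eq_square mult.assoc)
  then have "\<gamma>1 * ?n \<le> ?K"
    using pos L2_norm_nonneg[of M "weak_grad \<Omega> e"]
    by (cases "?n = 0") (auto simp: mult_le_cancel_right less_le)
  then show ?thesis by (simp only: e_def)
qed

end

theorem theorem4p7:
  fixes \<Omega> :: "(real^'n) set" and \<T>\<^sub>0 :: "(real^'n) set set" and \<rho> :: real
  assumes "bounded \<Omega>" and "lipschitz_domain \<Omega>" and "polyhedral_boundary \<Omega>"
    and "regular_triangulation \<Omega> \<T>\<^sub>0" and "\<rho> > 0"
  shows "\<exists>\<kappa>>0. \<exists>C\<^sub>d\<^sub>F>0.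
    \<forall>\<phi> \<gamma>\<^sub>1 \<gamma>\<^sub>2. nonlinearity \<phi> \<gamma>\<^sub>1 \<gamma>\<^sub>2 \<and> C1_map (flux \<phi> :: real^'n \<Rightarrow> real^'n) \<longrightarrow>
    (\<forall>\<T>\<in>admissible_triangulations \<Omega> \<T>\<^sub>0 \<rho>. \<forall>\<nu>. side_normals \<T> \<nu> \<longrightarrow>
    (\<forall>f\<in>L2 (lebesgue_on \<Omega>). \<forall>u\<in>H10 \<Omega>. \<forall>t\<in>H_minus_half_skeleton \<Omega> \<T>.
      (\<forall>v\<in>H1_pw \<T>. b_form \<Omega> \<T> \<phi> u t v = load \<Omega> f v) \<longrightarrow>
      (\<forall>v\<^sub>C\<in>S10 \<Omega> \<T>. \<forall>s\<^sub>0 :: (real^'n) set \<Rightarrow> real.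
        \<gamma>\<^sub>1\<^sup>2 * (L2_norm (lebesgue_on \<Omega>) (weak_grad \<Omega> (\<lambda>x. u x - v\<^sub>C x)))\<^sup>2
        \<le> (1 + C\<^sub>d\<^sub>F\<^sup>2) *
            (CR_dual_norm \<Omega> \<T> (\<lambda>v. load \<Omega> f v - b_form \<Omega> \<T> \<phi> v\<^sub>C (embed_P0 \<nu> s\<^sub>0) v))\<^sup>2
          + \<kappa>\<^sup>2 * (L2_norm (lebesgue_on \<Omega>) (\<lambda>x. mesh_size \<T> x * f x))\<^sup>2)))"
proof -
  define A where "A = ((2::real) ^ CARD('n) + 4) * (diameter \<Omega> + 1)"
  define B where "B = (2::real) ^ CARD('n) + 2"
  have d0: "diameter \<Omega> \<ge> 0" by (rule diameter_ge_0[OF assms(1)])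
  have "(0::real) \<le> 2 ^ CARD('n)" by simp
  then have A: "A \<ge> 4"
    using d0 mult_mono[of 4 "2 ^ CARD('n) + 4" 1 "diameter \<Omega> + 1"] by (simp add: A_def)
  have "B > 0" by (simp add: B_def add_pos_pos)
  \<comment> \<open>Squaring the sum of the two terms costs a factor 2, so the aim is 1 + C^2 = 2
    A^2 and K^2 = 2 B^2; A \<ge> 4 makes the radicand in C positive.\<close>
  define K where "K = sqrt 2 * B"
  define C where "C = sqrt (2 * A\<^sup>2 - 1)"
  have "A\<^sup>2 \<ge> 4\<^sup>2" using A by (intro power_mono) auto
  then have C: "C > 0" "1 + C\<^sup>2 = 2 * A\<^sup>2" by (simp_all add: C_def)
  have K: "K > 0" "K\<^sup>2 = 2 * B\<^sup>2" using \<open>B > 0\<close> by (simp_all add: K_def power_mult_distrib)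
  show ?thesis
  proof (rule exI[of _ K], rule conjI[OF K(1)], rule exI[of _ C], rule conjI[OF C(1)], intro allI impI ballI)
    fix \<phi> \<gamma>1 \<gamma>2 \<T> \<nu> f u t vC and s0 :: "(real^'n) set \<Rightarrow> real"
    assume \<phi>: "nonlinearity \<phi> \<gamma>1 \<gamma>2 \<and> C1_map (flux \<phi> :: real^'n \<Rightarrow> real^'n)"
      and \<T>: "\<T> \<in> admissible_triangulations \<Omega> \<T>\<^sub>0 \<rho>"
      and f: "f \<in> L2 (lebesgue_on \<Omega>)" and u: "u \<in> H10 \<Omega>" and t: "t \<in> H_minus_half_skeleton \<Omega> \<T>"
      and sol: "\<forall>v\<in>H1_pw \<T>. b_form \<Omega> \<T> \<phi> u t v = load \<Omega> f v" and vC: "vC \<in> S10 \<Omega> \<T>"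
    interpret triangulated_domain \<Omega> \<T>
      by unfold_locales (use assms \<T> in \<open>auto simp: admissible_triangulations_def\<close>)
    let ?r = "CR_dual_norm \<Omega> \<T> (\<lambda>v. load \<Omega> f v - b_form \<Omega> \<T> \<phi> vC (embed_P0 \<nu> s0) v)"
    let ?m = "L2_norm (lebesgue_on \<Omega>) (\<lambda>x. mesh_size \<T> x * f x)"
    let ?n = "L2_norm (lebesgue_on \<Omega>) (weak_grad \<Omega> (\<lambda>x. u x - vC x))"
    have "\<gamma>1 > 0" using \<phi> by (simp add: nonlinearity_def)
    have "\<gamma>1 * ?n \<le> ?r * A + B * ?m"
      unfolding A_def B_def
      by (rule error_estimate[OF _ _ f u t _ vC]) (use \<phi> sol in auto)
    then have "(\<gamma>1 * ?n)\<^sup>2 \<le> (?r * A + B * ?m)\<^sup>2"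
      using \<open>\<gamma>1 > 0\<close> by (intro power_mono) auto
    also have "\<dots> \<le> 2 * (?r * A)\<^sup>2 + 2 * (B * ?m)\<^sup>2"
      using sum_squares_bound[of "?r * A" "B * ?m"] by (simp add: power2_sum)
    also have "\<dots> = (1 + C\<^sup>2) * ?r\<^sup>2 + K\<^sup>2 * ?m\<^sup>2"
      by (simp add: C(2) K(2) power_mult_distrib)
    finally show "\<gamma>1\<^sup>2 * ?n\<^sup>2 \<le> (1 + C\<^sup>2) * ?r\<^sup>2 + K\<^sup>2 * ?m\<^sup>2"
      by (simp add: power_mult_distrib)
  qed
qed

end
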